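(* Let $m,n\geq 3$, let $k\leq n$, and let $p,q$ be distinct primes. Let $F$ be the orbit equivalence relation on $\mathrm{Gr}_k(\mathbb{Q}_q^n)$ induced by the natural action of $\mathrm{GL}_n(\mathbb{Q})$. Then the action of $\mathrm{SL}_m(\mathbb{Z})$ on $\mathbb{P}(\mathbb{Q}_p^m)$, equipped with its Haar measure, is $F$-ergodic.
   Context: $\mathbb{Q}_p$ denotes the field of $p$-adic numbers and $\mathbb{Z}_p$ the $p$-adic integers. $\mathrm{Gr}_k(\mathbb{Q}_q^n)$ is the Grassmann space of all $k$-dimensional $\mathbb{Q}_q$-linear subspaces of $\mathbb{Q}_q^n$, and $\mathbb{P}(\mathbb{Q}_p^m)=\mathrm{Gr}_1(\mathbb{Q}_p^m)$. The compact group $\mathrm{SL}_m(\mathbb{Z}_p)$ acts transitively on $\mathbb{P}(\mathbb{Q}_p^m)$, and the Haar measure on $\mathbb{P}(\mathbb{Q}_p^m)$ is the push-forward of the Haar probability measure of $\mathrm{SL}_m(\mathbb{Z}_p)$; it is invariant under $\mathrm{SL}_m(\mathbb{Z})\leq\mathrm{SL}_m(\mathbb{Z}_p)$. For equivalence relations $E$ on $X$ and $F$ on $Y$, a Borel homomorphism from $E$ to $F$ is a Borel map $f\colon X\to Y$ with $x\mathrel{E}x'\Rightarrow f(x)\mathrel{F}f(x')$. A probability measure-preserving action $\Gamma\curvearrowright (X,\mu)$ of a countable group with orbit equivalence relation $E_\Gamma$ is called $F$-ergodic (for an equivalence relation $F$ on a standard Borel space $Y$) iff for every Borel homomorphism $f\colon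 X\to Y$ from $E_\Gamma$ to $F$ there is a $\mu$-conull set $A\subseteq X$ such that $f(A)$ is contained in a single $F$-class. *)

theory Defs
  imports "HOL-Analysis.Analysis" "HOL-Probability.Probability_Measure" "Berlekamp_Zassenhaus.Finite_Field"
begin

section \<open>The field of p-adic numbers\<close>

subsection \<open>The p-adic absolute value on the rationals\<close>

definition padic_abs :: "nat \<Rightarrow> rat \<Rightarrow> real" where
  "padic_abs p x = (if x = 0 then 0 else
     (case quotient_of x of (a, b) \<Rightarrow>
        real p powi (int (multiplicity (int p) b) - int (multiplicity (int p) a))))"

lemma padic_abs_0 [simp]: "padic_abs p 0 = 0"
  by (simp add: padic_abs_def)

lemma padic_abs_frac:
  assumes p: "prime p" and a: "a \<noteq> 0" and b: "b \<noteq> 0"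
  shows "padic_abs p (of_int a / of_int b) =
    real p powi (int (multiplicity (int p) b) - int (multiplicity (int p) a))"
proof -
  obtain c d where cd: "quotient_of (of_int a / of_int b) = (c, d)"
    by (cases "quotient_of (of_int a / of_int b)") auto
  have d: "d > 0" using quotient_of_denom_pos[OF cd] .
  have eq: "of_int a / of_int b = (of_int c / of_int d :: rat)"
    using quotient_of_div[OF cd] .
  then have "of_int (a * d) = (of_int (c * b) :: rat)"
    using b d by (simp add: field_simps)
  then have e: "a * d = c * b" by (simp only: of_int_eq_iff)
  then have c: "c \<noteq> 0" using a d by auto
  have pp: "prime_elem (int p)" using p by simp
  have "multiplicity (int p) a + multiplicity (int p) d =
      multiplicity (int p) c + multiplicity (int p) b"
    using e a b c d pp prime_elem_multiplicity_mult_distrib[OF pp, of a d]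
      prime_elem_multiplicity_mult_distrib[OF pp, of c b] by simp
  then have "int (multiplicity (int p) b) - int (multiplicity (int p) a) =
     int (multiplicity (int p) d) - int (multiplicity (int p) c)" by linarith
  moreover have "(of_int a / of_int b :: rat) \<noteq> 0" using a b by simp
  ultimately show ?thesis using cd by (simp add: padic_abs_def)
qed

lemma rat_frac_cases:
  fixes x :: rat
  obtains a b :: int where "x = of_int a / of_int b" "b \<noteq> 0"
  by (metis quotient_of_div quotient_of_denom_pos less_irrefl surj_pair)

context
  fixes p :: nat
  assumes p: "prime p"
begin

lemma padic_abs_nonneg: "0 \<le> padic_abs p x"
  by (auto simp: padic_abs_def split: prod.split)

lemma padic_abs_eq_0_iff: "padic_abs p x = 0 \<longleftrightarrow> x = 0"
  using p by (auto simp: padic_abs_def power_int_eq_0_iff split: prod.splits)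

lemma padic_abs_1: "padic_abs p 1 = 1"
  using padic_abs_frac[OF p, of 1 1] by simp

lemma padic_abs_mult: "padic_abs p (x * y) = padic_abs p x * padic_abs p y"
proof (cases "x = 0 \<or> y = 0")
  case False
  obtain a b where x: "x = of_int a / of_int b" "b \<noteq> 0" by (rule rat_frac_cases)
  obtain c d where y: "y = of_int c / of_int d" "d \<noteq> 0" by (rule rat_frac_cases)
  have ac: "a \<noteq> 0" "c \<noteq> 0" using False x y by auto
  have xy: "x * y = of_int (a * c) / of_int (b * d)" using x y by simp
  have pp: "prime_elem (int p)" using p by simp
  have p0: "real p \<noteq> 0" using p by auto
  show ?thesis
    unfolding xy unfolding x y
    using ac x y p0
    by (simp add: padic_abs_frac[OF p] prime_elem_multiplicity_mult_distrib[OF pp]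
         flip: power_int_add of_int_mult)
       (simp add: algebra_simps)
qed auto

lemma padic_abs_minus: "padic_abs p (- x) = padic_abs p x"
proof -
  have "padic_abs p (-1) = 1"
    using padic_abs_frac[OF p, of "-1" 1] by (simp add: multiplicity_unit_right)
  then show ?thesis using padic_abs_mult[of "-1" x] by simp
qed

lemma padic_abs_ultrametric: "padic_abs p (x + y) \<le> max (padic_abs p x) (padic_abs p y)"
proof (cases "x = 0 \<or> y = 0 \<or> x + y = 0")
  case True
  then show ?thesis using padic_abs_nonneg[of x] padic_abs_nonneg[of y] by auto
next
  case False
  obtain a b where x: "x = of_int a / of_int b" "b \<noteq> 0" by (rule rat_frac_cases)
  obtain c d where y: "y = of_int c / of_int d" "d \<noteq> 0" by (rule rat_frac_cases)
  define u v w where "u = a * d" and "v = c * b" and "w = b * d"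
  have w: "w \<noteq> 0" using x y by (simp add: w_def)
  have x': "x = of_int u / of_int w" and y': "y = of_int v / of_int w"
    using x y by (simp_all add: u_def v_def w_def)
  have xy': "x + y = of_int (u + v) / of_int w"
    using x' y' by (simp add: add_divide_distrib)
  have nz: "u \<noteq> 0" "v \<noteq> 0" "u + v \<noteq> 0"
    using False x' y' xy' by (auto simp del: of_int_add)
  define k where "k = min (multiplicity (int p) u) (multiplicity (int p) v)"
  have "int p ^ k dvd u" "int p ^ k dvd v"
    by (auto simp: k_def intro!: multiplicity_dvd')
  then have "int p ^ k dvd u + v" by simp
  moreover have "\<not> is_unit (int p)" using prime_gt_1_nat[OF p] by auto
  ultimately have k: "k \<le> multiplicity (int p) (u + v)"
    using nz by (intro multiplicity_geI) auto
  have "padic_abs p (x + y) \<le> real p powi (int (multiplicity (int p) w) - int k)"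
    unfolding xy' padic_abs_frac[OF p nz(3) w]
    by (rule power_int_increasing) (use k p prime_gt_1_nat[OF p] in auto)
  also have "\<dots> \<le> max (padic_abs p x) (padic_abs p y)"
    unfolding x' y' padic_abs_frac[OF p nz(1) w] padic_abs_frac[OF p nz(2) w]
    by (auto simp: k_def min_def max_def)
  finally show ?thesis .
qed

lemma padic_abs_triangle: "padic_abs p (x + y) \<le> padic_abs p x + padic_abs p y"
  using padic_abs_ultrametric[of x y] padic_abs_nonneg[of x] padic_abs_nonneg[of y] by linarith

lemma padic_abs_commute: "padic_abs p (x - y) = padic_abs p (y - x)"
  using padic_abs_minus[of "x - y"] by simp

lemma padic_abs_diff: "\<bar>padic_abs p x - padic_abs p y\<bar> \<le> padic_abs p (x - y)"
  using padic_abs_triangle[of "x - y" y] padic_abs_triangle[of "y - x" x]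
    padic_abs_commute[of x y] by simp

lemma padic_abs_inverse: "padic_abs p (inverse x) = inverse (padic_abs p x)"
proof (cases "x = 0")
  case False
  then have "padic_abs p x * padic_abs p (inverse x) = 1"
    by (simp add: padic_abs_1 flip: padic_abs_mult)
  then show ?thesis by (simp add: inverse_unique)
qed simp

end

subsection \<open>Completion by Cauchy sequences\<close>

definition padic_cauchy :: "nat \<Rightarrow> (nat \<Rightarrow> rat) \<Rightarrow> bool" where
  "padic_cauchy p X \<longleftrightarrow> (\<forall>e>0. \<exists>N. \<forall>m\<ge>N. \<forall>n\<ge>N. padic_abs p (X m - X n) < e)"

definition padic_null :: "nat \<Rightarrow> (nat \<Rightarrow> rat) \<Rightarrow> bool" where
  "padic_null p X \<longleftrightarrow> (\<lambda>n. padic_abs p (X n)) \<longlonglongrightarrow> 0"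

definition padic_rel :: "nat \<Rightarrow> (nat \<Rightarrow> rat) \<Rightarrow> (nat \<Rightarrow> rat) \<Rightarrow> bool" where
  "padic_rel p X Y \<longleftrightarrow> padic_cauchy p X \<and> padic_cauchy p Y \<and> padic_null p (\<lambda>n. X n - Y n)"

context
  fixes p :: nat
  assumes p: "prime p"
begin

lemma padic_null_add:
  assumes "padic_null p X" "padic_null p Y"
  shows "padic_null p (\<lambda>n. X n + Y n)"
proof -
  have l: "(\<lambda>n. padic_abs p (X n) + padic_abs p (Y n)) \<longlonglongrightarrow> 0"
    using tendsto_add[OF assms[unfolded padic_null_def]] by simp
  show ?thesis
    unfolding padic_null_def
    by (rule tendsto_sandwich[where f = "\<lambda>_. 0"
          and h = "\<lambda>n. padic_abs p (X n) + padic_abs p (Y n)"])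
       (simp_all add: padic_abs_nonneg[OF p] padic_abs_triangle[OF p] l)
qed

lemma padic_null_minus: "padic_null p X \<Longrightarrow> padic_null p (\<lambda>n. - X n)"
  by (simp add: padic_null_def padic_abs_minus[OF p])

lemma padic_null_diff:
  "padic_null p X \<Longrightarrow> padic_null p Y \<Longrightarrow> padic_null p (\<lambda>n. X n - Y n)"
  using padic_null_add[of X "\<lambda>n. - Y n"] padic_null_minus[of Y] by simp

lemma padic_cauchy_const: "padic_cauchy p (\<lambda>n. c)"
  by (simp add: padic_cauchy_def)

lemma padic_cauchy_add:
  assumes "padic_cauchy p X" "padic_cauchy p Y"
  shows "padic_cauchy p (\<lambda>n. X n + Y n)"
  unfolding padic_cauchy_def
proof (intro allI impI)
  fix e :: real assume e: "e > 0"
  obtain N where N: "\<And>m n. m \<ge> N \<Longrightarrow> n \<ge> N \<Longrightarrow> padic_abs p (X m - X n) < e"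
    using assms(1) e unfolding padic_cauchy_def by meson
  obtain M where M: "\<And>m n. m \<ge> M \<Longrightarrow> n \<ge> M \<Longrightarrow> padic_abs p (Y m - Y n) < e"
    using assms(2) e unfolding padic_cauchy_def by meson
  show "\<exists>N. \<forall>m\<ge>N. \<forall>n\<ge>N. padic_abs p (X m + Y m - (X n + Y n)) < e"
  proof (intro exI allI impI)
    fix m n assume "max N M \<le> m" "max N M \<le> n"
    then have "padic_abs p (X m - X n) < e" "padic_abs p (Y m - Y n) < e"
      using N M by auto
    moreover have "padic_abs p (X m + Y m - (X n + Y n)) =
       padic_abs p ((X m - X n) + (Y m - Y n))" by (simp add: algebra_simps)
    ultimately show "padic_abs p (X m + Y m - (X n + Y n)) < e"
      using padic_abs_ultrametric[OF p, of "X m - X n" "Y m - Y n"] by linarith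
  qed
qed

lemma padic_cauchy_minus: "padic_cauchy p X \<Longrightarrow> padic_cauchy p (\<lambda>n. - X n)"
proof -
  have "padic_abs p (- X m - - X n) = padic_abs p (X m - X n)" for m n
    using padic_abs_commute[OF p, of "X m" "X n"] by simp
  then show "padic_cauchy p X \<Longrightarrow> padic_cauchy p (\<lambda>n. - X n)"
    unfolding padic_cauchy_def by presburger
qed

lemma padic_cauchy_diff:
  "padic_cauchy p X \<Longrightarrow> padic_cauchy p Y \<Longrightarrow> padic_cauchy p (\<lambda>n. X n - Y n)"
  using padic_cauchy_add[of X "\<lambda>n. - Y n"] padic_cauchy_minus[of Y] by simp

lemma padic_cauchy_convergent_abs:
  assumes "padic_cauchy p X"
  shows "convergent (\<lambda>n. padic_abs p (X n))"
proof -
  have "Cauchy (\<lambda>n. padic_abs p (X n))"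
    unfolding Cauchy_def dist_real_def
  proof (intro allI impI)
    fix e :: real assume "e > 0"
    then obtain N where "\<And>m n. m \<ge> N \<Longrightarrow> n \<ge> N \<Longrightarrow> padic_abs p (X m - X n) < e"
      using assms unfolding padic_cauchy_def by meson
    then show "\<exists>M. \<forall>m\<ge>M. \<forall>n\<ge>M. \<bar>padic_abs p (X m) - padic_abs p (X n)\<bar> < e"
      using order_le_less_trans[OF padic_abs_diff[OF p]] by blast
  qed
  then show ?thesis by (rule Cauchy_convergent)
qed

lemma padic_cauchy_bounded:
  assumes "padic_cauchy p X"
  obtains B where "B > 0" "\<And>n. padic_abs p (X n) \<le> B"
proof -
  have "Bseq (\<lambda>n. padic_abs p (X n))"
    using padic_cauchy_convergent_abs[OF assms] by (rule convergent_imp_Bseq)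
  then show ?thesis
    using that padic_abs_nonneg[OF p] by (auto elim!: BseqE)
qed

lemma padic_null_mult:
  assumes "padic_null p X" "padic_cauchy p Y"
  shows "padic_null p (\<lambda>n. X n * Y n)"
proof -
  obtain B where B: "B > 0" "\<And>n. padic_abs p (Y n) \<le> B"
    using padic_cauchy_bounded[OF assms(2)] by blast
  have l: "(\<lambda>n. padic_abs p (X n) * B) \<longlonglongrightarrow> 0"
    using tendsto_mult_right[OF assms(1)[unfolded padic_null_def], of B] by simp
  show ?thesis
    unfolding padic_null_def
    by (rule tendsto_sandwich[where f = "\<lambda>_. 0" and h = "\<lambda>n. padic_abs p (X n) * B"])
       (auto simp: padic_abs_nonneg[OF p] padic_abs_mult[OF p] mult_left_mono B l)
qed

lemma padic_cauchy_mult: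
  assumes "padic_cauchy p X" "padic_cauchy p Y"
  shows "padic_cauchy p (\<lambda>n. X n * Y n)"
  unfolding padic_cauchy_def
proof (intro allI impI)
  fix e :: real assume e: "e > 0"
  obtain A where A: "A > 0" "\<And>n. padic_abs p (X n) \<le> A"
    using padic_cauchy_bounded[OF assms(1)] by blast
  obtain B where B: "B > 0" "\<And>n. padic_abs p (Y n) \<le> B"
    using padic_cauchy_bounded[OF assms(2)] by blast
  obtain N where N: "\<And>m n. m \<ge> N \<Longrightarrow> n \<ge> N \<Longrightarrow> padic_abs p (X m - X n) < e / B"
    using assms(1) e B unfolding padic_cauchy_def by (meson divide_pos_pos)
  obtain M where M: "\<And>m n. m \<ge> M \<Longrightarrow> n \<ge> M \<Longrightarrow> padic_abs p (Y m - Y n) < e / A"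
    using assms(2) e A unfolding padic_cauchy_def by (meson divide_pos_pos)
  show "\<exists>N. \<forall>m\<ge>N. \<forall>n\<ge>N. padic_abs p (X m * Y m - X n * Y n) < e"
  proof (intro exI allI impI)
    fix m n assume mn: "max N M \<le> m" "max N M \<le> n"
    have "padic_abs p (X m * (Y m - Y n)) \<le> A * padic_abs p (Y m - Y n)"
      using A padic_abs_nonneg[OF p] by (simp add: padic_abs_mult[OF p] mult_right_mono)
    also have "\<dots> < e" using M[of m n] mn A by (simp add: field_simps)
    finally have 1: "padic_abs p (X m * (Y m - Y n)) < e" .
    have "padic_abs p ((X m - X n) * Y n) \<le> padic_abs p (X m - X n) * B"
      using B padic_abs_nonneg[OF p] by (simp add: padic_abs_mult[OF p] mult_left_mono)
    also have "\<dots> < e" using N[of m n] mn B by (simp add: field_simps)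
    finally have 2: "padic_abs p ((X m - X n) * Y n) < e" .
    have "X m * Y m - X n * Y n = X m * (Y m - Y n) + (X m - X n) * Y n"
      by (simp add: algebra_simps)
    then show "padic_abs p (X m * Y m - X n * Y n) < e"
      using 1 2 padic_abs_ultrametric[OF p, of "X m * (Y m - Y n)" "(X m - X n) * Y n"] by simp
  qed
qed

lemma padic_not_null:
  assumes "padic_cauchy p X" "\<not> padic_null p X"
  obtains b N where "b > 0" "\<And>n. n \<ge> N \<Longrightarrow> padic_abs p (X n) > b"
proof -
  obtain L where L: "(\<lambda>n. padic_abs p (X n)) \<longlonglongrightarrow> L"
    using padic_cauchy_convergent_abs[OF assms(1)] by (auto simp: convergent_def)
  have "L \<ge> 0" using L padic_abs_nonneg[OF p] by (intro LIMSEQ_le_const) auto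
  then have "L > 0" using assms(2) L by (cases "L = 0") (auto simp: padic_null_def)
  then have "eventually (\<lambda>n. padic_abs p (X n) > L / 2) sequentially"
    using L by (intro order_tendstoD) auto
  then show ?thesis using that[of "L / 2"] \<open>L > 0\<close> by (auto simp: eventually_sequentially)
qed

lemma padic_cauchy_inverse:
  assumes "padic_cauchy p X" "\<not> padic_null p X"
  shows "padic_cauchy p (\<lambda>n. inverse (X n))"
  unfolding padic_cauchy_def
proof (intro allI impI)
  fix e :: real assume e: "e > 0"
  obtain b N where b: "b > 0" "\<And>n. n \<ge> N \<Longrightarrow> padic_abs p (X n) > b"
    using padic_not_null[OF assms] by blast
  obtain M where M: "\<And>m n. m \<ge> M \<Longrightarrow> n \<ge> M \<Longrightarrow> padic_abs p (X m - X n) < e * (b * b)"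
    using assms(1) e b unfolding padic_cauchy_def by (meson mult_pos_pos)
  show "\<exists>N. \<forall>m\<ge>N. \<forall>n\<ge>N. padic_abs p (inverse (X m) - inverse (X n)) < e"
  proof (intro exI allI impI)
    fix m n assume mn: "max N M \<le> m" "max N M \<le> n"
    have bm: "padic_abs p (X m) > b" and bn: "padic_abs p (X n) > b" using b mn by auto
    then have nz: "X m \<noteq> 0" "X n \<noteq> 0" using b by auto
    have "inverse (X m) - inverse (X n) = (X n - X m) * inverse (X m) * inverse (X n)"
      using nz by (simp add: field_simps)
    then have eq: "padic_abs p (inverse (X m) - inverse (X n)) =
        padic_abs p (X n - X m) / (padic_abs p (X m) * padic_abs p (X n))"
      by (simp add: padic_abs_mult[OF p] padic_abs_inverse[OF p] divide_inverse)
    have "padic_abs p (X n - X m) < e * (b * b)" using M mn by auto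
    also have "\<dots> \<le> e * (padic_abs p (X m) * padic_abs p (X n))"
      using bm bn b e by (intro mult_left_mono mult_mono) auto
    finally show "padic_abs p (inverse (X m) - inverse (X n)) < e"
      unfolding eq using bm bn b by (simp add: pos_divide_less_eq)
  qed
qed

lemma padic_null_inverse_diff:
  assumes X: "padic_cauchy p X" "\<not> padic_null p X"
    and Y: "padic_cauchy p Y" "\<not> padic_null p Y"
    and XY: "padic_null p (\<lambda>n. X n - Y n)"
  shows "padic_null p (\<lambda>n. inverse (X n) - inverse (Y n))"
proof -
  have "padic_null p (\<lambda>n. (X n - Y n) * (inverse (X n) * inverse (Y n)))"
    by (intro padic_null_mult padic_cauchy_mult padic_cauchy_inverse X Y XY)
  then have l: "(\<lambda>n. padic_abs p ((X n - Y n) * (inverse (X n) * inverse (Y n)))) \<longlonglongrightarrow> 0"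
    by (simp add: padic_null_def)
  obtain b N where b: "b > 0" "\<And>n. n \<ge> N \<Longrightarrow> padic_abs p (X n) > b"
    using padic_not_null[OF X] by blast
  obtain c M where c: "c > 0" "\<And>n. n \<ge> M \<Longrightarrow> padic_abs p (Y n) > c"
    using padic_not_null[OF Y] by blast
  have "\<forall>\<^sub>F n in sequentially. padic_abs p ((X n - Y n) * (inverse (X n) * inverse (Y n))) =
      padic_abs p (inverse (X n) - inverse (Y n))"
  proof (rule eventually_sequentiallyI[of "max N M"])
    fix n assume n: "max N M \<le> n"
    have "padic_abs p (X n) > b" "padic_abs p (Y n) > c" using b c n by auto
    then have "X n \<noteq> 0" "Y n \<noteq> 0" using b c by auto
    then have "(X n - Y n) * (inverse (X n) * inverse (Y n)) = - (inverse (X n) - inverse (Y n))"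
      by (simp add: field_simps)
    then show "padic_abs p ((X n - Y n) * (inverse (X n) * inverse (Y n))) =
      padic_abs p (inverse (X n) - inverse (Y n))" by (simp only: padic_abs_minus[OF p])
  qed
  then show ?thesis
    unfolding padic_null_def using l by (rule Lim_transform_eventually[rotated])
qed

lemma padic_rel_null_iff:
  assumes "padic_rel p X Y"
  shows "padic_null p X \<longleftrightarrow> padic_null p Y"
proof -
  have n: "padic_null p (\<lambda>n. X n - Y n)" using assms by (simp add: padic_rel_def)
  show ?thesis
    using padic_null_diff[OF _ n, of X] padic_null_add[OF n, of Y] by auto
qed

lemma padic_rel_abs_lim:
  assumes "padic_rel p X Y"
  shows "lim (\<lambda>n. padic_abs p (X n)) = lim (\<lambda>n. padic_abs p (Y n))"
proof -
  have XY: "padic_cauchy p X" "padic_null p (\<lambda>n. X n - Y n)"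
    using assms by (simp_all add: padic_rel_def)
  have L: "(\<lambda>n. padic_abs p (X n)) \<longlonglongrightarrow> lim (\<lambda>n. padic_abs p (X n))"
    using padic_cauchy_convergent_abs[OF XY(1)] by (simp add: convergent_LIMSEQ_iff)
  have "(\<lambda>n. padic_abs p (Y n) - padic_abs p (X n)) \<longlonglongrightarrow> 0"
  proof (rule tendsto_rabs_zero_cancel,
      rule tendsto_sandwich[where f = "\<lambda>_. 0" and h = "\<lambda>n. padic_abs p (X n - Y n)"])
    show "(\<lambda>n. padic_abs p (X n - Y n)) \<longlonglongrightarrow> 0" using XY(2) by (simp add: padic_null_def)
    show "\<forall>\<^sub>F n in sequentially. \<bar>padic_abs p (Y n) - padic_abs p (X n)\<bar> \<le> padic_abs p (X n - Y n)"
    proof (intro always_eventually allI)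
      fix n show "\<bar>padic_abs p (Y n) - padic_abs p (X n)\<bar> \<le> padic_abs p (X n - Y n)"
        using padic_abs_diff[OF p, of "Y n" "X n"] padic_abs_commute[OF p, of "X n" "Y n"] by simp
    qed
  qed auto
  from tendsto_add[OF this L] have "(\<lambda>n. padic_abs p (Y n)) \<longlonglongrightarrow> lim (\<lambda>n. padic_abs p (X n))"
    by simp
  then show ?thesis by (simp add: limI)
qed

lemma part_equivp_padic_rel: "part_equivp (padic_rel p)"
proof (rule part_equivpI)
  show "\<exists>X. padic_rel p X X"
    by (rule exI[of _ "\<lambda>_. 0"]) (simp add: padic_rel_def padic_cauchy_const padic_null_def)
  show "symp (padic_rel p)"
  proof (rule sympI)
    fix X Y assume "padic_rel p X Y"
    then show "padic_rel p Y X"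
      using padic_null_minus[of "\<lambda>n. X n - Y n"] by (simp add: padic_rel_def)
  qed
  show "transp (padic_rel p)"
  proof (rule transpI)
    fix X Y Z assume "padic_rel p X Y" "padic_rel p Y Z"
    then show "padic_rel p X Z"
      using padic_null_add[of "\<lambda>n. X n - Y n" "\<lambda>n. Y n - Z n"] by (simp add: padic_rel_def)
  qed
qed

end

text \<open>
  The prime is carried by the type argument: \<open>'a padic\<close> is the completion of the
  rationals for the p-adic absolute value with \<open>p = CARD('a)\<close>.
\<close>

typedef (overloaded) ('a :: prime_card) padic =
  "{X. padic_cauchy CARD('a) X} // {(X, Y). padic_rel CARD('a) X Y}"
  using padic_cauchy_const[OF prime_card] by (auto simp: quotient_def)

definition abs_padic :: "(nat \<Rightarrow> rat) \<Rightarrow> 'a :: prime_card padic" where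
  "abs_padic X = Abs_padic ({(X, Y). padic_rel CARD('a) X Y} `` {X})"

definition rep_padic :: "'a :: prime_card padic \<Rightarrow> nat \<Rightarrow> rat" where
  "rep_padic x = (SOME X. X \<in> Rep_padic x)"

definition cr_padic :: "(nat \<Rightarrow> rat) \<Rightarrow> 'a :: prime_card padic \<Rightarrow> bool" where
  "cr_padic X x \<longleftrightarrow> padic_rel CARD('a) X X \<and> abs_padic X = x"

lemma padic_rel_refl_iff: "padic_rel p X X \<longleftrightarrow> padic_cauchy p X"
  by (simp add: padic_rel_def padic_null_def)

lemma Quotient_padic:
  "Quotient (padic_rel CARD('a)) abs_padic rep_padic
     (cr_padic :: (nat \<Rightarrow> rat) \<Rightarrow> 'a :: prime_card padic \<Rightarrow> bool)"
proof -
  let ?R = "padic_rel CARD('a)"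
  have sym: "?R X Y \<Longrightarrow> ?R Y X" and trans: "?R X Y \<Longrightarrow> ?R Y Z \<Longrightarrow> ?R X Z" for X Y Z
    using part_equivp_padic_rel[OF prime_card[where 'a = 'a]]
    by (auto elim!: part_equivpE dest: sympD transpD)
  have Rep: "Rep_padic (abs_padic X :: 'a padic) = {Y. ?R X Y}" if "?R X X" for X
    unfolding abs_padic_def using that
    by (subst Abs_padic_inverse) (auto simp: quotient_def padic_rel_refl_iff)
  have ex: "\<exists>X. ?R X X \<and> x = abs_padic X" for x :: "'a padic"
    using Rep_padic[of x] Rep_padic_inverse[of x]
    by (auto simp: quotient_def abs_padic_def padic_rel_refl_iff)
  have rep: "?R X (rep_padic (abs_padic X :: 'a padic))" if "?R X X" for X
    unfolding rep_padic_def Rep[OF that] using that by (simp add: someI[of "?R X" X])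
  have eq: "(abs_padic X :: 'a padic) = abs_padic Y \<longleftrightarrow> ?R X Y" if "?R X X" "?R Y Y" for X Y
  proof -
    have "(abs_padic X :: 'a padic) = abs_padic Y \<longleftrightarrow> {Z. ?R X Z} = {Z. ?R Y Z}"
      using Rep[OF that(1)] Rep[OF that(2)] Rep_padic_inject by metis
    also have "\<dots> \<longleftrightarrow> ?R X Y" using that sym trans by blast
    finally show ?thesis .
  qed
  show ?thesis
  proof (rule QuotientI)
    fix x :: "'a padic"
    obtain X where X: "?R X X" "x = abs_padic X" using ex by blast
    have r: "?R X (rep_padic x)" using rep X by simp
    show rr: "?R (rep_padic x) (rep_padic x)" using r sym trans by blast
    show "abs_padic (rep_padic x) = x" using eq[OF X(1) rr] r X by simp
  next
    fix X Y
    show "?R X Y = (?R X X \<and> ?R Y Y \<and> (abs_padic X :: 'a padic) = abs_padic Y)"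
      using eq sym trans by blast
  next
    show "(cr_padic :: _ \<Rightarrow> 'a padic \<Rightarrow> bool) = (\<lambda>X x. ?R X X \<and> abs_padic X = x)"
      by (simp add: cr_padic_def fun_eq_iff)
  qed
qed

setup_lifting Quotient_padic

instantiation padic :: (prime_card) comm_ring_1
begin

lift_definition zero_padic :: "'a padic" is "\<lambda>n. 0"
  by (simp add: padic_rel_def padic_cauchy_const[OF prime_card] padic_null_def)

lift_definition one_padic :: "'a padic" is "\<lambda>n. 1"
  by (simp add: padic_rel_def padic_cauchy_const[OF prime_card] padic_null_def)

lift_definition plus_padic :: "'a padic \<Rightarrow> 'a padic \<Rightarrow> 'a padic" is "\<lambda>X Y n. X n + Y n"
proof -
  fix X X' Y Y' :: "nat \<Rightarrow> rat"
  assume *: "padic_rel CARD('a) X X'" "padic_rel CARD('a) Y Y'"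
  then have "padic_null CARD('a) (\<lambda>n. (X n - X' n) + (Y n - Y' n))"
    by (auto simp: padic_rel_def intro: padic_null_add[OF prime_card])
  then show "padic_rel CARD('a) (\<lambda>n. X n + Y n) (\<lambda>n. X' n + Y' n)"
    using * by (auto simp: padic_rel_def algebra_simps intro: padic_cauchy_add[OF prime_card])
qed

lift_definition uminus_padic :: "'a padic \<Rightarrow> 'a padic" is "\<lambda>X n. - X n"
proof -
  fix X X' :: "nat \<Rightarrow> rat"
  assume *: "padic_rel CARD('a) X X'"
  then have "padic_null CARD('a) (\<lambda>n. - (X n - X' n))"
    by (intro padic_null_minus[OF prime_card]) (simp add: padic_rel_def)
  then show "padic_rel CARD('a) (\<lambda>n. - X n) (\<lambda>n. - X' n)"
    using * by (auto simp: padic_rel_def intro: padic_cauchy_minus[OF prime_card])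
qed

definition minus_padic :: "'a padic \<Rightarrow> 'a padic \<Rightarrow> 'a padic" where
  "minus_padic x y = x + - y"

lift_definition times_padic :: "'a padic \<Rightarrow> 'a padic \<Rightarrow> 'a padic" is "\<lambda>X Y n. X n * Y n"
proof -
  fix X X' Y Y' :: "nat \<Rightarrow> rat"
  assume *: "padic_rel CARD('a) X X'" "padic_rel CARD('a) Y Y'"
  then have "padic_null CARD('a) (\<lambda>n. (X n - X' n) * Y n + (Y n - Y' n) * X' n)"
    by (auto simp: padic_rel_def intro: padic_null_add[OF prime_card] padic_null_mult[OF prime_card])
  then show "padic_rel CARD('a) (\<lambda>n. X n * Y n) (\<lambda>n. X' n * Y' n)"
    using * by (auto simp: padic_rel_def algebra_simps intro: padic_cauchy_mult[OF prime_card])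
qed

instance
proof
  fix x y z :: "'a padic"
  note cs = padic_cauchy_add[OF prime_card] padic_cauchy_mult[OF prime_card]
    padic_cauchy_minus[OF prime_card] padic_cauchy_const[OF prime_card]
  show "x + y + z = x + (y + z)"
    by transfer (auto simp: padic_rel_def algebra_simps padic_null_def intro!: cs)
  show "x + y = y + x"
    by transfer (auto simp: padic_rel_def algebra_simps padic_null_def intro!: cs)
  show "0 + x = x"
    by transfer (auto simp: padic_rel_def algebra_simps padic_null_def intro!: cs)
  show "- x + x = 0"
    by transfer (auto simp: padic_rel_def algebra_simps padic_null_def intro!: cs)
  show "x - y = x + - y" by (rule minus_padic_def)
  show "x * y * z = x * (y * z)"
    by transfer (auto simp: padic_rel_def algebra_simps padic_null_def intro!: cs)
  show "x * y = y * x"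
    by transfer (auto simp: padic_rel_def algebra_simps padic_null_def intro!: cs)
  show "1 * x = x"
    by transfer (auto simp: padic_rel_def algebra_simps padic_null_def intro!: cs)
  show "(x + y) * z = x * z + y * z"
    by transfer (auto simp: padic_rel_def distrib_right padic_null_def intro!: cs)
  show "(0 :: 'a padic) \<noteq> 1"
  proof (transfer, rule notI)
    assume "padic_rel CARD('a) (\<lambda>n. 0) (\<lambda>n. 1)"
    then show False
      by (simp add: padic_rel_def padic_null_def padic_abs_minus[OF prime_card]
            padic_abs_1[OF prime_card] LIMSEQ_const_iff)
  qed
qed

end

lift_definition padic_inverse :: "'a :: prime_card padic \<Rightarrow> 'a padic"
  is "\<lambda>X. if padic_null CARD('a) X then (\<lambda>n. 0) else (\<lambda>n. inverse (X n))"
proof -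
  fix X X' :: "nat \<Rightarrow> rat"
  assume *: "padic_rel CARD('a) X X'"
  show "padic_rel CARD('a) (if padic_null CARD('a) X then (\<lambda>n. 0) else (\<lambda>n. inverse (X n)))
         (if padic_null CARD('a) X' then (\<lambda>n. 0) else (\<lambda>n. inverse (X' n)))"
  proof (cases "padic_null CARD('a) X")
    case True
    then show ?thesis using padic_rel_null_iff[OF prime_card *]
      by (simp add: padic_rel_def padic_cauchy_const[OF prime_card] padic_null_def)
  next
    case False
    then show ?thesis using padic_rel_null_iff[OF prime_card *] *
      by (auto simp: padic_rel_def intro!: padic_cauchy_inverse[OF prime_card]
            padic_null_inverse_diff[OF prime_card])
  qed
qed

lemma padic_inverse_0: "padic_inverse 0 = 0"
  by transfer (simp add: padic_rel_def padic_null_def padic_cauchy_const[OF prime_card])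

lemma padic_inverse_mult: "x \<noteq> 0 \<Longrightarrow> padic_inverse x * x = 1"
proof transfer
  note cs = padic_cauchy_add[OF prime_card] padic_cauchy_mult[OF prime_card]
    padic_cauchy_minus[OF prime_card] padic_cauchy_const[OF prime_card]
  fix X :: "nat \<Rightarrow> rat"
  assume X: "padic_rel CARD('a) X X" "\<not> padic_rel CARD('a) X (\<lambda>n. 0)"
  have cX: "padic_cauchy CARD('a) X" using X by (simp add: padic_rel_def)
  have nX: "\<not> padic_null CARD('a) X"
    using X cX padic_cauchy_const[OF prime_card] by (auto simp: padic_rel_def)
  obtain b N where b: "b > 0" "\<And>n. n \<ge> N \<Longrightarrow> padic_abs CARD('a) (X n) > b"
    using padic_not_null[OF prime_card cX nX] by blast
  have "inverse (X n) * X n - 1 = 0" if "n \<ge> N" for n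
    using b(2)[OF that] b(1) by (cases "X n = 0") auto
  then have "\<forall>\<^sub>F n in sequentially. padic_abs CARD('a) (inverse (X n) * X n - 1) = 0"
    by (intro eventually_sequentiallyI[of N]) simp
  then have "padic_null CARD('a) (\<lambda>n. inverse (X n) * X n - 1)"
    unfolding padic_null_def by (rule tendsto_eventually)
  then show "padic_rel CARD('a)
      (\<lambda>n. (if padic_null CARD('a) X then (\<lambda>n. 0) else (\<lambda>n. inverse (X n))) n * X n) (\<lambda>n. 1)"
    using nX cX by (auto simp: padic_rel_def
        intro!: cs padic_cauchy_inverse[OF prime_card])
qed

instantiation padic :: (prime_card) field
begin

definition inverse_padic :: "'a padic \<Rightarrow> 'a padic" where
  "inverse_padic = padic_inverse"

definition divide_padic :: "'a padic \<Rightarrow> 'a padic \<Rightarrow> 'a padic" where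
  "divide_padic x y = x * inverse y"

instance
  by standard (simp_all add: inverse_padic_def divide_padic_def padic_inverse_0 padic_inverse_mult)

end

lemma of_nat_padic: "(of_nat n :: 'a :: prime_card padic) = abs_padic (\<lambda>_. of_nat n)"
proof (induction n)
  case (Suc n)
  have c: "padic_rel CARD('a) (\<lambda>_. c) (\<lambda>_. c)" for c
    by (simp add: padic_rel_refl_iff padic_cauchy_const[OF prime_card])
  show ?case
    using Suc plus_padic.abs_eq[where 'a = 'a, OF c c, of 1 "of_nat n"]
    by (simp add: one_padic.abs_eq)
qed (simp add: zero_padic.abs_eq)

instance padic :: (prime_card) field_char_0
proof
  show "inj (of_nat :: nat \<Rightarrow> 'a padic)"
  proof (rule injI)
    fix m n :: nat
    assume "(of_nat m :: 'a padic) = of_nat n"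
    then have "padic_rel CARD('a) (\<lambda>_. of_nat m) (\<lambda>_. of_nat n)"
      using Quotient_rel[OF Quotient_padic[where 'a = 'a], of "\<lambda>_. of_nat m" "\<lambda>_. of_nat n"]
      by (simp add: of_nat_padic padic_rel_refl_iff padic_cauchy_const[OF prime_card])
    then have "padic_abs CARD('a) (of_nat m - of_nat n) = 0"
      by (simp add: padic_rel_def padic_null_def LIMSEQ_const_iff)
    then show "m = n" by (simp add: padic_abs_eq_0_iff[OF prime_card])
  qed
qed

subsection \<open>Absolute value and metric\<close>

lift_definition padic_norm :: "'a :: prime_card padic \<Rightarrow> real"
  is "\<lambda>X. lim (\<lambda>n. padic_abs CARD('a) (X n))"
  by (rule padic_rel_abs_lim[OF prime_card])

lemma padic_abs_tendsto_lim:
  assumes "padic_rel CARD('a :: prime_card) X X"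
  shows "(\<lambda>n. padic_abs CARD('a) (X n)) \<longlonglongrightarrow> lim (\<lambda>n. padic_abs CARD('a) (X n))"
  using padic_cauchy_convergent_abs[OF prime_card] assms
  by (simp add: padic_rel_refl_iff convergent_LIMSEQ_iff)

lemma padic_norm_nonneg: "0 \<le> padic_norm x"
proof transfer
  fix X assume "padic_rel CARD('a) X X"
  from padic_abs_tendsto_lim[OF this] show "0 \<le> lim (\<lambda>n. padic_abs CARD('a) (X n))"
    by (rule LIMSEQ_le_const) (use padic_abs_nonneg[OF prime_card] in auto)
qed

lemma padic_norm_eq_0_iff: "padic_norm x = 0 \<longleftrightarrow> x = 0"
proof transfer
  fix X assume X: "padic_rel CARD('a) X X"
  have "lim (\<lambda>n. padic_abs CARD('a) (X n)) = 0 \<longleftrightarrow> padic_null CARD('a) X"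
    using padic_abs_tendsto_lim[OF X] unfolding padic_null_def by (auto dest: limI)
  then show "(lim (\<lambda>n. padic_abs CARD('a) (X n)) = 0) = padic_rel CARD('a) X (\<lambda>n. 0)"
    using X by (simp add: padic_rel_refl_iff) (simp add: padic_rel_def padic_cauchy_const[OF prime_card])
qed

lemma padic_norm_mult: "padic_norm (x * y) = padic_norm x * padic_norm y"
proof transfer
  fix X Y assume "padic_rel CARD('a) X X" "padic_rel CARD('a) Y Y"
  from tendsto_mult[OF this[THEN padic_abs_tendsto_lim]]
  show "lim (\<lambda>n. padic_abs CARD('a) (X n * Y n)) =
      lim (\<lambda>n. padic_abs CARD('a) (X n)) * lim (\<lambda>n. padic_abs CARD('a) (Y n))"
    by (intro limI) (simp add: padic_abs_mult[OF prime_card])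
qed

lemma padic_norm_minus: "padic_norm (- x) = padic_norm x"
  by transfer (simp add: padic_abs_minus[OF prime_card])

lemma padic_norm_ultrametric: "padic_norm (x + y) \<le> max (padic_norm x) (padic_norm y)"
proof transfer
  fix X Y assume X: "padic_rel CARD('a) X X" and Y: "padic_rel CARD('a) Y Y"
  have "padic_rel CARD('a) (\<lambda>n. X n + Y n) (\<lambda>n. X n + Y n)"
    using X Y by (simp add: padic_rel_refl_iff padic_cauchy_add[OF prime_card])
  from padic_abs_tendsto_lim[OF this]
    tendsto_max[OF padic_abs_tendsto_lim[OF X] padic_abs_tendsto_lim[OF Y]]
  show "lim (\<lambda>n. padic_abs CARD('a) (X n + Y n)) \<le>
      max (lim (\<lambda>n. padic_abs CARD('a) (X n))) (lim (\<lambda>n. padic_abs CARD('a) (Y n)))"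
    by (rule LIMSEQ_le) (use padic_abs_ultrametric[OF prime_card] in auto)
qed

instantiation padic :: (prime_card) metric_space
begin

definition dist_padic :: "'a padic \<Rightarrow> 'a padic \<Rightarrow> real" where
  "dist_padic x y = padic_norm (x - y)"

definition uniformity_padic :: "('a padic \<times> 'a padic) filter" where
  "uniformity_padic = (INF e\<in>{0<..}. principal {(x, y). dist x y < e})"

definition open_padic :: "'a padic set \<Rightarrow> bool" where
  "open_padic U \<longleftrightarrow> (\<forall>x\<in>U. eventually (\<lambda>(x', y). x' = x \<longrightarrow> y \<in> U) uniformity)"

instance
proof
  fix x y z :: "'a padic"
  show "dist x y = 0 \<longleftrightarrow> x = y"
    by (simp add: dist_padic_def padic_norm_eq_0_iff)
  have "padic_norm (x - y) \<le> max (padic_norm (x - z)) (padic_norm (z - y))"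
    using padic_norm_ultrametric[of "x - z" "z - y"] by simp
  moreover have "padic_norm (z - y) = padic_norm (y - z)"
    using padic_norm_minus[of "y - z"] by simp
  ultimately show "dist x y \<le> dist x z + dist y z"
    using padic_norm_nonneg[of "x - z"] padic_norm_nonneg[of "y - z"]
    by (simp add: dist_padic_def)
qed (simp_all add: uniformity_padic_def open_padic_def)

end

lemma of_rat_padic: "(of_rat r :: 'a :: prime_card padic) = abs_padic (\<lambda>_. r)"
proof -
  have c: "padic_rel CARD('a) (\<lambda>_. c) (\<lambda>_. c)" for c
    by (simp add: padic_rel_refl_iff padic_cauchy_const[OF prime_card])
  have int: "(of_int a :: 'a padic) = abs_padic (\<lambda>_. of_int a)" for a
    using uminus_padic.abs_eq[where 'a = 'a, OF c]
    by (cases a rule: int_cases2) (simp_all add: of_nat_padic)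
  obtain a b where ab: "r = of_int a / of_int b" "b \<noteq> 0" by (rule rat_frac_cases)
  have "of_rat r * of_int b = (of_int a :: 'a padic)"
    using ab by (simp add: of_rat_divide)
  moreover have "abs_padic (\<lambda>_. r) * of_int b = (of_int a :: 'a padic)"
    unfolding int using times_padic.abs_eq[where 'a = 'a, OF c c, of r "of_int b"] ab by simp
  ultimately show ?thesis using ab
    by (metis mult_right_cancel of_int_eq_0_iff)
qed

lemma padic_norm_of_rat: "padic_norm (of_rat r :: 'a :: prime_card padic) = padic_abs CARD('a) r"
  unfolding of_rat_padic
  by (subst padic_norm.abs_eq) (simp_all add: padic_rel_refl_iff padic_cauchy_const[OF prime_card] limI)

lemma of_rat_tendsto_abs_padic:
  assumes X: "padic_cauchy CARD('a) X"
  shows "(\<lambda>n. of_rat (X n)) \<longlonglongrightarrow> (abs_padic X :: 'a :: prime_card padic)"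
proof (rule metric_LIMSEQ_I)
  fix e :: real assume e: "e > 0"
  then obtain N where N: "\<And>m n. m \<ge> N \<Longrightarrow> n \<ge> N \<Longrightarrow> padic_abs CARD('a) (X m - X n) < e / 2"
    using X unfolding padic_cauchy_def by (meson half_gt_zero)
  show "\<exists>N. \<forall>n\<ge>N. dist (of_rat (X n)) (abs_padic X :: 'a padic) < e"
  proof (intro exI allI impI)
    fix n assume n: "n \<ge> N"
    have r: "padic_rel CARD('a) (\<lambda>_. X n) (\<lambda>_. X n)" "padic_rel CARD('a) X X"
      "padic_rel CARD('a) (\<lambda>k. - X k) (\<lambda>k. - X k)"
      "padic_rel CARD('a) (\<lambda>k. X n - X k) (\<lambda>k. X n - X k)"
      using X by (simp_all add: padic_rel_refl_iff padic_cauchy_const[OF prime_card]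
          padic_cauchy_minus[OF prime_card] padic_cauchy_diff[OF prime_card])
    have "of_rat (X n) - abs_padic X = (abs_padic (\<lambda>k. X n - X k) :: 'a padic)"
      by (simp add: minus_padic_def of_rat_padic uminus_padic.abs_eq[OF r(2)]
          plus_padic.abs_eq[OF r(1) r(3)])
    then have "dist (of_rat (X n)) (abs_padic X :: 'a padic) =
        lim (\<lambda>k. padic_abs CARD('a) (X n - X k))"
      by (simp add: dist_padic_def padic_norm.abs_eq[OF r(4)])
    also have "\<dots> \<le> e / 2"
      by (rule LIMSEQ_le_const2[OF padic_abs_tendsto_lim[OF r(4)]])
         (use N n in \<open>auto intro!: exI[of _ N] less_imp_le\<close>)
    finally show "dist (of_rat (X n)) (abs_padic X :: 'a padic) < e" using e by simp
  qed
qed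

lemma padic_rat_dense:
  assumes "e > 0"
  shows "\<exists>r. dist (of_rat r) (x :: 'a :: prime_card padic) < e"
proof -
  have "padic_cauchy CARD('a) (rep_padic x)" "abs_padic (rep_padic x) = x"
    using Quotient_rep_reflp[OF Quotient_padic] Quotient_abs_rep[OF Quotient_padic]
    by (auto simp: padic_rel_refl_iff)
  then have "(\<lambda>n. of_rat (rep_padic x n)) \<longlonglongrightarrow> x"
    using of_rat_tendsto_abs_padic by metis
  then show ?thesis using metric_LIMSEQ_D[OF _ assms] by blast
qed

instance padic :: (prime_card) complete_space
proof
  fix x :: "nat \<Rightarrow> 'a padic"
  assume x: "Cauchy x"
  have "\<forall>n. \<exists>r. dist (of_rat r) (x n) < 1 / real (Suc n)"
    by (intro allI padic_rat_dense) simp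
  then obtain R where R: "\<And>n. dist (of_rat (R n)) (x n) < 1 / real (Suc n)"
    by metis
  have lim0: "(\<lambda>n. 1 / real (Suc n)) \<longlonglongrightarrow> 0" by (rule LIMSEQ_inverse_real_of_nat[unfolded inverse_eq_divide])
  have R0: "(\<lambda>n. dist (of_rat (R n)) (x n)) \<longlonglongrightarrow> 0"
    by (rule tendsto_sandwich[OF _ _ tendsto_const lim0]) (auto intro!: always_eventually less_imp_le R simp del: of_nat_Suc)
  have "padic_cauchy CARD('a) R"
    unfolding padic_cauchy_def
  proof (intro allI impI)
    fix e :: real assume e: "e > 0"
    obtain N where N: "\<And>m n. m \<ge> N \<Longrightarrow> n \<ge> N \<Longrightarrow> dist (x m) (x n) < e / 3"
      using x e unfolding Cauchy_def by (meson zero_less_divide_iff zero_less_numeral)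
    have "\<forall>\<^sub>F n in sequentially. dist (of_rat (R n)) (x n) < e / 3"
      using order_tendstoD(2)[OF R0, of "e / 3"] e by simp
    then obtain M where M: "\<And>n. n \<ge> M \<Longrightarrow> dist (of_rat (R n)) (x n) < e / 3"
      by (auto simp: eventually_sequentially)
    show "\<exists>N. \<forall>m\<ge>N. \<forall>n\<ge>N. padic_abs CARD('a) (R m - R n) < e"
    proof (intro exI allI impI)
      fix m n assume mn: "max N M \<le> m" "max N M \<le> n"
      have "padic_abs CARD('a) (R m - R n) = dist (of_rat (R m)) (of_rat (R n) :: 'a padic)"
        by (simp add: dist_padic_def padic_norm_of_rat flip: of_rat_diff)
      also have "\<dots> \<le> dist (of_rat (R m)) (x m) + dist (x m) (x n) + dist (of_rat (R n)) (x n)"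
        using dist_triangle[of "of_rat (R m)" "of_rat (R n)" "x m"]
          dist_triangle[of "x m" "of_rat (R n)" "x n"] by (simp add: dist_commute)
      also have "\<dots> < e" using M[of m] M[of n] N[of m n] mn by simp
      finally show "padic_abs CARD('a) (R m - R n) < e" .
    qed
  qed
  then have l: "(\<lambda>n. of_rat (R n)) \<longlonglongrightarrow> (abs_padic R :: 'a padic)"
    by (rule of_rat_tendsto_abs_padic)
  have "x \<longlonglongrightarrow> abs_padic R"
  proof (rule iffD2[OF tendsto_dist_iff], rule tendsto_sandwich[where f = "\<lambda>_. 0"])
    show "(\<lambda>n. dist (of_rat (R n)) (x n) + dist (of_rat (R n)) (abs_padic R :: 'a padic)) \<longlonglongrightarrow> 0"
      using tendsto_add[OF R0 iffD1[OF tendsto_dist_iff l]] by simp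
    show "\<forall>\<^sub>F n in sequentially. dist (x n) (abs_padic R) \<le>
        dist (of_rat (R n)) (x n) + dist (of_rat (R n)) (abs_padic R :: 'a padic)"
      by (intro always_eventually allI) (metis dist_commute dist_triangle)
    show "\<forall>\<^sub>F n in sequentially. 0 \<le> dist (x n) (abs_padic R)" by simp
  qed simp
  then show "convergent x" by (auto simp: convergent_def)
qed

instance padic :: (prime_card) topological_comm_monoid_add
proof
  fix a b :: "'a padic"
  show "((\<lambda>x. fst x + snd x) \<longlongrightarrow> a + b) (nhds a \<times>\<^sub>F nhds b)"
  proof (rule tendstoI)
    fix e :: real assume e: "e > 0"
    have "\<forall>\<^sub>F x in nhds a. dist x a < e" "\<forall>\<^sub>F x in nhds b. dist x b < e"
      using e by (auto simp: eventually_nhds_metric)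
    then have "\<forall>\<^sub>F x in nhds a \<times>\<^sub>F nhds b. dist (fst x) a < e \<and> dist (snd x) b < e"
      by (rule eventually_prodI)
    then show "\<forall>\<^sub>F x in nhds a \<times>\<^sub>F nhds b. dist (fst x + snd x) (a + b) < e"
    proof (rule eventually_mono)
      fix x :: "'a padic \<times> 'a padic" assume "dist (fst x) a < e \<and> dist (snd x) b < e"
      then show "dist (fst x + snd x) (a + b) < e"
        using padic_norm_ultrametric[of "fst x - a" "snd x - b"]
        by (auto simp: dist_padic_def algebra_simps)
    qed
  qed
qed

instance padic :: (prime_card) topological_semigroup_mult
proof
  fix a b :: "'a padic"
  show "((\<lambda>x. fst x * snd x) \<longlongrightarrow> a * b) (nhds a \<times>\<^sub>F nhds b)"
  proof (rule tendstoI)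
    fix e :: real assume e: "e > 0"
    define A where "A = padic_norm a + 1"
    define B where "B = padic_norm b + 1"
    have AB: "A \<ge> 1" "B \<ge> 1" "A \<ge> padic_norm a" "B \<ge> padic_norm b"
      using padic_norm_nonneg[of a] padic_norm_nonneg[of b] by (simp_all add: A_def B_def)
    have "\<forall>\<^sub>F x in nhds a. dist x a < e / B" "\<forall>\<^sub>F x in nhds b. dist x b < min 1 (e / A)"
      unfolding eventually_nhds_metric
      by (rule exI[of _ "e / B"], use e AB in simp)
         (rule exI[of _ "min 1 (e / A)"], use e AB in simp)
    then have "\<forall>\<^sub>F x in nhds a \<times>\<^sub>F nhds b. dist (fst x) a < e / B \<and> dist (snd x) b < min 1 (e / A)"
      by (rule eventually_prodI)
    then show "\<forall>\<^sub>F x in nhds a \<times>\<^sub>F nhds b. dist (fst x * snd x) (a * b) < e"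
    proof (rule eventually_mono)
      fix x :: "'a padic \<times> 'a padic"
      assume "dist (fst x) a < e / B \<and> dist (snd x) b < min 1 (e / A)"
      then have x: "padic_norm (fst x - a) < e / B" "padic_norm (snd x - b) < 1"
        "padic_norm (snd x - b) < e / A" by (auto simp: dist_padic_def)
      have "padic_norm (snd x) \<le> B"
        using padic_norm_ultrametric[of "snd x - b" b] x AB by simp
      then have "padic_norm ((fst x - a) * snd x) \<le> padic_norm (fst x - a) * B"
        by (simp add: padic_norm_mult padic_norm_nonneg mult_left_mono)
      also have "\<dots> < e" using x AB by (simp add: field_simps)
      finally have 1: "padic_norm ((fst x - a) * snd x) < e" .
      have "padic_norm (a * (snd x - b)) \<le> A * padic_norm (snd x - b)"
        using AB by (simp add: padic_norm_mult padic_norm_nonneg mult_right_mono)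
      also have "\<dots> < e" using x AB by (simp add: field_simps)
      finally have 2: "padic_norm (a * (snd x - b)) < e" .
      have "fst x * snd x - a * b = (fst x - a) * snd x + a * (snd x - b)"
        by (simp add: algebra_simps)
      then show "dist (fst x * snd x) (a * b) < e"
        using 1 2 padic_norm_ultrametric[of "(fst x - a) * snd x" "a * (snd x - b)"]
        by (simp add: dist_padic_def)
    qed
  qed
qed

definition padic_integers :: "'a :: prime_card padic set" where
  "padic_integers = {x. padic_norm x \<le> 1}"

section \<open>Grassmann spaces\<close>

definition grassmannian :: "nat \<Rightarrow> ('a :: field ^ 'n) set set" where
  "grassmannian k = {V. vec.subspace V \<and> vec.dim V = k}"

definition frames :: "nat \<Rightarrow> (nat \<Rightarrow> 'a :: field ^ 'n) set" where
  "frames k = {v \<in> {..<k} \<rightarrow>\<^sub>E UNIV. inj_on v {..<k} \<and> vec.independent (v ` {..<k})}"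

definition frame_topology :: "nat \<Rightarrow> (nat \<Rightarrow> ('a :: {field, topological_space}) ^ 'n) topology" where
  "frame_topology k = subtopology (product_topology (\<lambda>_. euclidean) {..<k}) (frames k)"

text \<open>The quotient topology under the map sending a k-frame to its span.\<close>

definition grassmannian_topology ::
    "nat \<Rightarrow> (('a :: {field, topological_space}) ^ 'n) set topology" where
  "grassmannian_topology k = topology (\<lambda>U. U \<subseteq> grassmannian k \<and>
     openin (frame_topology k) {v \<in> frames k. vec.span (v ` {..<k}) \<in> U})"

lemma topspace_frame_topology [simp]: "topspace (frame_topology k) = frames k"
  by (auto simp: frame_topology_def frames_def)

lemma frame_span_grassmannian: "v \<in> frames k \<Longrightarrow> vec.span (v ` {..<k}) \<in> grassmannian k"
  by (auto simp: frames_def grassmannian_def vec.dim_span vec.dim_eq_card_independent card_image)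

lemma openin_grassmannian_topology:
  "openin (grassmannian_topology k) U \<longleftrightarrow> U \<subseteq> grassmannian k \<and>
     openin (frame_topology k) {v \<in> frames k. vec.span (v ` {..<k}) \<in> U}"
proof -
  let ?f = "\<lambda>v :: nat \<Rightarrow> 'a ^ 'b. vec.span (v ` {..<k})"
  have "istopology (\<lambda>U. U \<subseteq> grassmannian k \<and>
     openin (frame_topology k) {v \<in> frames k. ?f v \<in> U})"
    unfolding istopology_def
  proof (intro conjI allI impI)
    fix S T :: "('a ^ 'b) set set"
    assume a: "S \<subseteq> grassmannian k \<and> openin (frame_topology k) {v \<in> frames k. ?f v \<in> S}"
      "T \<subseteq> grassmannian k \<and> openin (frame_topology k) {v \<in> frames k. ?f v \<in> T}"
    show "S \<inter> T \<subseteq> grassmannian k" using a by blast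
    have "{v \<in> frames k. ?f v \<in> S \<inter> T} = {v \<in> frames k. ?f v \<in> S} \<inter> {v \<in> frames k. ?f v \<in> T}"
      by auto
    then show "openin (frame_topology k) {v \<in> frames k. ?f v \<in> S \<inter> T}" using a by auto
  next
    fix K :: "('a ^ 'b) set set set"
    assume a: "\<forall>S\<in>K. S \<subseteq> grassmannian k \<and> openin (frame_topology k) {v \<in> frames k. ?f v \<in> S}"
    then show "\<Union> K \<subseteq> grassmannian k" by blast
    have "{v \<in> frames k. ?f v \<in> \<Union> K} = (\<Union>S\<in>K. {v \<in> frames k. ?f v \<in> S})" by auto
    then show "openin (frame_topology k) {v \<in> frames k. ?f v \<in> \<Union> K}" using a by auto
  qed
  then show ?thesis unfolding grassmannian_topology_def by (subst topology_inverse') auto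
qed

lemma topspace_grassmannian_topology [simp]:
  "topspace (grassmannian_topology k :: ('a :: {field, topological_space} ^ 'n) set topology) =
     grassmannian k"
proof
  show "topspace (grassmannian_topology k :: ('a ^ 'n) set topology) \<subseteq> grassmannian k"
    by (metis openin_grassmannian_topology openin_topspace)
  have "{v \<in> frames k. vec.span (v ` {..<k}) \<in> grassmannian k} = (frames k :: (nat \<Rightarrow> 'a ^ 'n) set)"
    using frame_span_grassmannian by auto
  then have "openin (grassmannian_topology k) (grassmannian k :: ('a ^ 'n) set set)"
    using openin_topspace[of "frame_topology k :: (nat \<Rightarrow> 'a ^ 'n) topology"]
    by (simp add: openin_grassmannian_topology)
  then show "(grassmannian k :: ('a ^ 'n) set set) \<subseteq> topspace (grassmannian_topology k)"
    by (rule openin_subset)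
qed

lemma grassmannian_frame:
  assumes "V \<in> grassmannian k"
  shows "\<exists>v\<in>frames k. V = vec.span (v ` {..<k})"
proof -
  obtain B where B: "B \<subseteq> V" "vec.independent B" "V \<subseteq> vec.span B" "card B = vec.dim V"
    using vec.basis_exists by blast
  have V: "vec.subspace V" "vec.dim V = k" using assms by (auto simp: grassmannian_def)
  have fin: "finite B" using B(2) by (rule vec.finiteI_independent)
  obtain h where h: "bij_betw h {0..<k} B"
    using ex_bij_betw_nat_finite[OF fin] B(4) V(2) by auto
  define v where "v = restrict h {..<k}"
  have h': "bij_betw h {..<k} B" using h by (simp add: lessThan_atLeast0)
  have im: "v ` {..<k} = B" using h' by (simp add: v_def bij_betw_def)
  have "inj_on v {..<k}" using h' by (simp add: v_def bij_betw_def inj_on_restrict_eq)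
  then have "v \<in> frames k" using im B(2) by (auto simp: frames_def v_def)
  moreover have "V = vec.span B"
    using B V vec.span_minimal[of B V] by auto
  ultimately show ?thesis using im by auto
qed

lemma quotient_map_frame_span:
  "quotient_map (frame_topology k) (grassmannian_topology k) (\<lambda>v. vec.span (v ` {..<k}))"
  unfolding quotient_map_def
  using frame_span_grassmannian grassmannian_frame
  by (auto simp: openin_grassmannian_topology image_iff)

section \<open>Measures and ergodicity\<close>

definition borel_of :: "'a topology \<Rightarrow> 'a measure" where
  "borel_of T = sigma (topspace T) {U. openin T U}"

definition matrix_image :: "'a :: comm_semiring_1 ^ 'n ^ 'n \<Rightarrow> ('a ^ 'n) set \<Rightarrow> ('a ^ 'n) set" where
  "matrix_image A V = (\<lambda>v. A *v v) ` V"

definition SL_padic_integers :: "('p :: prime_card padic ^ 'm ^ 'm) set" where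
  "SL_padic_integers = {A. (\<forall>i j. A $ i $ j \<in> padic_integers) \<and> det A = 1}"

definition is_haar_prob ::
    "('a :: {comm_ring_1, topological_space} ^ 'm ^ 'm) set \<Rightarrow> ('a ^ 'm ^ 'm) measure \<Rightarrow> bool" where
  "is_haar_prob G \<nu> \<longleftrightarrow> prob_space \<nu> \<and> sets \<nu> = sets (restrict_space borel G) \<and>
     (\<forall>g\<in>G. \<forall>B\<in>sets \<nu>. emeasure \<nu> ((\<lambda>h. g ** h) ` B) = emeasure \<nu> B)"

text \<open>
  The action of the special linear group over the p-adic integers on lines is transitive,
  so the push-forward does not depend on the base point \<open>L\<close>.
\<close>

definition is_haar_projective :: "('p :: prime_card padic ^ 'm) set measure \<Rightarrow> bool" where
  "is_haar_projective \<mu> \<longleftrightarrow> (\<exists>\<nu> L. is_haar_prob SL_padic_integers \<nu> \<and> L \<in> grassmannian 1 \<and>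
     \<mu> = distr \<nu> (borel_of (grassmannian_topology 1)) (\<lambda>g. matrix_image g L))"

lemma matrix_image_span:
  fixes A :: "'a :: field ^ 'n ^ 'n"
  shows "matrix_image A (vec.span S) = vec.span (((*v) A) ` S)"
  unfolding matrix_image_def by (rule vec.linear_span_image[OF matrix_vector_mul_linear_gen, symmetric])

lemma matrix_image_frame:
  fixes A :: "'a :: field ^ 'n ^ 'n"
  assumes v: "v \<in> frames k" and A: "invertible A"
  shows "(\<lambda>i\<in>{..<k}. A *v v i) \<in> frames k"
proof -
  have inj: "inj ((*v) A)" using A by (rule inj_matrix_vector_mult)
  have im: "(\<lambda>i\<in>{..<k}. A *v v i) ` {..<k} = ((*v) A) ` v ` {..<k}" by auto
  have "vec.independent (((*v) A) ` v ` {..<k})"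
  proof (rule vec.linear_independent_injective_image[OF matrix_vector_mul_linear_gen])
    show "vec.independent (v ` {..<k})" using v by (simp add: frames_def)
    show "inj_on ((*v) A) (vec.span (v ` {..<k}))" using inj by (rule inj_on_subset) simp
  qed
  moreover have "inj_on (\<lambda>i\<in>{..<k}. A *v v i) {..<k}"
    using v inj by (auto simp: frames_def inj_on_def inj_def)
  ultimately show ?thesis by (simp add: frames_def image_image)
qed

lemma continuous_map_orbit:
  fixes G :: "('a :: {field, topological_comm_monoid_add, topological_semigroup_mult} ^ 'n ^ 'n) set"
  assumes V: "V \<in> grassmannian k" and G: "\<And>A. A \<in> G \<Longrightarrow> invertible A"
  shows "continuous_map (top_of_set G) (grassmannian_topology k) (\<lambda>A. matrix_image A V)"
proof -
  obtain v where v: "v \<in> frames k" "V = vec.span (v ` {..<k})"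
    using grassmannian_frame[OF V] by blast
  let ?f = "\<lambda>A. \<lambda>i\<in>{..<k}. A *v v i"
  have "continuous_map (top_of_set G) euclidean (\<lambda>A. A *v w)" for w :: "'a ^ 'n"
    unfolding continuous_map_iff_continuous matrix_vector_mult_def
    by (intro continuous_on_vec_lambda continuous_intros)
  then have "continuous_map (top_of_set G) (product_topology (\<lambda>_. euclidean) {..<k}) ?f"
    by (auto simp: continuous_map_componentwise)
  moreover have "?f ` topspace (top_of_set G) \<subseteq> frames k"
    using matrix_image_frame[OF v(1) G] by auto
  ultimately have "continuous_map (top_of_set G) (frame_topology k) ?f"
    unfolding frame_topology_def by (auto simp: continuous_map_in_subtopology)
  from continuous_map_compose[OF this quotient_imp_continuous_map[OF quotient_map_frame_span]]
  have "continuous_map (top_of_set G) (grassmannian_topology k) (\<lambda>A. vec.span (?f A ` {..<k}))"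
    by (simp add: o_def)
  moreover have "vec.span (?f A ` {..<k}) = matrix_image A V" for A
    by (simp add: v(2) matrix_image_span image_image)
  ultimately show ?thesis by simp
qed

lemma SL_padic_integers_invertible: "A \<in> SL_padic_integers \<Longrightarrow> invertible A"
  by (simp add: SL_padic_integers_def invertible_det_nz)

lemma prob_space_haar_projective:
  fixes \<mu> :: "('p :: prime_card padic ^ 'm) set measure"
  assumes "is_haar_projective \<mu>"
  shows "prob_space \<mu>"
proof -
  let ?T = "grassmannian_topology 1 :: ('p padic ^ 'm) set topology"
  obtain \<nu> L where \<nu>: "is_haar_prob SL_padic_integers \<nu>" and L: "L \<in> grassmannian 1"
    and \<mu>: "\<mu> = distr \<nu> (borel_of ?T) (\<lambda>g. matrix_image g L)"
    using assms by (auto simp: is_haar_projective_def)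
  have sets: "sets \<nu> = sets (restrict_space borel SL_padic_integers)" and p: "prob_space \<nu>"
    using \<nu> by (auto simp: is_haar_prob_def)
  have sp: "space \<nu> = SL_padic_integers"
    using sets_eq_imp_space_eq[OF sets] by (simp add: space_restrict_space)
  have c: "continuous_map (top_of_set SL_padic_integers) ?T (\<lambda>g. matrix_image g L)"
    using L SL_padic_integers_invertible by (rule continuous_map_orbit)
  have "(\<lambda>g. matrix_image g L) \<in> measurable \<nu> (borel_of ?T)"
    unfolding borel_of_def
  proof (rule measurable_measure_of)
    show "{U. openin ?T U} \<subseteq> Pow (topspace ?T)"
      by (auto dest: openin_subset simp del: topspace_grassmannian_topology)
    show "(\<lambda>g. matrix_image g L) \<in> space \<nu> \<rightarrow> topspace ?T"
      using continuous_map_funspace[OF c] by (simp add: sp)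
    fix U assume "U \<in> {U. openin ?T U}"
    then have "openin (top_of_set SL_padic_integers) {g \<in> SL_padic_integers. matrix_image g L \<in> U}"
      using openin_continuous_map_preimage[OF c] by simp
    moreover have "(\<lambda>g. matrix_image g L) -` U \<inter> space \<nu> = {g \<in> SL_padic_integers. matrix_image g L \<in> U}"
      by (auto simp: sp)
    ultimately show "(\<lambda>g. matrix_image g L) -` U \<inter> space \<nu> \<in> sets \<nu>"
      by (auto simp: sets sets_restrict_space openin_open)
  qed
  then show ?thesis unfolding \<mu> by (rule prob_space.prob_space_distr[OF p])
qed

definition orbit_rel :: "'g set \<Rightarrow> ('g \<Rightarrow> 'x \<Rightarrow> 'x) \<Rightarrow> 'x set \<Rightarrow> ('x \<times> 'x) set" where
  "orbit_rel G act X = {(x, y). x \<in> X \<and> y \<in> X \<and> (\<exists>g\<in>G. y = act g x)}"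

definition borel_homomorphism ::
    "'x measure \<Rightarrow> ('x \<times> 'x) set \<Rightarrow> 'y measure \<Rightarrow> ('y \<times> 'y) set \<Rightarrow> ('x \<Rightarrow> 'y) \<Rightarrow> bool" where
  "borel_homomorphism M E N F f \<longleftrightarrow> f \<in> measurable M N \<and> (\<forall>(x, x')\<in>E. (f x, f x') \<in> F)"

definition F_ergodic ::
    "'g set \<Rightarrow> ('g \<Rightarrow> 'x \<Rightarrow> 'x) \<Rightarrow> 'x measure \<Rightarrow> 'y measure \<Rightarrow> ('y \<times> 'y) set \<Rightarrow> bool" where
  "F_ergodic G act M N F \<longleftrightarrow>
     (\<forall>f. borel_homomorphism M (orbit_rel G act (space M)) N F f \<longrightarrow>
        (\<exists>A\<in>sets M. space M - A \<in> null_sets M \<and> (\<exists>y\<in>space N. f ` A \<subseteq> F `` {y})))"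

definition SL_int :: "(int ^ 'm ^ 'm) set" where
  "SL_int = {A. det A = 1}"

definition GL_rat :: "(rat ^ 'n ^ 'n) set" where
  "GL_rat = {A. invertible A}"

end

theory Submission
  imports Defs "HOL-Number_Theory.Cong"
begin

text \<open>
  In the affine chart where a fixed coordinate equals 1 and all coordinates are integral, the Haar measure
  becomes a probability measure on which the translations by integer vectors act as a \<open>p\<close>-adic
  odometer, and the elementary matrices not touching the fixed coordinate normalise this action.

  Let \<open>f\<close> be a homomorphism into the orbit relation of a countable group \<open>\<Lambda>\<close>. For two
  points \<open>x\<close>, \<open>y\<close> of a small ball, compare the elements of \<open>\<Lambda>\<close> moving \<open>f x\<close> to \<open>f (g x)\<close> and
  \<open>f y\<close> to \<open>f (g y)\<close>. The probability that the comparison is the same for \<open>g\<close> and \<open>h\<close> is a positive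
  semidefinite kernel, almost invariant for the finitely many generators once the balls are small. By
  relative property (T) of the plane in its semidirect product with the shears, a single element of
  \<open>\<Lambda>\<close> works simultaneously for most points of the ball, uniformly over all translations. Since
  only countably many stabilisers occur, \<open>f (x + j p\<^sup>k e) = u\<^sup>j (f x)\<close> follows on most of some ball,
  for a fixed \<open>u\<close> in \<open>\<Lambda>\<close> and all \<open>j\<close>.

  Choose exponents tending to 0 in the \<open>p\<close>-adic and to 1 in the \<open>q\<close>-adic integers. Along them the left side
  returns to \<open>f x\<close> because translations by small vectors do. On Pluecker coordinates, \<open>u\<close> is a linear map
  over the \<open>q\<close>-adic numbers, and a line that is recurrent along powers tending \<open>q\<close>-adically to the first
  power is fixed by one of them. So some power of \<open>u\<close> fixes \<open>f x\<close>, the map \<open>f\<close> is almost invariant under a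
  finite index group of translations of the ball, and hence has a fibre of positive measure. Ergodicity of
  the translations turns this fibre into a conull class.
\<close>

section \<open>Kernels on the plane and relative property (T)\<close>

text \<open>The obstacle is that rational matrices do not act freely on the Grassmannian: nothing
  singles out one matrix carrying \<open>f x\<close> to \<open>f (g x)\<close>, so there is no
  cocycle that a superrigidity theorem could take as input. Only coincidences of double cosets are
  counted, and the probability of a coincidence is still a positive definite kernel. Uniformity is
  the whole gain from property (T): one small ball serves all translations, so the exponent may
  afterwards run along any sequence, in particular one that has different limits at the two primes.
  That the primes differ enters only through the Chinese remainder theorem. The hypothesis
  \<open>3 \<le> CARD('m)\<close> leaves two coordinates besides the normalised one, hence a plane
  and its shears. Spectral arguments are phrased with finite sums against kernels, so that neither
  unitary representations nor spectral measures are constructed. Stabilisers are countable in number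
  because the rational matrices mapping a subspace into itself form a finite-dimensional rational
  vector space, and there are only countably many of these.\<close>

definition psd :: "('i \<Rightarrow> 'i \<Rightarrow> real) \<Rightarrow> bool" where
  "psd K \<longleftrightarrow> (\<forall>i j. K i j = K j i) \<and>
     (\<forall>(n::nat) s a. 0 \<le> (\<Sum>i<n. \<Sum>j<n. a i * a j * K (s i) (s j)))"

lemma psd_sym: "psd K \<Longrightarrow> K i j = K j i"
  by (auto simp: psd_def)

text \<open>Index lists in \<open>psd\<close> may contain repetitions, so pulling back along a map
  that is not injective costs nothing.\<close>

lemma psd_comp: "psd K \<Longrightarrow> psd (\<lambda>i j. K (f i) (f j))"
  unfolding psd_def
proof (elim conjE, intro conjI allI)
  fix n :: nat and s :: "nat \<Rightarrow> 'b" and a :: "nat \<Rightarrow> real"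
  assume "\<forall>(n::nat) s a. 0 \<le> (\<Sum>i<n. \<Sum>j<n. a i * a j * K (s i) (s j))"
  then show "0 \<le> (\<Sum>i<n. \<Sum>j<n. a i * a j * K (f (s i)) (f (s j)))"
    by (elim allE[where x = n] allE[where x = "\<lambda>i. f (s i)"] allE[where x = a])
qed auto

lemma psd_nonneg:
  assumes "psd K" "finite A"
  shows "0 \<le> (\<Sum>i\<in>A. \<Sum>j\<in>A. a i * a j * K (s i) (s j))"
proof -
  obtain h where h: "bij_betw h {..<card A} A"
    using ex_bij_betw_nat_finite[OF assms(2)] by (auto simp: lessThan_atLeast0)
  have "(\<Sum>i\<in>A. \<Sum>j\<in>A. a i * a j * K (s i) (s j)) =
    (\<Sum>i<card A. \<Sum>j<card A. a (h i) * a (h j) * K (s (h i)) (s (h j)))"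
    by (simp add: sum.reindex_bij_betw[OF h, symmetric])
  moreover have "0 \<le> (\<Sum>i<card A. \<Sum>j<card A. a (h i) * a (h j) * K (s (h i)) (s (h j)))"
    using conjunct2[OF assms(1)[unfolded psd_def]]
    by (elim allE[where x = "card A"] allE[where x = "\<lambda>i. s (h i)"] allE[where x = "\<lambda>i. a (h i)"])
  ultimately show ?thesis by simp
qed

lemma discriminant_le:
  fixes x y z :: real
  assumes "\<And>t. 0 \<le> x + 2 * t * y + t^2 * z" and "0 \<le> z"
  shows "y^2 \<le> x * z"
proof (cases "z = 0")
  case True
  have "y = 0"
  proof (rule ccontr)
    assume "y \<noteq> 0"
    \<comment> \<open>At this \<open>t\<close> the expression \<open>x + 2 * t * y\<close> equals
      -1.\<close>
    then show False using assms(1)[of "- (x + 1) / (2 * y)"] True by (simp add: field_simps)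
  qed
  then show ?thesis using True by simp
next
  case False
  then show ?thesis using assms(1)[of "- y / z"] assms(2)
    by (simp add: field_simps power2_eq_square)
qed

text \<open>Two combinations of vectors appear as two coefficient families over one index set;
  combinations with different supports are obtained by letting coefficients vanish.\<close>

lemma psd_Cauchy_Schwarz:
  assumes K: "psd K" and A: "finite A"
  shows "(\<Sum>i\<in>A. \<Sum>j\<in>A. a i * b j * K (s i) (s j))\<^sup>2 \<le>
    (\<Sum>i\<in>A. \<Sum>j\<in>A. a i * a j * K (s i) (s j)) * (\<Sum>i\<in>A. \<Sum>j\<in>A. b i * b j * K (s i) (s j))"
proof (rule discriminant_le)
  fix t :: real
  let ?Q = "\<lambda>a b. \<Sum>i\<in>A. \<Sum>j\<in>A. a i * b j * K (s i) (s j)"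
  have sym: "?Q b a = ?Q a b"
    by (subst sum.swap) (simp add: psd_sym[OF K] mult.commute mult.left_commute)
  have "0 \<le> ?Q (\<lambda>i. a i + t * b i) (\<lambda>i. a i + t * b i)"
    by (rule psd_nonneg[OF K A])
  also have "\<dots> = ?Q a a + t * ?Q a b + t * ?Q b a + t^2 * ?Q b b"
    by (simp add: algebra_simps sum.distrib sum_distrib_left power2_eq_square)
  also have "\<dots> = ?Q a a + 2 * t * ?Q a b + t^2 * ?Q b b" by (simp add: sym)
  finally show "0 \<le> ?Q a a + 2 * t * ?Q a b + t^2 * ?Q b b" .
qed (rule psd_nonneg[OF K A])

section \<open>Trigonometric polynomials on the torus\<close>

definition ang :: "int \<times> int \<Rightarrow> real \<times> real \<Rightarrow> real" where
  "ang u \<theta> = 2 * pi * (of_int (fst u) * fst \<theta> + of_int (snd u) * snd \<theta>)"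

lemma ang_add: "ang (u + v) \<theta> = ang u \<theta> + ang v \<theta>"
  and ang_diff: "ang (u - v) \<theta> = ang u \<theta> - ang v \<theta>"
  and ang_minus: "ang (- u) \<theta> = - ang u \<theta>"
  and ang_0 [simp]: "ang 0 \<theta> = 0"
  by (simp_all add: ang_def algebra_simps)

text \<open>Orthogonality of the characters of the integers modulo \<open>R\<close>: the bound on
  \<open>k\<close> leaves 0 as the only multiple of \<open>R\<close> in range.\<close>

lemma sum_cis_root:
  fixes k :: int and R :: nat
  assumes "R > 0" "\<bar>k\<bar> < int R"
  shows "(\<Sum>j<R. cis (2 * pi * (of_int k * (real j / real R)))) = (if k = 0 then of_nat R else 0)"
proof (cases "k = 0")
  case False
  define z where "z = cis (2 * pi * of_int k / real R)"
  have pw: "cis (2 * pi * (of_int k * (real j / real R))) = z ^ j" for j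
    unfolding z_def Complex.DeMoivre by (simp add: mult_ac)
  have "z ^ R = cis (2 * pi * of_int k)"
    unfolding z_def Complex.DeMoivre using assms by simp
  also have "\<dots> = 1" by (simp add: cis_multiple_2pi)
  finally have zR: "z ^ R = 1" .
  have "z \<noteq> 1"
  proof
    assume "z = 1"
    then have "cos (2 * pi * of_int k / real R) = 1" by (simp add: z_def complex_eq_iff)
    then obtain n :: int where n: "2 * pi * of_int k / real R = of_int n * 2 * pi"
      by (auto simp: cos_one_2pi_int)
    then have "real_of_int k = of_int (n * int R)" using assms by (simp add: field_simps)
    then have "k = n * int R" by linarith
    then have "int R * \<bar>n\<bar> < int R" using assms by (simp add: abs_mult mult.commute)
    then have "n = 0" using assms by (simp add: mult_less_cancel_left1)
    then show False using \<open>k = n * int R\<close> False by simp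
  qed
  moreover have "(\<Sum>j<R. z ^ j) * (z - 1) = 0"
    using geometric_sum[of z R] zR \<open>z \<noteq> 1\<close> by simp
  ultimately show ?thesis using False by (simp only: pw) simp
qed simp

definition grid :: "nat \<Rightarrow> (real \<times> real) set" where
  "grid R = (\<lambda>(i, j). (real i / real R, real j / real R)) ` ({..<R} \<times> {..<R})"

lemma sum_cos_grid:
  fixes u :: "int \<times> int"
  assumes "R > 0" "\<bar>fst u\<bar> < int R" "\<bar>snd u\<bar> < int R"
  shows "(\<Sum>\<theta>\<in>grid R. cos (ang u \<theta>)) = (if u = 0 then (real R)^2 else 0)"
proof -
  have inj: "inj_on (\<lambda>(i, j). (real i / real R, real j / real R)) ({..<R} \<times> {..<R})"
    using assms by (auto simp: inj_on_def)
  have "(\<Sum>\<theta>\<in>grid R. cos (ang u \<theta>)) =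
    Re (\<Sum>i<R. \<Sum>j<R. cis (2 * pi * (of_int (fst u) * (real i / real R))) * cis (2 * pi * (of_int (snd u) * (real j / real R))))"
    unfolding grid_def sum.reindex[OF inj]
    by (simp add: sum.cartesian_product ang_def case_prod_unfold cis_mult algebra_simps)
  also have "\<dots> = Re ((\<Sum>i<R. cis (2 * pi * (of_int (fst u) * (real i / real R)))) * (\<Sum>j<R. cis (2 * pi * (of_int (snd u) * (real j / real R)))))"
    by (simp only: sum_product)
  also have "\<dots> = (if u = 0 then (real R)^2 else 0)"
    unfolding sum_cis_root[OF assms(1,2)] sum_cis_root[OF assms(1,3)]
    by (auto simp: prod_eq_iff power2_eq_square)
  finally show ?thesis .
qed

definition zbox :: "nat \<Rightarrow> (int \<times> int) set" where
  "zbox N = {0..<int N} \<times> {0..<int N}"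

lemma finite_zbox [simp]: "finite (zbox N)" by (simp add: zbox_def)

text \<open>These counts are the weights of a Fejer kernel. Divided by the area of the box they tend
  to 1 for fixed \<open>u\<close>, which is how the box disappears from the next lemma.\<close>

lemma card_zbox_diff:
  fixes u :: "int \<times> int"
  assumes "\<bar>fst u\<bar> \<le> int N" "\<bar>snd u\<bar> \<le> int N"
  shows "real (card {(v, w) \<in> zbox N \<times> zbox N. v - w = u}) =
     (real N - of_int \<bar>fst u\<bar>) * (real N - of_int \<bar>snd u\<bar>)"
proof -
  let ?I = "\<lambda>k::int. {max 0 (-k)..<min (int N) (int N - k)}"
  have "bij_betw (\<lambda>w. (w + u, w)) (?I (fst u) \<times> ?I (snd u)) {(v, w) \<in> zbox N \<times> zbox N. v - w = u}"
    by (rule bij_betw_byWitness[where f' = snd]) (auto simp: zbox_def plus_prod_def)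
  then have "card {(v, w) \<in> zbox N \<times> zbox N. v - w = u} = card (?I (fst u) \<times> ?I (snd u))"
    by (simp add: bij_betw_same_card)
  moreover have "real (card (?I k)) = real N - of_int \<bar>k\<bar>" if "\<bar>k\<bar> \<le> int N" for k
    using that by (simp add: of_nat_nat)
  ultimately show ?thesis using assms by (simp add: card_cartesian_product)
qed

text \<open>A positive definite function is a positive functional on trigonometric polynomials; this
  replaces its spectral measure. For each \<open>\<theta>\<close> the sum of
  \<open>cos (ang (v - w) \<theta>) * \<psi> (v - w)\<close> over a box is nonnegative, and so is
  its product with the given polynomial. Summing over a fine grid keeps only matching frequencies
  and produces the wanted sum with Fejer weights, which tend to 1 as the box grows.\<close>

lemma trig_positive:
  fixes \<psi> :: "int \<times> int \<Rightarrow> real"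
  assumes K: "psd (\<lambda>v w. \<psi> (v - w))" and I: "finite I"
    and pos: "\<And>\<theta>. 0 \<le> (\<Sum>i\<in>I. \<alpha> i * cos (ang (s i) \<theta>))"
  shows "0 \<le> (\<Sum>i\<in>I. \<alpha> i * \<psi> (s i))"
proof -
  have even: "\<psi> (- u) = \<psi> u" for u
    using psd_sym[OF K, of 0 u] by simp
  define b where "b = Max (insert 0 ((\<lambda>i. max \<bar>fst (s i)\<bar> \<bar>snd (s i)\<bar>) ` I))"
  have b: "\<bar>fst (s i)\<bar> \<le> b" "\<bar>snd (s i)\<bar> \<le> b" if "i \<in> I" for i
  proof -
    have "max \<bar>fst (s i)\<bar> \<bar>snd (s i)\<bar> \<le> b" unfolding b_def using I that by (intro Max_ge) auto
    then show "\<bar>fst (s i)\<bar> \<le> b" "\<bar>snd (s i)\<bar> \<le> b" by auto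
  qed
  have b0: "b \<ge> 0" unfolding b_def using I by (intro Max_ge) auto
  define C where "C N u = real (card {(v, w) \<in> zbox N \<times> zbox N. v - w = u})" for N and u :: "int \<times> int"
  have Csum: "(\<Sum>v\<in>zbox N. \<Sum>w\<in>zbox N. if v - w = u then x else 0) = C N u * x" for N u x
  proof -
    have "(\<Sum>v\<in>zbox N. \<Sum>w\<in>zbox N. if v - w = u then x else 0) =
      (\<Sum>z\<in>zbox N \<times> zbox N. if fst z - snd z = u then x else 0)"
      by (simp add: sum.cartesian_product case_prod_unfold)
    also have "\<dots> = (\<Sum>z\<in>{z \<in> zbox N \<times> zbox N. fst z - snd z = u}. x)"
      by (rule sum.inter_filter[symmetric]) simp
    also have "{z \<in> zbox N \<times> zbox N. fst z - snd z = u} = {(v, w) \<in> zbox N \<times> zbox N. v - w = u}" by auto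
    finally show ?thesis by (simp add: C_def)
  qed
  have Cm: "C N (- u) = C N u" for N u
  proof -
    have "bij_betw prod.swap {(v, w) \<in> zbox N \<times> zbox N. v - w = u} {(v, w) \<in> zbox N \<times> zbox N. v - w = - u}"
      by (rule bij_betw_byWitness[where f' = prod.swap]) (auto simp: zbox_def prod_eq_iff)
    then show ?thesis by (simp add: C_def bij_betw_same_card)
  qed
  have fin: "0 \<le> (\<Sum>i\<in>I. \<alpha> i * \<psi> (s i) * C N (s i))" for N
  proof -
    \<comment> \<open>Larger than every coordinate of \<open>s i - (v - w)\<close> and
      \<open>s i + (v - w)\<close> in absolute value, so that on the grid only the frequency 0
      survives.\<close>
    define R where "R = 2 * N + nat b + 1"
    have R: "R > 0" by (simp add: R_def)
    have bx: "\<bar>fst (v - w)\<bar> < int N + 1" "\<bar>snd (v - w)\<bar> < int N + 1"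
      if "v \<in> zbox N" "w \<in> zbox N" for v w using that by (auto simp: zbox_def)
    define T where "T i v w = (\<Sum>\<theta>\<in>grid R. cos (ang (s i) \<theta>) * cos (ang (v - w) \<theta>))" for i v w
    \<comment> \<open>The product of cosines splits into the frequencies
      \<open>s i - (v - w)\<close> and \<open>s i + (v - w)\<close>. Evenness of
      \<open>\<psi>\<close> later merges the two contributions.\<close>
    have T: "T i v w = (real R)^2 / 2 * ((if v - w = s i then 1 else 0) + (if v - w = - s i then 1 else 0))"
      if "i \<in> I" "v \<in> zbox N" "w \<in> zbox N" for i v w
    proof -
      have "T i v w = (\<Sum>\<theta>\<in>grid R. cos (ang (s i - (v - w)) \<theta>) / 2 + cos (ang (s i + (v - w)) \<theta>) / 2)"
        unfolding T_def by (intro sum.cong refl) (simp add: ang_add ang_diff cos_times_cos add_divide_distrib)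
      also have "\<dots> = (if s i - (v - w) = 0 then (real R)^2 else 0) / 2 + (if s i + (v - w) = 0 then (real R)^2 else 0) / 2"
        unfolding sum.distrib sum_divide_distrib[symmetric]
        using bx[OF that(2,3)] b[OF that(1)] b0 R
        by (subst (1 2) sum_cos_grid) (auto simp: R_def)
      also have "\<dots> = (real R)^2 / 2 * ((if v - w = s i then 1 else 0) + (if v - w = - s i then 1 else 0))"
      proof -
        have "s i - (v - w) = 0 \<longleftrightarrow> v - w = s i" by auto
        moreover have "s i + (v - w) = 0 \<longleftrightarrow> v - w = - s i" by (simp add: add_eq_0_iff eq_neg_iff_add_eq_0)
        ultimately show ?thesis by auto
      qed
      finally show ?thesis .
    qed
    \<comment> \<open>The addition formula splits the sum into two quadratic forms of the kernel,
      with coefficients \<open>cos (ang v \<theta>)\<close> and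
      \<open>sin (ang v \<theta>)\<close>.\<close>
    have q: "0 \<le> (\<Sum>v\<in>zbox N. \<Sum>w\<in>zbox N. cos (ang (v - w) \<theta>) * \<psi> (v - w))" for \<theta>
    proof -
      have "0 \<le> (\<Sum>v\<in>zbox N. \<Sum>w\<in>zbox N. cos (ang v \<theta>) * cos (ang w \<theta>) * \<psi> (v - w)) +
         (\<Sum>v\<in>zbox N. \<Sum>w\<in>zbox N. sin (ang v \<theta>) * sin (ang w \<theta>) * \<psi> (v - w))"
        using psd_nonneg[OF K finite_zbox, where a = "\<lambda>v. cos (ang v \<theta>)" and s = "\<lambda>v. v"]
          psd_nonneg[OF K finite_zbox, where a = "\<lambda>v. sin (ang v \<theta>)" and s = "\<lambda>v. v"] by simp
      then show ?thesis by (simp add: ang_diff cos_diff algebra_simps sum.distrib)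
    qed
    have "0 \<le> (\<Sum>\<theta>\<in>grid R. (\<Sum>i\<in>I. \<alpha> i * cos (ang (s i) \<theta>)) * (\<Sum>v\<in>zbox N. \<Sum>w\<in>zbox N. cos (ang (v - w) \<theta>) * \<psi> (v - w)))"
      by (intro sum_nonneg mult_nonneg_nonneg pos q)
    also have "\<dots> = (\<Sum>\<theta>\<in>grid R. \<Sum>i\<in>I. \<Sum>v\<in>zbox N. \<Sum>w\<in>zbox N. \<alpha> i * \<psi> (v - w) * (cos (ang (s i) \<theta>) * cos (ang (v - w) \<theta>)))"
      unfolding sum_distrib_right unfolding sum_distrib_left
      by (intro sum.cong refl) (simp add: mult_ac)
    also have "\<dots> = (\<Sum>i\<in>I. \<Sum>v\<in>zbox N. \<Sum>w\<in>zbox N. \<alpha> i * \<psi> (v - w) * T i v w)"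
      unfolding T_def sum_distrib_left
      by (simp only: sum.swap[where A = "grid R"])
    also have "\<dots> = (\<Sum>i\<in>I. \<Sum>v\<in>zbox N. \<Sum>w\<in>zbox N. (real R)^2 / 2 *
       ((if v - w = s i then \<alpha> i * \<psi> (s i) else 0) + (if v - w = - s i then \<alpha> i * \<psi> (s i) else 0)))"
      by (intro sum.cong refl) (auto simp: T even)
    also have "\<dots> = (\<Sum>i\<in>I. (real R)^2 / 2 * (C N (s i) * (\<alpha> i * \<psi> (s i)) + C N (- s i) * (\<alpha> i * \<psi> (s i))))"
      by (simp only: sum_distrib_left[symmetric] sum.distrib Csum)
    also have "\<dots> = (real R)^2 * (\<Sum>i\<in>I. \<alpha> i * \<psi> (s i) * C N (s i))"
      by (simp add: Cm sum_distrib_left mult_ac)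
    finally show ?thesis using R by (simp add: zero_le_mult_iff)
  qed
  have lim: "(\<lambda>N. C N (s i) / (real N)^2) \<longlonglongrightarrow> 1" if "i \<in> I" for i
  proof -
    let ?x = "of_int \<bar>fst (s i)\<bar> :: real" and ?y = "of_int \<bar>snd (s i)\<bar> :: real"
    have 1: "(\<lambda>N. (1 - ?x * inverse (real N)) * (1 - ?y * inverse (real N))) \<longlonglongrightarrow> (1 - ?x * 0) * (1 - ?y * 0)"
      by (intro tendsto_intros lim_inverse_n)
    have "\<forall>\<^sub>F N in sequentially. (1 - ?x * inverse (real N)) * (1 - ?y * inverse (real N)) = C N (s i) / (real N)^2"
    proof (rule eventually_sequentiallyI[of "nat b + 1"])
      fix N assume N: "nat b + 1 \<le> N"
      then have "\<bar>fst (s i)\<bar> \<le> int N" "\<bar>snd (s i)\<bar> \<le> int N" using b[OF that] b0 by auto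
      then show "(1 - ?x * inverse (real N)) * (1 - ?y * inverse (real N)) = C N (s i) / (real N)^2"
        unfolding C_def using N by (subst card_zbox_diff) (auto simp: field_simps power2_eq_square)
    qed
    with 1 show ?thesis by (simp add: Lim_transform_eventually)
  qed
  have "(\<lambda>N. \<Sum>i\<in>I. \<alpha> i * \<psi> (s i) * (C N (s i) / (real N)^2)) \<longlonglongrightarrow> (\<Sum>i\<in>I. \<alpha> i * \<psi> (s i) * 1)"
    by (intro tendsto_intros lim)
  moreover have "0 \<le> (\<Sum>i\<in>I. \<alpha> i * \<psi> (s i) * (C N (s i) / (real N)^2))" for N
  proof -
    have "(\<Sum>i\<in>I. \<alpha> i * \<psi> (s i) * (C N (s i) / (real N)^2)) = (\<Sum>i\<in>I. \<alpha> i * \<psi> (s i) * C N (s i)) / (real N)^2"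
      by (simp add: sum_divide_distrib)
    then show ?thesis using fin[of N] by simp
  qed
  ultimately show ?thesis by (intro LIMSEQ_le_const[where a = 0]) auto
qed

text \<open>The number \<open>c\<close> stands for the integral of \<open>\<phi>\<close> against the
  spectral measure of \<open>\<psi>\<close>. A relation is used because one function has several
  expansions: \<open>u\<close> and \<open>- u\<close> have the same cosine.\<close>

definition trig_value :: "(int \<times> int \<Rightarrow> real) \<Rightarrow> (real \<times> real \<Rightarrow> real) \<Rightarrow> real \<Rightarrow> bool" where
  "trig_value \<psi> \<phi> c \<longleftrightarrow> (\<exists>A \<alpha>. finite A \<and> (\<forall>\<theta>. \<phi> \<theta> = (\<Sum>u\<in>A. \<alpha> u * cos (ang u \<theta>))) \<and>
     c = (\<Sum>u\<in>A. \<alpha> u * \<psi> u))"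

lemma trig_value_cos: "trig_value \<psi> (\<lambda>\<theta>. k * cos (ang u \<theta>)) (k * \<psi> u)"
  unfolding trig_value_def by (intro exI[of _ "{u}"] exI[of _ "\<lambda>_. k"]) auto

lemma trig_value_const: "trig_value \<psi> (\<lambda>\<theta>. k) (k * \<psi> 0)"
  using trig_value_cos[of \<psi> k 0] by simp

lemma trig_value_add:
  assumes "trig_value \<psi> \<phi> c" "trig_value \<psi> \<phi>' c'"
  shows "trig_value \<psi> (\<lambda>\<theta>. \<phi> \<theta> + \<phi>' \<theta>) (c + c')"
proof -
  obtain A \<alpha> where A: "finite A" "\<And>\<theta>. \<phi> \<theta> = (\<Sum>u\<in>A. \<alpha> u * cos (ang u \<theta>))" "c = (\<Sum>u\<in>A. \<alpha> u * \<psi> u)"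
    using assms(1) unfolding trig_value_def by auto
  obtain B \<beta> where B: "finite B" "\<And>\<theta>. \<phi>' \<theta> = (\<Sum>u\<in>B. \<beta> u * cos (ang u \<theta>))" "c' = (\<Sum>u\<in>B. \<beta> u * \<psi> u)"
    using assms(2) unfolding trig_value_def by auto
  define \<gamma> where "\<gamma> u = (if u \<in> A then \<alpha> u else 0) + (if u \<in> B then \<beta> u else 0)" for u
  have "(\<Sum>u\<in>A \<union> B. \<gamma> u * h u) = (\<Sum>u\<in>A. \<alpha> u * h u) + (\<Sum>u\<in>B. \<beta> u * h u)" for h
  proof -
    have "(\<Sum>u\<in>A \<union> B. \<gamma> u * h u) = (\<Sum>u\<in>A \<union> B. if u \<in> A then \<alpha> u * h u else 0) + (\<Sum>u\<in>A \<union> B. if u \<in> B then \<beta> u * h u else 0)"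
      unfolding sum.distrib[symmetric] by (intro sum.cong refl) (auto simp: \<gamma>_def algebra_simps)
    also have "\<dots> = (\<Sum>u\<in>A. \<alpha> u * h u) + (\<Sum>u\<in>B. \<beta> u * h u)"
      using A(1) B(1) by (simp add: sum.inter_restrict[symmetric] Int_absorb1)
    finally show ?thesis .
  qed
  then show ?thesis unfolding trig_value_def
    by (intro exI[of _ "A \<union> B"] exI[of _ \<gamma>]) (use A B in simp)
qed

lemma trig_value_cmult:
  assumes "trig_value \<psi> \<phi> c"
  shows "trig_value \<psi> (\<lambda>\<theta>. k * \<phi> \<theta>) (k * c)"
proof -
  obtain A \<alpha> where A: "finite A" "\<And>\<theta>. \<phi> \<theta> = (\<Sum>u\<in>A. \<alpha> u * cos (ang u \<theta>))" "c = (\<Sum>u\<in>A. \<alpha> u * \<psi> u)"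
    using assms(1) unfolding trig_value_def by auto
  show ?thesis unfolding trig_value_def
    by (intro exI[of _ A] exI[of _ "\<lambda>u. k * \<alpha> u"]) (use A in \<open>simp add: sum_distrib_left mult_ac\<close>)
qed

lemma trig_value_nonneg:
  assumes K: "psd (\<lambda>v w. \<psi> (v - w))" and "trig_value \<psi> \<phi> c" "\<And>\<theta>. 0 \<le> \<phi> \<theta>"
  shows "0 \<le> c"
proof -
  obtain A \<alpha> where A: "finite A" "\<And>\<theta>. \<phi> \<theta> = (\<Sum>u\<in>A. \<alpha> u * cos (ang u \<theta>))" "c = (\<Sum>u\<in>A. \<alpha> u * \<psi> u)"
    using assms(2) unfolding trig_value_def by auto
  show ?thesis unfolding A(3) by (rule trig_positive[OF K A(1)]) (use assms(3) A(2) in metis)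
qed

lemma trig_value_ex_sum:
  assumes "finite I" "\<And>i. i \<in> I \<Longrightarrow> \<exists>c. trig_value \<psi> (\<phi> i) c"
  shows "\<exists>c. trig_value \<psi> (\<lambda>\<theta>. \<Sum>i\<in>I. \<phi> i \<theta>) c"
  using assms
proof (induction I rule: finite_induct)
  case empty
  show ?case using trig_value_const[of \<psi> 0] by auto
next
  case (insert i I)
  then show ?case using trig_value_add[of \<psi> "\<phi> i" _ "\<lambda>\<theta>. \<Sum>i\<in>I. \<phi> i \<theta>"] by fastforce
qed

lemma trig_value_ex_mult:
  assumes "\<exists>c. trig_value \<psi> \<phi> c" "\<exists>c. trig_value \<psi> \<phi>' c"
  shows "\<exists>c. trig_value \<psi> (\<lambda>\<theta>. \<phi> \<theta> * \<phi>' \<theta>) c"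
proof -
  obtain A \<alpha> where A: "finite A" "\<And>\<theta>. \<phi> \<theta> = (\<Sum>u\<in>A. \<alpha> u * cos (ang u \<theta>))"
    using assms(1) unfolding trig_value_def by auto
  obtain B \<beta> where B: "finite B" "\<And>\<theta>. \<phi>' \<theta> = (\<Sum>u\<in>B. \<beta> u * cos (ang u \<theta>))"
    using assms(2) unfolding trig_value_def by auto
  have "\<exists>c. trig_value \<psi> (\<lambda>\<theta>. \<Sum>u\<in>A. \<Sum>v\<in>B. \<alpha> u * \<beta> v / 2 * cos (ang (u - v) \<theta>) + \<alpha> u * \<beta> v / 2 * cos (ang (u + v) \<theta>)) c"
    by (intro trig_value_ex_sum A(1) B(1)) (use trig_value_add[OF trig_value_cos trig_value_cos] in blast)
  moreover have "\<phi> \<theta> * \<phi>' \<theta> = (\<Sum>u\<in>A. \<Sum>v\<in>B. \<alpha> u * \<beta> v / 2 * cos (ang (u - v) \<theta>) + \<alpha> u * \<beta> v / 2 * cos (ang (u + v) \<theta>))" for \<theta>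
    unfolding A(2) B(2) sum_product
    by (intro sum.cong refl) (simp add: ang_add ang_diff cos_add cos_diff algebra_simps)
  ultimately show ?thesis by simp
qed

text \<open>Continuous functions of the two basic cosines are uniform limits of such polynomials, so
  this is the bridge from the cutoffs below to values of \<open>\<psi>\<close>.\<close>

lemma trig_value_ex_poly:
  assumes "real_polynomial_function p"
  shows "\<exists>c. trig_value \<psi> (\<lambda>\<theta>. p (cos (2 * pi * fst \<theta>), cos (2 * pi * snd \<theta>))) c"
  using assms
proof (induction rule: real_polynomial_function.induct)
  case (linear f)
  have lin: "f (x, y) = f (1, 0) * x + f (0, 1) * y" for x y
  proof -
    have "f (x, y) = f (x *\<^sub>R (1, 0) + y *\<^sub>R (0, 1))" by simp
    also have "\<dots> = x *\<^sub>R f (1, 0) + y *\<^sub>R f (0, 1)"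
      by (simp only: linear_add[OF bounded_linear.linear[OF linear]] linear_scale[OF bounded_linear.linear[OF linear]])
    finally show ?thesis by simp
  qed
  have "f (cos (2 * pi * fst \<theta>), cos (2 * pi * snd \<theta>)) =
      f (1, 0) * cos (ang (1, 0) \<theta>) + f (0, 1) * cos (ang (0, 1) \<theta>)" for \<theta>
    by (subst lin) (simp add: ang_def)
  then show ?case
    by (simp only:) (rule exI, rule trig_value_add[OF trig_value_cos trig_value_cos])
next
  case (const c)
  show ?case using trig_value_const by blast
next
  case (add f g)
  then show ?case using trig_value_add by blast
next
  case (mult f g)
  then show ?case using trig_value_ex_mult by blast
qed

text \<open>
  The kernel \<open>\<kappa>\<close> is the Gram matrix of two copies of the orbit of a unit vector, the second one moved by an
  operator implementing \<open>g\<close>; the last condition says that this operator almost fixes the vector.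
\<close>

definition almost_inv :: "real \<Rightarrow> (int \<times> int \<Rightarrow> real) \<Rightarrow> (int \<times> int \<Rightarrow> int \<times> int) \<Rightarrow> bool" where
  "almost_inv \<delta> \<psi> g \<longleftrightarrow> (\<exists>\<kappa> :: bool \<times> int \<times> int \<Rightarrow> bool \<times> int \<times> int \<Rightarrow> real. psd \<kappa> \<and>
     (\<forall>v w. \<kappa> (False, v) (False, w) = \<psi> (v - w)) \<and>
     (\<forall>v w. \<kappa> (True, v) (True, w) = \<psi> (g (v - w))) \<and>
     (\<forall>v w. \<kappa> (True, v) (False, w) = \<kappa> (True, 0) (False, w - v)) \<and>
     1 - \<delta> \<le> \<kappa> (True, 0) (False, 0))"

text \<open>In the Gram representation of \<open>\<psi>\<close> the left side is the squared norm of
  a combination of orbit vectors, that is, the integral of the squared modulus of the polynomial. As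
  the sine part vanishes, this modulus is the cosine sum and is at most \<open>B\<close>.\<close>

lemma trig_square_le:
  fixes \<psi> :: "int \<times> int \<Rightarrow> real"
  assumes K: "psd (\<lambda>v w. \<psi> (v - w))" and I: "finite I" and \<psi>0: "\<psi> 0 = 1"
    and c: "\<And>\<theta>. \<bar>\<Sum>i\<in>I. \<alpha> i * cos (ang (s i) \<theta>)\<bar> \<le> B"
    and sn: "\<And>\<theta>. (\<Sum>i\<in>I. \<alpha> i * sin (ang (s i) \<theta>)) = 0"
  shows "(\<Sum>i\<in>I. \<Sum>j\<in>I. \<alpha> i * \<alpha> j * \<psi> (s i - s j)) \<le> B^2"
proof -
  let ?J = "insert None (Some ` (I \<times> I))"
  \<comment> \<open>The index \<open>None\<close> carries the constant \<open>B^2\<close> at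
    frequency 0, so that \<open>B^2\<close> minus the squared modulus is a single trigonometric
    sum.\<close>
  define \<beta> where "\<beta> z = (case z of None \<Rightarrow> B^2 | Some (i, j) \<Rightarrow> - (\<alpha> i * \<alpha> j))" for z
  define r where "r z = (case z of None \<Rightarrow> 0 | Some (i, j) \<Rightarrow> s i - s j)" for z
  have S: "(\<Sum>z\<in>?J. \<beta> z * h (r z)) = B^2 * h 0 - (\<Sum>i\<in>I. \<Sum>j\<in>I. \<alpha> i * \<alpha> j * h (s i - s j))" for h :: "int \<times> int \<Rightarrow> real"
    using I by (subst sum.insert) (auto simp: sum.reindex \<beta>_def r_def sum.cartesian_product case_prod_unfold sum_negf)
  have "0 \<le> (\<Sum>z\<in>?J. \<beta> z * \<psi> (r z))"
  proof (rule trig_positive[OF K])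
    fix \<theta>
    have "(\<Sum>i\<in>I. \<Sum>j\<in>I. \<alpha> i * \<alpha> j * cos (ang (s i - s j) \<theta>)) =
      (\<Sum>i\<in>I. \<alpha> i * cos (ang (s i) \<theta>))^2 + (\<Sum>i\<in>I. \<alpha> i * sin (ang (s i) \<theta>))^2"
      unfolding power2_eq_square sum_product sum.distrib[symmetric]
      by (intro sum.cong refl) (simp add: ang_diff cos_diff algebra_simps)
    also have "\<dots> \<le> B^2" using power_mono[OF c, of \<theta> 2] by (simp add: sn)
    finally have "0 \<le> B^2 * cos (ang 0 \<theta>) - (\<Sum>i\<in>I. \<Sum>j\<in>I. \<alpha> i * \<alpha> j * cos (ang (s i - s j) \<theta>))" by simp
    then show "0 \<le> (\<Sum>z\<in>?J. \<beta> z * cos (ang (r z) \<theta>))"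
      by (subst S[of "\<lambda>u. cos (ang u \<theta>)"])
  qed (use I in simp)
  then show ?thesis by (simp add: S \<psi>0)
qed

text \<open>Think of the vectors at \<open>(False, 0)\<close> and \<open>(True, 0)\<close> and let
  \<open>\<phi>\<close> act through the translations. The two sums are the matrix coefficients of
  \<open>\<phi>\<close> at these vectors. Passing from one coefficient to the other replaces one
  vector at a time; each replacement costs at most \<open>B\<close> times the distance of the two
  vectors, which is at most \<open>sqrt (2 * \<delta>)\<close>.\<close>

lemma trig_value_almost_inv:
  fixes \<psi> :: "int \<times> int \<Rightarrow> real"
  assumes inv: "almost_inv \<delta> \<psi> g" and g: "\<And>v w. g (v - w) = g v - g w" and \<psi>0: "\<psi> 0 = 1"
    and A: "finite A" "\<And>\<theta>. \<phi> \<theta> = (\<Sum>u\<in>A. \<alpha> u * cos (ang u \<theta>))"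
    and B: "\<And>\<theta>. \<bar>\<phi> \<theta>\<bar> \<le> B"
  shows "\<bar>(\<Sum>u\<in>A. \<alpha> u * \<psi> (g u)) - (\<Sum>u\<in>A. \<alpha> u * \<psi> u)\<bar> \<le> 2 * B * sqrt (2 * \<delta>)"
proof -
  obtain \<kappa> where k: "psd \<kappa>"
    and FF: "\<And>v w. \<kappa> (False, v) (False, w) = \<psi> (v - w)"
    and TT: "\<And>v w. \<kappa> (True, v) (True, w) = \<psi> (g (v - w))"
    and TF: "\<And>v w. \<kappa> (True, v) (False, w) = \<kappa> (True, 0) (False, w - v)"
    and \<delta>: "1 - \<delta> \<le> \<kappa> (True, 0) (False, 0)"
    using inv unfolding almost_inv_def by metis
  have B0: "B \<ge> 0" using B[of 0] by linarith
  have g0: "g 0 = 0" using g[of 0 0] by simp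
  have K: "psd (\<lambda>v w. \<psi> (v - w))" using psd_comp[OF k, of "Pair False"] by (simp add: FF)
  have Kg: "psd (\<lambda>v w. \<psi> (g (v - w)))" using psd_comp[OF k, of "Pair True"] by (simp add: TT)
  have even: "\<psi> (- u) = \<psi> u" for u using psd_sym[OF K, of 0 u] by simp
  have eveng: "\<psi> (g (- u)) = \<psi> (g u)" for u using psd_sym[OF Kg, of 0 u] by simp
  \<comment> \<open>Tests the kernel on the difference of the two base vectors; \<open>d2\<close>
    says that their squared distance is nonnegative.\<close>
  have "0 \<le> (\<Sum>i\<in>{True, False}. \<Sum>j\<in>{True, False}. (if i then 1 else -1) * (if j then 1 else -1) * \<kappa> (i, 0) (j, 0))"
    by (rule psd_nonneg[OF k]) simp
  then have d2: "0 \<le> 2 - 2 * \<kappa> (True, 0) (False, 0)"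
    using psd_sym[OF k, of "(True, 0)" "(False, 0)"] by (simp add: FF TT g0 \<psi>0)
  \<comment> \<open>Symmetrising the frequencies makes the trigonometric sum real, so its square is the kernel norm.\<close>
  define I where "I = A \<times> {True, False}"
  define s where "s i = (if snd i then fst i else - fst i)" for i :: "(int \<times> int) \<times> bool"
  define a where "a i = \<alpha> (fst i) / 2" for i :: "(int \<times> int) \<times> bool"
  have I: "finite I" using A by (simp add: I_def)
  have SI: "(\<Sum>i\<in>I. h i) = (\<Sum>u\<in>A. h (u, True) + h (u, False))" for h :: "_ \<Rightarrow> real"
    by (simp add: I_def sum.cartesian_product')
  have c: "(\<Sum>i\<in>I. a i * cos (ang (s i) \<theta>)) = \<phi> \<theta>" for \<theta>
    by (simp add: SI a_def s_def ang_minus A(2) field_simps)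
  have sn: "(\<Sum>i\<in>I. a i * sin (ang (s i) \<theta>)) = 0" for \<theta>
    by (simp add: SI a_def s_def ang_minus)
  have n1: "(\<Sum>i\<in>I. \<Sum>j\<in>I. a i * a j * \<psi> (s i - s j)) \<le> B^2"
    by (rule trig_square_le[OF K I \<psi>0]) (simp_all add: c sn B)
  have n2: "(\<Sum>i\<in>I. \<Sum>j\<in>I. a i * a j * \<psi> (g (s i - s j))) \<le> B^2"
    by (rule trig_square_le[where \<psi> = "\<lambda>u. \<psi> (g u)", OF Kg I]) (simp_all add: c sn B g0 \<psi>0)
  have main: "\<bar>\<Sum>i\<in>I. a i * (\<kappa> (b, s i) (True, 0) - \<kappa> (b, s i) (False, 0))\<bar> \<le> B * sqrt (2 * \<delta>)" for b
  proof -
    \<comment> \<open>Adjoins the two base vectors to the index set, so that Cauchy-Schwarz pairs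
      the combination \<open>x\<close> with the difference \<open>y\<close> of the base
      vectors.\<close>
    define J where "J = Inl ` I \<union> Inr ` {True, False}"
    define r where "r z = (case z of Inl i \<Rightarrow> (b, s i) | Inr c \<Rightarrow> (c, 0))" for z
    define x where "x z = (case z of Inl i \<Rightarrow> a i | Inr c \<Rightarrow> 0)" for z :: "_ + bool"
    define y where "y z = (case z of Inl (i :: (int \<times> int) \<times> bool) \<Rightarrow> 0 | Inr c \<Rightarrow> (if c then 1 else - (1 :: real)))" for z
    have J: "finite J" using I by (simp add: J_def)
    have SJ: "(\<Sum>z\<in>J. h z) = (\<Sum>i\<in>I. h (Inl i)) + h (Inr True) + h (Inr False)" for h :: "_ \<Rightarrow> real"
      unfolding J_def using I by (subst sum.union_disjoint) (auto simp: sum.reindex)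
    have xx: "(\<Sum>i\<in>J. \<Sum>j\<in>J. x i * x j * \<kappa> (r i) (r j)) \<le> B^2"
      using n1 n2 by (cases b) (simp_all add: SJ x_def r_def FF TT)
    have yy: "(\<Sum>i\<in>J. \<Sum>j\<in>J. y i * y j * \<kappa> (r i) (r j)) = 2 - 2 * \<kappa> (True, 0) (False, 0)"
      using psd_sym[OF k, of "(True, 0)" "(False, 0)"] by (simp add: SJ y_def r_def FF TT g0 \<psi>0)
    have xy: "(\<Sum>i\<in>J. \<Sum>j\<in>J. x i * y j * \<kappa> (r i) (r j)) = (\<Sum>i\<in>I. a i * (\<kappa> (b, s i) (True, 0) - \<kappa> (b, s i) (False, 0)))"
      by (simp add: SJ x_def y_def r_def algebra_simps)
    have "(\<Sum>i\<in>I. a i * (\<kappa> (b, s i) (True, 0) - \<kappa> (b, s i) (False, 0)))^2 \<le> B^2 * (2 - 2 * \<kappa> (True, 0) (False, 0))"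
      using psd_Cauchy_Schwarz[OF k J, of x y r] mult_right_mono[OF xx d2] unfolding xy yy by linarith
    also have "\<dots> \<le> B^2 * (2 * \<delta>)" using \<delta> by (intro mult_left_mono) auto
    also have "\<dots> = (B * sqrt (2 * \<delta>))^2" using \<delta> d2 by (simp add: power_mult_distrib)
    finally have "\<bar>\<Sum>i\<in>I. a i * (\<kappa> (b, s i) (True, 0) - \<kappa> (b, s i) (False, 0))\<bar>^2 \<le> (B * sqrt (2 * \<delta>))^2"
      by (simp only: power2_abs)
    then show ?thesis by (rule power2_le_imp_le) (use B0 \<delta> d2 in simp)
  qed
  have e1: "(\<Sum>i\<in>I. a i * \<kappa> (True, s i) (True, 0)) = (\<Sum>u\<in>A. \<alpha> u * \<psi> (g u))"
    by (simp add: SI a_def s_def TT eveng field_simps)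
  have e2: "(\<Sum>i\<in>I. a i * \<kappa> (False, s i) (False, 0)) = (\<Sum>u\<in>A. \<alpha> u * \<psi> u)"
    by (simp add: SI a_def s_def FF even field_simps)
  \<comment> \<open>The mixed coefficients agree: translation invariance moves a frequency to the
    other side with the opposite sign, and the symmetrised coefficients do not see the sign.\<close>
  have e3: "(\<Sum>i\<in>I. a i * \<kappa> (True, s i) (False, 0)) = (\<Sum>i\<in>I. a i * \<kappa> (False, s i) (True, 0))"
  proof -
    have "\<kappa> (True, u) (False, 0) = \<kappa> (False, - u) (True, 0)" for u
      using TF[of u 0] psd_sym[OF k, of "(True, 0)" "(False, - u)"] by simp
    moreover from this[of "- u" for u] have "\<kappa> (True, - u) (False, 0) = \<kappa> (False, u) (True, 0)" for u
      by simp
    ultimately show ?thesis by (simp add: SI a_def s_def algebra_simps)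
  qed
  show ?thesis using main[of True] main[of False]
    by (simp add: right_diff_distrib sum_subtractf e1 e2 e3)
qed

section \<open>Cones near the origin of the torus\<close>

lemma clamp_cone_ineq:
  fixes x y r :: real
  assumes "r > 0"
  shows "max 0 (min 1 ((2 * \<bar>y\<bar> - \<bar>x + 4 * y\<bar>) / r)) + max 0 (min 1 ((2 * \<bar>y\<bar> - \<bar>x - 4 * y\<bar>) / r))
    \<le> max 0 (min 1 ((2 * \<bar>x\<bar> - \<bar>y\<bar>) / r))"
proof -
  define k where "k s = max 0 (min 1 (s / r))" for s
  have mono: "k s \<le> k t" if "s \<le> t" for s t
    unfolding k_def by (intro max.mono min.mono order_refl divide_right_mono that) (use assms in simp)
  have zero: "k s = 0" if "s \<le> 0" for s
    using divide_nonpos_pos[OF that assms] by (simp add: k_def)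
  have nn: "0 \<le> k s" for s by (simp add: k_def)
  \<comment> \<open>If \<open>?a\<close> is positive, then \<open>x\<close> lies within
    \<open>2 * \<bar>y\<bar>\<close> of \<open>- 4 * y\<close>; hence
    \<open>\<bar>x\<bar> > 2 * \<bar>y\<bar>\<close>, and the distance of \<open>x\<close> from
    \<open>4 * y\<close> exceeds \<open>6 * \<bar>y\<bar>\<close>. So the two cones on the left are
    disjoint and both lie in the cone on the right. A shear by 4 is enough to separate cones of
    slope 2.\<close>
  let ?a = "2 * \<bar>y\<bar> - \<bar>x + 4 * y\<bar>" and ?b = "2 * \<bar>y\<bar> - \<bar>x - 4 * y\<bar>" and ?c = "2 * \<bar>x\<bar> - \<bar>y\<bar>"
  have "k ?a + k ?b \<le> k ?c"
  proof (cases "?a \<le> 0")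
    case a: True
    show ?thesis
    proof (cases "?b \<le> 0")
      case True
      then show ?thesis by (simp only: zero[OF a] zero[OF True]) (simp add: nn)
    next
      case False
      then have "?b \<le> ?c" by linarith
      from mono[OF this] show ?thesis by (simp only: zero[OF a])
    qed
  next
    case False
    then have "?b \<le> 0" "?a \<le> ?c" by linarith+
    from mono[OF this(2)] zero[OF this(1)] show ?thesis by linarith
  qed
  then show ?thesis by (simp only: k_def)
qed

text \<open>Distance to the nearest integer. Written with \<open>arccos\<close> it is visibly a
  continuous function of the cosine, the form in which Stone-Weierstrass can be applied.\<close>

definition circ :: "real \<Rightarrow> real" where
  "circ x = arccos (cos (2 * pi * x)) / (2 * pi)"

lemma circ_abs: "\<bar>x\<bar> \<le> 1 / 2 \<Longrightarrow> circ x = \<bar>x\<bar>"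
proof -
  assume x: "\<bar>x\<bar> \<le> 1 / 2"
  have "cos (2 * pi * x) = cos (2 * pi * \<bar>x\<bar>)" by (cases "x \<ge> 0") auto
  moreover have "2 * pi * \<bar>x\<bar> \<le> pi" using x by (simp add: mult_left_le)
  ultimately show ?thesis by (simp add: circ_def arccos_cos)
qed

lemma cos_2pi_shift: "cos (2 * pi * (x - of_int n)) = cos (2 * pi * x)"
  by (simp only: right_diff_distrib cos_diff cos_int_2pin sin_int_2pin mult_1_right mult_zero_right add_0_right)

lemma circ_shift: "circ (x - of_int n) = circ x"
  by (simp add: circ_def cos_2pi_shift)

lemma near_int: obtains n :: int where "\<bar>x - of_int n\<bar> \<le> (1 / 2 :: real)"
proof -
  have "\<bar>x - of_int (round x)\<bar> \<le> 1 / 2" using of_int_round_abs_le[of x] by (simp add: abs_minus_commute)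
  then show ?thesis using that by blast
qed

text \<open>A continuous cutoff for the cone \<open>a < 2 * b\<close>, rising from 0 to 1 while
  \<open>2 * b - a\<close> grows from 0 to \<open>r\<close>.\<close>

definition qcone :: "real \<Rightarrow> real \<Rightarrow> real \<Rightarrow> real" where
  "qcone r a b = max 0 (min 1 ((2 * b - a) / r))"

lemma cone_bounds: "0 \<le> qcone r a b" "qcone r a b \<le> 1"
  by (auto simp: qcone_def)

text \<open>Close to 0 the torus looks like the plane and the planar inequality applies. Elsewhere
  the error term alone is at least 2, an upper bound for the left side. The error is a combination
  of the two basic cosines, so its value is small as soon as \<open>\<psi>\<close> is close to 1 at
  the generators.\<close>

lemma cone_torus_ineq:
  fixes x y r :: real
  assumes r: "r > 0"
  shows "qcone r (circ (x + 4 * y)) (circ y) + qcone r (circ (x - 4 * y)) (circ y) \<le>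
    qcone r (circ y) (circ x) + 2 / (1 - cos (pi / 5)) * (2 - cos (2 * pi * x) - cos (2 * pi * y))"
proof -
  have c: "1 - cos (pi / 5) > 0"
    using cos_monotone_0_pi[of 0 "pi / 5"] by simp
  obtain m where m: "\<bar>x - of_int m\<bar> \<le> 1 / 2" by (rule near_int)
  obtain n where n: "\<bar>y - of_int n\<bar> \<le> 1 / 2" by (rule near_int)
  define x' y' where "x' = x - of_int m" and "y' = y - of_int n"
  have 1: "circ (x + 4 * y) = circ (x' + 4 * y')" "circ (x - 4 * y) = circ (x' - 4 * y')"
    using circ_shift[of "x + 4 * y" "m + 4 * n"] circ_shift[of "x - 4 * y" "m - 4 * n"]
    by (simp_all add: x'_def y'_def algebra_simps)
  have 2: "circ x = \<bar>x'\<bar>" "circ y = \<bar>y'\<bar>" "cos (2 * pi * x) = cos (2 * pi * x')" "cos (2 * pi * y) = cos (2 * pi * y')"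
    using m n by (simp_all add: x'_def y'_def circ_abs cos_2pi_shift flip: circ_shift[of x m] circ_shift[of y n])
  show ?thesis
  \<comment> \<open>With both coordinates at most 1/10 the points \<open>x' + 4 * y'\<close> and
    \<open>x' - 4 * y'\<close> stay within 1/2, where \<open>circ\<close> is the absolute value.
    Beyond 1/10 the cosine is at most \<open>cos (2 * pi / 10)\<close>, which explains the
    constant.\<close>
  proof (cases "\<bar>x'\<bar> \<le> 1 / 10 \<and> \<bar>y'\<bar> \<le> 1 / 10")
    case True
    then have "circ (x' + 4 * y') = \<bar>x' + 4 * y'\<bar>" "circ (x' - 4 * y') = \<bar>x' - 4 * y'\<bar>"
      by (intro circ_abs; linarith)+
    moreover have "0 \<le> 2 / (1 - cos (pi / 5)) * (2 - cos (2 * pi * x') - cos (2 * pi * y'))"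
    proof (rule mult_nonneg_nonneg)
      show "0 \<le> 2 - cos (2 * pi * x') - cos (2 * pi * y')"
        using cos_le_one[of "2 * pi * x'"] cos_le_one[of "2 * pi * y'"] by linarith
    qed (use c in simp)
    ultimately show ?thesis using clamp_cone_ineq[OF r, of y' x'] unfolding 1 2 qcone_def by simp
  next
    case False
    have far: "cos (2 * pi * t) \<le> cos (pi / 5)" if "\<bar>t\<bar> \<le> 1 / 2" "\<not> \<bar>t\<bar> \<le> 1 / 10" for t
    proof -
      have "cos (2 * pi * t) = cos (2 * pi * \<bar>t\<bar>)" by (cases "t \<ge> 0") auto
      also have "\<dots> \<le> cos (pi / 5)"
        using that by (intro cos_monotone_0_pi_le) (auto simp: field_simps)
      finally show ?thesis .
    qed
    have "1 - cos (pi / 5) \<le> 2 - cos (2 * pi * x') - cos (2 * pi * y')"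
      using False far[of x'] far[of y'] m n cos_le_one[of "2 * pi * x'"] cos_le_one[of "2 * pi * y'"]
      unfolding x'_def[symmetric] y'_def[symmetric] by linarith
    then have "2 \<le> 2 / (1 - cos (pi / 5)) * (2 - cos (2 * pi * x') - cos (2 * pi * y'))"
      using c by (simp add: field_simps)
    then show ?thesis unfolding 1 2
      using cone_bounds(2)[of r "circ (x' + 4 * y')" "\<bar>y'\<bar>"] cone_bounds(2)[of r "circ (x' - 4 * y')" "\<bar>y'\<bar>"]
        cone_bounds(1)[of r "\<bar>y'\<bar>" "\<bar>x'\<bar>"] by linarith
  qed
qed

text \<open>The larger coordinate decides: if \<open>a \<le> b\<close> and \<open>r \<le> b\<close>,
  then \<open>2 * b - a \<ge> b \<ge> r\<close>, so one of the cutoffs has reached 1.\<close>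

lemma cone_cover:
  assumes "r > 0" "r \<le> a \<or> r \<le> b"
  shows "1 \<le> qcone r a b + qcone r b a"
proof -
  have *: "1 \<le> qcone r a b" if "a \<le> b" "r \<le> b" for a b
    using that assms(1) by (simp add: qcone_def field_simps)
  show ?thesis using assms(2) *[of a b] *[of b a] cone_bounds(1)[of r a b] cone_bounds(1)[of r b a]
    by linarith
qed

definition shear1 :: "int \<Rightarrow> int \<times> int \<Rightarrow> int \<times> int" where
  "shear1 c u = (fst u, snd u + c * fst u)"

definition shear2 :: "int \<Rightarrow> int \<times> int \<Rightarrow> int \<times> int" where
  "shear2 c u = (fst u + c * snd u, snd u)"

text \<open>A shear of the frequencies is dual to the transposed shear of the torus: cutoffs are
  moved by shears of points, while \<open>\<psi>\<close> is compared along shears of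
  frequencies.\<close>

lemma ang_shear1: "ang (shear1 c u) \<theta> = ang u (fst \<theta> + of_int c * snd \<theta>, snd \<theta>)"
  and ang_shear2: "ang (shear2 c u) \<theta> = ang u (fst \<theta>, snd \<theta> + of_int c * fst \<theta>)"
  by (simp_all add: ang_def shear1_def shear2_def algebra_simps)

lemma shear_diff: "shear1 c (v - w) = shear1 c v - shear1 c w" "shear2 c (v - w) = shear2 c v - shear2 c w"
  by (auto simp: shear1_def shear2_def prod_eq_iff algebra_simps)

lemma inj_shear: "inj (shear1 c)" "inj (shear2 c)"
  by (auto simp: inj_def shear1_def shear2_def prod_eq_iff)

lemma cone_approx:
  assumes "r > 0" "e > 0"
  obtains p where "real_polynomial_function p"
    "\<And>x y. \<bar>qcone r (circ x) (circ y) - p (cos (2 * pi * x), cos (2 * pi * y))\<bar> < e"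
proof -
  let ?S = "{-1..1} \<times> {-1..1} :: (real \<times> real) set"
  let ?f = "\<lambda>z. qcone r (arccos (fst z) / (2 * pi)) (arccos (snd z) / (2 * pi))"
  have 1: "continuous_on ?S (\<lambda>z. arccos (fst z))"
    by (rule continuous_on_compose2[OF continuous_on_arccos' continuous_on_fst[OF continuous_on_id]]) auto
  have 2: "continuous_on ?S (\<lambda>z. arccos (snd z))"
    by (rule continuous_on_compose2[OF continuous_on_arccos' continuous_on_snd[OF continuous_on_id]]) auto
  have "continuous_on ?S ?f"
    unfolding qcone_def divide_inverse
    by (intro continuous_on_max continuous_on_min continuous_on_const continuous_on_mult continuous_on_diff 1 2)
  with compact_Times[OF compact_Icc compact_Icc] show ?thesis
  proof (rule Stone_Weierstrass_real_polynomial_function[OF _ _ assms(2)])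
    fix p assume p: "real_polynomial_function p" "\<And>z. z \<in> ?S \<Longrightarrow> \<bar>?f z - p z\<bar> < e"
    show ?thesis
    proof (rule that[OF p(1)])
      fix x y
      have "(cos (2 * pi * x), cos (2 * pi * y)) \<in> ?S" by simp
      from p(2)[OF this] show "\<bar>qcone r (circ x) (circ y) - p (cos (2 * pi * x), cos (2 * pi * y))\<bar> < e"
        by (simp add: circ_def)
    qed
  qed
qed

text \<open>
  Burger's argument: the spectral measure of \<open>\<psi>\<close> on the torus is concentrated near 0, while the shears by 4
  push each of two cones covering a punctured neighbourhood of 0 into two essentially disjoint parts of the
  other cone. Almost invariance then forces nearly all the mass to sit at 0.
\<close>

theorem relative_property_T:
  assumes "\<epsilon> > 0"
  obtains \<delta> where "\<delta> > 0"
    "\<And>\<psi> v. \<psi> 0 = 1 \<Longrightarrow> 1 - \<delta> \<le> \<psi> (1, 0) \<Longrightarrow> 1 - \<delta> \<le> \<psi> (0, 1) \<Longrightarrow>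
       (\<And>c. c \<in> {4, -4} \<Longrightarrow> almost_inv \<delta> \<psi> (shear1 c) \<and> almost_inv \<delta> \<psi> (shear2 c)) \<Longrightarrow> 1 - \<epsilon> \<le> \<psi> v"
proof -
  define C where "C = 2 / (1 - cos (pi / 5))"
  have c: "1 - cos (pi / 5) > 0"
    using cos_monotone_0_pi[of 0 "pi / 5"] by simp
  then have C: "C > 0" by (simp add: C_def)
  \<comment> \<open>The estimates below add up to \<open>1 - \<psi> v \<le> 64 * t + 8 * C *
    \<delta> + 16 * e + \<epsilon> / 2\<close>, with \<open>\<delta> \<le> t\<close>. This dictates
    \<open>t\<close> here and \<open>e\<close> later; neither depends on \<open>v\<close>.\<close>
  define t where "t = min 1 (\<epsilon> / (4 * (64 + 8 * C)))"
  have t: "0 < t" "t \<le> 1" "t * (64 + 8 * C) \<le> \<epsilon> / 4"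
  proof -
    have p: "4 * (64 + 8 * C) > 0" using C by simp
    show "0 < t" "t \<le> 1" using p assms by (auto simp: t_def)
    have "t \<le> \<epsilon> / (4 * (64 + 8 * C))" by (simp add: t_def)
    then have "t * (4 * (64 + 8 * C)) \<le> \<epsilon>" using p by (simp only: pos_le_divide_eq)
    then show "t * (64 + 8 * C) \<le> \<epsilon> / 4" by (simp add: algebra_simps)
  qed
  \<comment> \<open>Almost invariance costs a multiple of \<open>sqrt (2 * \<delta>)\<close>, hence
    the square.\<close>
  define \<delta> where "\<delta> = t^2"
  have sq: "sqrt (2 * \<delta>) \<le> 2 * t" using t by (intro real_le_lsqrt) (auto simp: \<delta>_def power2_eq_square)
  have dt: "\<delta> \<le> t" using t by (simp add: \<delta>_def power2_eq_square mult_left_le)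
  show ?thesis
  proof (rule that[of \<delta>])
    show "\<delta> > 0" using t by (simp add: \<delta>_def)
  next
    fix \<psi> :: "int \<times> int \<Rightarrow> real" and v :: "int \<times> int"
    assume \<psi>0: "\<psi> 0 = 1" and \<psi>1: "1 - \<delta> \<le> \<psi> (1, 0)" and \<psi>2: "1 - \<delta> \<le> \<psi> (0, 1)"
      and inv: "\<And>c. c \<in> {4, -4} \<Longrightarrow> almost_inv \<delta> \<psi> (shear1 c) \<and> almost_inv \<delta> \<psi> (shear2 c)"
    have K: "psd (\<lambda>v w. \<psi> (v - w))"
    proof -
      obtain \<kappa> :: "bool \<times> int \<times> int \<Rightarrow> bool \<times> int \<times> int \<Rightarrow> real"
        where k: "psd \<kappa>" "\<And>v w. \<kappa> (False, v) (False, w) = \<psi> (v - w)"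
        using inv[of 4] unfolding almost_inv_def by auto
      show ?thesis using psd_comp[OF k(1), of "Pair False"] by (simp add: k(2))
    qed
    define e where "e = min 1 (\<epsilon> / 64)"
    have e: "0 < e" "e \<le> 1" "16 * e \<le> \<epsilon> / 4" using assms by (auto simp: e_def)
    \<comment> \<open>For coordinates below \<open>r\<close> the angle of \<open>v\<close> is at
      most \<open>\<epsilon> / 8\<close>. The width may depend on \<open>v\<close> because the cone
      inequality has the same constants for every \<open>r\<close>; this is why
      \<open>\<delta>\<close> can be independent of \<open>v\<close>.\<close>
    define r where "r = min (1 / 4) (\<epsilon> / (16 * pi * (1 + \<bar>of_int (fst v)\<bar> + \<bar>of_int (snd v)\<bar>)))"
    have r: "r > 0"
      unfolding r_def min_less_iff_conj
      by (intro conjI divide_pos_pos mult_pos_pos assms) (simp_all add: add_pos_nonneg)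
    obtain p where p: "real_polynomial_function p"
      "\<And>x y. \<bar>qcone r (circ x) (circ y) - p (cos (2 * pi * x), cos (2 * pi * y))\<bar> < e"
      using cone_approx[OF r e(1)] by blast
    obtain p' where p': "real_polynomial_function p'"
      "\<And>x y. \<bar>qcone r (circ y) (circ x) - p' (cos (2 * pi * x), cos (2 * pi * y))\<bar> < e"
    proof -
      have "real_polynomial_function (\<lambda>z. p (snd z, fst z))"
        using p(1)
      proof (induction rule: real_polynomial_function.induct)
        case (linear f)
        have "bounded_linear (\<lambda>z::real \<times> real. f (snd z, fst z))"
          by (rule bounded_linear_compose[OF linear]) (intro bounded_linear_Pair bounded_linear_snd bounded_linear_fst)
        then show ?case by blast
      qed auto
      then show ?thesis using that[of "\<lambda>z. p (snd z, fst z)"] p(2) by simp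
    qed
    define fC where "fC \<theta> = p (cos (2 * pi * fst \<theta>), cos (2 * pi * snd \<theta>))" for \<theta>
    define fD where "fD \<theta> = p' (cos (2 * pi * fst \<theta>), cos (2 * pi * snd \<theta>))" for \<theta>
    have fC: "\<bar>qcone r (circ x) (circ y) - fC (x, y)\<bar> < e" for x y using p(2) by (simp add: fC_def)
    have fD: "\<bar>qcone r (circ y) (circ x) - fD (x, y)\<bar> < e" for x y using p'(2) by (simp add: fD_def)
    have bC: "\<bar>fC \<theta>\<bar> \<le> 2" and bD: "\<bar>fD \<theta>\<bar> \<le> 2" for \<theta>
      using fC[of "fst \<theta>" "snd \<theta>"] fD[of "snd \<theta>" "fst \<theta>"] e
        cone_bounds[of r "circ (fst \<theta>)" "circ (snd \<theta>)"] cone_bounds[of r "circ (snd \<theta>)" "circ (fst \<theta>)"] by auto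
    obtain LC where "trig_value \<psi> fC LC"
      using trig_value_ex_poly[OF p(1), of \<psi>] unfolding fC_def[symmetric] by blast
    then obtain A \<alpha> where A: "finite A" "\<And>\<theta>. fC \<theta> = (\<Sum>u\<in>A. \<alpha> u * cos (ang u \<theta>))"
      and LC: "LC = (\<Sum>u\<in>A. \<alpha> u * \<psi> u)" and vC: "trig_value \<psi> fC LC"
      unfolding trig_value_def by blast
    obtain LD where "trig_value \<psi> fD LD"
      using trig_value_ex_poly[OF p'(1), of \<psi>] unfolding fD_def[symmetric] by blast
    then obtain B \<beta> where B: "finite B" "\<And>\<theta>. fD \<theta> = (\<Sum>u\<in>B. \<beta> u * cos (ang u \<theta>))"
      and LD: "LD = (\<Sum>u\<in>B. \<beta> u * \<psi> u)" and vD: "trig_value \<psi> fD LD"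
      unfolding trig_value_def by blast
    have reindex: "trig_value \<psi> (\<lambda>\<theta>. \<Sum>u\<in>E. \<gamma> u * cos (ang (g u) \<theta>)) (\<Sum>u\<in>E. \<gamma> u * \<psi> (g u))"
      if "finite E" "inj g" for E \<gamma> g
      unfolding trig_value_def using that
      by (intro exI[of _ "g ` E"] exI[of _ "\<lambda>u. \<gamma> (inv_into UNIV g u)"])
         (auto simp: sum.reindex inj_on_subset[OF _ subset_UNIV])
    \<comment> \<open>The polynomial is bounded by 2, so composing it with a shear changes its value
      by at most \<open>4 * sqrt (2 * \<delta>) \<le> 8 * t\<close>.\<close>
    have shiftC: "\<exists>L. trig_value \<psi> (\<lambda>\<theta>. fC (fst \<theta> + of_int c * snd \<theta>, snd \<theta>)) L \<and> LC - 8 * t \<le> L"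
      if "c \<in> {4, -4}" for c
    proof -
      have "\<bar>(\<Sum>u\<in>A. \<alpha> u * \<psi> (shear1 c u)) - LC\<bar> \<le> 2 * 2 * sqrt (2 * \<delta>)"
        unfolding LC using inv[OF that]
        by (intro trig_value_almost_inv[where \<psi> = \<psi> and g = "shear1 c" and \<phi> = fC, OF _ _ \<psi>0 A bC]) (auto simp: shear_diff)
      then have "LC - 8 * t \<le> (\<Sum>u\<in>A. \<alpha> u * \<psi> (shear1 c u))" using sq by linarith
      then show ?thesis using reindex[OF A(1) inj_shear(1), of \<alpha> c] by (auto simp: A(2) ang_shear1)
    qed
    have shiftD: "\<exists>L. trig_value \<psi> (\<lambda>\<theta>. fD (fst \<theta>, snd \<theta> + of_int c * fst \<theta>)) L \<and> LD - 8 * t \<le> L"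
      if "c \<in> {4, -4}" for c
    proof -
      have "\<bar>(\<Sum>u\<in>B. \<beta> u * \<psi> (shear2 c u)) - LD\<bar> \<le> 2 * 2 * sqrt (2 * \<delta>)"
        unfolding LD using inv[OF that]
        by (intro trig_value_almost_inv[where \<psi> = \<psi> and g = "shear2 c" and \<phi> = fD, OF _ _ \<psi>0 B bD]) (auto simp: shear_diff)
      then have "LD - 8 * t \<le> (\<Sum>u\<in>B. \<beta> u * \<psi> (shear2 c u))" using sq by linarith
      then show ?thesis using reindex[OF B(1) inj_shear(2), of \<beta> c] by (auto simp: B(2) ang_shear2)
    qed
    have a1: "ang (1, 0) \<theta> = 2 * pi * fst \<theta>" and a2: "ang (0, 1) \<theta> = 2 * pi * snd \<theta>" for \<theta>
      by (auto simp: ang_def)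
    have err: "trig_value \<psi> (\<lambda>\<theta>. (2 * C + 3 * e) + ((- C) * cos (2 * pi * fst \<theta>) + (- C) * cos (2 * pi * snd \<theta>)))
        (2 * C + 3 * e + ((- C) * \<psi> (1, 0) + (- C) * \<psi> (0, 1)))"
      using trig_value_add[OF trig_value_const[of \<psi> "2 * C + 3 * e"]
        trig_value_add[OF trig_value_cos[of \<psi> "- C" "(1, 0)"] trig_value_cos[of \<psi> "- C" "(0, 1)"]]]
      by (simp only: a1 a2 \<psi>0 mult_1_right)
    have errb: "2 * C + 3 * e + ((- C) * \<psi> (1, 0) + (- C) * \<psi> (0, 1)) \<le> 2 * C * \<delta> + 3 * e"
      using mult_left_mono[OF \<psi>1, of C] mult_left_mono[OF \<psi>2, of C] C by (simp add: algebra_simps)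
    \<comment> \<open>Two sheared copies of the first cone fit disjointly into the second, so twice
      the mass of the first is at most the mass of the second, up to errors. Together with the
      reverse inequality this makes both masses small.\<close>
    have I1: "2 * LC - 16 * t \<le> LD + 2 * C * \<delta> + 3 * e"
    proof -
      obtain L1 where L1: "trig_value \<psi> (\<lambda>\<theta>. fC (fst \<theta> + of_int 4 * snd \<theta>, snd \<theta>)) L1" "LC - 8 * t \<le> L1"
        using shiftC[of 4] by auto
      obtain L2 where L2: "trig_value \<psi> (\<lambda>\<theta>. fC (fst \<theta> + of_int (-4) * snd \<theta>, snd \<theta>)) L2" "LC - 8 * t \<le> L2"
        using shiftC[of "-4"] by auto
      have "0 \<le> (LD + (2 * C + 3 * e + ((- C) * \<psi> (1, 0) + (- C) * \<psi> (0, 1)))) + ((-1) * L1 + (-1) * L2)"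
      proof (rule trig_value_nonneg[OF K trig_value_add[OF trig_value_add[OF vD err] trig_value_add[OF trig_value_cmult[OF L1(1)] trig_value_cmult[OF L2(1)]]]])
        fix \<theta> :: "real \<times> real"
        show "0 \<le> fD \<theta> + (2 * C + 3 * e + (- C * cos (2 * pi * fst \<theta>) + - C * cos (2 * pi * snd \<theta>))) +
          (- 1 * fC (fst \<theta> + real_of_int 4 * snd \<theta>, snd \<theta>) + - 1 * fC (fst \<theta> + real_of_int (- 4) * snd \<theta>, snd \<theta>))"
          using cone_torus_ineq[OF r, of "fst \<theta>" "snd \<theta>"] fD[of "snd \<theta>" "fst \<theta>"]
            fC[of "fst \<theta> + 4 * snd \<theta>" "snd \<theta>"] fC[of "fst \<theta> - 4 * snd \<theta>" "snd \<theta>"]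
          by (simp add: C_def[symmetric] right_diff_distrib)
      qed
      then show ?thesis using L1 L2 errb by linarith
    qed
    have I2: "2 * LD - 16 * t \<le> LC + 2 * C * \<delta> + 3 * e"
    proof -
      obtain L1 where L1: "trig_value \<psi> (\<lambda>\<theta>. fD (fst \<theta>, snd \<theta> + of_int 4 * fst \<theta>)) L1" "LD - 8 * t \<le> L1"
        using shiftD[of 4] by auto
      obtain L2 where L2: "trig_value \<psi> (\<lambda>\<theta>. fD (fst \<theta>, snd \<theta> + of_int (-4) * fst \<theta>)) L2" "LD - 8 * t \<le> L2"
        using shiftD[of "-4"] by auto
      have "0 \<le> (LC + (2 * C + 3 * e + ((- C) * \<psi> (1, 0) + (- C) * \<psi> (0, 1)))) + ((-1) * L1 + (-1) * L2)"
      proof (rule trig_value_nonneg[OF K trig_value_add[OF trig_value_add[OF vC err] trig_value_add[OF trig_value_cmult[OF L1(1)] trig_value_cmult[OF L2(1)]]]])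
        fix \<theta> :: "real \<times> real"
        show "0 \<le> fC \<theta> + (2 * C + 3 * e + (- C * cos (2 * pi * fst \<theta>) + - C * cos (2 * pi * snd \<theta>))) +
          (- 1 * fD (fst \<theta>, snd \<theta> + real_of_int 4 * fst \<theta>) + - 1 * fD (fst \<theta>, snd \<theta> + real_of_int (- 4) * fst \<theta>))"
          using cone_torus_ineq[OF r, of "snd \<theta>" "fst \<theta>"] fC[of "fst \<theta>" "snd \<theta>"]
            fD[of "snd \<theta> + 4 * fst \<theta>" "fst \<theta>"] fD[of "snd \<theta> - 4 * fst \<theta>" "fst \<theta>"]
          by (simp add: C_def[symmetric] right_diff_distrib)
      qed
      then show ?thesis using L1 L2 errb by linarith
    qed
    \<comment> \<open>Away from 0 the cones cover, and \<open>2 * fC + 2 * fD\<close> makes up for a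
      cosine as low as -1; near 0 the cosine itself is almost 1.\<close>
    have fin: "0 \<le> (2 * LC + 2 * LD) + ((\<epsilon> / 2 + 4 * e - 1) * \<psi> 0 + 1 * \<psi> v)"
    proof (rule trig_value_nonneg[OF K trig_value_add[OF trig_value_add[OF trig_value_cmult[OF vC] trig_value_cmult[OF vD]] trig_value_add[OF trig_value_const trig_value_cos]]])
      fix \<theta> :: "real \<times> real"
      obtain m where m: "\<bar>fst \<theta> - of_int m\<bar> \<le> 1 / 2" by (rule near_int)
      obtain n where n: "\<bar>snd \<theta> - of_int n\<bar> \<le> 1 / 2" by (rule near_int)
      define x y where "x = fst \<theta> - of_int m" and "y = snd \<theta> - of_int n"
      have xy: "circ (fst \<theta>) = \<bar>x\<bar>" "circ (snd \<theta>) = \<bar>y\<bar>"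
        using m n by (simp_all add: x_def y_def circ_abs flip: circ_shift[of "fst \<theta>" m] circ_shift[of "snd \<theta>" n])
      have F: "\<bar>qcone r \<bar>x\<bar> \<bar>y\<bar> - fC \<theta>\<bar> < e" "\<bar>qcone r \<bar>y\<bar> \<bar>x\<bar> - fD \<theta>\<bar> < e"
        using fC[of "fst \<theta>" "snd \<theta>"] fD[of "snd \<theta>" "fst \<theta>"] by (simp_all add: xy)
      show "0 \<le> 2 * fC \<theta> + 2 * fD \<theta> + (\<epsilon> / 2 + 4 * e - 1 + 1 * cos (ang v \<theta>))"
      proof (cases "r \<le> \<bar>x\<bar> \<or> r \<le> \<bar>y\<bar>")
        case True
        then show ?thesis using cone_cover[OF r, of "\<bar>x\<bar>" "\<bar>y\<bar>"] F cos_ge_minus_one[of "ang v \<theta>"] assms by linarith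
      next
        case False
        let ?a = "\<bar>of_int (fst v)\<bar> :: real" and ?b = "\<bar>of_int (snd v)\<bar> :: real"
        define w where "w = 2 * pi * (of_int (fst v) * x + of_int (snd v) * y)"
        have "ang v \<theta> = w + 2 * pi * of_int (fst v * m + snd v * n)"
          by (simp add: ang_def w_def x_def y_def algebra_simps)
        then have cw: "cos (ang v \<theta>) = cos w"
          by (simp add: cos_add cos_int_2pin sin_int_2pin del: of_int_add of_int_mult)
        have "\<bar>of_int (fst v) * x + of_int (snd v) * y\<bar> \<le> ?a * r + ?b * r"
          using False by (intro order_trans[OF abs_triangle_ineq] add_mono) (auto simp: abs_mult intro!: mult_left_mono)
        also have "\<dots> \<le> (1 + ?a + ?b) * r" using r by (simp add: algebra_simps)
        also have "\<dots> \<le> (1 + ?a + ?b) * (\<epsilon> / (16 * pi * (1 + ?a + ?b)))"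
          by (intro mult_left_mono) (auto simp: r_def)
        also have "\<dots> = \<epsilon> / (16 * pi)"
        proof -
          have "1 + ?a + ?b \<noteq> 0" using abs_ge_zero[of "of_int (fst v) :: real"] abs_ge_zero[of "of_int (snd v) :: real"] by linarith
          then show ?thesis by simp
        qed
        finally have "2 * pi * \<bar>of_int (fst v) * x + of_int (snd v) * y\<bar> \<le> 2 * pi * (\<epsilon> / (16 * pi))"
          by (rule mult_left_mono) simp
        then have "\<bar>w\<bar> \<le> 2 * pi * (\<epsilon> / (16 * pi))" by (simp only: w_def abs_mult) simp
        then have w: "\<bar>w\<bar> \<le> \<epsilon> / 8" by simp
        have "1 - cos w \<le> \<bar>w\<bar>"
        proof -
          have "1 - cos w = 2 * (sin (w / 2))^2" using cos_double_sin[of "w / 2"] by simp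
          also have "\<dots> \<le> 2 * \<bar>sin (w / 2)\<bar>"
            using mult_left_le[OF abs_sin_le_one[of "w / 2"] abs_ge_zero[of "sin (w / 2)"]]
            by (simp add: power2_eq_square)
          also have "\<dots> \<le> \<bar>w\<bar>" using abs_sin_x_le_abs_x[of "w / 2"] by simp
          finally show ?thesis .
        qed
        then have "1 - cos (ang v \<theta>) \<le> \<epsilon> / 8" using w unfolding cw by (rule order_trans)
        moreover have "- e < fC \<theta>" "- e < fD \<theta>"
          using F[unfolded abs_less_iff] cone_bounds(1)[of r "\<bar>x\<bar>" "\<bar>y\<bar>"] cone_bounds(1)[of r "\<bar>y\<bar>" "\<bar>x\<bar>"]
          by (auto simp del: abs_less_iff)
        ultimately show ?thesis using assms by simp
      qed
    qed
    have "C * \<delta> \<le> C * t" using dt C by simp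
    moreover have "64 * t + 8 * (C * t) \<le> \<epsilon> / 4" using t(3) by (simp add: algebra_simps)
    ultimately show "1 - \<epsilon> \<le> \<psi> v"
      using fin I1 I2 e(3) by (simp add: \<psi>0)
  qed
qed

section \<open>Odometers\<close>

lemma incseq_UN_lessThan: "incseq (\<lambda>n. \<Union>i<n. B i)"
  by (intro monoI UN_mono) auto

text \<open>
  A model of the additive group of \<open>p\<close>-adic integer vectors indexed by \<open>I\<close>: the code \<open>q k x\<close> names the ball of radius
  \<open>p\<close> to the power \<open>-k\<close> around \<open>x\<close>, and \<open>T t\<close> is the translation by the integer vector \<open>t\<close>.
\<close>

locale odometer = prob_space M for M :: "'x measure" +
  fixes q :: "nat \<Rightarrow> 'x \<Rightarrow> 'b" and p :: nat and I :: "'d set" and T :: "('d \<Rightarrow> int) \<Rightarrow> 'x \<Rightarrow> 'x"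
  assumes p_gt_1: "p > 1" and finite_I: "finite I"
    and finite_q: "finite (q k ` space M)"
    and card_q: "card (q k ` space M) \<le> p ^ (k * card I)"
    and q_sets: "{x \<in> space M. q k x = b} \<in> sets M"
    and q_Suc: "x \<in> space M \<Longrightarrow> y \<in> space M \<Longrightarrow> q (Suc k) x = q (Suc k) y \<Longrightarrow> q k x = q k y"
    and q_gen: "sets M = sigma_sets (space M) {{x \<in> space M. q k x = b} |k b. True}"
    and T_meas: "T t \<in> measurable M M"
    and T_distr: "distr M M (T t) = M"
    and T_add: "x \<in> space M \<Longrightarrow> T s (T t x) = T (\<lambda>i. s i + t i) x"
    and T_zero: "x \<in> space M \<Longrightarrow> T (\<lambda>i. 0) x = x"
    and T_level: "x \<in> space M \<Longrightarrow> y \<in> space M \<Longrightarrow> q k (T t x) = q k (T t y) \<longleftrightarrow> q k x = q k y"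
    and T_fix: "x \<in> space M \<Longrightarrow> q k (T t x) = q k x \<longleftrightarrow> (\<forall>i\<in>I. int p ^ k dvd t i)"
    and T_trans: "x \<in> space M \<Longrightarrow> y \<in> space M \<Longrightarrow> \<exists>t. q k (T t x) = q k y"
begin

lemma T_space: "x \<in> space M \<Longrightarrow> T t x \<in> space M"
  using T_meas[of t] by (rule measurable_space)

lemma q_mono: "k \<le> k' \<Longrightarrow> x \<in> space M \<Longrightarrow> y \<in> space M \<Longrightarrow> q k' x = q k' y \<Longrightarrow> q k x = q k y"
  by (induction k' rule: dec_induct) (auto dest: q_Suc)

definition cell :: "nat \<Rightarrow> 'b \<Rightarrow> 'x set" where "cell k b = {x \<in> space M. q k x = b}"

definition ncell :: "nat \<Rightarrow> nat" where "ncell k = card (q k ` space M)"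

text \<open>Unions of balls of level \<open>k\<close>. Over all levels they form the algebra that
  generates the measurable sets.\<close>

definition sat :: "nat \<Rightarrow> 'x set \<Rightarrow> bool" where
  "sat k W \<longleftrightarrow> W \<subseteq> space M \<and> (\<forall>x\<in>space M. \<forall>y\<in>space M. q k x = q k y \<longrightarrow> x \<in> W \<longrightarrow> y \<in> W)"

lemma cell_sets [measurable]: "cell k b \<in> sets M"
  using q_sets by (simp add: cell_def)

lemma sat_mono: "k \<le> k' \<Longrightarrow> sat k W \<Longrightarrow> sat k' W"
  unfolding sat_def using q_mono by blast

lemma sat_sets: "sat k W \<Longrightarrow> W \<in> sets M"
proof -
  assume s: "sat k W"
  have "W = (\<Union>b\<in>q k ` W. cell k b)" 
  proof (intro equalityI subsetI)
    fix x assume "x \<in> W"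
    then show "x \<in> (\<Union>b\<in>q k ` W. cell k b)" using s by (auto simp: sat_def cell_def)
  next
    fix x assume "x \<in> (\<Union>b\<in>q k ` W. cell k b)"
    then obtain w where "w \<in> W" "x \<in> space M" "q k w = q k x" by (auto simp: cell_def)
    then show "x \<in> W" using s unfolding sat_def by blast
  qed
  moreover have "finite (q k ` W)"
    using s by (intro finite_subset[OF _ finite_q[of k]] image_mono) (simp add: sat_def)
  then have "(\<Union>b\<in>q k ` W. cell k b) \<in> sets M" by (intro sets.finite_UN cell_sets)
  ultimately show "W \<in> sets M" by simp
qed

text \<open>The approximable sets contain the balls and are closed under complements and countable
  unions.\<close>

lemma approx_sat:
  assumes "B \<in> sets M" "\<kappa> > 0"
  shows "\<exists>k W. sat k W \<and> measure M (sym_diff B W) < \<kappa>"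
  using assms(1)[unfolded q_gen] assms(2)
proof (induction arbitrary: \<kappa> rule: sigma_sets.induct)
  case (Basic a)
  then obtain k b where "a = cell k b" by (auto simp: cell_def)
  then have "sat k a" by (auto simp: sat_def cell_def)
  then show ?case using Basic by (intro exI[of _ k] exI[of _ a]) auto
next
  case Empty
  then show ?case by (intro exI[of _ 0] exI[of _ "{}"]) (auto simp: sat_def)
next
  case (Compl a)
  then obtain k W where W: "sat k W" "measure M (sym_diff a W) < \<kappa>" by blast
  have "a \<subseteq> space M" using Compl(1) sets.sets_into_space[of a M] by (simp add: q_gen)
  then have "sym_diff (space M - a) (space M - W) = sym_diff a W" using W(1) by (auto simp: sat_def)
  moreover have "sat k (space M - W)" using W(1) unfolding sat_def by (metis Diff_iff Diff_subset)
  ultimately show ?case using W by (intro exI[of _ k] exI[of _ "space M - W"]) auto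
next
  case (Union a)
  have a: "a n \<in> sets M" for n using Union(1) by (simp add: q_gen)
  have "(\<lambda>n. measure M (\<Union>i<n. a i)) \<longlonglongrightarrow> measure M (\<Union>n. \<Union>i<n. a i)"
    by (rule finite_Lim_measure_incseq[OF _ incseq_UN_lessThan]) (use a in auto)
  also have "(\<Union>n. \<Union>i<n. a i) = (\<Union>i. a i)"
  proof (intro equalityI subsetI)
    fix x assume "x \<in> (\<Union>i. a i)"
    then obtain n where "x \<in> a n" by blast
    then show "x \<in> (\<Union>n. \<Union>i<n. a i)" by (auto intro!: exI[of _ "Suc n"] bexI[of _ n])
  qed auto
  finally have "\<forall>\<^sub>F n in sequentially. measure M (\<Union>i. a i) - \<kappa> / 2 < measure M (\<Union>i<n. a i)"
    using Union(3) by (intro order_tendstoD) auto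
  then obtain N where N: "measure M (\<Union>i. a i) - \<kappa> / 2 < measure M (\<Union>i<N. a i)"
    by (auto simp: eventually_sequentially)
  \<comment> \<open>The summand 1 in the denominator takes care of \<open>N = 0\<close>.\<close>
  have "\<forall>i. \<exists>k W. sat k W \<and> measure M (sym_diff (a i) W) < \<kappa> / (2 * (real N + 1))"
    using Union(2,3) by simp
  then obtain k W where W: "\<And>i. sat (k i) (W i)" "\<And>i. measure M (sym_diff (a i) (W i)) < \<kappa> / (2 * (real N + 1))"
    by metis
  define K where "K = Max (insert 0 (k ` {..<N}))"
  have K: "k i \<le> K" if "i < N" for i unfolding K_def using that by (intro Max_ge) auto
  have s: "sat K (\<Union>i<N. W i)"
    using sat_mono[OF K W(1)] unfolding sat_def by blast
  have Ws: "W i \<in> sets M" for i using sat_sets W(1) by blast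
  have "sym_diff (\<Union>i. a i) (\<Union>i<N. W i) \<subseteq> ((\<Union>i. a i) - (\<Union>i<N. a i)) \<union> (\<Union>i<N. sym_diff (a i) (W i))" by auto
  then have "measure M (sym_diff (\<Union>i. a i) (\<Union>i<N. W i)) \<le> measure M (((\<Union>i. a i) - (\<Union>i<N. a i)) \<union> (\<Union>i<N. sym_diff (a i) (W i)))"
    by (intro finite_measure_mono) (use a Ws in auto)
  also have "\<dots> \<le> measure M ((\<Union>i. a i) - (\<Union>i<N. a i)) + measure M (\<Union>i<N. sym_diff (a i) (W i))"
    by (rule measure_Un_le) (use a Ws in auto)
  also have "measure M ((\<Union>i. a i) - (\<Union>i<N. a i)) = measure M (\<Union>i. a i) - measure M (\<Union>i<N. a i)"
    by (rule finite_measure_Diff) (use a in auto)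
  also have "measure M (\<Union>i<N. sym_diff (a i) (W i)) \<le> (\<Sum>i<N. measure M (sym_diff (a i) (W i)))"
    by (rule finite_measure_subadditive_finite) (use a Ws in auto)
  also have "\<dots> \<le> (\<Sum>i<N. \<kappa> / (2 * (real N + 1)))" by (intro sum_mono less_imp_le W(2))
  also have "\<dots> \<le> \<kappa> / 2" using Union(3) by (simp add: field_simps)
  finally have "measure M (sym_diff (\<Union>i. a i) (\<Union>i<N. W i)) < \<kappa>" using N by linarith
  then show ?case using s by blast
qed

text \<open>A measurable choice among countably many pieces is nearly constant on small balls. One
  exceptional set serves all levels from \<open>k0\<close> on, so several such requirements can
  later be met at a common level.\<close>

lemma approx_cover:
  fixes B :: "nat \<Rightarrow> 'x set"
  assumes B: "\<And>n. B n \<in> sets M" and cov: "space M \<subseteq> (\<Union>n. B n)" and "\<eta> > 0"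
  obtains E k0 where "E \<in> sets M" "measure M E \<le> \<eta>"
    "\<And>k x y. k \<ge> k0 \<Longrightarrow> x \<in> space M - E \<Longrightarrow> y \<in> space M - E \<Longrightarrow> q k x = q k y \<Longrightarrow> \<exists>n. x \<in> B n \<and> y \<in> B n"
proof -
  have "(\<lambda>n. measure M (\<Union>i<n. B i)) \<longlonglongrightarrow> measure M (\<Union>n. \<Union>i<n. B i)"
    by (rule finite_Lim_measure_incseq[OF _ incseq_UN_lessThan]) (use B in auto)
  also have "(\<Union>n. \<Union>i<n. B i) = space M" 
  proof (intro equalityI subsetI)
    fix x assume "x \<in> space M"
    then obtain n where "x \<in> B n" using cov by blast
    then show "x \<in> (\<Union>n. \<Union>i<n. B i)" by (auto intro!: exI[of _ "Suc n"] bexI[of _ n])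
  qed (use B[THEN sets.sets_into_space] in auto)
  finally have "\<forall>\<^sub>F n in sequentially. 1 - \<eta> / 2 < measure M (\<Union>i<n. B i)"
    using assms(3) by (intro order_tendstoD) (auto simp: prob_space)
  then obtain N where N: "1 - \<eta> / 2 < measure M (\<Union>i<N. B i)"
    by (auto simp: eventually_sequentially)
  have D: "disjointed B i \<in> sets M" for i using sets.range_disjointed_sets[of B M] B by auto
  have "\<forall>i. \<exists>k W. sat k W \<and> measure M (sym_diff (disjointed B i) W) < \<eta> / (2 * (real N + 1))"
    using approx_sat[OF D] assms(3) by simp
  then obtain k W where W: "\<And>i. sat (k i) (W i)" "\<And>i. measure M (sym_diff (disjointed B i) (W i)) < \<eta> / (2 * (real N + 1))"
    by metis
  have Ws: "W i \<in> sets M" for i using sat_sets W(1) by blast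
  define K where "K = Max (insert 0 (k ` {..<N}))"
  have K: "k i \<le> K" if "i < N" for i unfolding K_def using that by (intro Max_ge) auto
  \<comment> \<open>Outside \<open>E\<close> membership in one of the first \<open>N\<close>
    disjoint pieces coincides with membership in its approximation, and the approximations do not
    separate points of one small ball.\<close>
  define E where "E = (space M - (\<Union>i<N. B i)) \<union> (\<Union>i<N. sym_diff (disjointed B i) (W i))"
  show ?thesis
  proof (rule that[of E K])
    show "E \<in> sets M" unfolding E_def using B D Ws by auto
    have "measure M E \<le> measure M (space M - (\<Union>i<N. B i)) + measure M (\<Union>i<N. sym_diff (disjointed B i) (W i))"
      unfolding E_def by (rule measure_Un_le) (use B D Ws in auto)
    also have "measure M (space M - (\<Union>i<N. B i)) = 1 - measure M (\<Union>i<N. B i)"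
      by (rule prob_compl) (use B in auto)
    also have "measure M (\<Union>i<N. sym_diff (disjointed B i) (W i)) \<le> (\<Sum>i<N. measure M (sym_diff (disjointed B i) (W i)))"
      by (rule finite_measure_subadditive_finite) (use D Ws in auto)
    also have "\<dots> \<le> (\<Sum>i<N. \<eta> / (2 * (real N + 1)))" by (intro sum_mono less_imp_le W(2))
    also have "\<dots> \<le> \<eta> / 2" using assms(3) by (simp add: field_simps)
    finally show "measure M E \<le> \<eta>" using N by linarith
  next
    fix l x y assume l: "K \<le> l" and x: "x \<in> space M - E" and y: "y \<in> space M - E" and eq: "q l x = q l y"
    have "x \<in> (\<Union>i<N. B i)" using x by (auto simp: E_def)
    then have "x \<in> (\<Union>i<N. disjointed B i)" by (simp only: lessThan_atLeast0 finite_UN_disjointed_eq)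
    then obtain n where n: "n < N" "x \<in> disjointed B n" by auto
    have "x \<in> W n" using x n by (auto simp: E_def)
    moreover have "sat l (W n)" using sat_mono[OF _ W(1)] K[OF n(1)] l by (metis order_trans)
    ultimately have "y \<in> W n" using x y eq by (auto simp: sat_def)
    then have "y \<in> disjointed B n" using y n by (auto simp: E_def)
    then show "\<exists>n. x \<in> B n \<and> y \<in> B n" using n disjointed_subset[of B n] by blast
  qed
qed

lemma approx_set:
  assumes D: "D \<in> sets M" and "\<eta> > 0"
  obtains E k0 where "E \<in> sets M" "measure M E \<le> \<eta>"
    "\<And>k x y. k \<ge> k0 \<Longrightarrow> x \<in> space M - E \<Longrightarrow> y \<in> space M - E \<Longrightarrow> q k x = q k y \<Longrightarrow> x \<in> D \<longleftrightarrow> y \<in> D"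
proof (rule approx_cover[of "\<lambda>n. if n = 0 then D else space M - D" \<eta>])
  show "space M \<subseteq> (\<Union>n. if n = (0::nat) then D else space M - D)"
  proof
    fix x assume "x \<in> space M"
    then show "x \<in> (\<Union>n. if n = (0::nat) then D else space M - D)"
      by (cases "x \<in> D") (auto intro: exI[of _ "0::nat"] exI[of _ "1::nat"])
  qed
next
  fix E k0
  assume E: "E \<in> sets M" "measure M E \<le> \<eta>" and
    c: "\<And>k x y. k0 \<le> k \<Longrightarrow> x \<in> space M - E \<Longrightarrow> y \<in> space M - E \<Longrightarrow> q k x = q k y \<Longrightarrow>
      \<exists>n. x \<in> (if n = (0::nat) then D else space M - D) \<and> y \<in> (if n = 0 then D else space M - D)"
  show thesis
  proof (rule that[OF E, of k0])
    fix k x y assume "k0 \<le> k" "x \<in> space M - E" "y \<in> space M - E" "q k x = q k y"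
    from c[OF this] show "x \<in> D \<longleftrightarrow> y \<in> D" by (auto split: if_splits)
  qed
qed (use assms in auto)

lemma T_measure:
  assumes "A \<in> sets M"
  shows "measure M (T t -` A \<inter> space M) = measure M A"
  using measure_distr[OF T_meas assms, of t] by (simp add: T_distr)

lemma T_vimage_cell:
  assumes "x \<in> space M"
  shows "T t -` cell k (q k (T t x)) \<inter> space M = cell k (q k x)"
  using assms by (auto simp: cell_def T_space T_level)

lemma ncell_pos: "ncell k > 0"
  using finite_q[of k] not_empty by (auto simp: ncell_def card_gt_0_iff)

lemma sum_cells:
  assumes "A \<in> sets M"
  shows "(\<Sum>b\<in>q k ` space M. measure M (A \<inter> cell k b)) = measure M A"
proof -
  have "measure M (\<Union>b\<in>q k ` space M. A \<inter> cell k b) = (\<Sum>b\<in>q k ` space M. measure M (A \<inter> cell k b))"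
  proof (rule finite_measure_finite_Union[OF finite_q])
    show "disjoint_family_on (\<lambda>b. A \<inter> cell k b) (q k ` space M)"
      by (auto simp: disjoint_family_on_def cell_def)
  qed (use assms in auto)
  moreover have "(\<Union>b\<in>q k ` space M. A \<inter> cell k b) = A"
    using sets.sets_into_space[OF assms] by (auto simp: cell_def)
  ultimately show ?thesis by simp
qed

text \<open>Translations preserve the measure and act transitively on the balls of one level, so an
  invariant set has equal shares in them.\<close>

lemma invariant_cell:
  assumes D: "D \<in> sets M" and inv: "\<And>t x. x \<in> space M \<Longrightarrow> T t x \<in> D \<longleftrightarrow> x \<in> D" and b: "b \<in> q k ` space M"
  shows "measure M (D \<inter> cell k b) = measure M D / ncell k"
proof -
  obtain y where y: "y \<in> space M" "b = q k y" using b by auto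
  have eq: "measure M (D \<inter> cell k c) = measure M (D \<inter> cell k b)" if c: "c \<in> q k ` space M" for c
  proof -
    obtain x where x: "x \<in> space M" "c = q k x" using c by (elim imageE)
    obtain t where t: "q k (T t x) = q k y" using T_trans x y by blast
    have "T t -` (D \<inter> cell k b) \<inter> space M = D \<inter> cell k c"
      using T_vimage_cell[OF x(1), of t k] inv sets.sets_into_space[OF D] t x y by auto
    then show ?thesis using T_measure[of "D \<inter> cell k b" t] D by auto
  qed
  have "measure M D = (\<Sum>c\<in>q k ` space M. measure M (D \<inter> cell k b))"
    unfolding sum_cells[OF D, of k, symmetric] by (intro sum.cong refl eq)
  then show ?thesis using ncell_pos[of k] by (simp add: ncell_def field_simps)
qed

lemma measure_cell: "b \<in> q k ` space M \<Longrightarrow> measure M (cell k b) = 1 / ncell k"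
  using invariant_cell[of "space M" b k] T_space sets.sets_into_space[OF cell_sets[of k b]]
  by (simp add: prob_space Int_absorb1)

text \<open>A measurable set is nearly full or nearly empty in some ball, while an invariant set has
  the same density in all balls; positive density rules out the second case.\<close>

lemma ergodic:
  assumes D: "D \<in> sets M" and inv: "\<And>t x. x \<in> space M \<Longrightarrow> T t x \<in> D \<longleftrightarrow> x \<in> D" and pos: "measure M D > 0"
  shows "measure M D = 1"
proof -
  have *: "1 - \<eta> \<le> measure M D" if \<eta>: "0 < \<eta>" "\<eta> < measure M D" for \<eta>
  proof -
    obtain E k where E: "E \<in> sets M" "measure M E \<le> \<eta>"
      "\<And>x y. x \<in> space M - E \<Longrightarrow> y \<in> space M - E \<Longrightarrow> q k x = q k y \<Longrightarrow> x \<in> D \<longleftrightarrow> y \<in> D"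
      using approx_set[OF D \<eta>(1)] by (metis order_refl)
    \<comment> \<open>Averaging: some ball has at most its proportional share of the exceptional
      set.\<close>
    have "\<exists>b\<in>q k ` space M. measure M (E \<inter> cell k b) \<le> \<eta> / ncell k"
    proof (rule ccontr)
      assume "\<not> ?thesis"
      then have "(\<Sum>b\<in>q k ` space M. \<eta> / ncell k) < (\<Sum>b\<in>q k ` space M. measure M (E \<inter> cell k b))"
        using finite_q[of k] not_empty by (intro sum_strict_mono) (auto simp: not_le)
      then show False using E(2) ncell_pos[of k] by (simp add: sum_cells[OF E(1)] ncell_def)
    qed
    then obtain b where b: "b \<in> q k ` space M" "measure M (E \<inter> cell k b) \<le> \<eta> / ncell k" by blast
    have inv': "measure M (D \<inter> cell k b) = measure M D / ncell k" by (rule invariant_cell[OF D inv b(1)])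
    have "cell k b - E \<subseteq> D \<or> D \<inter> cell k b \<subseteq> E \<inter> cell k b"
    proof (cases "\<exists>y\<in>cell k b - E. y \<in> D")
      case True
      then obtain y where y: "y \<in> space M" "q k y = b" "y \<notin> E" "y \<in> D" by (auto simp: cell_def)
      have "cell k b - E \<subseteq> D"
      proof
        fix x assume "x \<in> cell k b - E"
        then show "x \<in> D" using E(3)[of x y] y by (auto simp: cell_def)
      qed
      then show ?thesis ..
    qed blast
    then show ?thesis
    proof
      assume "cell k b - E \<subseteq> D"
      then have "cell k b \<subseteq> (D \<inter> cell k b) \<union> (E \<inter> cell k b)" by auto
      then have "measure M (cell k b) \<le> measure M ((D \<inter> cell k b) \<union> (E \<inter> cell k b))"
        by (intro finite_measure_mono) (use D E in auto)
      also have "\<dots> \<le> measure M (D \<inter> cell k b) + measure M (E \<inter> cell k b)"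
        by (rule measure_Un_le) (use D E in auto)
      finally have "1 / ncell k \<le> measure M D / ncell k + \<eta> / ncell k"
        using inv' b measure_cell[OF b(1)] by linarith
      then show ?thesis using ncell_pos[of k] by (simp add: field_simps)
    next
      assume "D \<inter> cell k b \<subseteq> E \<inter> cell k b"
      then have "measure M (D \<inter> cell k b) \<le> measure M (E \<inter> cell k b)"
        by (intro finite_measure_mono) (use D E in auto)
      then have "measure M D / ncell k \<le> \<eta> / ncell k" using inv' b by linarith
      then show ?thesis using \<eta> ncell_pos[of k] by (simp add: field_simps)
    qed
  qed
  have "1 \<le> measure M D + \<eta>" if "0 < \<eta>" for \<eta>
    using *[of "min \<eta> (measure M D / 2)"] that pos by linarith
  then have "1 \<le> measure M D" by (rule field_le_epsilon)
  then show ?thesis using prob_le_1[of D] by simp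
qed

section \<open>Random pairs of points in a common ball\<close>

definition same_cell :: "nat \<Rightarrow> ('x \<times> 'x) set" where
  "same_cell k = {z \<in> space M \<times> space M. q k (fst z) = q k (snd z)}"

text \<open>Probability conditioned on the two points lying in the same ball:
  \<open>same_cell k\<close> consists of \<open>ncell k\<close> squares of side
  \<open>1 / ncell k\<close>, hence the factor.\<close>

definition pair_prob :: "nat \<Rightarrow> ('x \<times> 'x) set \<Rightarrow> real" where
  "pair_prob k S = ncell k * measure (M \<Otimes>\<^sub>M M) (S \<inter> same_cell k)"

lemma measure_Times:
  assumes "A \<in> sets M" "B \<in> sets M"
  shows "measure (M \<Otimes>\<^sub>M M) (A \<times> B) = measure M A * measure M B"
  unfolding measure_def by (simp add: emeasure_pair_measure_Times assms enn2real_mult)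

sublocale PM: prob_space "M \<Otimes>\<^sub>M M"
proof -
  interpret pair_prob_space M M ..
  show "prob_space (M \<Otimes>\<^sub>M M)" by unfold_locales
qed

lemma same_cell_eq: "same_cell k = (\<Union>b\<in>q k ` space M. cell k b \<times> cell k b)"
  by (auto simp: same_cell_def cell_def)

lemma same_cell_sets [measurable]: "same_cell k \<in> sets (M \<Otimes>\<^sub>M M)"
  unfolding same_cell_eq by (intro sets.finite_UN finite_q) auto

lemma pair_prob_mono:
  assumes "S \<inter> same_cell k \<subseteq> S'" "S' \<in> sets (M \<Otimes>\<^sub>M M)"
  shows "pair_prob k S \<le> pair_prob k S'"
  unfolding pair_prob_def using assms by (intro mult_left_mono PM.finite_measure_mono) auto

lemma pair_prob_Un_le:
  assumes "S \<in> sets (M \<Otimes>\<^sub>M M)" "S' \<in> sets (M \<Otimes>\<^sub>M M)"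
  shows "pair_prob k (S \<union> S') \<le> pair_prob k S + pair_prob k S'"
proof -
  have eq: "(S \<union> S') \<inter> same_cell k = (S \<inter> same_cell k) \<union> (S' \<inter> same_cell k)" by blast
  have "measure (M \<Otimes>\<^sub>M M) ((S \<union> S') \<inter> same_cell k) \<le> measure (M \<Otimes>\<^sub>M M) (S \<inter> same_cell k) + measure (M \<Otimes>\<^sub>M M) (S' \<inter> same_cell k)"
    unfolding eq by (rule measure_Un_le; rule sets.Int[OF _ same_cell_sets]; fact assms)
  from mult_left_mono[OF this, of "ncell k"] show ?thesis unfolding pair_prob_def
    by (simp add: distrib_left)
qed

lemma pair_prob_rect:
  assumes "A \<in> sets M" "B \<in> sets M"
  shows "pair_prob k (A \<times> B) = ncell k * (\<Sum>b\<in>q k ` space M. measure M (A \<inter> cell k b) * measure M (B \<inter> cell k b))"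
proof -
  have "(A \<times> B) \<inter> same_cell k = (\<Union>b\<in>q k ` space M. (A \<inter> cell k b) \<times> (B \<inter> cell k b))"
    unfolding same_cell_eq by blast
  also have "measure (M \<Otimes>\<^sub>M M) \<dots> = (\<Sum>b\<in>q k ` space M. measure (M \<Otimes>\<^sub>M M) ((A \<inter> cell k b) \<times> (B \<inter> cell k b)))"
  proof (rule PM.finite_measure_finite_Union[OF finite_q])
    show "disjoint_family_on (\<lambda>b. (A \<inter> cell k b) \<times> (B \<inter> cell k b)) (q k ` space M)"
      by (auto simp: disjoint_family_on_def cell_def)
  qed (use assms in auto)
  finally show ?thesis using assms by (simp add: pair_prob_def measure_Times)
qed

text \<open>Under the conditioning each point alone is still distributed by \<open>M\<close>, so
  exceptional sets of single points keep their size.\<close>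

lemma pair_prob_fst: "A \<in> sets M \<Longrightarrow> pair_prob k (A \<times> space M) = measure M A"
  and pair_prob_snd: "A \<in> sets M \<Longrightarrow> pair_prob k (space M \<times> A) = measure M A"
proof -
  assume A: "A \<in> sets M"
  have c: "space M \<inter> cell k b = cell k b" for b by (auto simp: cell_def)
  have n: "ncell k > 0" by (rule ncell_pos)
  have "(\<Sum>b\<in>q k ` space M. measure M (A \<inter> cell k b) * measure M (cell k b)) = (\<Sum>b\<in>q k ` space M. measure M (A \<inter> cell k b)) / ncell k"
    unfolding sum_divide_distrib by (intro sum.cong refl) (simp only: measure_cell, simp)
  then have *: "ncell k * (\<Sum>b\<in>q k ` space M. measure M (A \<inter> cell k b) * measure M (cell k b)) = measure M A"
    using n by (simp add: sum_cells[OF A])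
  show "pair_prob k (A \<times> space M) = measure M A" "pair_prob k (space M \<times> A) = measure M A"
    using * A by (simp_all add: pair_prob_rect c mult.commute)
qed

lemma pair_prob_space: "pair_prob k (space M \<times> space M) = 1"
  by (simp add: pair_prob_fst prob_space)

lemma pair_prob_compl:
  assumes "S \<in> sets (M \<Otimes>\<^sub>M M)"
  shows "pair_prob k (space M \<times> space M - S) = 1 - pair_prob k S"
proof -
  have "(space M \<times> space M - S) \<inter> same_cell k = same_cell k - (S \<inter> same_cell k)" by (auto simp: same_cell_def)
  moreover have "measure (M \<Otimes>\<^sub>M M) (same_cell k - (S \<inter> same_cell k)) = measure (M \<Otimes>\<^sub>M M) (same_cell k) - measure (M \<Otimes>\<^sub>M M) (S \<inter> same_cell k)"
    using assms by (intro PM.finite_measure_Diff) auto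
  moreover have "space M \<times> space M \<inter> same_cell k = same_cell k" by (auto simp: same_cell_def)
  ultimately show ?thesis using pair_prob_space[of k] by (simp add: pair_prob_def right_diff_distrib)
qed

end

section \<open>Homomorphisms into a countable group of bijections\<close>

lemma sum_same_class_nonneg:
  fixes a :: "nat \<Rightarrow> real"
  shows "0 \<le> (\<Sum>i<n. \<Sum>j<n. a i * a j * (if c i = c j then 1 else 0))"
proof -
  have "(\<Sum>i<n. \<Sum>j<n. a i * a j * (if c i = c j then 1 else 0)) =
    (\<Sum>i<n. \<Sum>j<n. \<Sum>v\<in>c ` {..<n}. (if c i = v then a i else 0) * (if c j = v then a j else 0))"
  proof (intro sum.cong refl)
    fix i j assume "i \<in> {..<n}" "j \<in> {..<n}"
    have "(\<Sum>v\<in>c ` {..<n}. (if c i = v then a i else 0) * (if c j = v then a j else 0)) =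
      (\<Sum>v\<in>c ` {..<n}. if c i = v then (if c j = c i then a i * a j else 0) else 0)"
      by (intro sum.cong refl) auto
    also have "\<dots> = (if c j = c i then a i * a j else 0)"
      using \<open>i \<in> {..<n}\<close> by (subst sum.delta') auto
    finally show "a i * a j * (if c i = c j then 1 else 0) = (\<Sum>v\<in>c ` {..<n}. (if c i = v then a i else 0) * (if c j = v then a j else 0))"
      by simp
  qed
  also have "\<dots> = (\<Sum>v\<in>c ` {..<n}. \<Sum>i<n. \<Sum>j<n. (if c i = v then a i else 0) * (if c j = v then a j else 0))"
    by (simp only: sum.swap[where B = "c ` {..<n}"])
  \<comment> \<open>One square per class, namely that of the total coefficient of the class.\<close>
  also have "\<dots> = (\<Sum>v\<in>c ` {..<n}. (\<Sum>i<n. if c i = v then a i else 0)^2)"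
    by (simp only: power2_eq_square sum_product)
  also have "\<dots> \<ge> 0" by (intro sum_nonneg) simp
  finally show ?thesis .
qed

abbreviation ginv :: "('y \<Rightarrow> 'y) \<Rightarrow> 'y \<Rightarrow> 'y" where "ginv l \<equiv> inv_into UNIV l"

text \<open>\<open>G\<close> is a semigroup of transformations along which \<open>f\<close> is
  followed, and \<open>L\<close> is the countable acting group. At each point \<open>hom\<close>
  yields some element of \<open>L\<close> without a measurable choice; measurability comes from the
  countability of \<open>L\<close> and \<open>hom_sets\<close>.\<close>

locale odometer_hom = odometer M q p I T for M :: "'x measure" and q :: "nat \<Rightarrow> 'x \<Rightarrow> 'b" and p
    and I :: "'d set" and T :: "('d \<Rightarrow> int) \<Rightarrow> 'x \<Rightarrow> 'x" +
  fixes G :: "('x \<Rightarrow> 'x) set" and L :: "('y \<Rightarrow> 'y) set" and f :: "'x \<Rightarrow> 'y"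
  assumes G_meas: "g \<in> G \<Longrightarrow> g \<in> measurable M M"
    and G_distr: "g \<in> G \<Longrightarrow> distr M M g = M"
    and G_level: "g \<in> G \<Longrightarrow> x \<in> space M \<Longrightarrow> y \<in> space M \<Longrightarrow> q k (g x) = q k (g y) \<longleftrightarrow> q k x = q k y"
    and G_comp: "g \<in> G \<Longrightarrow> h \<in> G \<Longrightarrow> (\<lambda>x. g (h x)) \<in> G"
    and T_G: "T t \<in> G"
    and L_countable: "countable L"
    and L_bij: "l \<in> L \<Longrightarrow> bij l"
    and L_comp: "l \<in> L \<Longrightarrow> m \<in> L \<Longrightarrow> l \<circ> m \<in> L"
    and L_inv: "l \<in> L \<Longrightarrow> ginv l \<in> L"
    and L_id: "id \<in> L"
    and hom: "g \<in> G \<Longrightarrow> x \<in> space M \<Longrightarrow> \<exists>l\<in>L. l (f x) = f (g x)"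
    and hom_sets: "g \<in> G \<Longrightarrow> l \<in> L \<Longrightarrow> {x \<in> space M. l (f x) = f (g x)} \<in> sets M"
begin

lemma G_space: "g \<in> G \<Longrightarrow> x \<in> space M \<Longrightarrow> g x \<in> space M"
  using G_meas by (rule measurable_space)

lemma inv_l [simp]: "l \<in> L \<Longrightarrow> ginv l (l y) = y" "l \<in> L \<Longrightarrow> l (ginv l y) = y"
  using L_bij by (auto simp: bij_def inv_f_f surj_f_inv_f)

lemma inv_comp: "l \<in> L \<Longrightarrow> m \<in> L \<Longrightarrow> ginv (l \<circ> m) = ginv m \<circ> ginv l"
  using L_bij o_inv_distrib by metis

lemma inv_inv: "l \<in> L \<Longrightarrow> ginv (ginv l) = l"
  using L_bij inv_inv_eq by metis

definition common :: "('x \<Rightarrow> 'x) \<Rightarrow> ('x \<times> 'x) set" where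
  "common g = {z \<in> space M \<times> space M. \<exists>l\<in>L. l (f (fst z)) = f (g (fst z)) \<and> l (f (snd z)) = f (g (snd z))}"

definition bad :: "('x \<Rightarrow> 'x) \<Rightarrow> ('x \<times> 'x) set" where
  "bad g = space M \<times> space M - common g"

text \<open>
  Compares the elements moving \<open>f\<close> along \<open>g\<close> at the two points of \<open>z\<close>. As the action of \<open>L\<close> need not be free,
  they are determined only up to stabilisers, so the comparison is a double coset.
\<close>

definition twist :: "('x \<Rightarrow> 'x) \<Rightarrow> 'x \<times> 'x \<Rightarrow> ('y \<Rightarrow> 'y) set" where
  "twist g z = {ginv l \<circ> m |l m. l \<in> L \<and> m \<in> L \<and> l (f (fst z)) = f (g (fst z)) \<and> m (f (snd z)) = f (g (snd z))}"

lemma twistI: "l \<in> L \<Longrightarrow> m \<in> L \<Longrightarrow> l (f (fst z)) = f (g (fst z)) \<Longrightarrow> m (f (snd z)) = f (g (snd z)) \<Longrightarrow>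
    ginv l \<circ> m \<in> twist g z"
  unfolding twist_def by blast

lemma twist_nonempty: "g \<in> G \<Longrightarrow> z \<in> space M \<times> space M \<Longrightarrow> twist g z \<noteq> {}"
  using hom[of g "fst z"] hom[of g "snd z"] by (fastforce simp: twist_def)

text \<open>A twist is a double coset of the stabilisers of the two values of \<open>f\<close>, so
  two twists with a common element coincide. The new witnesses arise from \<open>l'\<close> and
  \<open>m'\<close> by the stabiliser elements \<open>ginv l \<circ> a\<close> and
  \<open>ginv m \<circ> b\<close>.\<close>

lemma twist_subset:
  assumes "l \<in> L" "m \<in> L" "l (f (fst z)) = f (g (fst z))" "m (f (snd z)) = f (g (snd z))"
    and "l' \<in> L" "m' \<in> L" "l' (f (fst z)) = f (h (fst z))" "m' (f (snd z)) = f (h (snd z))"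
    and eq: "ginv l \<circ> m = ginv l' \<circ> m'"
  shows "twist g z \<subseteq> twist h z"
proof
  fix c assume "c \<in> twist g z"
  then obtain a b where ab: "a \<in> L" "b \<in> L" "a (f (fst z)) = f (g (fst z))" "b (f (snd z)) = f (g (snd z))" "c = ginv a \<circ> b"
    by (auto simp: twist_def)
  define a' where "a' = l' \<circ> (ginv l \<circ> a)"
  define b' where "b' = m' \<circ> (ginv m \<circ> b)"
  have L: "a' \<in> L" "b' \<in> L" unfolding a'_def b'_def using assms ab by (auto intro!: L_comp L_inv)
  have "a' (f (fst z)) = f (h (fst z))" "b' (f (snd z)) = f (h (snd z))"
    using assms ab inv_l(1)[OF assms(1), of "f (fst z)"] inv_l(1)[OF assms(2), of "f (snd z)"] by (auto simp: a'_def b'_def)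
  moreover have "ginv a' \<circ> b' = c"
  proof -
    have "ginv a' = ginv a \<circ> l \<circ> ginv l'"
      unfolding a'_def using assms ab by (simp add: inv_comp L_comp L_inv inv_inv o_assoc)
    then have "ginv a' \<circ> b' = ginv a \<circ> l \<circ> (ginv l' \<circ> m') \<circ> ginv m \<circ> b" by (simp add: b'_def o_assoc)
    also have "\<dots> = ginv a \<circ> l \<circ> (ginv l \<circ> m) \<circ> ginv m \<circ> b" by (simp only: eq)
    also have "\<dots> = ginv a \<circ> b" using assms by (simp add: fun_eq_iff)
    finally show ?thesis using ab by simp
  qed
  ultimately show "c \<in> twist h z" using L unfolding twist_def by blast
qed

lemma twist_eq_iff:
  assumes "g \<in> G" "h \<in> G" "z \<in> space M \<times> space M"
  shows "twist g z = twist h z \<longleftrightarrow> (\<exists>l\<in>L. \<exists>m\<in>L. \<exists>l'\<in>L. \<exists>m'\<in>L. ginv l \<circ> m = ginv l' \<circ> m' \<and>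
     l (f (fst z)) = f (g (fst z)) \<and> m (f (snd z)) = f (g (snd z)) \<and>
     l' (f (fst z)) = f (h (fst z)) \<and> m' (f (snd z)) = f (h (snd z)))"
proof
  assume eq: "twist g z = twist h z"
  obtain c where "c \<in> twist g z" "c \<in> twist h z" using twist_nonempty[OF assms(1,3)] eq by blast
  then show "\<exists>l\<in>L. \<exists>m\<in>L. \<exists>l'\<in>L. \<exists>m'\<in>L. ginv l \<circ> m = ginv l' \<circ> m' \<and>
     l (f (fst z)) = f (g (fst z)) \<and> m (f (snd z)) = f (g (snd z)) \<and>
     l' (f (fst z)) = f (h (fst z)) \<and> m' (f (snd z)) = f (h (snd z))"
    unfolding twist_def by blast
next
  assume "\<exists>l\<in>L. \<exists>m\<in>L. \<exists>l'\<in>L. \<exists>m'\<in>L. ginv l \<circ> m = ginv l' \<circ> m' \<and>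
     l (f (fst z)) = f (g (fst z)) \<and> m (f (snd z)) = f (g (snd z)) \<and>
     l' (f (fst z)) = f (h (fst z)) \<and> m' (f (snd z)) = f (h (snd z))"
  then obtain l m l' m' where *: "l \<in> L" "m \<in> L" "l' \<in> L" "m' \<in> L" "ginv l \<circ> m = ginv l' \<circ> m'"
     "l (f (fst z)) = f (g (fst z))" "m (f (snd z)) = f (g (snd z))"
     "l' (f (fst z)) = f (h (fst z))" "m' (f (snd z)) = f (h (snd z))" by blast
  show "twist g z = twist h z"
    using twist_subset[OF *(1,2,6,7,3,4,8,9,5)] twist_subset[OF *(3,4,8,9,1,2,6,7) *(5)[symmetric]] by blast
qed

text \<open>The cocycle identity for double cosets: precomposition with \<open>a\<close> multiplies
  by fixed elements on either side. This operation is injective, so equality of twists is not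
  affected.\<close>

lemma twist_comp:
  assumes "a \<in> G" "z \<in> space M \<times> space M"
    and \<alpha>: "\<alpha> \<in> L" "\<alpha> (f (fst z)) = f (a (fst z))" and \<beta>: "\<beta> \<in> L" "\<beta> (f (snd z)) = f (a (snd z))"
  shows "twist (\<lambda>x. g (a x)) z = (\<lambda>c. ginv \<alpha> \<circ> c \<circ> \<beta>) ` twist g (map_prod a a z)"
proof (intro equalityI subsetI)
  fix c assume "c \<in> twist (\<lambda>x. g (a x)) z"
  then obtain l m where lm: "l \<in> L" "m \<in> L" "l (f (fst z)) = f (g (a (fst z)))" "m (f (snd z)) = f (g (a (snd z)))" "c = ginv l \<circ> m"
    by (auto simp: twist_def)
  have "ginv (l \<circ> ginv \<alpha>) \<circ> (m \<circ> ginv \<beta>) \<in> twist g (map_prod a a z)"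
    by (rule twistI) (use lm \<alpha> \<beta> in \<open>auto intro!: L_comp L_inv simp flip: \<alpha>(2) \<beta>(2)\<close>)
  moreover have "c = ginv \<alpha> \<circ> (ginv (l \<circ> ginv \<alpha>) \<circ> (m \<circ> ginv \<beta>)) \<circ> \<beta>"
    using lm \<alpha> \<beta> by (simp add: inv_comp L_inv inv_inv fun_eq_iff)
  ultimately show "c \<in> (\<lambda>c. ginv \<alpha> \<circ> c \<circ> \<beta>) ` twist g (map_prod a a z)" by blast
next
  fix c assume "c \<in> (\<lambda>c. ginv \<alpha> \<circ> c \<circ> \<beta>) ` twist g (map_prod a a z)"
  then obtain l m where lm: "l \<in> L" "m \<in> L" "l (f (a (fst z))) = f (g (a (fst z)))" "m (f (a (snd z))) = f (g (a (snd z)))" "c = ginv \<alpha> \<circ> (ginv l \<circ> m) \<circ> \<beta>"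
    by (auto simp: twist_def)
  then have "c = ginv (l \<circ> \<alpha>) \<circ> (m \<circ> \<beta>)" using \<alpha> by (simp add: inv_comp o_assoc)
  then show "c \<in> twist (\<lambda>x. g (a x)) z"
    by (simp only:) (rule twistI, use lm \<alpha> \<beta> in \<open>auto intro!: L_comp\<close>)
qed

lemma twist_comp_eq_iff:
  assumes "a \<in> G" "z \<in> space M \<times> space M"
  shows "twist (\<lambda>x. g (a x)) z = twist (\<lambda>x. h (a x)) z \<longleftrightarrow> twist g (map_prod a a z) = twist h (map_prod a a z)"
proof -
  obtain \<alpha> where \<alpha>: "\<alpha> \<in> L" "\<alpha> (f (fst z)) = f (a (fst z))" using hom[OF assms(1), of "fst z"] assms(2) by auto
  obtain \<beta> where \<beta>: "\<beta> \<in> L" "\<beta> (f (snd z)) = f (a (snd z))" using hom[OF assms(1), of "snd z"] assms(2) by auto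
  have "inj (\<lambda>c. ginv \<alpha> \<circ> c \<circ> \<beta>)"
  proof (rule injI)
    fix c d assume eq: "ginv \<alpha> \<circ> c \<circ> \<beta> = ginv \<alpha> \<circ> d \<circ> \<beta>"
    have "\<alpha> \<circ> (ginv \<alpha> \<circ> c \<circ> \<beta>) \<circ> ginv \<beta> = \<alpha> \<circ> (ginv \<alpha> \<circ> d \<circ> \<beta>) \<circ> ginv \<beta>" by (simp only: eq)
    then show "c = d" using \<alpha> \<beta> by (simp add: fun_eq_iff)
  qed
  then show ?thesis unfolding twist_comp[OF assms \<alpha> \<beta>] by (simp add: inj_image_eq_iff)
qed

text \<open>The twist of the identity is the product of the two stabilisers. If \<open>g\<close> has
  the same twist, an element serving \<open>g\<close> at the first point can be corrected by a
  stabiliser so as to serve at both.\<close>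

lemma twist_id_iff:
  assumes "g \<in> G" "z \<in> space M \<times> space M"
  shows "twist g z = twist (T (\<lambda>_. 0)) z \<longleftrightarrow> z \<in> common g"
proof
  assume "twist g z = twist (T (\<lambda>_. 0)) z"
  then obtain l m l' m' where *: "l \<in> L" "m \<in> L" "l' \<in> L" "m' \<in> L" "ginv l \<circ> m = ginv l' \<circ> m'"
     "l (f (fst z)) = f (g (fst z))" "m (f (snd z)) = f (g (snd z))"
     "l' (f (fst z)) = f (fst z)" "m' (f (snd z)) = f (snd z)"
    using assms unfolding twist_eq_iff[OF assms(1) T_G assms(2)] by (auto simp: T_zero)
  have 1: "ginv l' (f (fst z)) = f (fst z)" using inv_l(1)[OF *(3), of "f (fst z)"] * by simp
  have 2: "ginv l (m (f (snd z))) = ginv l' (m' (f (snd z)))" using fun_cong[OF *(5), of "f (snd z)"] by simp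
  have "(l \<circ> ginv l') (f (snd z)) = l (ginv l' (m' (f (snd z))))" using * by simp
  also have "\<dots> = f (g (snd z))" unfolding 2[symmetric] using * by simp
  finally have "(l \<circ> ginv l') (f (snd z)) = f (g (snd z))" .
  moreover have "(l \<circ> ginv l') (f (fst z)) = f (g (fst z))" using 1 * by simp
  moreover have "l \<circ> ginv l' \<in> L" using * by (intro L_comp L_inv)
  ultimately show "z \<in> common g" using assms unfolding common_def by blast
next
  assume "z \<in> common g"
  then obtain l where "l \<in> L" "l (f (fst z)) = f (g (fst z))" "l (f (snd z)) = f (g (snd z))" by (auto simp: common_def)
  then show "twist g z = twist (T (\<lambda>_. 0)) z"
    unfolding twist_eq_iff[OF assms(1) T_G assms(2)] using assms L_id
    by (intro bexI[of _ l] bexI[of _ id]) (auto simp: T_zero fun_eq_iff)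
qed

lemma common_sets:
  assumes "g \<in> G"
  shows "common g \<in> sets (M \<Otimes>\<^sub>M M)"
proof -
  have "common g = (\<Union>l\<in>L. {x \<in> space M. l (f x) = f (g x)} \<times> {x \<in> space M. l (f x) = f (g x)})"
    by (auto simp: common_def)
  also have "\<dots> \<in> sets (M \<Otimes>\<^sub>M M)"
    by (intro sets.countable_UN'' L_countable pair_measureI hom_sets assms)
  finally show ?thesis .
qed

lemma bad_sets: "g \<in> G \<Longrightarrow> bad g \<in> sets (M \<Otimes>\<^sub>M M)"
  unfolding bad_def using common_sets sets.compl_sets by (metis space_pair_measure)

lemma twist_sets:
  assumes "g \<in> G" "h \<in> G"
  shows "{z \<in> space M \<times> space M. twist g z = twist h z} \<in> sets (M \<Otimes>\<^sub>M M)"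
proof -
  let ?E = "\<lambda>g l. {x \<in> space M. l (f x) = f (g x)}"
  have "{z \<in> space M \<times> space M. twist g z = twist h z} =
    (\<Union>l\<in>L. \<Union>m\<in>L. \<Union>l'\<in>L. \<Union>m'\<in>{m'\<in>L. ginv l \<circ> m = ginv l' \<circ> m'}. (?E g l \<inter> ?E h l') \<times> (?E g m \<inter> ?E h m'))" (is "?A = ?B")
  proof (intro equalityI subsetI)
    fix z assume "z \<in> ?A"
    then have z: "z \<in> space M \<times> space M" and e: "twist g z = twist h z" by auto
    show "z \<in> ?B" using e[unfolded twist_eq_iff[OF assms z]] z by (cases z) fastforce
  next
    fix z assume B: "z \<in> ?B"
    then have z: "z \<in> space M \<times> space M" by auto
    have "twist g z = twist h z" unfolding twist_eq_iff[OF assms z] using B by (cases z) fastforce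
    then show "z \<in> ?A" using z by simp
  qed
  also have "\<dots> \<in> sets (M \<Otimes>\<^sub>M M)"
    by (intro sets.countable_UN'' L_countable pair_measureI sets.Int hom_sets assms countable_subset[OF _ L_countable]) auto
  finally show ?thesis .
qed

lemma map_prod_measure:
  assumes "a \<in> G" "S \<in> sets (M \<Otimes>\<^sub>M M)"
  shows "measure (M \<Otimes>\<^sub>M M) {z \<in> space M \<times> space M. map_prod a a z \<in> S} = measure (M \<Otimes>\<^sub>M M) S"
proof -
  have m: "a \<in> measurable M M" by (rule G_meas[OF assms(1)])
  have "distr M M a \<Otimes>\<^sub>M distr M M a = distr (M \<Otimes>\<^sub>M M) (M \<Otimes>\<^sub>M M) (\<lambda>(x, y). (a x, a y))"
    by (rule pair_measure_distr) (use m G_distr[OF assms(1)] in \<open>auto intro: sigma_finite_measure_axioms\<close>)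
  then have d: "distr (M \<Otimes>\<^sub>M M) (M \<Otimes>\<^sub>M M) (map_prod a a) = M \<Otimes>\<^sub>M M"
    by (simp add: G_distr[OF assms(1)] map_prod_def)
  have mm: "map_prod a a \<in> measurable (M \<Otimes>\<^sub>M M) (M \<Otimes>\<^sub>M M)"
    unfolding map_prod_def using m by measurable
  have "measure (M \<Otimes>\<^sub>M M) S = measure (M \<Otimes>\<^sub>M M) (map_prod a a -` S \<inter> space (M \<Otimes>\<^sub>M M))"
    using measure_distr[OF mm, of S] assms(2) by (simp add: d)
  also have "map_prod a a -` S \<inter> space (M \<Otimes>\<^sub>M M) = {z \<in> space M \<times> space M. map_prod a a z \<in> S}"
    by (auto simp: space_pair_measure)
  finally show ?thesis by simp
qed

lemma map_prod_G:
  assumes "a \<in> G" "S \<in> sets (M \<Otimes>\<^sub>M M)"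
  shows "pair_prob k {z \<in> space M \<times> space M. map_prod a a z \<in> S} = pair_prob k S"
proof -
  have "{z \<in> space M \<times> space M. map_prod a a z \<in> S} \<inter> same_cell k = {z \<in> space M \<times> space M. map_prod a a z \<in> S \<inter> same_cell k}"
    by (auto simp: same_cell_def G_level[OF assms(1)] G_space[OF assms(1)])
  then show ?thesis using map_prod_measure[OF assms(1), of "S \<inter> same_cell k"] assms(2) by (simp add: pair_prob_def)
qed

definition twist_kernel :: "nat \<Rightarrow> ('x \<Rightarrow> 'x) \<Rightarrow> ('x \<Rightarrow> 'x) \<Rightarrow> real" where
  "twist_kernel k g h = pair_prob k {z \<in> space M \<times> space M. twist g z = twist h z}"

lemma twist_cong: "z \<in> space M \<times> space M \<Longrightarrow> (\<And>x. x \<in> space M \<Longrightarrow> g x = h x) \<Longrightarrow> twist g z = twist h z"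
  unfolding twist_def by (cases z) simp

lemma twist_kernel_cong: "(\<And>x. x \<in> space M \<Longrightarrow> g x = g' x) \<Longrightarrow> (\<And>x. x \<in> space M \<Longrightarrow> h x = h' x) \<Longrightarrow> twist_kernel k g h = twist_kernel k g' h'"
  unfolding twist_kernel_def by (intro arg_cong[of _ _ "pair_prob k"] Collect_cong conj_cong refl) (simp only: twist_cong[of _ g g'] twist_cong[of _ h h'])

text \<open>The map \<open>a\<close> applied to both points preserves the conditional measure on
  pairs, and the twists along the composites agree at a pair exactly when the original twists agree
  at its image.\<close>

lemma twist_kernel_comp:
  assumes "a \<in> G" "g \<in> G" "h \<in> G"
  shows "twist_kernel k (\<lambda>x. g (a x)) (\<lambda>x. h (a x)) = twist_kernel k g h"
proof -
  have "{z \<in> space M \<times> space M. twist (\<lambda>x. g (a x)) z = twist (\<lambda>x. h (a x)) z} =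
    {z \<in> space M \<times> space M. map_prod a a z \<in> {z \<in> space M \<times> space M. twist g z = twist h z}}"
  proof (intro Collect_cong conj_cong refl)
    fix z assume z: "z \<in> space M \<times> space M"
    then have "map_prod a a z \<in> space M \<times> space M" by (cases z) (simp add: G_space[OF assms(1)])
    then show "twist (\<lambda>x. g (a x)) z = twist (\<lambda>x. h (a x)) z \<longleftrightarrow> map_prod a a z \<in> {z \<in> space M \<times> space M. twist g z = twist h z}"
      using twist_comp_eq_iff[OF assms(1) z, of g h] by simp
  qed
  then show ?thesis unfolding twist_kernel_def using map_prod_G[OF assms(1) twist_sets[OF assms(2,3)]] by simp
qed

lemma twist_kernel_id:
  assumes "g \<in> G"
  shows "twist_kernel k g (T (\<lambda>_. 0)) = 1 - pair_prob k (bad g)"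
proof -
  have "{z \<in> space M \<times> space M. twist g z = twist (T (\<lambda>_. 0)) z} = common g"
  proof (intro equalityI subsetI)
    fix z assume "z \<in> common g"
    moreover from this have "z \<in> space M \<times> space M" unfolding common_def by blast
    ultimately show "z \<in> {z \<in> space M \<times> space M. twist g z = twist (T (\<lambda>_. 0)) z}" using twist_id_iff[OF assms, of z] by simp
  qed (use twist_id_iff[OF assms] in blast)
  moreover have "pair_prob k (bad g) = 1 - pair_prob k (common g)"
    unfolding bad_def by (rule pair_prob_compl[OF common_sets[OF assms]])
  ultimately show ?thesis by (simp add: twist_kernel_def)
qed

text \<open>For a fixed pair of points the entries are the matrix of an equivalence relation on the
  indices, a sum of squares. The kernel is an average of such matrices.\<close>

lemma psd_twist_kernel:
  assumes "\<And>i. s i \<in> G"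
  shows "psd (\<lambda>i j. twist_kernel k (s i) (s j))"
  unfolding psd_def
proof (intro conjI allI)
  fix i j show "twist_kernel k (s i) (s j) = twist_kernel k (s j) (s i)"
    unfolding twist_kernel_def by (simp only: eq_commute[of "twist (s i) _"])
next
  fix n :: nat and r :: "nat \<Rightarrow> _" and a :: "nat \<Rightarrow> real"
  define A where "A i j = {z \<in> space M \<times> space M. twist (s (r i)) z = twist (s (r j)) z} \<inter> same_cell k" for i j
  have A: "A i j \<in> sets (M \<Otimes>\<^sub>M M)" for i j unfolding A_def by (intro sets.Int twist_sets assms same_cell_sets)
  have Ksum: "twist_kernel k (s (r i)) (s (r j)) = ncell k * (LINT z|(M \<Otimes>\<^sub>M M). indicator (A i j) z)" for i j
    using sets.sets_into_space[OF A[of i j]] by (simp add: twist_kernel_def pair_prob_def A_def[symmetric] Int_absorb2)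
  have "(\<Sum>i<n. \<Sum>j<n. a i * a j * twist_kernel k (s (r i)) (s (r j))) =
    ncell k * (LINT z|(M \<Otimes>\<^sub>M M). (\<Sum>i<n. \<Sum>j<n. a i * a j * indicator (A i j) z))"
    using A by (simp add: Ksum sum_distrib_left mult_ac PM.integrable_const_bound[where B = 1])
  also have "0 \<le> \<dots>"
  proof (intro mult_nonneg_nonneg integral_nonneg_AE AE_I2)
    fix z assume "z \<in> space (M \<Otimes>\<^sub>M M)"
    then have z: "z \<in> space M \<times> space M" by (simp add: space_pair_measure)
    show "0 \<le> (\<Sum>i<n. \<Sum>j<n. a i * a j * indicator (A i j) z)"
    proof (cases "z \<in> same_cell k")
      case True
      then have "(\<Sum>i<n. \<Sum>j<n. a i * a j * indicator (A i j) z) =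
        (\<Sum>i<n. \<Sum>j<n. a i * a j * (if twist (s (r i)) z = twist (s (r j)) z then 1 else 0))"
        using z by (intro sum.cong refl) (auto simp: A_def indicator_def)
      then show ?thesis using sum_same_class_nonneg[of a "\<lambda>i. twist (s (r i)) z" n] by (simp only:)
    qed (simp add: A_def)
  qed simp
  finally show "0 \<le> (\<Sum>i<n. \<Sum>j<n. a i * a j * twist_kernel k (s (r i)) (s (r j)))" .
qed

text \<open>The probability that the twist of a translation equals that of the identity is a
  positive definite function on the plane, and the shears make it almost invariant. Since
  \<open>\<delta>\<close> depends on \<open>\<epsilon>\<close> alone, the level \<open>k\<close> can
  be chosen afterwards to make finitely many generators good.\<close>

lemma translation_bad_small:
  assumes "\<epsilon> > 0"
  obtains \<delta> where "\<delta> > 0"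
    "\<And>k \<tau> S1 S2 v. (\<And>v. \<tau> v \<in> G) \<Longrightarrow> (\<And>v w x. x \<in> space M \<Longrightarrow> \<tau> v (\<tau> w x) = \<tau> (v + w) x) \<Longrightarrow>
      (\<And>x. x \<in> space M \<Longrightarrow> \<tau> 0 x = x) \<Longrightarrow> (\<And>c. S1 c \<in> G) \<Longrightarrow> (\<And>c. S2 c \<in> G) \<Longrightarrow>
      (\<And>c v x. x \<in> space M \<Longrightarrow> S1 c (\<tau> v x) = \<tau> (shear1 c v) (S1 c x)) \<Longrightarrow>
      (\<And>c v x. x \<in> space M \<Longrightarrow> S2 c (\<tau> v x) = \<tau> (shear2 c v) (S2 c x)) \<Longrightarrow>
      pair_prob k (bad (\<tau> (1, 0))) \<le> \<delta> \<Longrightarrow> pair_prob k (bad (\<tau> (0, 1))) \<le> \<delta> \<Longrightarrow>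
      (\<And>c. c \<in> {4, -4} \<Longrightarrow> pair_prob k (bad (S1 c)) \<le> \<delta> \<and> pair_prob k (bad (S2 c)) \<le> \<delta>) \<Longrightarrow>
      pair_prob k (bad (\<tau> v)) \<le> \<epsilon>"
proof -
  obtain \<delta> where \<delta>: "\<delta> > 0" and RT: "\<And>\<psi> v. \<psi> 0 = 1 \<Longrightarrow> 1 - \<delta> \<le> \<psi> (1, 0) \<Longrightarrow> 1 - \<delta> \<le> \<psi> (0, 1) \<Longrightarrow>
       (\<And>c. c \<in> {4, -4} \<Longrightarrow> almost_inv \<delta> \<psi> (shear1 c) \<and> almost_inv \<delta> \<psi> (shear2 c)) \<Longrightarrow> 1 - \<epsilon> \<le> \<psi> v"
    using relative_property_T[OF assms] by metis
  show ?thesis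
  proof (rule that[OF \<delta>])
    fix k :: nat and \<tau> :: "int \<times> int \<Rightarrow> 'x \<Rightarrow> 'x" and S1 S2 :: "int \<Rightarrow> 'x \<Rightarrow> 'x" and v
    assume G: "\<And>v. \<tau> v \<in> G" and add: "\<And>v w x. x \<in> space M \<Longrightarrow> \<tau> v (\<tau> w x) = \<tau> (v + w) x"
      and zero: "\<And>x. x \<in> space M \<Longrightarrow> \<tau> 0 x = x" and S1G: "\<And>c. S1 c \<in> G" and S2G: "\<And>c. S2 c \<in> G"
      and S1: "\<And>c v x. x \<in> space M \<Longrightarrow> S1 c (\<tau> v x) = \<tau> (shear1 c v) (S1 c x)"
      and S2: "\<And>c v x. x \<in> space M \<Longrightarrow> S2 c (\<tau> v x) = \<tau> (shear2 c v) (S2 c x)"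
      and b1: "pair_prob k (bad (\<tau> (1, 0))) \<le> \<delta>" and b2: "pair_prob k (bad (\<tau> (0, 1))) \<le> \<delta>"
      and bS: "\<And>c. c \<in> {4, -4} \<Longrightarrow> pair_prob k (bad (S1 c)) \<le> \<delta> \<and> pair_prob k (bad (S2 c)) \<le> \<delta>"
    define \<psi> where "\<psi> v = twist_kernel k (\<tau> v) (T (\<lambda>_. 0))" for v
    have \<psi>: "\<psi> v = 1 - pair_prob k (bad (\<tau> v))" for v by (simp add: \<psi>_def twist_kernel_id[OF G])
    have \<psi>0: "\<psi> 0 = 1"
    proof -
      have "bad (\<tau> 0) = {}" using L_id zero by (fastforce simp: bad_def common_def)
      then show ?thesis by (simp add: \<psi> pair_prob_def)
    qed
    have Kt: "twist_kernel k (\<tau> v) (\<tau> w) = \<psi> (v - w)" for v w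
    proof -
      have "twist_kernel k (\<tau> v) (\<tau> w) = twist_kernel k (\<lambda>x. \<tau> (v - w) (\<tau> w x)) (\<lambda>x. T (\<lambda>_. 0) (\<tau> w x))"
        by (rule twist_kernel_cong) (simp_all add: add T_zero G_space[OF G])
      also have "\<dots> = \<psi> (v - w)" unfolding \<psi>_def by (rule twist_kernel_comp[OF G G T_G])
      finally show ?thesis .
    qed
    have inv: "almost_inv \<delta> \<psi> sh"
      if SG: "S \<in> G" and S: "\<And>v x. x \<in> space M \<Longrightarrow> S (\<tau> v x) = \<tau> (sh v) (S x)"
        and sh: "\<And>v w. sh (v - w) = sh v - sh w" and bS: "pair_prob k (bad S) \<le> \<delta>" for S sh
    proof -
      \<comment> \<open>The two orbits demanded by \<open>almost_inv\<close>: the second is moved by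
        \<open>S\<close>, and commuting \<open>S\<close> past a translation turns \<open>v\<close>
        into \<open>sh v\<close>.\<close>
      define e where "e z = (if fst z then (\<lambda>x. S (\<tau> (snd z) x)) else \<tau> (snd z))" for z :: "bool \<times> int \<times> int"
      have eG: "e z \<in> G" for z by (simp add: e_def G G_comp[OF SG G])
      show ?thesis unfolding almost_inv_def
      proof (intro exI[of _ "\<lambda>z w. twist_kernel k (e z) (e w)"] conjI allI)
        show "psd (\<lambda>z w. twist_kernel k (e z) (e w))" by (rule psd_twist_kernel[OF eG])
        show "twist_kernel k (e (False, v)) (e (False, w)) = \<psi> (v - w)" for v w by (simp add: e_def Kt)
        show "twist_kernel k (e (True, v)) (e (True, w)) = \<psi> (sh (v - w))" for v w
        proof -
          have "twist_kernel k (e (True, v)) (e (True, w)) = twist_kernel k (\<lambda>x. \<tau> (sh v) (S x)) (\<lambda>x. \<tau> (sh w) (S x))"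
            by (rule twist_kernel_cong) (simp_all add: e_def S)
          also have "\<dots> = twist_kernel k (\<tau> (sh v)) (\<tau> (sh w))" by (rule twist_kernel_comp[OF SG G G])
          finally show ?thesis by (simp add: Kt sh)
        qed
        show "twist_kernel k (e (True, v)) (e (False, w)) = twist_kernel k (e (True, 0)) (e (False, w - v))" for v w
        proof -
          have "twist_kernel k (e (True, v)) (e (False, w)) = twist_kernel k (\<lambda>x. e (True, 0) (\<tau> v x)) (\<lambda>x. e (False, w - v) (\<tau> v x))"
            by (rule twist_kernel_cong) (simp_all add: e_def add)
          also have "\<dots> = twist_kernel k (e (True, 0)) (e (False, w - v))" by (rule twist_kernel_comp[OF G eG eG])
          finally show ?thesis .
        qed
        have "twist_kernel k (e (True, 0)) (e (False, 0)) = twist_kernel k S (T (\<lambda>_. 0))"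
          by (rule twist_kernel_cong) (simp_all add: e_def zero T_zero)
        then show "1 - \<delta> \<le> twist_kernel k (e (True, 0)) (e (False, 0))" using bS by (simp add: twist_kernel_id[OF SG])
      qed
    qed
    have "1 - \<epsilon> \<le> \<psi> v"
    proof (rule RT[of \<psi>, OF \<psi>0])
      show "1 - \<delta> \<le> \<psi> (1, 0)" "1 - \<delta> \<le> \<psi> (0, 1)" using b1 b2 by (simp_all add: \<psi>)
      show "almost_inv \<delta> \<psi> (shear1 c) \<and> almost_inv \<delta> \<psi> (shear2 c)" if "c \<in> {4, -4}" for c
        using inv[OF S1G S1 shear_diff(1)] inv[OF S2G S2 shear_diff(2)] bS[OF that] by blast
    qed
    then show "pair_prob k (bad (\<tau> v)) \<le> \<epsilon>" by (simp add: \<psi>)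
  qed
qed

text \<open>Only countably many elements are available, so for most pairs in a small ball one of
  them serves both points.\<close>

lemma bad_small:
  assumes g: "g \<in> G" and "\<delta> > 0"
  shows "\<exists>k0. \<forall>k\<ge>k0. pair_prob k (bad g) \<le> \<delta>"
proof -
  have ne: "L \<noteq> {}" using L_id by auto
  let ?B = "\<lambda>n. {x \<in> space M. from_nat_into L n (f x) = f (g x)}"
  have l: "from_nat_into L n \<in> L" for n using ne by (rule from_nat_into)
  have cov: "space M \<subseteq> (\<Union>n. ?B n)"
  proof
    fix x assume x: "x \<in> space M"
    then obtain l where "l \<in> L" "l (f x) = f (g x)" using hom[OF g] by blast
    then show "x \<in> (\<Union>n. ?B n)" using x from_nat_into_surj[OF L_countable, of l] by auto
  qed
  have B: "?B n \<in> sets M" for n by (rule hom_sets[OF g l])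
  have "\<delta> / 2 > 0" using assms by simp
  then obtain E k0 where E: "E \<in> sets M" "measure M E \<le> \<delta> / 2"
    "\<And>k x y. k \<ge> k0 \<Longrightarrow> x \<in> space M - E \<Longrightarrow> y \<in> space M - E \<Longrightarrow> q k x = q k y \<Longrightarrow> \<exists>n. x \<in> ?B n \<and> y \<in> ?B n"
    by (rule approx_cover[OF B cov]) blast
  show ?thesis
  proof (intro exI[of _ k0] allI impI)
    fix k assume k: "k0 \<le> k"
    have "bad g \<inter> same_cell k \<subseteq> (E \<times> space M) \<union> (space M \<times> E)"
    proof
      fix z assume z: "z \<in> bad g \<inter> same_cell k"
      then have zz: "fst z \<in> space M" "snd z \<in> space M" "q k (fst z) = q k (snd z)" by (auto simp: same_cell_def)
      show "z \<in> (E \<times> space M) \<union> (space M \<times> E)"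
      proof (rule ccontr)
        assume "z \<notin> (E \<times> space M) \<union> (space M \<times> E)"
        then have "fst z \<notin> E" "snd z \<notin> E" using zz by (auto simp: mem_Times_iff)
        then obtain n where "fst z \<in> ?B n" "snd z \<in> ?B n" using E(3)[OF k, of "fst z" "snd z"] zz by auto
        then have "z \<in> common g" using l[of n] zz by (auto simp: common_def mem_Times_iff)
        then show False using z by (simp add: bad_def)
      qed
    qed
    then have "pair_prob k (bad g) \<le> pair_prob k ((E \<times> space M) \<union> (space M \<times> E))"
      by (rule pair_prob_mono) (use E in auto)
    also have "\<dots> \<le> pair_prob k (E \<times> space M) + pair_prob k (space M \<times> E)" by (rule pair_prob_Un_le) (use E in auto)
    also have "\<dots> \<le> \<delta>" using E by (simp add: pair_prob_fst pair_prob_snd)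
    finally show "pair_prob k (bad g) \<le> \<delta>" .
  qed
qed

section \<open>Balls on which one element serves most points\<close>

definition bad_density :: "nat \<Rightarrow> 'b \<Rightarrow> ('x \<Rightarrow> 'x) \<Rightarrow> real" where
  "bad_density k b g = (ncell k)^2 * measure (M \<Otimes>\<^sub>M M) (bad g \<inter> (cell k b \<times> cell k b))"

lemma bad_density_nonneg: "0 \<le> bad_density k b g" by (simp add: bad_density_def)

lemma bad_density_le_1:
  assumes "b \<in> q k ` space M"
  shows "bad_density k b g \<le> 1"
proof -
  have "measure (M \<Otimes>\<^sub>M M) (bad g \<inter> (cell k b \<times> cell k b)) \<le> measure (M \<Otimes>\<^sub>M M) (cell k b \<times> cell k b)"
    by (intro PM.finite_measure_mono) auto
  also have "\<dots> = (1 / ncell k)^2" by (simp add: measure_Times measure_cell[OF assms] power2_eq_square)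
  finally have "measure (M \<Otimes>\<^sub>M M) (bad g \<inter> (cell k b \<times> cell k b)) \<le> (1 / ncell k)^2" .
  from mult_left_mono[OF this, of "(real (ncell k))^2"] show ?thesis
    using ncell_pos[of k] by (simp add: bad_density_def power_divide)
qed

text \<open>\<open>bad_density\<close> is the failure probability conditioned on a single ball, and
  its average over the balls is the failure probability for a pair in a common ball.\<close>

lemma bad_density_sum:
  assumes "g \<in> G"
  shows "(\<Sum>b\<in>q k ` space M. bad_density k b g) = ncell k * pair_prob k (bad g)"
proof -
  have "bad g \<inter> same_cell k = (\<Union>b\<in>q k ` space M. bad g \<inter> (cell k b \<times> cell k b))" unfolding same_cell_eq by blast
  also have "measure (M \<Otimes>\<^sub>M M) \<dots> = (\<Sum>b\<in>q k ` space M. measure (M \<Otimes>\<^sub>M M) (bad g \<inter> (cell k b \<times> cell k b)))"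
  proof (rule PM.finite_measure_finite_Union[OF finite_q])
    show "disjoint_family_on (\<lambda>b. bad g \<inter> (cell k b \<times> cell k b)) (q k ` space M)"
      by (auto simp: disjoint_family_on_def cell_def)
  qed (use bad_sets[OF assms] in auto)
  finally show ?thesis by (simp add: pair_prob_def bad_density_def sum_distrib_left power2_eq_square mult_ac)
qed

text \<open>If one element serves both points along \<open>v\<close> and another along
  \<open>s + v\<close>, their quotient serves the translated pair along \<open>s\<close>. The
  translation preserves the measure and the ball.\<close>

lemma bad_density_triangle:
  assumes \<rho>G: "\<And>s. \<rho> s \<in> G" and \<rho>add: "\<And>s t x. x \<in> space M \<Longrightarrow> \<rho> s (\<rho> t x) = \<rho> (s + t) x"
    and \<rho>q: "\<And>s x. x \<in> space M \<Longrightarrow> q k (\<rho> s x) = q k x"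
  shows "bad_density k b (\<rho> s) \<le> bad_density k b (\<rho> v) + bad_density k b (\<rho> (s + v :: int))"
proof -
  let ?N = "M \<Otimes>\<^sub>M M" and ?c = "cell k b \<times> cell k b"
  have S: "bad (\<rho> t) \<inter> ?c \<in> sets ?N" for t by (intro sets.Int bad_sets \<rho>G) auto
  have "measure ?N (bad (\<rho> s) \<inter> ?c) = measure ?N {z \<in> space M \<times> space M. map_prod (\<rho> v) (\<rho> v) z \<in> bad (\<rho> s) \<inter> ?c}"
    by (rule map_prod_measure[OF \<rho>G S, symmetric])
  also have "\<dots> \<le> measure ?N ((bad (\<rho> v) \<inter> ?c) \<union> (bad (\<rho> (s + v)) \<inter> ?c))"
  proof (rule PM.finite_measure_mono)
    show "{z \<in> space M \<times> space M. map_prod (\<rho> v) (\<rho> v) z \<in> bad (\<rho> s) \<inter> ?c} \<subseteq> (bad (\<rho> v) \<inter> ?c) \<union> (bad (\<rho> (s + v)) \<inter> ?c)"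
    proof
      fix z assume z: "z \<in> {z \<in> space M \<times> space M. map_prod (\<rho> v) (\<rho> v) z \<in> bad (\<rho> s) \<inter> ?c}"
      then have sp: "fst z \<in> space M" "snd z \<in> space M" by auto
      have zc: "z \<in> ?c" using z sp \<rho>q by (cases z) (auto simp: cell_def)
      show "z \<in> (bad (\<rho> v) \<inter> ?c) \<union> (bad (\<rho> (s + v)) \<inter> ?c)"
      proof (rule ccontr)
        assume "z \<notin> (bad (\<rho> v) \<inter> ?c) \<union> (bad (\<rho> (s + v)) \<inter> ?c)"
        then have "z \<in> common (\<rho> v)" "z \<in> common (\<rho> (s + v))" using zc z by (auto simp: bad_def)
        then obtain l m where l: "l \<in> L" "l (f (fst z)) = f (\<rho> v (fst z))" "l (f (snd z)) = f (\<rho> v (snd z))"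
          and m: "m \<in> L" "m (f (fst z)) = f (\<rho> (s + v) (fst z))" "m (f (snd z)) = f (\<rho> (s + v) (snd z))"
          unfolding common_def by blast
        have "(m \<circ> ginv l) (f (\<rho> v (fst z))) = f (\<rho> s (\<rho> v (fst z)))" "(m \<circ> ginv l) (f (\<rho> v (snd z))) = f (\<rho> s (\<rho> v (snd z)))"
          using l(1) m sp by (simp_all add: l(2,3)[symmetric] \<rho>add)
        moreover have "m \<circ> ginv l \<in> L" using l m by (intro L_comp L_inv)
        ultimately have "map_prod (\<rho> v) (\<rho> v) z \<in> common (\<rho> s)"
          using sp G_space[OF \<rho>G] unfolding common_def by (cases z) (auto intro!: bexI[of _ "m \<circ> ginv l"])
        then show False using z by (simp add: bad_def)
      qed
    qed
  qed (use S in auto)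
  also have "\<dots> \<le> measure ?N (bad (\<rho> v) \<inter> ?c) + measure ?N (bad (\<rho> (s + v)) \<inter> ?c)"
    by (rule measure_Un_le) (rule S)+
  finally have "measure ?N (bad (\<rho> s) \<inter> ?c) \<le> measure ?N (bad (\<rho> v) \<inter> ?c) + measure ?N (bad (\<rho> (s + v)) \<inter> ?c)" .
  from mult_left_mono[OF this, of "(real (ncell k))^2"] show ?thesis by (simp add: bad_density_def distrib_left)
qed

text \<open>A maximal inequality: the hypothesis bounds each \<open>s\<close> separately, the
  conclusion all of them at once. If a ball fails for one \<open>s\<close>, the triangle inequality
  spreads the failure to \<open>v\<close> or \<open>s + v\<close> for every \<open>v\<close>, so the
  long-run average of its density is at least \<open>C * e / 2\<close>. The average over all balls
  is at most \<open>e\<close>, so few balls can do this.\<close>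

lemma card_bad_cells:
  assumes \<rho>G: "\<And>s. \<rho> s \<in> G" and \<rho>add: "\<And>s t x. x \<in> space M \<Longrightarrow> \<rho> s (\<rho> t x) = \<rho> (s + t) x"
    and \<rho>q: "\<And>s x. x \<in> space M \<Longrightarrow> q k (\<rho> s x) = q k x"
    and small: "\<And>s. pair_prob k (bad (\<rho> s)) \<le> e" and e: "e > 0" and C: "C > 0"
  shows "card {b \<in> q k ` space M. \<exists>s::nat. bad_density k b (\<rho> (int s)) > C * e} \<le> 2 / C * ncell k"
proof -
  define D where "D b s = bad_density k b (\<rho> (int s))" for b s
  define X where "X = {b \<in> q k ` space M. \<exists>s::nat. D b s > C * e}"
  have finX: "finite X" unfolding X_def using finite_q by simp
  define sb where "sb b = (SOME s. D b s > C * e)" for b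
  have sb: "D b (sb b) > C * e" if "b \<in> X" for b
    using that unfolding X_def sb_def by (auto intro: someI_ex)
  \<comment> \<open>A common bound for the chosen shifts; it controls the boundary terms of the
    averages over \<open>N\<close>, which vanish in the limit.\<close>
  define m where "m = Max (insert 0 (sb ` X))"
  have m: "sb b \<le> m" if "b \<in> X" for b unfolding m_def using that finX by (intro Max_ge) auto
  have D01: "0 \<le> D b s" "D b s \<le> 1" if "b \<in> X" for b s
    using that bad_density_nonneg bad_density_le_1 by (auto simp: D_def X_def)
  have per: "real N * (C * e) \<le> 2 * (\<Sum>v<N. D b v) + m" if b: "b \<in> X" for b and N :: nat
  proof -
    have "real N * (C * e) = (\<Sum>v<N. C * e)" by simp
    also have "\<dots> \<le> (\<Sum>v<N. D b v + D b (sb b + v))"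
    proof (rule sum_mono)
      fix v
      have "D b (sb b) \<le> D b v + D b (sb b + v)"
        using bad_density_triangle[OF \<rho>G \<rho>add \<rho>q, where b = b and s = "int (sb b)" and v = "int v"] by (simp add: D_def)
      then show "C * e \<le> D b v + D b (sb b + v)" using sb[OF b] by linarith
    qed
    also have "\<dots> = (\<Sum>v<N. D b v) + (\<Sum>v<N. D b (sb b + v))" by (rule sum.distrib)
    also have "(\<Sum>v<N. D b (sb b + v)) = (\<Sum>v=sb b..<N + sb b. D b v)"
      by (simp add: sum.shift_bounds_nat_ivl[of _ 0 "sb b" N, simplified] lessThan_atLeast0 add.commute)
    also have "\<dots> \<le> (\<Sum>v<N + sb b. D b v)" using D01[OF b] by (intro sum_mono2) auto
    also have "\<dots> = (\<Sum>v<N. D b v) + (\<Sum>v=N..<N + sb b. D b v)"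
      by (simp add: lessThan_atLeast0 sum.atLeastLessThan_concat)
    also have "(\<Sum>v=N..<N + sb b. D b v) \<le> (\<Sum>v=N..<N + sb b. 1)" using D01[OF b] by (intro sum_mono) auto
    also have "\<dots> \<le> m" using m[OF b] by simp
    finally show ?thesis by simp
  qed
  have tot: "real (card X) * (C * e) \<le> 2 * e * ncell k + real (card X) * m / real N" if N: "N > 0" for N :: nat
  proof -
    have "real N * (real (card X) * (C * e)) = (\<Sum>b\<in>X. real N * (C * e))" by simp
    also have "\<dots> \<le> (\<Sum>b\<in>X. 2 * (\<Sum>v<N. D b v) + m)" by (intro sum_mono per)
    also have "\<dots> = 2 * (\<Sum>v<N. \<Sum>b\<in>X. D b v) + real (card X) * m"
      by (simp add: sum.distrib sum_distrib_left sum.swap[of _ X])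
    also have "(\<Sum>v<N. \<Sum>b\<in>X. D b v) \<le> (\<Sum>v<N. ncell k * e)"
    proof (rule sum_mono)
      fix v
      have "(\<Sum>b\<in>X. D b v) \<le> (\<Sum>b\<in>q k ` space M. D b v)"
        by (intro sum_mono2 finite_q) (auto simp: X_def D_def bad_density_nonneg)
      also have "\<dots> = ncell k * pair_prob k (bad (\<rho> (int v)))" unfolding D_def by (rule bad_density_sum[OF \<rho>G])
      also have "\<dots> \<le> ncell k * e" using small by (intro mult_left_mono) auto
      finally show "(\<Sum>b\<in>X. D b v) \<le> ncell k * e" .
    qed
    finally have "real N * (real (card X) * (C * e)) \<le> 2 * (real N * (ncell k * e)) + real (card X) * m" by simp
    then show ?thesis using N by (simp add: field_simps)
  qed
  have "real (card X) * (C * e) \<le> 2 * e * ncell k"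
  proof (rule LIMSEQ_le_const)
    have "(\<lambda>N. 2 * e * ncell k + real (card X) * m * inverse (real (Suc N))) \<longlonglongrightarrow> 2 * e * ncell k + real (card X) * m * 0"
      by (intro tendsto_intros LIMSEQ_inverse_real_of_nat)
    then show "(\<lambda>N. 2 * e * ncell k + real (card X) * m * inverse (real (Suc N))) \<longlonglongrightarrow> 2 * e * ncell k" by simp
    show "\<exists>N. \<forall>n\<ge>N. real (card X) * (C * e) \<le> 2 * e * ncell k + real (card X) * m * inverse (real (Suc n))"
      using tot[of "Suc n" for n] by (auto simp: divide_inverse simp del: of_nat_Suc)
  qed
  then have "real (card X) * C \<le> 2 * ncell k" using e by (simp add: mult_ac)
  then show ?thesis using C unfolding X_def D_def by (simp add: field_simps)
qed

text \<open>By Fubini one element \<open>l s\<close> serves most of the ball for each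
  \<open>s\<close>. On \<open>B0\<close> all values of \<open>f\<close> have the stabiliser
  \<open>S0\<close>, so \<open>l s\<close> is determined modulo \<open>S0\<close>. Comparing
  \<open>l (Suc j)\<close> with \<open>u \<circ> l j\<close> at a common point yields inductively
  \<open>l j = (u ^^ j) \<circ> \<sigma>\<close> with \<open>\<sigma>\<close> in
  \<open>S0\<close>.\<close>

lemma cell_homomorphism:
  assumes \<rho>G: "\<And>s. \<rho> s \<in> G" and \<rho>add: "\<And>s t x. x \<in> space M \<Longrightarrow> \<rho> s (\<rho> t x) = \<rho> (s + t :: int) x"
    and \<rho>q: "\<And>s x. x \<in> space M \<Longrightarrow> q k (\<rho> s x) = q k x" and \<rho>0: "\<And>x. x \<in> space M \<Longrightarrow> \<rho> 0 x = x"
    and b: "b \<in> q k ` space M" and e: "0 < e" "e < 1 / 20"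
    and small: "\<And>s::nat. bad_density k b (\<rho> (int s)) \<le> e"
    and B0: "B0 \<in> sets M" and stab: "\<And>x. x \<in> B0 \<Longrightarrow> {l \<in> L. l (f x) = f x} = S0"
    and dens: "measure M (cell k b - B0) \<le> e * measure M (cell k b)"
  shows "\<exists>u\<in>L. \<forall>j::nat. (1 - 4 * e) * measure M (cell k b) \<le> measure M {x \<in> cell k b. f (\<rho> (int j) x) = (u ^^ j) (f x)}"
proof -
  let ?c = "cell k b" and ?N = "M \<Otimes>\<^sub>M M"
  define m where "m = measure M ?c"
  have m: "m = 1 / ncell k" "m > 0" using measure_cell[OF b] ncell_pos[of k] by (simp_all add: m_def)
  define H where "H l s = {x \<in> ?c \<inter> B0. l (f x) = f (\<rho> s x)}" for l s
  have csp: "?c \<subseteq> space M" by (auto simp: cell_def)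
  have H: "H l s \<in> sets M" if "l \<in> L" for l s
  proof -
    have "H l s = (?c \<inter> B0) \<inter> {x \<in> space M. l (f x) = f (\<rho> s x)}" using csp by (auto simp: H_def)
    then show ?thesis using hom_sets[OF \<rho>G that] B0 by auto
  qed
  have step: "\<exists>l\<in>L. (1 - 4 * e) * m \<le> measure M (H l (int s))" for s :: nat
  proof -
    define Q where "Q = ((?c \<inter> B0) \<times> (?c \<inter> B0)) \<inter> common (\<rho> (int s))"
    have Q: "Q \<in> sets ?N" unfolding Q_def using B0 common_sets[OF \<rho>G] by auto
    have sub: "?c \<times> ?c \<subseteq> Q \<union> (((?c - B0) \<times> ?c) \<union> (?c \<times> (?c - B0)) \<union> (bad (\<rho> (int s)) \<inter> (?c \<times> ?c)))"
      using csp by (auto simp: Q_def bad_def)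
    have bs: "bad (\<rho> (int s)) \<in> sets ?N" by (rule bad_sets[OF \<rho>G])
    have "m * m = measure ?N (?c \<times> ?c)" by (simp add: measure_Times m_def)
    also have "\<dots> \<le> measure ?N (Q \<union> (((?c - B0) \<times> ?c) \<union> (?c \<times> (?c - B0)) \<union> (bad (\<rho> (int s)) \<inter> (?c \<times> ?c))))"
      using sub by (rule PM.finite_measure_mono) (use Q B0 bs in auto)
    also have "\<dots> \<le> measure ?N Q + measure ?N (((?c - B0) \<times> ?c) \<union> (?c \<times> (?c - B0)) \<union> (bad (\<rho> (int s)) \<inter> (?c \<times> ?c)))"
      by (rule measure_Un_le) (use Q B0 bs in auto)
    also have "measure ?N (((?c - B0) \<times> ?c) \<union> (?c \<times> (?c - B0)) \<union> (bad (\<rho> (int s)) \<inter> (?c \<times> ?c))) \<le>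
        measure ?N (((?c - B0) \<times> ?c) \<union> (?c \<times> (?c - B0))) + measure ?N (bad (\<rho> (int s)) \<inter> (?c \<times> ?c))"
      by (rule measure_Un_le) (use B0 bs in auto)
    also have "measure ?N (((?c - B0) \<times> ?c) \<union> (?c \<times> (?c - B0))) \<le> measure ?N ((?c - B0) \<times> ?c) + measure ?N (?c \<times> (?c - B0))"
      by (rule measure_Un_le) (use B0 in auto)
    also have "measure ?N ((?c - B0) \<times> ?c) \<le> e * m * m"
      unfolding measure_Times[OF sets.Diff[OF cell_sets B0] cell_sets] m_def[symmetric]
      using dens m(2) by (intro mult_right_mono) (simp_all add: m_def)
    also have "measure ?N (?c \<times> (?c - B0)) \<le> m * (e * m)"
      unfolding measure_Times[OF cell_sets sets.Diff[OF cell_sets B0]] m_def[symmetric]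
      using dens m(2) by (intro mult_left_mono) (simp_all add: m_def)
    also have "measure ?N (bad (\<rho> (int s)) \<inter> (?c \<times> ?c)) \<le> e * m * m"
    proof -
      have "measure ?N (bad (\<rho> (int s)) \<inter> (?c \<times> ?c)) = bad_density k b (\<rho> (int s)) * (m * m)"
        using ncell_pos[of k] by (simp add: bad_density_def m power2_eq_square)
      also have "\<dots> \<le> e * (m * m)" using small[of s] m by (intro mult_right_mono) auto
      finally show ?thesis by (simp add: mult_ac)
    qed
    finally have Qm: "(1 - 3 * e) * (m * m) \<le> measure ?N Q" by (simp add: algebra_simps)
    \<comment> \<open>Of the loss \<open>3 * e\<close> in the product, two parts come from leaving
      \<open>B0\<close> and one from bad pairs. Allowing \<open>4 * e\<close> in a section makes the
      contradiction strict.\<close>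
    have "\<exists>x\<in>?c. (1 - 4 * e) * m \<le> measure M (Pair x -` Q)"
    proof (rule ccontr)
      assume "\<not> ?thesis"
      then have lt: "measure M (Pair x -` Q) \<le> (1 - 4 * e) * m" if "x \<in> ?c" for x using that by force
      have c0: "0 \<le> (1 - 4 * e) * m" using e m by simp
      have "emeasure ?N Q = (\<integral>\<^sup>+x. emeasure M (Pair x -` Q) \<partial>M)"
        by (rule emeasure_pair_measure_alt[OF Q])
      also have "\<dots> \<le> (\<integral>\<^sup>+x. ennreal ((1 - 4 * e) * m) * indicator ?c x \<partial>M)"
      proof (rule nn_integral_mono)
        fix x assume "x \<in> space M"
        show "emeasure M (Pair x -` Q) \<le> ennreal ((1 - 4 * e) * m) * indicator ?c x"
        proof (cases "x \<in> ?c")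
          case True
          then show ?thesis using lt[OF True] c0 by (simp add: emeasure_eq_measure ennreal_leI)
        next
          case False
          then have "Pair x -` Q = {}" by (auto simp: Q_def)
          then show ?thesis by simp
        qed
      qed
      also have "\<dots> = ennreal ((1 - 4 * e) * m) * emeasure M ?c" by (simp add: nn_integral_cmult_indicator)
      also have "\<dots> = ennreal ((1 - 4 * e) * m * m)" using c0 m(2) by (simp add: emeasure_eq_measure m_def[symmetric] ennreal_mult'')
      finally have "measure ?N Q \<le> (1 - 4 * e) * m * m" using c0 m(2) by (simp add: PM.emeasure_eq_measure)
      then have "(1 - 3 * e) * (m * m) \<le> (1 - 4 * e) * (m * m)" using Qm by (simp add: mult_ac)
      then have "1 - 3 * e \<le> 1 - 4 * e" using mult_pos_pos[OF m(2) m(2)] by (simp only: mult_le_cancel_right_pos)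
      then show False using e by simp
    qed
    then obtain x where x: "x \<in> ?c" "(1 - 4 * e) * m \<le> measure M (Pair x -` Q)" by blast
    have "(1 - 4 * e) * m > 0" using e m by simp
    then have "Pair x -` Q \<noteq> {}" using x by (metis measure_empty not_le)
    then have xB: "x \<in> B0" by (auto simp: Q_def)
    obtain l where l: "l \<in> L" "l (f x) = f (\<rho> (int s) x)" using hom[OF \<rho>G] x csp by blast
    have "Pair x -` Q \<subseteq> H l (int s)"
    proof
      fix y assume "y \<in> Pair x -` Q"
      then obtain l' where y: "y \<in> ?c" "y \<in> B0" and l': "l' \<in> L" "l' (f x) = f (\<rho> (int s) x)" "l' (f y) = f (\<rho> (int s) y)"
        by (auto simp: Q_def common_def split: if_splits)
      \<comment> \<open>The element \<open>l'\<close> may depend on \<open>y\<close>, but it differs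
        from \<open>l\<close> by a stabiliser of \<open>f x\<close>, and \<open>f y\<close> has the
        same stabiliser.\<close>
      have "(ginv l' \<circ> l) (f x) = f x" using l l' inv_l(1)[OF l'(1), of "f x"] by simp
      then have "ginv l' \<circ> l \<in> {l \<in> L. l (f x) = f x}" using l l' by (auto intro!: L_comp L_inv)
      then have "ginv l' \<circ> l \<in> {l \<in> L. l (f y) = f y}" using stab[OF xB] stab[OF y(2)] by simp
      then have "ginv l' (l (f y)) = f y" by simp
      then have "l (f y) = l' (f y)" using inv_l(2)[OF l'(1), of "l (f y)"] by simp
      then show "y \<in> H l (int s)" using y l' by (simp add: H_def)
    qed
    then have "measure M (Pair x -` Q) \<le> measure M (H l (int s))" by (rule finite_measure_mono[OF _ H[OF l(1)]])
    then show ?thesis using x l by (intro bexI[of _ l]) auto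
  qed
  then obtain l where l: "\<And>s. l s \<in> L" "\<And>s::nat. (1 - 4 * e) * m \<le> measure M (H (l s) (int s))" by metis
  define u where "u = l 1"
  have u: "u \<in> L" by (simp add: u_def l)
  have uj: "u ^^ j \<in> L" for j
  proof (induction j)
    case 0
    show ?case unfolding funpow.simps(1) by (rule L_id)
  next
    case (Suc j)
    then show ?case unfolding funpow.simps(2) by (rule L_comp[OF u])
  qed
  have S0_comp: "s \<circ> t \<in> S0" if "x \<in> B0" "s \<in> S0" "t \<in> S0" for x s t
    using that stab[OF that(1), symmetric] by (auto intro: L_comp)
  have pos: "(1 - 12 * e) * m > 0" using e m by simp
  have claim: "\<exists>\<sigma>\<in>S0. l j = (u ^^ j) \<circ> \<sigma>" for j
  proof (induction j)
    case 0
    have "H (l 0) 0 \<noteq> {}"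
    proof
      assume "H (l 0) 0 = {}"
      then have "(1 - 4 * e) * m \<le> 0" using l(2)[of 0] by simp
      then show False using mult_pos_pos[of "1 - 4 * e" m] e m(2) by linarith
    qed
    then obtain x where "x \<in> ?c" "x \<in> B0" "l 0 (f x) = f (\<rho> 0 x)" by (auto simp: H_def)
    then have "l 0 \<in> {l \<in> L. l (f x) = f x}" using csp l by (auto simp: \<rho>0)
    then have "l 0 \<in> S0" using stab \<open>x \<in> B0\<close> by auto
    then show ?case by (intro bexI[of _ "l 0"]) auto
  next
    case (Suc j)
    then obtain \<sigma> where \<sigma>: "\<sigma> \<in> S0" "l j = (u ^^ j) \<circ> \<sigma>" by blast
    \<comment> \<open>The points that \<open>j\<close> steps bring to where \<open>u\<close> makes
      the next step. This is one of three sets missing at most \<open>4 * e\<close> of the ball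
      each; they meet because \<open>12 * e < 1\<close>.\<close>
    let ?V = "\<rho> (int j) -` H u 1 \<inter> space M"
    have V: "?V \<in> sets M" using measurable_sets[OF G_meas[OF \<rho>G] H[OF u]] .
    have Vm: "measure M ?V = measure M (H u 1)"
      using measure_distr[OF G_meas[OF \<rho>G] H[OF u], of "int j"] by (simp add: G_distr[OF \<rho>G])
    have Vc: "?V \<subseteq> ?c" using \<rho>q by (auto simp: H_def cell_def)
    have Hc: "H a s \<subseteq> ?c" for a s by (auto simp: H_def)
    have cm: "measure M (?c - A) \<le> 4 * e * m" if "A \<in> sets M" "A \<subseteq> ?c" "(1 - 4 * e) * m \<le> measure M A" for A
      using that finite_measure_Diff[of ?c A] by (simp add: m_def[symmetric] algebra_simps)
    have "?c - (H (l j) (int j) \<inter> H (l (Suc j)) (int (Suc j)) \<inter> ?V) \<subseteq> ((?c - H (l j) (int j)) \<union> (?c - H (l (Suc j)) (int (Suc j)))) \<union> (?c - ?V)" by blast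
    then have "measure M (?c - (H (l j) (int j) \<inter> H (l (Suc j)) (int (Suc j)) \<inter> ?V)) \<le> measure M (((?c - H (l j) (int j)) \<union> (?c - H (l (Suc j)) (int (Suc j)))) \<union> (?c - ?V))"
      by (rule finite_measure_mono) (use H[OF l(1)] V in auto)
    also have "\<dots> \<le> measure M ((?c - H (l j) (int j)) \<union> (?c - H (l (Suc j)) (int (Suc j)))) + measure M (?c - ?V)"
      by (rule measure_Un_le) (use H[OF l(1)] V in auto)
    also have "measure M ((?c - H (l j) (int j)) \<union> (?c - H (l (Suc j)) (int (Suc j)))) \<le> measure M (?c - H (l j) (int j)) + measure M (?c - H (l (Suc j)) (int (Suc j)))"
      by (rule measure_Un_le) (use H[OF l(1)] V in auto)
    also have "measure M (?c - H (l j) (int j)) \<le> 4 * e * m" by (rule cm[OF H[OF l(1)] Hc l(2)])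
    also have "measure M (?c - H (l (Suc j)) (int (Suc j))) \<le> 4 * e * m" by (rule cm[OF H[OF l(1)] Hc l(2)])
    also have "measure M (?c - ?V) \<le> 4 * e * m" using l(2)[of 1] by (intro cm[OF V Vc]) (simp only: Vm, simp add: u_def)
    finally have le: "measure M (?c - (H (l j) (int j) \<inter> H (l (Suc j)) (int (Suc j)) \<inter> ?V)) \<le> 12 * e * m" by simp
    have "H (l j) (int j) \<inter> H (l (Suc j)) (int (Suc j)) \<inter> ?V \<noteq> {}"
    proof
      assume "H (l j) (int j) \<inter> H (l (Suc j)) (int (Suc j)) \<inter> ?V = {}"
      then have "m \<le> 12 * e * m" using le by (simp add: m_def)
      then show False using pos by (simp add: algebra_simps)
    qed
    then obtain x where x: "x \<in> H (l j) (int j)" "x \<in> H (l (Suc j)) (int (Suc j))" "\<rho> (int j) x \<in> H u 1" "x \<in> space M" by blast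
    have xB: "x \<in> B0" using x by (simp add: H_def)
    have "f (\<rho> (int (Suc j)) x) = f (\<rho> 1 (\<rho> (int j) x))" using x(4) by (simp add: \<rho>add)
    also have "\<dots> = u (l j (f x))" using x by (simp add: H_def)
    finally have eq: "l (Suc j) (f x) = u (l j (f x))" using x by (simp add: H_def)
    define t where "t = ginv (u \<circ> l j) \<circ> l (Suc j)"
    have ul: "u \<circ> l j \<in> L" using u l by (intro L_comp)
    have "t (f x) = f x" unfolding t_def using eq inv_l(1)[OF ul, of "f x"] by simp
    moreover have "t \<in> L" unfolding t_def by (rule L_comp[OF L_inv[OF ul] l(1)])
    ultimately have t: "t \<in> S0" using stab[OF xB] by auto
    have "l (Suc j) = u \<circ> l j \<circ> t" unfolding t_def using inv_l(2)[OF ul] by (auto simp: fun_eq_iff)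
    then have "l (Suc j) = (u ^^ Suc j) \<circ> (\<sigma> \<circ> t)" by (simp add: \<sigma>(2) o_assoc)
    then show ?case using S0_comp[OF xB \<sigma>(1) t] by blast
  qed
  show ?thesis
  proof (rule bexI[OF _ u], rule allI)
    fix j
    obtain \<sigma> where \<sigma>: "\<sigma> \<in> S0" "l j = (u ^^ j) \<circ> \<sigma>" using claim by blast
    have "H (l j) (int j) \<subseteq> {x \<in> ?c. f (\<rho> (int j) x) = (u ^^ j) (f x)}"
    proof
      fix x assume x: "x \<in> H (l j) (int j)"
      then have "\<sigma> (f x) = f x" using \<sigma>(1) stab[of x] by (auto simp: H_def)
      then show "x \<in> {x \<in> ?c. f (\<rho> (int j) x) = (u ^^ j) (f x)}" using x \<sigma>(2) by (auto simp: H_def)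
    qed
    moreover have "{x \<in> ?c. f (\<rho> (int j) x) = (u ^^ j) (f x)} = ?c \<inter> {x \<in> space M. (u ^^ j) (f x) = f (\<rho> (int j) x)}"
      using csp by auto
    ultimately have "measure M (H (l j) (int j)) \<le> measure M {x \<in> ?c. f (\<rho> (int j) x) = (u ^^ j) (f x)}"
      using hom_sets[OF \<rho>G uj, of j "int j"] by (intro finite_measure_mono) auto
    then show "(1 - 4 * e) * measure M ?c \<le> measure M {x \<in> ?c. f (\<rho> (int j) x) = (u ^^ j) (f x)}"
      using l(2)[of j] by (simp add: m_def)
  qed
qed

text \<open>The ball must lie mostly in \<open>B0\<close>, and for each direction \<open>i\<close>
  its failure density must be small for all multiples at once. As a proportion of all balls, at
  least 5/8 of the measure of \<open>B0\<close> meet the first demand, while at most 1/4 of that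
  measure violate the second.\<close>

lemma good_cell_exists:
  assumes e: "0 < e" "e < 1 / 20" and I2: "\<And>i. i \<in> I \<Longrightarrow> \<exists>j\<in>I. j \<noteq> i" and Ine: "I \<noteq> {}"
    and Sh: "\<And>i j c. i \<in> I \<Longrightarrow> j \<in> I \<Longrightarrow> i \<noteq> j \<Longrightarrow> Sh i j c \<in> G"
      "\<And>i j c t x. i \<in> I \<Longrightarrow> j \<in> I \<Longrightarrow> i \<noteq> j \<Longrightarrow> x \<in> space M \<Longrightarrow>
         Sh i j c (T t x) = T (t(i := t i + c * t j)) (Sh i j c x)"
    and B0: "B0 \<in> sets M" "measure M B0 > 0" and stab: "\<And>x. x \<in> B0 \<Longrightarrow> {l \<in> L. l (f x) = f x} = S0"
  obtains k b where "b \<in> q k ` space M"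
    "\<And>i. i \<in> I \<Longrightarrow> \<exists>u\<in>L. \<forall>j::nat. (1 - 4 * e) * measure M (cell k b) \<le>
        measure M {x \<in> cell k b. f (T ((\<lambda>_. 0)(i := int j * int p ^ k)) x) = (u ^^ j) (f x)}"
proof -
  define \<beta> where "\<beta> = measure M B0"
  define n where "n = real (card I)"
  have n: "n \<ge> 1" using Ine finite_I by (simp add: n_def Suc_le_eq card_gt_0_iff)
  \<comment> \<open>Each of the \<open>card I\<close> directions can spoil a proportion
    \<open>2 / C\<close> of the balls, in total \<open>\<beta> / 4\<close>. The threshold for the
    density then becomes \<open>C * e' = e\<close>.\<close>
  define C where "C = 8 * n / \<beta>"
  have \<beta>: "0 < \<beta>" using B0 by (simp add: \<beta>_def)
  have C: "C > 0" using \<beta> n by (simp add: C_def)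
  define e' where "e' = e / C"
  have e': "e' > 0" "C * e' = e" using e C by (simp_all add: e'_def)
  show ?thesis
  proof (rule translation_bad_small[OF e'(1)])
  fix \<delta> :: real
  assume \<delta>: "\<delta> > 0" and RT: "\<And>k \<tau> S1 S2 v. (\<And>v. \<tau> v \<in> G) \<Longrightarrow> (\<And>v w x. x \<in> space M \<Longrightarrow> \<tau> v (\<tau> w x) = \<tau> (v + w) x) \<Longrightarrow>
      (\<And>x. x \<in> space M \<Longrightarrow> \<tau> 0 x = x) \<Longrightarrow> (\<And>c. S1 c \<in> G) \<Longrightarrow> (\<And>c. S2 c \<in> G) \<Longrightarrow>
      (\<And>c v x. x \<in> space M \<Longrightarrow> S1 c (\<tau> v x) = \<tau> (shear1 c v) (S1 c x)) \<Longrightarrow>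
      (\<And>c v x. x \<in> space M \<Longrightarrow> S2 c (\<tau> v x) = \<tau> (shear2 c v) (S2 c x)) \<Longrightarrow>
      pair_prob k (bad (\<tau> (1, 0))) \<le> \<delta> \<Longrightarrow> pair_prob k (bad (\<tau> (0, 1))) \<le> \<delta> \<Longrightarrow>
      (\<And>c. c \<in> {4, -4} \<Longrightarrow> pair_prob k (bad (S1 c)) \<le> \<delta> \<and> pair_prob k (bad (S2 c)) \<le> \<delta>) \<Longrightarrow>
      pair_prob k (bad (\<tau> v)) \<le> e'"
  \<comment> \<open>A second coordinate, which makes direction \<open>i\<close> the first axis of a
    plane carrying both shears.\<close>
  define par where "par i = (SOME j. j \<in> I \<and> j \<noteq> i)" for i
  have par: "par i \<in> I" "par i \<noteq> i" if "i \<in> I" for i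
    using someI_ex[of "\<lambda>j. j \<in> I \<and> j \<noteq> i"] I2[OF that] unfolding par_def by auto
  define \<tau> where "\<tau> i v = T ((\<lambda>_. 0)(i := fst v, par i := snd v))" for i and v :: "int \<times> int"
  define X where "X = (\<Union>i\<in>I. {\<tau> i (1, 0), \<tau> i (0, 1), Sh (par i) i 4, Sh (par i) i (-4), Sh i (par i) 4, Sh i (par i) (-4)})"
  have X: "finite X" "X \<subseteq> G"
    using finite_I T_G Sh(1) par par(2)[THEN not_sym] by (auto simp: X_def \<tau>_def)
  have "\<forall>g\<in>X. \<exists>k0. \<forall>k\<ge>k0. pair_prob k (bad g) \<le> \<delta>" using bad_small \<delta> X by blast
  then obtain kk where kk: "\<And>g k. g \<in> X \<Longrightarrow> k \<ge> kk g \<Longrightarrow> pair_prob k (bad g) \<le> \<delta>" by metis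
  define \<eta> where "\<eta> = e * \<beta> / 8"
  have \<eta>: "\<eta> > 0" using e \<beta> by (simp add: \<eta>_def)
  obtain E k0 where E: "E \<in> sets M" "measure M E \<le> \<eta>"
    "\<And>k x y. k \<ge> k0 \<Longrightarrow> x \<in> space M - E \<Longrightarrow> y \<in> space M - E \<Longrightarrow> q k x = q k y \<Longrightarrow> x \<in> B0 \<longleftrightarrow> y \<in> B0"
    using approx_set[OF B0(1) \<eta>] by metis
  \<comment> \<open>At this level the generators of all planes are good simultaneously, and
    \<open>B0\<close> is nearly a union of balls.\<close>
  define k where "k = Max (insert k0 (kk ` X))"
  have k0: "k0 \<le> k" unfolding k_def using X by (intro Max_ge) auto
  have kX: "pair_prob k (bad g) \<le> \<delta>" if "g \<in> X" for g
    using that X by (intro kk) (auto simp: k_def)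
  let ?Q = "q k ` space M"
  define N where "N = real (ncell k)"
  have N: "N > 0" "real (card ?Q) = N" using ncell_pos[of k] by (simp_all add: N_def ncell_def)
  have \<tau>small: "pair_prob k (bad (\<tau> i v)) \<le> e'" if i: "i \<in> I" for i v
  proof (rule RT[of "\<tau> i" "Sh (par i) i" "Sh i (par i)" k v])
    note pi = par[OF i]
    show "\<tau> i v \<in> G" for v by (simp add: \<tau>_def T_G)
    show "Sh (par i) i c \<in> G" "Sh i (par i) c \<in> G" for c using Sh(1) i pi by auto
    show "\<tau> i v (\<tau> i w x) = \<tau> i (v + w) x" if "x \<in> space M" for v w x
      unfolding \<tau>_def T_add[OF that] by (rule arg_cong[of _ _ "\<lambda>t. T t x"]) auto
    show "\<tau> i 0 x = x" if "x \<in> space M" for x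
    proof -
      have "(\<lambda>_. 0)(i := fst (0 :: int \<times> int), par i := snd (0 :: int \<times> int)) = (\<lambda>_. 0)" by auto
      then show ?thesis unfolding \<tau>_def using T_zero[OF that] by simp
    qed
    show "Sh (par i) i c (\<tau> i v x) = \<tau> i (shear1 c v) (Sh (par i) i c x)" if "x \<in> space M" for c v x
      unfolding \<tau>_def Sh(2)[OF pi(1) i pi(2) that]
      by (rule arg_cong[of _ _ "\<lambda>t. T t _"]) (use pi in \<open>auto simp: shear1_def fun_eq_iff\<close>)
    show "Sh i (par i) c (\<tau> i v x) = \<tau> i (shear2 c v) (Sh i (par i) c x)" if "x \<in> space M" for c v x
      unfolding \<tau>_def Sh(2)[OF i pi(1) pi(2)[symmetric] that]
      by (rule arg_cong[of _ _ "\<lambda>t. T t _"]) (use pi in \<open>auto simp: shear2_def fun_eq_iff\<close>)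
    show "pair_prob k (bad (\<tau> i (1, 0))) \<le> \<delta>" "pair_prob k (bad (\<tau> i (0, 1))) \<le> \<delta>" using i by (auto intro!: kX simp: X_def)
    show "pair_prob k (bad (Sh (par i) i c)) \<le> \<delta> \<and> pair_prob k (bad (Sh i (par i) c)) \<le> \<delta>" if "c \<in> {4, -4}" for c
      using that i by (auto intro!: kX simp: X_def)
  qed
  \<comment> \<open>Multiples of \<open>p ^ k\<close> preserve every ball of level \<open>k\<close>.
    They are particular vectors of the plane, so the bound that is uniform on the plane covers all
    of them.\<close>
  define \<rho> where "\<rho> i s = T ((\<lambda>_. 0)(i := s * int p ^ k))" for i and s :: int
  have \<rho>\<tau>: "\<rho> i s = \<tau> i (s * int p ^ k, 0)" if "i \<in> I" for i s
    unfolding \<rho>_def \<tau>_def using par[OF that] by (intro arg_cong[of _ _ T]) auto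
  have \<rho>G: "\<rho> i s \<in> G" for i s by (simp add: \<rho>_def T_G)
  have \<rho>add: "\<rho> i s (\<rho> i t x) = \<rho> i (s + t) x" if "x \<in> space M" for i s t x
    unfolding \<rho>_def T_add[OF that] by (rule arg_cong[of _ _ "\<lambda>t. T t x"]) (auto simp: algebra_simps)
  have \<rho>q: "q k (\<rho> i s x) = q k x" if "x \<in> space M" for i s x
    unfolding \<rho>_def T_fix[OF that] by auto
  have \<rho>0: "\<rho> i 0 x = x" if "x \<in> space M" for i x
  proof -
    have "(\<lambda>_. 0)(i := 0 * int p ^ k) = (\<lambda>_. 0)" by auto
    then show ?thesis unfolding \<rho>_def using T_zero[OF that] by simp
  qed
  define Y where "Y i = {b \<in> ?Q. \<exists>s::nat. bad_density k b (\<rho> i (int s)) > C * e'}" for i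
  have Y: "real (card (Y i)) \<le> 2 / C * N" if "i \<in> I" for i
    unfolding Y_def N_def
    by (rule card_bad_cells[OF \<rho>G \<rho>add \<rho>q _ e'(1) C]) (simp_all add: \<rho>\<tau>[OF that] \<tau>small[OF that])
  have "real (card (\<Union>i\<in>I. Y i)) \<le> (\<Sum>i\<in>I. real (card (Y i)))"
    using card_UN_le[OF finite_I, of Y] by (simp flip: of_nat_sum)
  also have "\<dots> \<le> (\<Sum>i\<in>I. 2 / C * N)" by (intro sum_mono Y)
  also have "\<dots> = \<beta> / 4 * N" using n \<beta> by (simp add: n_def[symmetric] C_def)
  finally have cY: "real (card (\<Union>i\<in>I. Y i)) \<le> \<beta> / 4 * N" .
  define Z where "Z = {b \<in> ?Q. measure M (E \<inter> cell k b) > e / N}"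
  \<comment> \<open>A ball with a small share of \<open>E\<close> and a point of \<open>B0\<close>
    outside \<open>E\<close> lies in \<open>B0\<close> up to \<open>E\<close>.\<close>
  define W where "W = {b \<in> ?Q - Z. \<exists>y\<in>cell k b - E. y \<in> B0}"
  have fin: "finite Z" "finite W" using finite_q by (auto simp: Z_def W_def)
  have cZ: "real (card Z) \<le> \<beta> / 8 * N"
  proof -
    have "real (card Z) * (e / N) = (\<Sum>b\<in>Z. e / N)" by simp
    also have "\<dots> \<le> (\<Sum>b\<in>Z. measure M (E \<inter> cell k b))" by (intro sum_mono) (auto simp: Z_def)
    also have "\<dots> \<le> (\<Sum>b\<in>?Q. measure M (E \<inter> cell k b))" by (intro sum_mono2 finite_q) (auto simp: Z_def)
    also have "\<dots> = measure M E" by (rule sum_cells[OF E(1)])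
    also have "\<dots> \<le> e * \<beta> / 8" using E(2) by (simp add: \<eta>_def)
    finally have "e * (real (card Z) / N) \<le> e * (\<beta> / 8)" by (simp add: mult_ac)
    then have "real (card Z) / N \<le> \<beta> / 8" using e by (simp only: mult_le_cancel_left_pos)
    then show ?thesis using N by (simp add: field_simps)
  qed
  have cW: "5 / 8 * \<beta> * N \<le> real (card W)"
  proof -
    have "\<beta> = (\<Sum>b\<in>?Q. measure M (B0 \<inter> cell k b))" unfolding \<beta>_def by (rule sum_cells[OF B0(1), symmetric])
    also have "\<dots> \<le> (\<Sum>b\<in>?Q. (if b \<in> W then 1 / N else 0) + (if b \<in> Z then 1 / N else 0) + measure M (E \<inter> cell k b))"
    proof (rule sum_mono)
      fix b assume b: "b \<in> ?Q"
      have cb: "measure M (B0 \<inter> cell k b) \<le> 1 / N"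
        using finite_measure_mono[of "B0 \<inter> cell k b" "cell k b"] measure_cell[OF b] by (simp add: N_def)
      show "measure M (B0 \<inter> cell k b) \<le> (if b \<in> W then 1 / N else 0) + (if b \<in> Z then 1 / N else 0) + measure M (E \<inter> cell k b)"
      proof (cases "b \<in> W \<or> b \<in> Z")
        case True
        have "0 \<le> measure M (E \<inter> cell k b)" "0 \<le> 1 / N" using N by simp_all
        then show ?thesis using True cb by (cases "b \<in> W"; cases "b \<in> Z"; simp only: if_True if_False simp_thms; linarith)
      next
        case False
        then have "B0 \<inter> cell k b \<subseteq> E \<inter> cell k b" using b by (auto simp: W_def)
        then have "measure M (B0 \<inter> cell k b) \<le> measure M (E \<inter> cell k b)"
          using E(1) by (intro finite_measure_mono) auto
        then show ?thesis using False by simp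
      qed
    qed
    also have "\<dots> = real (card W) / N + real (card Z) / N + measure M E"
    proof -
      have "?Q \<inter> {b. b \<in> W} = W" "?Q \<inter> {b. b \<in> Z} = Z" by (auto simp: W_def Z_def)
      then show ?thesis using finite_q[of k]
        by (simp add: sum.distrib sum_cells[OF E(1)] sum.If_cases)
    qed
    also have "measure M E \<le> \<beta> / 8"
    proof -
      have "e * \<beta> \<le> 1 * \<beta>" using e \<beta> by (intro mult_right_mono) auto
      then show ?thesis using E(2) by (simp add: \<eta>_def)
    qed
    also have "real (card Z) / N \<le> \<beta> / 8" using cZ N by (simp add: field_simps)
    finally have "5 / 8 * \<beta> \<le> real (card W) / N" using \<beta> by linarith
    then show ?thesis using N by (simp add: field_simps)
  qed
  have "\<not> W \<subseteq> (\<Union>i\<in>I. Y i)"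
  proof
    assume "W \<subseteq> (\<Union>i\<in>I. Y i)"
    moreover have "finite (\<Union>i\<in>I. Y i)" using finite_I finite_q by (auto simp: Y_def)
    ultimately have "real (card W) \<le> real (card (\<Union>i\<in>I. Y i))" by (simp add: card_mono)
    then have "5 / 8 * (\<beta> * N) \<le> 1 / 4 * (\<beta> * N)" using cW cY by linarith
    moreover have "\<beta> * N > 0" using \<beta> N by simp
    ultimately show False by linarith
  qed
  then obtain b where b: "b \<in> W" "\<And>i. i \<in> I \<Longrightarrow> b \<notin> Y i" by blast
  have bQ: "b \<in> ?Q" using b by (simp add: W_def)
  obtain y where y: "y \<in> cell k b" "y \<notin> E" "y \<in> B0" using b by (auto simp: W_def)
  have "cell k b - B0 \<subseteq> E \<inter> cell k b"
  proof
    fix x assume x: "x \<in> cell k b - B0"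
    then show "x \<in> E \<inter> cell k b" using E(3)[OF k0, of x y] y by (auto simp: cell_def)
  qed
  then have "measure M (cell k b - B0) \<le> measure M (E \<inter> cell k b)" using E(1) by (intro finite_measure_mono) auto
  also have "\<dots> \<le> e / N" using b by (auto simp: W_def Z_def not_less)
  also have "\<dots> = e * measure M (cell k b)" by (simp add: measure_cell[OF bQ] N_def)
  finally have dens: "measure M (cell k b - B0) \<le> e * measure M (cell k b)" .
  show ?thesis
  proof (rule that[OF bQ])
    fix i assume i: "i \<in> I"
    have small: "bad_density k b (\<rho> i (int s)) \<le> e" for s using b(2)[OF i] bQ e'(2) by (auto simp: Y_def not_less)
    show "\<exists>u\<in>L. \<forall>j::nat. (1 - 4 * e) * measure M (cell k b) \<le>
        measure M {x \<in> cell k b. f (T ((\<lambda>_. 0)(i := int j * int p ^ k)) x) = (u ^^ j) (f x)}"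
      using cell_homomorphism[OF \<rho>G \<rho>add \<rho>q \<rho>0 bQ e small B0(1) stab dens] unfolding \<rho>_def .
  qed
  qed
qed

end

section \<open>Fibres of positive measure\<close>

context odometer begin

definition scaled :: "nat \<Rightarrow> nat \<Rightarrow> ('d \<Rightarrow> nat) \<Rightarrow> 'x \<Rightarrow> 'x" where
  "scaled k m t = T (\<lambda>i. if i \<in> I then int (t i * m) * int p ^ k else 0)"

text \<open>Coordinate differences multiplied by \<open>m\<close> are less than
  \<open>p ^ (K - k)\<close> in absolute value, so divisibility by this power leaves only 0.
  Distinct vectors therefore send a point to distinct balls of level \<open>K\<close>.\<close>

lemma scaled_cell_inj:
  assumes x: "x \<in> space M" and m: "m > 0" "m \<le> p ^ a" and K: "k + a \<le> K"
    and t: "t \<in> I \<rightarrow>\<^sub>E {..<p ^ (K - k - a)}" "t' \<in> I \<rightarrow>\<^sub>E {..<p ^ (K - k - a)}"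
    and eq: "q K (scaled k m t x) = q K (scaled k m t' x)"
  shows "t = t'"
proof (rule PiE_ext[OF t])
  fix i assume i: "i \<in> I"
  let ?s = "\<lambda>i. (if i \<in> I then int (t i * m) * int p ^ k else 0)"
  let ?s' = "\<lambda>i. (if i \<in> I then int (t' i * m) * int p ^ k else 0)"
  have "T ?s x = T (\<lambda>i. ?s i - ?s' i) (T ?s' x)"
    using T_add[OF x, of "\<lambda>i. ?s i - ?s' i" ?s'] by simp
  then have "q K (T (\<lambda>i. ?s i - ?s' i) (T ?s' x)) = q K (T ?s' x)" using eq by (simp add: scaled_def)
  then have "int p ^ K dvd ?s i - ?s' i" using iffD1[OF T_fix[OF T_space[OF x]], THEN bspec, OF _ i] by fast
  then have "int p ^ K dvd int p ^ k * ((int (t i) - int (t' i)) * int m)" using i by (simp add: algebra_simps)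
  moreover have "int p ^ K = int p ^ k * int p ^ (K - k)" using K by (simp flip: power_add)
  ultimately have d: "int p ^ (K - k) dvd (int (t i) - int (t' i)) * int m" using p_gt_1 by simp
  have lt: "\<bar>int (t i) - int (t' i)\<bar> < int p ^ (K - k - a)"
  proof -
    have "t i < p ^ (K - k - a)" "t' i < p ^ (K - k - a)" using t i by auto
    then have "int (t i) < int p ^ (K - k - a)" "int (t' i) < int p ^ (K - k - a)" by (simp_all flip: of_nat_power)
    then show ?thesis by linarith
  qed
  have "\<bar>(int (t i) - int (t' i)) * int m\<bar> < int p ^ (K - k)"
  proof -
    have "\<bar>(int (t i) - int (t' i)) * int m\<bar> < int p ^ (K - k - a) * int m" using lt m by (simp add: abs_mult)
    also have "\<dots> \<le> int p ^ (K - k - a) * int p ^ a" using m by (intro mult_left_mono) (simp_all flip: of_nat_power)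
    also have "\<dots> = int p ^ (K - k)" using K by (simp flip: power_add)
    finally show ?thesis .
  qed
  then have "(int (t i) - int (t' i)) * int m = 0" using dvd_imp_le_int[OF _ d] p_gt_1 by (auto simp: abs_mult)
  then show "t i = t' i" using m by simp
qed

text \<open>The values of \<open>f\<close> are replaced by their codes with respect to the first
  \<open>n\<close> separating sets. A point and its translates often share a code, and the
  translates visit a fixed proportion of the small balls, each at most once. Hence two independent
  points share a code with probability bounded below independently of \<open>n\<close>. In the limit
  equal codes mean equal values.\<close>

lemma atom_exists:
  fixes f :: "'x \<Rightarrow> 'y" and Os :: "nat \<Rightarrow> 'y set"
  assumes Os: "\<And>n. {x \<in> space M. f x \<in> Os n} \<in> sets M"
    and sep: "\<And>x y. x \<in> space M \<Longrightarrow> y \<in> space M \<Longrightarrow> f x \<noteq> f y \<Longrightarrow> \<exists>n. (f x \<in> Os n) \<noteq> (f y \<in> Os n)"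
    and b: "b \<in> q k ` space M" and m: "m > 0"
    and half: "\<And>t. \<exists>A\<in>sets M. A \<subseteq> {x \<in> cell k b. f (scaled k m t x) = f x} \<and> measure M (cell k b) / 2 \<le> measure M A"
  shows "\<exists>x0\<in>space M. measure M {x \<in> space M. f x = f x0} > 0"
proof -
  define cd where "cd n x = {i. i < n \<and> f x \<in> Os i}" for n x
  define Bc where "Bc n P = {x \<in> space M. cd n x = P}" for n P
  have Bc: "Bc n P \<in> sets M" for n P
  proof -
    have one: "{x \<in> space M. (f x \<in> Os i) = (i \<in> P)} \<in> sets M" for i
    proof (cases "i \<in> P")
      case False
      then have "{x \<in> space M. (f x \<in> Os i) = (i \<in> P)} = space M - {x \<in> space M. f x \<in> Os i}" by auto
      then show ?thesis using Os[of i] by auto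
    qed (use Os in simp)
    have "Bc n P = (if P \<subseteq> {..<n} then {x \<in> space M. \<forall>i\<in>{..<n}. (f x \<in> Os i) = (i \<in> P)} else {})"
      by (auto simp: Bc_def cd_def)
    also have "\<dots> \<in> sets M" using sets.sets_Collect_finite_All[OF one, of "{..<n}"] by simp
    finally show ?thesis .
  qed
  define J where "J n = Pow {..<n::nat}" for n
  have finJ: "finite (J n)" for n by (simp add: J_def)
  have cdJ: "cd n x \<in> J n" for n x by (auto simp: cd_def J_def)
  define S where "S n = (\<Union>P\<in>J n. Bc n P \<times> Bc n P)" for n
  have S: "S n \<in> sets (M \<Otimes>\<^sub>M M)" for n unfolding S_def using finJ Bc by auto
  have Siff: "z \<in> S n \<longleftrightarrow> z \<in> space M \<times> space M \<and> cd n (fst z) = cd n (snd z)" for z n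
    using cdJ by (cases z) (auto simp: S_def Bc_def)
  have Sm: "measure (M \<Otimes>\<^sub>M M) (S n) = (\<Sum>P\<in>J n. (measure M (Bc n P))^2)" for n
  proof -
    have "measure (M \<Otimes>\<^sub>M M) (S n) = (\<Sum>P\<in>J n. measure (M \<Otimes>\<^sub>M M) (Bc n P \<times> Bc n P))"
      unfolding S_def
    proof (rule PM.finite_measure_finite_Union[OF finJ])
      show "disjoint_family_on (\<lambda>P. Bc n P \<times> Bc n P) (J n)" by (auto simp: disjoint_family_on_def Bc_def)
    qed (use Bc in auto)
    then show ?thesis by (simp add: measure_Times Bc power2_eq_square)
  qed
  \<comment> \<open>Any exponent with \<open>m \<le> p ^ a\<close> will do, and
    \<open>m < 2 ^ m\<close>.\<close>
  define a where "a = m"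
  have a: "m \<le> p ^ a" unfolding a_def using p_gt_1 less_exp[of m] power_mono[of 2 p m] by linarith
  \<comment> \<open>A bound for the ratio between the number of balls of level \<open>K\<close> and
    the number of vectors in \<open>Tb\<close>, valid for every \<open>K\<close> considered.\<close>
  define c' where "c' = real p ^ ((k + a) * card I)"
  have c': "c' > 0" using p_gt_1 by (simp add: c'_def)
  define \<gamma> where "\<gamma> = measure M (cell k b)"
  have \<gamma>: "\<gamma> > 0" using measure_cell[OF b] ncell_pos by (simp add: \<gamma>_def)
  have bound: "\<gamma> / (4 * c') \<le> measure (M \<Otimes>\<^sub>M M) (S n)" for n
  proof -
    \<comment> \<open>Makes \<open>(c' + 1) * \<eta> = \<gamma> / 4\<close>, so that half of the
      lower bound \<open>\<gamma> / 2\<close> survives the exceptional set.\<close>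
    define \<eta> where "\<eta> = \<gamma> / (4 * (c' + 1))"
    have \<eta>: "\<eta> > 0" using \<gamma> c' by (simp add: \<eta>_def)
    \<comment> \<open>The covering lemma takes a sequence of sets, so the finitely many codes are
      numbered by \<open>set_encode\<close>.\<close>
    have "space M \<subseteq> (\<Union>i. if i \<in> set_encode ` J n then Bc n (set_decode i) else {})"
    proof
      fix x assume "x \<in> space M"
      moreover have "finite (cd n x)" by (simp add: cd_def)
      ultimately have "x \<in> (if set_encode (cd n x) \<in> set_encode ` J n then Bc n (set_decode (set_encode (cd n x))) else {})"
        using cdJ by (simp add: Bc_def)
      then show "x \<in> (\<Union>i. if i \<in> set_encode ` J n then Bc n (set_decode i) else {})" by blast
    qed
    then obtain E k0 where E: "E \<in> sets M" "measure M E \<le> \<eta>"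
      "\<And>K x y. K \<ge> k0 \<Longrightarrow> x \<in> space M - E \<Longrightarrow> y \<in> space M - E \<Longrightarrow> q K x = q K y \<Longrightarrow> cd n x = cd n y"
    proof (rule approx_cover[rotated, OF _ \<eta>])
      show "(if i \<in> set_encode ` J n then Bc n (set_decode i) else {}) \<in> sets M" for i using Bc by simp
    next
      fix E k0
      assume E: "E \<in> sets M" "measure M E \<le> \<eta>" and
        c: "\<And>K x y. k0 \<le> K \<Longrightarrow> x \<in> space M - E \<Longrightarrow> y \<in> space M - E \<Longrightarrow> q K x = q K y \<Longrightarrow>
          \<exists>i. x \<in> (if i \<in> set_encode ` J n then Bc n (set_decode i) else {}) \<and> y \<in> (if i \<in> set_encode ` J n then Bc n (set_decode i) else {})"
      show thesis
      proof (rule that[OF E, of k0])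
        fix K x y assume "k0 \<le> K" "x \<in> space M - E" "y \<in> space M - E" "q K x = q K y"
        from c[OF this] show "cd n x = cd n y" by (auto simp: Bc_def split: if_splits)
      qed
    qed
    define K where "K = max k0 (k + a)"
    have K: "k0 \<le> K" "k + a \<le> K" by (simp_all add: K_def)
    define Tb where "Tb = (I \<rightarrow>\<^sub>E {..<p ^ (K - k - a)})"
    have finT: "finite Tb" unfolding Tb_def using finite_I by (intro finite_PiE) auto
    have cT: "real (card Tb) = real p ^ ((K - k - a) * card I)"
      unfolding Tb_def using finite_I by (simp add: card_PiE power_mult)
    define Wc where "Wc P = {w \<in> q K ` space M. \<exists>y\<in>space M - E. q K y = w \<and> y \<in> Bc n P}" for P
    \<comment> \<open>A union of balls that agrees with the code class \<open>Bc n P\<close> outside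
      \<open>E\<close>.\<close>
    define W where "W P = (\<Union>w\<in>Wc P. cell K w)" for P
    have Wc: "finite (Wc P)" "Wc P \<subseteq> q K ` space M" for P unfolding Wc_def using finite_q by auto
    have W: "W P \<in> sets M" for P unfolding W_def using Wc by auto
    have disj: "disjoint_family_on (\<lambda>w. cell K w) A" for A by (auto simp: disjoint_family_on_def cell_def)
    have Wm: "measure M (W P) = real (card (Wc P)) / ncell K" for P
    proof -
      have "measure M (W P) = (\<Sum>w\<in>Wc P. measure M (cell K w))" unfolding W_def
        by (rule finite_measure_finite_Union[OF Wc(1) _ disj]) auto
      also have "\<dots> = (\<Sum>w\<in>Wc P. 1 / ncell K)" using Wc(2) by (intro sum.cong refl measure_cell) auto
      finally show ?thesis by simp
    qed
    have WE: "W P \<subseteq> Bc n P \<union> (W P \<inter> E)" for P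
    proof
      fix x assume x: "x \<in> W P"
      then obtain y where y: "y \<in> space M - E" "q K y = q K x" "y \<in> Bc n P" "x \<in> space M"
        by (auto simp: W_def Wc_def cell_def)
      then show "x \<in> Bc n P \<union> (W P \<inter> E)" using x E(3)[OF K(1), of x y] by (auto simp: Bc_def)
    qed
    have Wdisj: "disjoint_family_on (\<lambda>P. W P \<inter> E) (J n)"
    proof -
      have "P = P'" if xW: "x \<in> W P" "x \<in> W P'" for x P P'
      proof -
        obtain y where y: "y \<in> space M - E" "q K y = q K x" "y \<in> Bc n P" using xW(1) by (auto simp: W_def Wc_def cell_def)
        obtain y' where y': "y' \<in> space M - E" "q K y' = q K x" "y' \<in> Bc n P'" using xW(2) by (auto simp: W_def Wc_def cell_def)
        show ?thesis using E(3)[OF K(1) y(1) y'(1)] y y' by (simp add: Bc_def)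
      qed
      then show ?thesis by (auto simp: disjoint_family_on_def)
    qed
    have one: "\<gamma> / 2 \<le> measure M E + (\<Sum>P\<in>J n. measure M (Bc n P \<inter> (scaled k m t -` W P \<inter> space M)))" for t
    proof -
      obtain A where A: "A \<in> sets M" "A \<subseteq> {x \<in> cell k b. f (scaled k m t x) = f x}" "\<gamma> / 2 \<le> measure M A"
        using half[of t] unfolding \<gamma>_def by blast
      have ms: "scaled k m t -` Z \<inter> space M \<in> sets M" if "Z \<in> sets M" for Z
        unfolding scaled_def using measurable_sets[OF T_meas that] .
      have Ub: "(\<Union>P\<in>J n. Bc n P \<inter> (scaled k m t -` W P \<inter> space M)) \<in> sets M"
        by (intro sets.finite_UN finJ sets.Int[OF Bc ms] W)
      have "A \<subseteq> (scaled k m t -` E \<inter> space M) \<union> (\<Union>P\<in>J n. Bc n P \<inter> (scaled k m t -` W P \<inter> space M))"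
      proof
        fix x assume x: "x \<in> A"
        have xs: "x \<in> space M" using x A(1) sets.sets_into_space by blast
        have fx: "f (scaled k m t x) = f x" using x A(2) by blast
        let ?y = "scaled k m t x"
        have ys: "?y \<in> space M" unfolding scaled_def by (rule T_space[OF xs])
        show "x \<in> (scaled k m t -` E \<inter> space M) \<union> (\<Union>P\<in>J n. Bc n P \<inter> (scaled k m t -` W P \<inter> space M))"
        proof (cases "?y \<in> E")
          case False
          have cde: "cd n ?y = cd n x" using fx by (simp add: cd_def)
          then have "?y \<in> W (cd n x)" using False ys by (auto simp: W_def Wc_def cell_def Bc_def)
          then show ?thesis using xs cdJ[of n x] by (auto simp: Bc_def)
        qed (use xs in auto)
      qed
      then have "measure M A \<le> measure M ((scaled k m t -` E \<inter> space M) \<union> (\<Union>P\<in>J n. Bc n P \<inter> (scaled k m t -` W P \<inter> space M)))"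
        by (rule finite_measure_mono[OF _ sets.Un[OF ms[OF E(1)] Ub]])
      also have "\<dots> \<le> measure M (scaled k m t -` E \<inter> space M) + measure M (\<Union>P\<in>J n. Bc n P \<inter> (scaled k m t -` W P \<inter> space M))"
        by (rule measure_Un_le[OF ms[OF E(1)] Ub])
      also have "measure M (scaled k m t -` E \<inter> space M) = measure M E" unfolding scaled_def by (rule T_measure[OF E(1)])
      also have "measure M (\<Union>P\<in>J n. Bc n P \<inter> (scaled k m t -` W P \<inter> space M)) \<le> (\<Sum>P\<in>J n. measure M (Bc n P \<inter> (scaled k m t -` W P \<inter> space M)))"
        by (rule finite_measure_subadditive_finite[OF finJ]) (use ms W Bc in blast)
      finally show ?thesis using A by linarith
    qed
    \<comment> \<open>For a fixed ball \<open>w\<close> the preimages under different vectors of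
      \<open>Tb\<close> are disjoint, so the sum over \<open>t\<close> counts each point of
      \<open>Bc n P\<close> at most once per ball.\<close>
    have two: "(\<Sum>t\<in>Tb. measure M (Bc n P \<inter> (scaled k m t -` W P \<inter> space M))) \<le> real (card (Wc P)) * measure M (Bc n P)" for P
    proof -
      have ms: "scaled k m t -` cell K w \<inter> space M \<in> sets M" for t w
        unfolding scaled_def using measurable_sets[OF T_meas cell_sets] .
      have "(\<Sum>t\<in>Tb. measure M (Bc n P \<inter> (scaled k m t -` W P \<inter> space M))) \<le>
        (\<Sum>t\<in>Tb. \<Sum>w\<in>Wc P. measure M (Bc n P \<inter> (scaled k m t -` cell K w \<inter> space M)))"
      proof (rule sum_mono)
        fix t
        have eq: "Bc n P \<inter> (scaled k m t -` W P \<inter> space M) = (\<Union>w\<in>Wc P. Bc n P \<inter> (scaled k m t -` cell K w \<inter> space M))"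
          by (auto simp: W_def)
        show "measure M (Bc n P \<inter> (scaled k m t -` W P \<inter> space M)) \<le> (\<Sum>w\<in>Wc P. measure M (Bc n P \<inter> (scaled k m t -` cell K w \<inter> space M)))"
          unfolding eq by (rule finite_measure_subadditive_finite[OF Wc(1)]) (use ms Bc in blast)
      qed
      also have "\<dots> = (\<Sum>w\<in>Wc P. \<Sum>t\<in>Tb. measure M (Bc n P \<inter> (scaled k m t -` cell K w \<inter> space M)))" by (rule sum.swap)
      also have "\<dots> \<le> (\<Sum>w\<in>Wc P. measure M (Bc n P))"
      proof (rule sum_mono)
        fix w
        have "(\<Sum>t\<in>Tb. measure M (Bc n P \<inter> (scaled k m t -` cell K w \<inter> space M))) = measure M (\<Union>t\<in>Tb. Bc n P \<inter> (scaled k m t -` cell K w \<inter> space M))"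
        proof (rule finite_measure_finite_Union[OF finT, symmetric])
          show "disjoint_family_on (\<lambda>t. Bc n P \<inter> (scaled k m t -` cell K w \<inter> space M)) Tb"
            unfolding disjoint_family_on_def
          proof (intro ballI impI, rule ccontr)
            fix t t' assume tt: "t \<in> Tb" "t' \<in> Tb" "t \<noteq> t'"
              and "Bc n P \<inter> (scaled k m t -` cell K w \<inter> space M) \<inter> (Bc n P \<inter> (scaled k m t' -` cell K w \<inter> space M)) \<noteq> {}"
            then obtain x where x: "x \<in> space M" "scaled k m t x \<in> cell K w" "scaled k m t' x \<in> cell K w" by blast
            then have "q K (scaled k m t x) = q K (scaled k m t' x)" by (simp add: cell_def)
            from scaled_cell_inj[OF x(1) m a K(2) _ _ this] tt show False by (auto simp: Tb_def)
          qed
        qed (use ms Bc in auto)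
        also have "\<dots> \<le> measure M (Bc n P)" using Bc by (intro finite_measure_mono) auto
        finally show "(\<Sum>t\<in>Tb. measure M (Bc n P \<inter> (scaled k m t -` cell K w \<inter> space M))) \<le> measure M (Bc n P)" .
      qed
      finally show ?thesis by simp
    qed
    have three: "real (card (Wc P)) * measure M (Bc n P) \<le> ncell K * ((measure M (Bc n P))^2 + measure M (W P \<inter> E))" for P
    proof -
      have "measure M (W P) \<le> measure M (Bc n P \<union> (W P \<inter> E))" using WE Bc W E(1) by (intro finite_measure_mono) auto
      also have "\<dots> \<le> measure M (Bc n P) + measure M (W P \<inter> E)" using Bc W E(1) by (intro measure_Un_le) auto
      finally have "measure M (W P) * measure M (Bc n P) \<le> (measure M (Bc n P) + measure M (W P \<inter> E)) * measure M (Bc n P)"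
        by (intro mult_right_mono) auto
      also have "\<dots> \<le> (measure M (Bc n P))^2 + measure M (W P \<inter> E)"
        using mult_left_le[OF prob_le_1[of "Bc n P"], of "measure M (W P \<inter> E)"] by (simp add: algebra_simps power2_eq_square)
      finally have "measure M (W P) * measure M (Bc n P) \<le> (measure M (Bc n P))^2 + measure M (W P \<inter> E)" .
      from mult_left_mono[OF this, of "ncell K"] show ?thesis using ncell_pos[of K] by (simp add: Wm)
    qed
    have "real (card Tb) * (\<gamma> / 2) = (\<Sum>t\<in>Tb. \<gamma> / 2)" by simp
    also have "\<dots> \<le> (\<Sum>t\<in>Tb. measure M E + (\<Sum>P\<in>J n. measure M (Bc n P \<inter> (scaled k m t -` W P \<inter> space M))))" by (intro sum_mono one)
    also have "\<dots> = real (card Tb) * measure M E + (\<Sum>P\<in>J n. \<Sum>t\<in>Tb. measure M (Bc n P \<inter> (scaled k m t -` W P \<inter> space M)))"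
      by (simp add: sum.distrib sum.swap[of _ Tb])
    also have "(\<Sum>P\<in>J n. \<Sum>t\<in>Tb. measure M (Bc n P \<inter> (scaled k m t -` W P \<inter> space M))) \<le> (\<Sum>P\<in>J n. ncell K * ((measure M (Bc n P))^2 + measure M (W P \<inter> E)))"
      by (intro sum_mono order_trans[OF two three])
    also have "\<dots> = ncell K * (measure (M \<Otimes>\<^sub>M M) (S n) + (\<Sum>P\<in>J n. measure M (W P \<inter> E)))"
      by (simp add: Sm sum_distrib_left[symmetric] sum.distrib)
    also have "(\<Sum>P\<in>J n. measure M (W P \<inter> E)) \<le> measure M E"
    proof -
      have "(\<Sum>P\<in>J n. measure M (W P \<inter> E)) = measure M (\<Union>P\<in>J n. W P \<inter> E)"
        by (rule finite_measure_finite_Union[OF finJ _ Wdisj, symmetric]) (use W E in auto)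
      also have "\<dots> \<le> measure M E" using E by (intro finite_measure_mono) auto
      finally show ?thesis .
    qed
    finally have "real (card Tb) * (\<gamma> / 2) \<le> real (card Tb) * measure M E + ncell K * (measure (M \<Otimes>\<^sub>M M) (S n) + measure M E)"
      by (simp add: mult_left_mono)
    also have "real (ncell K) \<le> real (card Tb) * c'"
    proof -
      have "real (ncell K) \<le> real (p ^ (K * card I))" unfolding ncell_def using card_q of_nat_mono by blast
      also have "\<dots> = real (card Tb) * c'" using K(2) by (simp add: cT c'_def flip: power_add add_mult_distrib)
      finally show ?thesis .
    qed
    finally have "real (card Tb) * (\<gamma> / 2) \<le> real (card Tb) * measure M E + real (card Tb) * c' * (measure (M \<Otimes>\<^sub>M M) (S n) + measure M E)"
      by (simp add: mult_right_mono)
    then have "real (card Tb) * (\<gamma> / 2) \<le> real (card Tb) * (measure M E + c' * (measure (M \<Otimes>\<^sub>M M) (S n) + measure M E))"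
      by (simp add: algebra_simps)
    moreover have "real (card Tb) > 0" using p_gt_1 by (simp add: cT)
    ultimately have "\<gamma> / 2 \<le> measure M E + c' * (measure (M \<Otimes>\<^sub>M M) (S n) + measure M E)" by (simp only: mult_le_cancel_left_pos)
    also have "\<dots> = (c' + 1) * measure M E + c' * measure (M \<Otimes>\<^sub>M M) (S n)" by (simp add: algebra_simps)
    also have "(c' + 1) * measure M E \<le> (c' + 1) * \<eta>" using E(2) c' by (intro mult_left_mono) auto
    also have "\<dots> = \<gamma> / 4" using c' unfolding \<eta>_def by (simp add: field_simps)
    finally have "\<gamma> / 4 \<le> c' * measure (M \<Otimes>\<^sub>M M) (S n)" by simp
    then show ?thesis using c' by (simp add: field_simps)
  qed
  \<comment> \<open>The intersection of the \<open>S n\<close> is the set of pairs with equal values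
    of \<open>f\<close>, and its sections are the fibres of \<open>f\<close>; a product set of
    positive measure has a section of positive measure.\<close>
  have "(\<lambda>n. measure (M \<Otimes>\<^sub>M M) (S n)) \<longlonglongrightarrow> measure (M \<Otimes>\<^sub>M M) (\<Inter>n. S n)"
  proof (rule PM.finite_Lim_measure_decseq)
    show "decseq S"
    proof (rule decseq_SucI, rule subsetI)
      fix n z assume "z \<in> S (Suc n)"
      then have z: "z \<in> space M \<times> space M" "cd (Suc n) (fst z) = cd (Suc n) (snd z)" by (auto simp: Siff)
      have "cd n w = cd (Suc n) w \<inter> {..<n}" for w by (auto simp: cd_def)
      then show "z \<in> S n" using z by (simp add: Siff)
    qed
  qed (use S in auto)
  then have "\<gamma> / (4 * c') \<le> measure (M \<Otimes>\<^sub>M M) (\<Inter>n. S n)" using bound by (intro LIMSEQ_le_const) auto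
  then have pos: "0 < measure (M \<Otimes>\<^sub>M M) (\<Inter>n. S n)" using \<gamma> c' by (smt (verit) divide_pos_pos mult_pos_pos zero_less_numeral)
  have SI: "(\<Inter>n. S n) \<in> sets (M \<Otimes>\<^sub>M M)" using S by auto
  have sec: "Pair x -` (\<Inter>n. S n) = {y \<in> space M. f y = f x}" if x: "x \<in> space M" for x
  proof (intro equalityI subsetI)
    fix y assume y: "y \<in> Pair x -` (\<Inter>n. S n)"
    then have ys: "y \<in> space M" and c: "cd n x = cd n y" for n by (auto simp: Siff)
    have "f y = f x"
    proof (rule ccontr)
      assume "f y \<noteq> f x"
      then obtain n where n: "(f y \<in> Os n) \<noteq> (f x \<in> Os n)" using sep[OF ys x] by blast
      have "n \<in> cd (Suc n) w \<longleftrightarrow> f w \<in> Os n" for w by (simp add: cd_def)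
      then show False using n c[of "Suc n"] by blast
    qed
    then show "y \<in> {y \<in> space M. f y = f x}" using ys by simp
  next
    fix y assume "y \<in> {y \<in> space M. f y = f x}"
    then show "y \<in> Pair x -` (\<Inter>n. S n)" using x by (auto simp: Siff cd_def)
  qed
  show ?thesis
  proof (rule ccontr)
    assume neg: "\<not> ?thesis"
    have "emeasure (M \<Otimes>\<^sub>M M) (\<Inter>n. S n) = (\<integral>\<^sup>+x. emeasure M (Pair x -` (\<Inter>n. S n)) \<partial>M)"
      by (rule emeasure_pair_measure_alt[OF SI])
    also have "\<dots> = (\<integral>\<^sup>+x. 0 \<partial>M)"
    proof (rule nn_integral_cong)
      fix x assume x: "x \<in> space M"
      have "\<not> 0 < measure M {y \<in> space M. f y = f x}" using neg x by blast
      then have "measure M {y \<in> space M. f y = f x} = 0" by (simp add: zero_less_measure_iff)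
      then show "emeasure M (Pair x -` (\<Inter>n. S n)) = 0" unfolding sec[OF x] by (simp add: emeasure_eq_measure)
    qed
    finally have "measure (M \<Otimes>\<^sub>M M) (\<Inter>n. S n) = 0" by (simp add: measure_def)
    then show False using pos by simp
  qed
qed

end

section \<open>Powers that fix values of the homomorphism\<close>

context odometer_hom begin

text \<open>A small translation keeps a point in its small ball, and outside a small set two points
  of such a ball have nearby values.\<close>

lemma return_small:
  fixes z :: "'x \<Rightarrow> 'z :: metric_space"
  assumes cover: "\<And>e. e > 0 \<Longrightarrow> \<exists>B::nat \<Rightarrow> 'x set. (\<forall>n. B n \<in> sets M) \<and> space M \<subseteq> (\<Union>n. B n) \<and>
      (\<forall>n x y. x \<in> B n \<longrightarrow> y \<in> B n \<longrightarrow> dist (z x) (z y) < e)"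
    and "e > 0" "\<eta> > 0"
  shows "\<exists>l. \<forall>t. (\<forall>i\<in>I. int p ^ l dvd t i) \<longrightarrow>
     (\<exists>E\<in>sets M. measure M E \<le> \<eta> \<and> (\<forall>x\<in>space M - E. dist (z (T t x)) (z x) < e))"
proof -
  obtain B :: "nat \<Rightarrow> 'x set" where B: "\<And>n. B n \<in> sets M" "space M \<subseteq> (\<Union>n. B n)"
    "\<And>n x y. x \<in> B n \<Longrightarrow> y \<in> B n \<Longrightarrow> dist (z x) (z y) < e" using cover[OF assms(2)] by blast
  have \<eta>2: "\<eta> / 2 > 0" using assms by simp
  obtain E l where E: "E \<in> sets M" "measure M E \<le> \<eta> / 2"
    "\<And>x y. x \<in> space M - E \<Longrightarrow> y \<in> space M - E \<Longrightarrow> q l x = q l y \<Longrightarrow> \<exists>n. x \<in> B n \<and> y \<in> B n"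
    using approx_cover[OF B(1,2) \<eta>2] by (metis order_refl)
  show ?thesis
  proof (intro exI[of _ l] allI impI)
    fix t assume t: "\<forall>i\<in>I. int p ^ l dvd t i"
    have Et: "T t -` E \<inter> space M \<in> sets M" by (rule measurable_sets[OF T_meas E(1)])
    show "\<exists>E\<in>sets M. measure M E \<le> \<eta> \<and> (\<forall>x\<in>space M - E. dist (z (T t x)) (z x) < e)"
    proof (intro bexI[of _ "E \<union> (T t -` E \<inter> space M)"] conjI ballI)
      have "measure M (E \<union> (T t -` E \<inter> space M)) \<le> measure M E + measure M (T t -` E \<inter> space M)"
        by (rule measure_Un_le[OF E(1) Et])
      then show "measure M (E \<union> (T t -` E \<inter> space M)) \<le> \<eta>" using E(2) T_measure[OF E(1), of t] by simp
      show "E \<union> (T t -` E \<inter> space M) \<in> sets M" using E(1) Et by auto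
      fix x assume x: "x \<in> space M - (E \<union> (T t -` E \<inter> space M))"
      then have "q l (T t x) = q l x" using T_fix[of x l t] t by simp
      then obtain n where "T t x \<in> B n" "x \<in> B n" using E(3)[of "T t x" x] x T_space[of x t] by auto
      then show "dist (z (T t x)) (z x) < e" by (rule B(3))
    qed
  qed
qed

lemma L_funpow: "u \<in> L \<Longrightarrow> u ^^ j \<in> L"
proof (induction j)
  case 0
  show ?case unfolding funpow.simps(1) by (rule L_id)
next
  case (Suc j)
  then show ?case unfolding funpow.simps(2) by (intro L_comp)
qed

lemma fix_sets: "l \<in> L \<Longrightarrow> {x \<in> space M. l (f x) = f x} \<in> sets M"
proof -
  assume l: "l \<in> L"
  have "{x \<in> space M. l (f x) = f x} = {x \<in> space M. l (f x) = f (T (\<lambda>_. 0) x)}" using T_zero by auto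
  then show ?thesis using hom_sets[OF T_G l, of "\<lambda>_. 0"] by simp
qed

lemma funpow_fix_dvd: "(u ^^ a) y = y \<Longrightarrow> a dvd b \<Longrightarrow> (u ^^ b) y = y"
proof -
  assume a: "(u ^^ a) y = y" and "a dvd b"
  then obtain c where c: "b = a * c" by blast
  have "((u ^^ a) ^^ c) y = y" by (induction c) (simp_all add: a)
  then show ?thesis by (simp add: c funpow_mult)
qed

text \<open>Along \<open>\<sigma>\<close> the translations tend to the identity, so powers of
  \<open>u\<close> bring \<open>f x\<close> back near itself for most \<open>x\<close>. Where this
  happens infinitely often, \<open>rec\<close> yields a power that fixes \<open>f x\<close>.
  Finitely many powers account for all but a small part of the ball, and their product serves them
  all. The loss is \<open>4 * e\<close> from \<open>hom_u\<close>, \<open>e\<close> from the returns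
  and \<open>e\<close> from the truncation.\<close>

lemma fixed_power:
  fixes y :: "'y \<Rightarrow> 'z :: metric_space"
  assumes cover: "\<And>e. e > 0 \<Longrightarrow> \<exists>B::nat \<Rightarrow> 'x set. (\<forall>n. B n \<in> sets M) \<and> space M \<subseteq> (\<Union>n. B n) \<and>
      (\<forall>n x x'. x \<in> B n \<longrightarrow> x' \<in> B n \<longrightarrow> dist (y (f x)) (y (f x')) < e)"
    and \<sigma>: "\<And>l. p ^ l dvd \<sigma> l" "\<And>l. \<sigma> l > 0"
    and rec: "\<And>x r. x \<in> space M \<Longrightarrow> strict_mono r \<Longrightarrow> (\<lambda>j. y ((u ^^ \<sigma> (r j)) (f x))) \<longlonglongrightarrow> y (f x) \<Longrightarrow>
        \<exists>j. (u ^^ \<sigma> (r j)) (f x) = f x"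
    and u: "u \<in> L" and i: "i \<in> I" and e: "e > 0" and b: "b \<in> q k ` space M"
    and hom_u: "\<And>j::nat. (1 - 4 * e) * measure M (cell k b) \<le>
        measure M {x \<in> cell k b. f (T ((\<lambda>_. 0)(i := int j * int p ^ k)) x) = (u ^^ j) (f x)}"
  shows "\<exists>N>0. (1 - 6 * e) * measure M (cell k b) \<le> measure M {x \<in> cell k b. (u ^^ N) (f x) = f x}"
proof -
  let ?c = "cell k b"
  define m where "m = measure M ?c"
  have m: "m > 0" using measure_cell[OF b] ncell_pos by (simp add: m_def)
  have csp: "?c \<subseteq> space M" by (auto simp: cell_def)
  define \<rho> where "\<rho> j = T ((\<lambda>_. 0)(i := int j * int p ^ k))" for j :: nat
  have em: "e * m > 0" using e m by simp
  have "\<forall>n. \<exists>l. \<forall>t. (\<forall>i\<in>I. int p ^ l dvd t i) \<longrightarrow>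
     (\<exists>E\<in>sets M. measure M E \<le> e * m \<and> (\<forall>x\<in>space M - E. dist (y (f (T t x))) (y (f x)) < 1 / real (Suc n)))"
    by (intro allI return_small[OF cover _ em]) auto
  then obtain l0 where l0: "\<And>n t. (\<forall>i\<in>I. int p ^ l0 n dvd t i) \<Longrightarrow>
     (\<exists>E\<in>sets M. measure M E \<le> e * m \<and> (\<forall>x\<in>space M - E. dist (y (f (T t x))) (y (f x)) < 1 / real (Suc n)))"
    by metis
  \<comment> \<open>Strictly increasing and at least \<open>l0\<close>, so that
    \<open>\<sigma> (r0 n)\<close> has the divisibility demanded by \<open>l0 n\<close>.\<close>
  define r0 where "r0 n = n + (\<Sum>j\<le>n. l0 j)" for n
  have r0: "strict_mono r0" unfolding strict_mono_Suc_iff by (simp add: r0_def)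
  have l0r: "l0 n \<le> r0 n" for n unfolding r0_def using member_le_sum[of n "{..n}" l0] by simp
  have "\<exists>E\<in>sets M. measure M E \<le> e * m \<and> (\<forall>x\<in>space M - E. dist (y (f (\<rho> (\<sigma> (r0 n)) x))) (y (f x)) < 1 / real (Suc n))" for n
    unfolding \<rho>_def
  proof (rule l0, intro ballI)
    fix i'
    have "p ^ l0 n dvd \<sigma> (r0 n)" using \<sigma>(1)[of "r0 n"] le_imp_power_dvd[OF l0r] dvd_trans by blast
    then have "int (p ^ l0 n) dvd int (\<sigma> (r0 n))" by (simp only: int_dvd_int_iff)
    then show "int p ^ l0 n dvd ((\<lambda>_. 0)(i := int (\<sigma> (r0 n)) * int p ^ k)) i'" by simp
  qed
  then obtain E where E: "\<And>n. E n \<in> sets M" "\<And>n. measure M (E n) \<le> e * m"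
    "\<And>n x. x \<in> space M - E n \<Longrightarrow> dist (y (f (\<rho> (\<sigma> (r0 n)) x))) (y (f x)) < 1 / real (Suc n)" by metis
  define H where "H j = {x \<in> ?c. f (\<rho> j x) = (u ^^ j) (f x)}" for j
  have H: "H j \<in> sets M" for j
  proof -
    have "H j = ?c \<inter> {x \<in> space M. (u ^^ j) (f x) = f (\<rho> j x)}" using csp by (auto simp: H_def)
    then show ?thesis using hom_sets[OF T_G L_funpow[OF u]] by (auto simp: \<rho>_def)
  qed
  define Gd where "Gd n = H (\<sigma> (r0 n)) - E n" for n
  have Gd: "Gd n \<in> sets M" for n using H E by (auto simp: Gd_def)
  have Gdm: "(1 - 5 * e) * m \<le> measure M (Gd n)" for n
  proof -
    have "H (\<sigma> (r0 n)) \<subseteq> Gd n \<union> E n" by (auto simp: Gd_def)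
    then have "measure M (H (\<sigma> (r0 n))) \<le> measure M (Gd n \<union> E n)" using Gd E(1) by (intro finite_measure_mono) auto
    also have "\<dots> \<le> measure M (Gd n) + measure M (E n)" by (rule measure_Un_le[OF Gd E(1)])
    finally show ?thesis using E(2)[of n] hom_u[of "\<sigma> (r0 n)"] by (simp add: H_def \<rho>_def m_def[symmetric] algebra_simps)
  qed
  \<comment> \<open>Decreasing sets whose intersection consists of the points lying in
    \<open>Gd n\<close> for infinitely many \<open>n\<close>; each has at least the measure of one
    \<open>Gd n\<close>.\<close>
  define U where "U n = (\<Union>j\<in>{n..}. Gd j)" for n
  have U: "U n \<in> sets M" for n unfolding U_def using Gd by (intro sets.countable_UN'') auto
  have "(\<lambda>n. measure M (U n)) \<longlonglongrightarrow> measure M (\<Inter>n. U n)"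
  proof (rule finite_Lim_measure_decseq)
    show "decseq U" unfolding decseq_def U_def by (intro allI impI UN_mono) auto
  qed (use U in auto)
  moreover have "(1 - 5 * e) * m \<le> measure M (U n)" for n
  proof -
    have "measure M (Gd n) \<le> measure M (U n)" using U by (intro finite_measure_mono) (auto simp: U_def)
    then show ?thesis using Gdm[of n] by linarith
  qed
  ultimately have Um: "(1 - 5 * e) * m \<le> measure M (\<Inter>n. U n)" by (intro LIMSEQ_le_const) auto
  define F where "F j = {x \<in> ?c. (u ^^ \<sigma> j) (f x) = f x}" for j
  have Fm: "{x \<in> ?c. (u ^^ j) (f x) = f x} \<in> sets M" for j
  proof -
    have "{x \<in> ?c. (u ^^ j) (f x) = f x} = ?c \<inter> {x \<in> space M. (u ^^ j) (f x) = f x}" using csp by auto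
    then show ?thesis using fix_sets[OF L_funpow[OF u]] by auto
  qed
  have F: "F j \<in> sets M" for j unfolding F_def by (rule Fm)
  have UF: "(\<Inter>n. U n) \<subseteq> (\<Union>j. F j)"
  proof
    fix x assume x: "x \<in> (\<Inter>n. U n)"
    have inf: "infinite {n. x \<in> Gd n}"
      unfolding infinite_nat_iff_unbounded_le using x by (auto simp: U_def)
    define r where "r = enumerate {n. x \<in> Gd n}"
    have r: "strict_mono r" "\<And>j. x \<in> Gd (r j)"
      using strict_mono_enumerate[OF inf] enumerate_in_set[OF inf] by (auto simp: r_def)
    have xc: "x \<in> ?c" using r(2)[of 0] by (auto simp: Gd_def H_def)
    then have xs: "x \<in> space M" using csp by blast
    have "(\<lambda>j. y ((u ^^ \<sigma> (r0 (r j))) (f x))) \<longlonglongrightarrow> y (f x)"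
    proof (rule metric_LIMSEQ_I)
      fix \<epsilon> :: real assume "\<epsilon> > 0"
      then obtain n where n: "1 / real (Suc n) < \<epsilon>" using nat_approx_posE by blast
      show "\<exists>no. \<forall>j\<ge>no. dist (y ((u ^^ \<sigma> (r0 (r j))) (f x))) (y (f x)) < \<epsilon>"
      proof (intro exI[of _ n] allI impI)
        fix j assume j: "n \<le> j"
        have "f (\<rho> (\<sigma> (r0 (r j))) x) = (u ^^ \<sigma> (r0 (r j))) (f x)" using r(2)[of j] by (auto simp: Gd_def H_def)
        then have "dist (y ((u ^^ \<sigma> (r0 (r j))) (f x))) (y (f x)) < 1 / real (Suc (r j))"
          using E(3)[of x "r j"] xs r(2)[of j] by (simp add: Gd_def)
        also have "\<dots> \<le> 1 / real (Suc n)"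
          using strict_mono_imp_increasing[OF r(1), of j] j by (intro divide_left_mono) auto
        finally show "dist (y ((u ^^ \<sigma> (r0 (r j))) (f x))) (y (f x)) < \<epsilon>" using n by linarith
      qed
    qed
    then have "\<exists>j. (u ^^ \<sigma> ((r0 \<circ> r) j)) (f x) = f x"
      by (intro rec[OF xs strict_mono_o[OF r0 r(1)]]) simp
    then show "x \<in> (\<Union>j. F j)" using xc by (auto simp: F_def)
  qed
  have "(\<lambda>n. measure M (\<Union>j<n. F j)) \<longlonglongrightarrow> measure M (\<Union>n. \<Union>j<n. F j)"
    by (rule finite_Lim_measure_incseq[OF _ incseq_UN_lessThan]) (use F in auto)
  also have "(\<Union>n. \<Union>j<n. F j) = (\<Union>j. F j)"
  proof (intro equalityI subsetI)
    fix x assume "x \<in> (\<Union>i. F i)"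
    then obtain n where "x \<in> F n" by blast
    then show "x \<in> (\<Union>n. \<Union>i<n. F i)" by (auto intro!: exI[of _ "Suc n"] bexI[of _ n])
  qed auto
  finally have lim: "(\<lambda>n. measure M (\<Union>j<n. F j)) \<longlonglongrightarrow> measure M (\<Union>j. F j)" .
  have "measure M (\<Inter>n. U n) \<le> measure M (\<Union>j. F j)" using UF F by (intro finite_measure_mono) auto
  then have "(1 - 6 * e) * m < measure M (\<Union>j. F j)" using Um em by (simp add: algebra_simps)
  from order_tendstoD(1)[OF lim this] obtain N where N: "(1 - 6 * e) * m < measure M (\<Union>j<N. F j)"
    by (auto simp: eventually_sequentially)
  define P where "P = (\<Prod>j<N. \<sigma> j)"
  have "(\<Union>j<N. F j) \<subseteq> {x \<in> ?c. (u ^^ P) (f x) = f x}"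
  proof
    fix x assume "x \<in> (\<Union>j<N. F j)"
    then obtain j where j: "j < N" "x \<in> F j" by blast
    have "\<sigma> j dvd P" unfolding P_def using j by (intro dvd_prodI) auto
    then show "x \<in> {x \<in> ?c. (u ^^ P) (f x) = f x}" using j funpow_fix_dvd[of "\<sigma> j" u "f x" P] by (simp add: F_def)
  qed
  then have "measure M (\<Union>j<N. F j) \<le> measure M {x \<in> ?c. (u ^^ P) (f x) = f x}"
    by (rule finite_measure_mono[OF _ Fm])
  moreover have "P > 0" unfolding P_def using \<sigma>(2) by (intro prod_pos) auto
  ultimately show ?thesis using N by (intro exI[of _ P]) (auto simp: m_def)
qed

text \<open>On a good ball every direction \<open>i\<close> has its element \<open>u i\<close>, and
  a power of \<open>u i\<close> fixes most values. Hence, for a suitable \<open>P\<close>, each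
  translation by a nonnegative vector divisible by \<open>P * p ^ k\<close> leaves \<open>f\<close>
  unchanged on half of the ball, which is the hypothesis of \<open>atom_exists\<close>.\<close>

theorem constant_on_positive_set:
  fixes y :: "'y \<Rightarrow> 'z :: metric_space" and Os :: "nat \<Rightarrow> 'y set"
  assumes I2: "\<And>i. i \<in> I \<Longrightarrow> \<exists>j\<in>I. j \<noteq> i" and Ine: "I \<noteq> {}"
    and Sh: "\<And>i j c. i \<in> I \<Longrightarrow> j \<in> I \<Longrightarrow> i \<noteq> j \<Longrightarrow> Sh i j c \<in> G"
      "\<And>i j c t x. i \<in> I \<Longrightarrow> j \<in> I \<Longrightarrow> i \<noteq> j \<Longrightarrow> x \<in> space M \<Longrightarrow>
         Sh i j c (T t x) = T (t(i := t i + c * t j)) (Sh i j c x)"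
    and stabs: "countable ((\<lambda>x. {l \<in> L. l (f x) = f x}) ` space M)"
    and cover: "\<And>e. e > 0 \<Longrightarrow> \<exists>B::nat \<Rightarrow> 'x set. (\<forall>n. B n \<in> sets M) \<and> space M \<subseteq> (\<Union>n. B n) \<and>
      (\<forall>n x x'. x \<in> B n \<longrightarrow> x' \<in> B n \<longrightarrow> dist (y (f x)) (y (f x')) < e)"
    and \<sigma>: "\<And>l. p ^ l dvd \<sigma> l" "\<And>l. \<sigma> l > 0"
    and rec: "\<And>u x r. u \<in> L \<Longrightarrow> x \<in> space M \<Longrightarrow> strict_mono r \<Longrightarrow> (\<lambda>j. y ((u ^^ \<sigma> (r j)) (f x))) \<longlonglongrightarrow> y (f x) \<Longrightarrow>
        \<exists>j. (u ^^ \<sigma> (r j)) (f x) = f x"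
    and Os: "\<And>n. {x \<in> space M. f x \<in> Os n} \<in> sets M"
    and sep: "\<And>x x'. x \<in> space M \<Longrightarrow> x' \<in> space M \<Longrightarrow> f x \<noteq> f x' \<Longrightarrow> \<exists>n. (f x \<in> Os n) \<noteq> (f x' \<in> Os n)"
  shows "\<exists>x0\<in>space M. measure M {x \<in> space M. f x = f x0} > 0"
proof -
  let ?St = "\<lambda>x. {l \<in> L. l (f x) = f x}"
  have St: "{x \<in> space M. ?St x = S} \<in> sets M" if "S \<subseteq> L" for S
  proof -
    define C where "C l = (if l \<in> S then {x \<in> space M. l (f x) = f x} else space M - {x \<in> space M. l (f x) = f x})" for l
    have C: "C l \<in> sets M" if "l \<in> L" for l using fix_sets[OF that] by (auto simp: C_def)
    have "{x \<in> space M. ?St x = S} = (\<Inter>l\<in>L. C l)"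
    proof (intro equalityI subsetI)
      fix x assume x: "x \<in> {x \<in> space M. ?St x = S}"
      show "x \<in> (\<Inter>l\<in>L. C l)"
      proof
        fix l assume "l \<in> L"
        then show "x \<in> C l" using x by (cases "l \<in> S") (auto simp: C_def)
      qed
    next
      fix x assume x: "x \<in> (\<Inter>l\<in>L. C l)"
      then have Cx: "x \<in> C l" if "l \<in> L" for l using that by blast
      have xs: "x \<in> space M" using Cx[OF L_id] by (cases "id \<in> S") (auto simp: C_def)
      have "l (f x) = f x \<longleftrightarrow> l \<in> S" if "l \<in> L" for l
        using Cx[OF that] by (cases "l \<in> S") (auto simp: C_def)
      then show "x \<in> {x \<in> space M. ?St x = S}" using xs that by blast
    qed
    also have "\<dots> \<in> sets M"
      using L_id by (intro sets.countable_INT' L_countable) (use C in auto)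
    finally show ?thesis .
  qed
  \<comment> \<open>Countably many classes of points with equal stabiliser make up a space of
    measure 1, so one class is not null.\<close>
  have "\<exists>S\<in>?St ` space M. measure M {x \<in> space M. ?St x = S} > 0"
  proof (rule ccontr)
    assume neg: "\<not> ?thesis"
    have "space M = (\<Union>S\<in>?St ` space M. {x \<in> space M. ?St x = S})" by auto
    also have "\<dots> \<in> null_sets M"
    proof (rule null_sets_UN'[OF stabs])
      fix S assume S: "S \<in> ?St ` space M"
      then have "S \<subseteq> L" by auto
      moreover have "measure M {x \<in> space M. ?St x = S} = 0" using neg S by (auto simp: zero_less_measure_iff)
      ultimately show "{x \<in> space M. ?St x = S} \<in> null_sets M" using St by (simp add: null_sets_def emeasure_eq_measure)
    qed
    finally have "emeasure M (space M) = 0" by (rule null_setsD1)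
    then show False using emeasure_space_1 by simp
  qed
  then obtain S0 where S0': "S0 \<in> ?St ` space M" and S0m: "measure M {x \<in> space M. ?St x = S0} > 0" by (elim bexE)
  have S0L: "S0 \<subseteq> L" using S0' by (elim imageE) simp
  note S0 = S0L S0m
  define n where "n = real (card I)"
  have n: "n \<ge> 1" using Ine finite_I by (simp add: n_def Suc_le_eq card_gt_0_iff)
  \<comment> \<open>Every direction will lose \<open>10 * e\<close>, so the total loss stays below
    one half.\<close>
  define e where "e = 1 / (21 * n)"
  have e: "0 < e" "e < 1 / 20" using n by (auto simp: e_def field_simps)
  obtain k b where b: "b \<in> q k ` space M" and hom_u:
    "\<And>i. i \<in> I \<Longrightarrow> \<exists>u\<in>L. \<forall>j::nat. (1 - 4 * e) * measure M (cell k b) \<le>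
        measure M {x \<in> cell k b. f (T ((\<lambda>_. 0)(i := int j * int p ^ k)) x) = (u ^^ j) (f x)}"
  proof (rule good_cell_exists[OF e I2 Ine Sh St[OF S0(1)] S0(2)])
    show "?St x = S0" if "x \<in> {x \<in> space M. ?St x = S0}" for x using that by simp
  qed (use that in blast)+
  let ?c = "cell k b"
  define m where "m = measure M ?c"
  have m: "m > 0" using measure_cell[OF b] ncell_pos by (simp add: m_def)
  have csp: "?c \<subseteq> space M" by (auto simp: cell_def)
  have "\<exists>u. \<forall>i\<in>I. u i \<in> L \<and> (\<forall>j. (1 - 4 * e) * m \<le>
        measure M {x \<in> ?c. f (T ((\<lambda>_. 0)(i := int j * int p ^ k)) x) = (u i ^^ j) (f x)})"
    by (rule bchoice) (use hom_u in \<open>unfold m_def Bex_def, blast\<close>)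
  then obtain u where u': "\<forall>i\<in>I. u i \<in> L \<and> (\<forall>j. (1 - 4 * e) * m \<le>
        measure M {x \<in> ?c. f (T ((\<lambda>_. 0)(i := int j * int p ^ k)) x) = (u i ^^ j) (f x)})" by (elim exE)
  have u: "u i \<in> L" "(1 - 4 * e) * m \<le>
        measure M {x \<in> ?c. f (T ((\<lambda>_. 0)(i := int j * int p ^ k)) x) = (u i ^^ j) (f x)}" if "i \<in> I" for i j
    using bspec[OF u' that] by (simp_all only: simp_thms)
  have "\<exists>N>0. (1 - 6 * e) * m \<le> measure M {x \<in> ?c. (u i ^^ N) (f x) = f x}" if i: "i \<in> I" for i
    unfolding m_def by (rule fixed_power[where y = y and \<sigma> = \<sigma> and i = i, OF cover \<sigma> rec[OF u(1)[OF i]] u(1)[OF i] i e(1) b u(2)[OF i, unfolded m_def]])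
  then have "\<exists>N. \<forall>i\<in>I. N i > 0 \<and> (1 - 6 * e) * m \<le> measure M {x \<in> ?c. (u i ^^ N i) (f x) = f x}"
    by (intro bchoice ballI)
  then obtain N :: "_ \<Rightarrow> nat" where N': "\<forall>i\<in>I. N i > 0 \<and> (1 - 6 * e) * m \<le> measure M {x \<in> ?c. (u i ^^ N i) (f x) = f x}"
    by (elim exE)
  have N: "N i > 0" "(1 - 6 * e) * m \<le> measure M {x \<in> ?c. (u i ^^ N i) (f x) = f x}" if "i \<in> I" for i
    using bspec[OF N' that] by (simp_all only: simp_thms)
  define P where "P = (\<Prod>i\<in>I. N i)"
  have P: "P > 0" unfolding P_def using N(1) by (intro prod_pos) auto
  \<comment> \<open>Here the translation is realised by a power of \<open>u i\<close>, at a loss of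
    \<open>4 * e\<close>, and this power fixes \<open>f x\<close>, at a loss of
    \<open>6 * e\<close>.\<close>
  define A where "A i j = {x \<in> ?c. f (T ((\<lambda>_. 0)(i := int (j * P) * int p ^ k)) x) = (u i ^^ (j * P)) (f x)} \<inter> {x \<in> ?c. (u i ^^ N i) (f x) = f x}" for i j
  have A: "A i j \<in> sets M" if "i \<in> I" for i j
  proof -
    have "A i j = ?c \<inter> {x \<in> space M. (u i ^^ (j * P)) (f x) = f (T ((\<lambda>_. 0)(i := int (j * P) * int p ^ k)) x)} \<inter> {x \<in> space M. (u i ^^ N i) (f x) = f x}"
      using csp by (auto simp: A_def)
    then show ?thesis using hom_sets[OF T_G L_funpow[OF u(1)[OF that]]] fix_sets[OF L_funpow[OF u(1)[OF that]]] by auto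
  qed
  have Asub: "A i j \<subseteq> {x \<in> ?c. f (T ((\<lambda>_. 0)(i := int (j * P) * int p ^ k)) x) = f x}" if "i \<in> I" for i j
  proof -
    have "N i dvd j * P" unfolding P_def using that finite_I by (intro dvd_mult dvd_prodI)
    then show ?thesis using funpow_fix_dvd[of "N i" "u i" _ "j * P"] by (auto simp: A_def)
  qed
  have cm: "measure M (?c - A i j) \<le> 10 * e * m" if i: "i \<in> I" for i j
  proof -
    let ?X = "{x \<in> ?c. f (T ((\<lambda>_. 0)(i := int (j * P) * int p ^ k)) x) = (u i ^^ (j * P)) (f x)}"
    let ?Y = "{x \<in> ?c. (u i ^^ N i) (f x) = f x}"
    have X: "?X \<in> sets M"
    proof -
      have "?X = ?c \<inter> {x \<in> space M. (u i ^^ (j * P)) (f x) = f (T ((\<lambda>_. 0)(i := int (j * P) * int p ^ k)) x)}" using csp by auto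
      then show ?thesis using hom_sets[OF T_G L_funpow[OF u(1)[OF i]]] by auto
    qed
    have Y: "?Y \<in> sets M"
    proof -
      have "?Y = ?c \<inter> {x \<in> space M. (u i ^^ N i) (f x) = f x}" using csp by auto
      then show ?thesis using fix_sets[OF L_funpow[OF u(1)[OF i]]] by auto
    qed
    have "?c - A i j = (?c - ?X) \<union> (?c - ?Y)" by (auto simp: A_def)
    then have "measure M (?c - A i j) \<le> measure M (?c - ?X) + measure M (?c - ?Y)"
      using measure_Un_le[OF sets.Diff[OF cell_sets X] sets.Diff[OF cell_sets Y]] by simp
    also have "measure M (?c - ?X) = m - measure M ?X" unfolding m_def using X by (intro finite_measure_Diff) auto
    also have "measure M (?c - ?Y) = m - measure M ?Y" unfolding m_def using Y by (intro finite_measure_Diff) auto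
    finally have "measure M (?c - A i j) \<le> (m - measure M ?X) + (m - measure M ?Y)" .
    moreover have "m - 4 * e * m \<le> measure M ?X" using u(2)[OF i, of "j * P"] by (simp only: left_diff_distrib mult_1)
    moreover have "m - 6 * e * m \<le> measure M ?Y" using N(2)[OF i] by (simp only: left_diff_distrib mult_1)
    ultimately show ?thesis by linarith
  qed
  \<comment> \<open>Directions are added one at a time. The translation along \<open>J\<close>
    preserves the measure and the ball, so the exceptional set of the next direction can be pulled
    back at no cost.\<close>
  have main: "\<exists>B\<in>sets M. B \<subseteq> ?c \<and> (\<forall>x\<in>B. f (T (\<lambda>i. if i \<in> J then int (t i * P) * int p ^ k else 0) x) = f x) \<and>
      (1 - 10 * real (card J) * e) * m \<le> measure M B" if "J \<subseteq> I" for J and t :: "_ \<Rightarrow> nat"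
    using finite_subset[OF that finite_I] that
  proof (induction J rule: finite_induct)
    case empty
    show ?case using csp T_zero by (intro bexI[of _ ?c]) (auto simp: m_def)
  next
    case (insert i J)
    then obtain B where B: "B \<in> sets M" "B \<subseteq> ?c" "\<And>x. x \<in> B \<Longrightarrow> f (T (\<lambda>i. if i \<in> J then int (t i * P) * int p ^ k else 0) x) = f x"
      "(1 - 10 * real (card J) * e) * m \<le> measure M B" by auto
    have i: "i \<in> I" using insert by simp
    let ?s = "\<lambda>i. if i \<in> J then int (t i * P) * int p ^ k else 0"
    let ?V = "T ?s -` (?c - A i (t i)) \<inter> space M"
    have V: "?V \<in> sets M" by (rule measurable_sets[OF T_meas sets.Diff[OF cell_sets A[OF i]]])
    have Vm: "measure M ?V \<le> 10 * e * m" using T_measure[OF sets.Diff[OF cell_sets A[OF i]], of ?s] cm[OF i] by simp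
    show ?case
    proof (intro bexI[of _ "B - ?V"] conjI ballI)
      show "B - ?V \<in> sets M" using B V by auto
      show "B - ?V \<subseteq> ?c" using B by auto
      have "B \<subseteq> (B - ?V) \<union> ?V" by auto
      then have "measure M B \<le> measure M ((B - ?V) \<union> ?V)" using B V by (intro finite_measure_mono) auto
      also have "\<dots> \<le> measure M (B - ?V) + measure M ?V" using B V by (intro measure_Un_le) auto
      finally have "measure M B - 10 * e * m \<le> measure M (B - ?V)" using Vm by linarith
      then show "(1 - 10 * real (card (insert i J)) * e) * m \<le> measure M (B - ?V)"
        using B(4) insert by (simp add: algebra_simps)
      fix x assume x: "x \<in> B - ?V"
      then have xs: "x \<in> space M" "x \<in> ?c" using B csp by auto
      have "q k (T ?s x) = q k x" unfolding T_fix[OF xs(1)] by auto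
      then have "T ?s x \<in> ?c" using xs T_space by (auto simp: cell_def)
      then have "T ?s x \<in> A i (t i)" using x xs by auto
      then have "f (T ((\<lambda>_. 0)(i := int (t i * P) * int p ^ k)) (T ?s x)) = f (T ?s x)" using Asub[OF i] by blast
      also have "\<dots> = f x" using B(3) x by blast
      also have "T ((\<lambda>_. 0)(i := int (t i * P) * int p ^ k)) (T ?s x) = T (\<lambda>j. if j \<in> insert i J then int (t j * P) * int p ^ k else 0) x"
        unfolding T_add[OF xs(1)] by (rule arg_cong[of _ _ "\<lambda>t. T t x"]) (use insert in \<open>auto simp: fun_eq_iff\<close>)
      finally show "f (T (\<lambda>j. if j \<in> insert i J then int (t j * P) * int p ^ k else 0) x) = f x" .
    qed
  qed
  show ?thesis
  proof (rule atom_exists[OF Os sep b P])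
    fix t :: "_ \<Rightarrow> nat"
    obtain B where B: "B \<in> sets M" "B \<subseteq> ?c" "\<And>x. x \<in> B \<Longrightarrow> f (T (\<lambda>i. if i \<in> I then int (t i * P) * int p ^ k else 0) x) = f x"
      "(1 - 10 * real (card I) * e) * m \<le> measure M B" using main[OF order_refl, of t] by blast
    have "10 * real (card I) * e \<le> 1 / 2" using n unfolding e_def n_def[symmetric] by (simp add: field_simps)
    then have "m / 2 \<le> (1 - 10 * real (card I) * e) * m" using m by (simp add: field_simps)
    then show "\<exists>A\<in>sets M. A \<subseteq> {x \<in> ?c. f (scaled k P t x) = f x} \<and> measure M ?c / 2 \<le> measure M A"
      using B unfolding scaled_def m_def by (intro bexI[of _ B]) auto
  qed
qed

end

section \<open>Recurrent lines\<close>

lemma padic_norm_0 [simp]: "padic_norm 0 = 0" by (simp add: padic_norm_eq_0_iff)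

lemma padic_norm_1 [simp]: "padic_norm (1 :: 'a :: prime_card padic) = 1"
  using padic_norm_of_rat[of 1, where 'a = 'a] by (simp add: padic_abs_1[OF prime_card])

lemma padic_norm_of_int: "padic_norm (of_int a :: 'a :: prime_card padic) = (if a = 0 then 0 else inverse (real CARD('a)) ^ multiplicity (int CARD('a)) a)"
proof -
  have "padic_norm (of_int a :: 'a padic) = padic_abs CARD('a) (of_int a / of_int 1)"
    using padic_norm_of_rat[of "of_int a", where 'a = 'a] by simp
  then show ?thesis
    by (cases "a = 0") (simp_all add: padic_abs_frac[OF prime_card] power_int_minus power_inverse del: of_int_1)
qed

lemma card_gt_1: "1 < CARD('a :: prime_card)"
  using prime_card[where 'a = 'a] prime_gt_1_nat by blast

lemma padic_norm_of_int_le_1: "padic_norm (of_int a :: 'a :: prime_card padic) \<le> 1"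
  using card_gt_1[where 'a = 'a] by (simp add: padic_norm_of_int power_le_one inverse_le_1_iff)

lemma padic_norm_of_int_le_iff:
  "padic_norm (of_int a :: 'a :: prime_card padic) \<le> inverse (real CARD('a)) ^ k \<longleftrightarrow> int CARD('a) ^ k dvd a"
proof (cases "a = 0")
  case False
  have p: "1 < real CARD('a)" using card_gt_1[where 'a = 'a] by simp
  have "padic_norm (of_int a :: 'a padic) \<le> inverse (real CARD('a)) ^ k \<longleftrightarrow> k \<le> multiplicity (int CARD('a)) a"
    unfolding padic_norm_of_int using False p
    by (auto simp: power_decreasing_iff inverse_less_1_iff)
  also have "\<dots> \<longleftrightarrow> int CARD('a) ^ k dvd a"
    using False card_gt_1[where 'a = 'a] by (subst power_dvd_iff_le_multiplicity) auto
  finally show ?thesis .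
qed simp

lemma padic_norm_diff_le: "padic_norm (x - y) \<le> max (padic_norm x) (padic_norm y)"
  using padic_norm_ultrametric[of x "- y"] by (simp add: padic_norm_minus)

lemma padic_norm_diff_commute: "padic_norm (x - y) = padic_norm (y - x)"
  using padic_norm_minus[of "x - y"] by simp

lemma padic_norm_add_le: "padic_norm x \<le> c \<Longrightarrow> padic_norm y \<le> c \<Longrightarrow> padic_norm (x + y) \<le> c"
  using padic_norm_ultrametric[of x y] by simp

lemma padic_norm_sum_le: "0 \<le> c \<Longrightarrow> (\<And>i. i \<in> A \<Longrightarrow> padic_norm (h i) \<le> c) \<Longrightarrow> padic_norm (\<Sum>i\<in>A. h i) \<le> c"
  by (induction A rule: infinite_finite_induct) (auto intro: padic_norm_add_le)

lemma dist_padic: "dist x y = padic_norm (x - y)" for x y :: "'a :: prime_card padic"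
  by (simp add: dist_padic_def)

lemma padic_norm_inverse: "padic_norm (inverse x) = inverse (padic_norm x)"
proof (cases "x = 0")
  case False
  then have "padic_norm x * padic_norm (inverse x) = 1" by (simp flip: padic_norm_mult)
  then show ?thesis by (simp add: inverse_unique)
qed simp

lemma padic_norm_divide: "padic_norm (x / y) = padic_norm x / padic_norm y"
  by (simp add: divide_inverse padic_norm_mult padic_norm_inverse)

lemma isCont_padic_norm: "continuous_on A (padic_norm :: 'a :: prime_card padic \<Rightarrow> real)"
proof -
  have "padic_norm x = dist x 0" for x :: "'a padic" by (simp add: dist_padic)
  then show ?thesis by (simp add: continuous_on_dist continuous_on_id continuous_on_const)
qed

text \<open>A rational number close to an integral \<open>x\<close> has a denominator prime to
  \<open>CARD('a)\<close>; inverting the denominator modulo the \<open>k\<close>-th power turns the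
  fraction into an integer.\<close>

lemma padic_int_dense:
  fixes x :: "'a :: prime_card padic"
  assumes "padic_norm x \<le> 1"
  obtains a :: nat where "a < CARD('a) ^ k" "padic_norm (x - of_nat a) \<le> inverse (real CARD('a)) ^ k"
proof -
  let ?p = "int CARD('a)"
  have pp: "prime ?p" using prime_card[where 'a = 'a] by simp
  have p1: "1 < real CARD('a)" using card_gt_1[where 'a = 'a] by simp
  obtain r where r: "dist (of_rat r) x < inverse (real CARD('a)) ^ k"
    using padic_rat_dense[of "inverse (real CARD('a)) ^ k" x] p1 by auto
  have le1: "inverse (real CARD('a)) ^ k \<le> 1" using p1 by (intro power_le_one) (auto simp: inverse_le_1_iff)
  have rn: "padic_norm (of_rat r :: 'a padic) \<le> 1"
    using padic_norm_ultrametric[of "of_rat r - x" x] r assms le1 by (simp add: dist_padic)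
  obtain c d where cd: "quotient_of r = (c, d)" by (cases "quotient_of r") auto
  have d: "d > 0" and cop: "coprime c d" and req: "r = of_int c / of_int d"
    using quotient_of_denom_pos[OF cd] quotient_of_coprime[OF cd] quotient_of_div[OF cd] by auto
  have pd: "\<not> ?p dvd d"
  proof
    assume pdv: "?p dvd d"
    then have "\<not> ?p dvd c" using cop pp by (meson coprime_common_divisor not_prime_unit)
    then have c: "multiplicity ?p c = 0" "c \<noteq> 0" by (auto simp: not_dvd_imp_multiplicity_0)
    have "\<not> is_unit ?p" using pp not_prime_unit by blast
    then have "multiplicity ?p d > 0" using multiplicity_gt_zero_iff[of d ?p] pdv d by simp
    then have "multiplicity ?p d \<ge> 1" by simp
    then have "1 < real CARD('a) powi (int (multiplicity ?p d))"
      using p1 by (simp add: power_int_def one_less_power)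
    moreover have "padic_norm (of_rat r :: 'a padic) = real CARD('a) powi (int (multiplicity ?p d) - int (multiplicity ?p c))"
      unfolding padic_norm_of_rat req using c d by (intro padic_abs_frac[OF prime_card]) auto
    ultimately show False using rn c by simp
  qed
  then have "coprime d (?p ^ k)" using prime_imp_coprime[OF pp, of d] by (simp add: coprime_commute)
  then obtain e where e: "[d * e = 1] (mod ?p ^ k)" using cong_solve_coprime_int by blast
  define a where "a = nat ((c * e) mod ?p ^ k)"
  have pk: "?p ^ k > 0" using card_gt_1[where 'a = 'a] by simp
  have a: "int a = (c * e) mod ?p ^ k" using pk by (simp add: a_def)
  have "?p ^ k dvd d * e - 1" using e by (simp add: cong_iff_dvd_diff)
  moreover have "?p ^ k dvd c * e - int a" unfolding a by (simp add: minus_mod_eq_div_mult)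
  \<comment> \<open>The combination equals \<open>c - d * int a\<close>.\<close>
  ultimately have "?p ^ k dvd - c * (d * e - 1) + d * (c * e - int a)" by (intro dvd_add dvd_mult)
  then have dv: "?p ^ k dvd c - d * int a" by (simp add: algebra_simps)
  have dn: "padic_norm (of_int d :: 'a padic) = 1"
    using pd d by (simp add: padic_norm_of_int not_dvd_imp_multiplicity_0)
  have "(of_rat r :: 'a padic) - of_nat a = of_int (c - d * int a) / of_int d"
    using d by (simp add: req of_rat_divide field_simps)
  then have "padic_norm (of_rat r - of_nat a :: 'a padic) \<le> inverse (real CARD('a)) ^ k"
    using dv by (simp only: padic_norm_divide dn padic_norm_of_int_le_iff div_by_1)
  then have "padic_norm ((x - of_rat r) + (of_rat r - of_nat a)) \<le> inverse (real CARD('a)) ^ k"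
    using r by (intro padic_norm_add_le) (simp_all add: dist_padic padic_norm_diff_commute[of x])
  then have 2: "padic_norm (x - of_nat a) \<le> inverse (real CARD('a)) ^ k" by simp
  have "int a < ?p ^ k" unfolding a using pk by simp
  then have "a < CARD('a) ^ k" by (metis of_nat_less_iff of_nat_power)
  then show ?thesis using 2 that by blast
qed

section \<open>Linear maps congruent to the identity\<close>

definition ivec :: "('a :: prime_card padic ^ 'N) set" where
  "ivec = {v. \<forall>a. padic_norm (v $ a) \<le> 1}"

text \<open>Congruence to the identity modulo the \<open>l\<close>-th power of the prime, expressed
  on the lattice of integral vectors so that composition needs no matrix entries.\<close>

definition near :: "nat \<Rightarrow> ('a :: prime_card padic ^ 'N \<Rightarrow> 'a padic ^ 'N) \<Rightarrow> bool" where
  "near l W \<longleftrightarrow> Vector_Spaces.linear (*s) (*s) W \<and>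
     (\<forall>v\<in>ivec. \<forall>a. padic_norm ((W v - v) $ a) \<le> inverse (real CARD('a)) ^ l)"

lemma q_pow_le_1: "inverse (real CARD('a :: prime_card)) ^ l \<le> 1"
  using card_gt_1[where 'a = 'a] by (intro power_le_one) (auto simp: inverse_le_1_iff)

lemma near_ivec:
  assumes W: "near l W" and v: "v \<in> ivec"
  shows "W v \<in> ivec"
  unfolding ivec_def
proof (intro CollectI allI)
  fix a
  have "padic_norm ((W v - v) $ a + v $ a) \<le> 1"
    using W v q_pow_le_1[of l] unfolding near_def ivec_def
    by (intro padic_norm_add_le) (auto intro: order_trans)
  then show "padic_norm (W v $ a) \<le> 1" by simp
qed

lemma near_id: "near l (\<lambda>v. v)"
  using card_gt_1 by (auto simp: near_def vec.linear_ident)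

lemma near_comp:
  assumes "near l W" "near l W'"
  shows "near l (\<lambda>v. W (W' v))"
  unfolding near_def
proof (intro conjI ballI allI)
  show "Vector_Spaces.linear (*s) (*s) (\<lambda>v. W (W' v))"
    using assms Vector_Spaces.linear_compose[of "(*s)" "(*s)" W' "(*s)" W] by (simp add: near_def o_def)
  fix v :: "'a padic ^ 'b" and a assume v: "v \<in> ivec"
  have "padic_norm ((W (W' v) - W' v) $ a + (W' v - v) $ a) \<le> inverse (real CARD('a)) ^ l"
    using assms v near_ivec[OF assms(2) v] unfolding near_def by (intro padic_norm_add_le) auto
  then show "padic_norm ((W (W' v) - v) $ a) \<le> inverse (real CARD('a)) ^ l" by simp
qed

lemma near_funpow: "near l W \<Longrightarrow> near l (W ^^ n)"
proof (induction n)
  case 0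
  show ?case using near_id[of l] by (simp add: id_def)
next
  case (Suc n)
  then show ?case using near_comp[of l W "W ^^ n"] by (simp add: o_def)
qed

lemma near_mono: "l' \<le> l \<Longrightarrow> near l W \<Longrightarrow> near l' W"
  for W :: "'a :: prime_card padic ^ 'N \<Rightarrow> 'a padic ^ 'N"
proof -
  assume l: "l' \<le> l" and W: "near l W"
  have "inverse (real CARD('a)) ^ l \<le> inverse (real CARD('a)) ^ l'"
    using card_gt_1[where 'a = 'a] l by (intro power_decreasing) (auto simp: inverse_le_1_iff)
  then show "near l' W" using W unfolding near_def by (meson order_trans)
qed

lemma padic_norm_card: "padic_norm (of_nat CARD('a) :: 'a :: prime_card padic) = inverse (real CARD('a))"
proof -
  have "multiplicity (int CARD('a)) (int CARD('a)) = 1"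
    using card_gt_1[where 'a = 'a] by (intro multiplicity_self) auto
  then show ?thesis using padic_norm_of_int[of "int CARD('a)", where 'a = 'a] by simp
qed

text \<open>Write the prime as q and \<open>W v - v\<close> as \<open>q^l\<close> times an integral
  vector. The difference for the q-th power is the sum of the images of \<open>W v - v\<close> under
  the first q powers of \<open>W\<close>. These images agree modulo one further factor q because
  \<open>l \<ge> 1\<close>, so a sum of q of them is divisible by q once more.\<close>

lemma near_card_power:
  fixes W :: "'a :: prime_card padic ^ 'N \<Rightarrow> 'a padic ^ 'N"
  assumes W: "near l W" and l: "l \<ge> 1"
  shows "near (Suc l) (W ^^ CARD('a))"
  unfolding near_def
proof (intro conjI ballI allI)
  let ?q = "CARD('a)"
  define \<pi> where "\<pi> = (of_nat ?q :: 'a padic)"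
  have \<pi>n: "padic_norm (\<pi> ^ j) = inverse (real ?q) ^ j" for j
    by (induction j) (simp_all add: padic_norm_mult padic_norm_card \<pi>_def)
  have \<pi>0: "\<pi> \<noteq> 0" using card_gt_1[where 'a = 'a] by (simp add: \<pi>_def)
  have lin: "Vector_Spaces.linear (*s) (*s) (W ^^ n)" for n using near_funpow[OF W] by (simp add: near_def)
  show "Vector_Spaces.linear (*s) (*s) (W ^^ ?q)" by (rule lin)
  fix v :: "'a padic ^ 'N" and a assume v: "v \<in> ivec"
  define d where "d = W v - v"
  define d' where "d' = inverse (\<pi> ^ l) *s d"
  have d: "d = \<pi> ^ l *s d'" using \<pi>0 by (simp add: d'_def vector_smult_assoc)
  have d': "d' \<in> ivec" unfolding ivec_def
  proof (intro CollectI allI)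
    fix a
    have "padic_norm (d $ a) \<le> inverse (real ?q) ^ l" using W v unfolding near_def d_def by blast
    then have "inverse (inverse (real ?q) ^ l) * padic_norm (d $ a) \<le> inverse (inverse (real ?q) ^ l) * inverse (real ?q) ^ l"
      by (rule mult_left_mono) simp
    moreover have "padic_norm (d' $ a) = inverse (inverse (real ?q) ^ l) * padic_norm (d $ a)"
      by (simp only: d'_def vector_smult_component padic_norm_mult padic_norm_inverse \<pi>n)
    ultimately show "padic_norm (d' $ a) \<le> 1" using card_gt_1[where 'a = 'a] by simp
  qed
  have tel: "(W ^^ n) v - v = (\<Sum>i<n. (W ^^ i) d)" for n
  proof (induction n)
    case (Suc n)
    have "(W ^^ Suc n) v = (W ^^ n) (v + d)" by (simp only: funpow_Suc_right o_apply) (simp add: d_def)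
    also have "\<dots> = (W ^^ n) v + (W ^^ n) d" by (rule vec.linear_add[OF lin])
    finally show ?case using Suc by (simp add: algebra_simps)
  qed simp
  have "(W ^^ ?q) v - v = \<pi> ^ l *s (\<Sum>i<?q. (W ^^ i) d')"
    unfolding tel d vec.linear_scale[OF lin] by (simp add: vec.scale_sum_right)
  also have "(\<Sum>i<?q. (W ^^ i) d') = \<pi> *s d' + (\<Sum>i<?q. (W ^^ i) d' - d')"
    by (simp add: sum_subtractf \<pi>_def vec_eq_iff of_nat_index)
  finally have "(W ^^ ?q) v - v = \<pi> ^ l *s (\<pi> *s d' + (\<Sum>i<?q. (W ^^ i) d' - d'))" .
  then have eq: "((W ^^ ?q) v - v) $ a = \<pi> ^ l * (\<pi> * d' $ a + (\<Sum>i<?q. ((W ^^ i) d' - d') $ a))"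
    by (simp only: vector_smult_component vector_add_component sum_component)
  have q1: "inverse (real ?q) ^ l \<le> inverse (real ?q)"
    using card_gt_1[where 'a = 'a] l power_decreasing[of 1 l "inverse (real ?q)"] by (simp add: inverse_le_1_iff)
  have "padic_norm (\<pi> * d' $ a + (\<Sum>i<?q. ((W ^^ i) d' - d') $ a)) \<le> inverse (real ?q)"
  proof (rule padic_norm_add_le)
    show "padic_norm (\<pi> * d' $ a) \<le> inverse (real ?q)"
      using d' by (simp add: ivec_def padic_norm_mult padic_norm_card \<pi>_def mult_left_le)
    show "padic_norm (\<Sum>i<?q. ((W ^^ i) d' - d') $ a) \<le> inverse (real ?q)"
      using near_funpow[OF W] d' q1 unfolding near_def by (intro padic_norm_sum_le) (auto intro: order_trans)
  qed
  then show "padic_norm (((W ^^ ?q) v - v) $ a) \<le> inverse (real ?q) ^ Suc l"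
    unfolding eq padic_norm_mult \<pi>n using card_gt_1[where 'a = 'a] by (simp add: mult_left_mono mult.commute)
qed

text \<open>Makes the powers of \<open>W\<close> continuous in the exponent for the adic topology of
  the prime.\<close>

lemma near_power_dvd:
  fixes W :: "'a :: prime_card padic ^ 'N \<Rightarrow> 'a padic ^ 'N"
  assumes W: "near 1 W" and "CARD('a) ^ l dvd n"
  shows "near (Suc l) (W ^^ n)"
proof -
  have "near (Suc l) (W ^^ (CARD('a) ^ l))"
  proof (induction l)
    case (Suc l)
    have "(W ^^ (CARD('a) ^ l)) ^^ CARD('a) = W ^^ (CARD('a) ^ Suc l)" by (simp add: funpow_mult mult.commute)
    then show ?case using near_card_power[OF Suc] by simp
  qed (use W in simp)
  moreover obtain c where "n = CARD('a) ^ l * c" using assms(2) by blast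
  ultimately show ?thesis using near_funpow[of "Suc l" "W ^^ (CARD('a) ^ l)" c] by (simp add: funpow_mult)
qed

lemma padic_vec_tendsto_iff:
  fixes X :: "nat \<Rightarrow> 'a :: prime_card padic ^ 'N"
  shows "X \<longlonglongrightarrow> L \<longleftrightarrow> (\<forall>a. (\<lambda>j. X j $ a) \<longlonglongrightarrow> L $ a)"
  using vec_tendstoI[of X L sequentially] tendsto_vec_nth[of X L sequentially] by blast

lemma padic_vec_tendsto_add:
  fixes X Y :: "nat \<Rightarrow> 'a :: prime_card padic ^ 'N"
  shows "X \<longlonglongrightarrow> L \<Longrightarrow> Y \<longlonglongrightarrow> K \<Longrightarrow> (\<lambda>j. X j + Y j) \<longlonglongrightarrow> L + K"
  unfolding padic_vec_tendsto_iff by (auto intro: tendsto_add)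

lemma tendsto_linear_padic:
  fixes g :: "'a :: prime_card padic ^ 'N \<Rightarrow> 'a padic ^ 'K"
  assumes g: "Vector_Spaces.linear (*s) (*s) g" and X: "X \<longlonglongrightarrow> L"
  shows "(\<lambda>j. g (X j)) \<longlonglongrightarrow> g L"
proof -
  have "g v = matrix g *v v" for v using matrix_works[OF g] by simp
  moreover have "(\<lambda>j. (matrix g *v X j) $ a) \<longlonglongrightarrow> (matrix g *v L) $ a" for a
    unfolding matrix_vector_mult_def vec_lambda_beta
    by (intro tendsto_sum tendsto_mult tendsto_const tendsto_vec_nth X)
  ultimately show ?thesis by (simp add: padic_vec_tendsto_iff)
qed

lemma padic_tendsto_norm_iff:
  fixes X :: "nat \<Rightarrow> 'a :: prime_card padic"
  shows "X \<longlonglongrightarrow> L \<longleftrightarrow> (\<forall>l. \<forall>\<^sub>F j in sequentially. padic_norm (X j - L) \<le> inverse (real CARD('a)) ^ l)"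
proof
  assume X: "X \<longlonglongrightarrow> L"
  show "\<forall>l. \<forall>\<^sub>F j in sequentially. padic_norm (X j - L) \<le> inverse (real CARD('a)) ^ l"
  proof
    fix l
    have "\<forall>\<^sub>F j in sequentially. dist (X j) L < inverse (real CARD('a)) ^ l"
      using X card_gt_1[where 'a = 'a] by (intro tendstoD) auto
    then show "\<forall>\<^sub>F j in sequentially. padic_norm (X j - L) \<le> inverse (real CARD('a)) ^ l"
      by (rule eventually_mono) (simp add: dist_padic)
  qed
next
  assume l: "\<forall>l. \<forall>\<^sub>F j in sequentially. padic_norm (X j - L) \<le> inverse (real CARD('a)) ^ l"
  show "X \<longlonglongrightarrow> L"
  proof (rule tendstoI)
    fix e :: real assume "e > 0"
    moreover have "inverse (real CARD('a)) < 1" using card_gt_1[where 'a = 'a] by (simp add: inverse_less_1_iff)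
    ultimately obtain l where "inverse (real CARD('a)) ^ l < e" using real_arch_pow_inv by blast
    then show "\<forall>\<^sub>F j in sequentially. dist (X j) L < e"
      using l by (auto elim!: eventually_mono[OF spec[of _ l]] simp: dist_padic)
  qed
qed

text \<open>On the cyclic space of \<open>y\<close> the maps \<open>s j *s U ^^ \<sigma> j\<close>
  tend to the identity, since they commute with \<open>U\<close>. Let \<open>W j\<close> be their
  extension to the whole space and fix \<open>i\<close> with \<open>W i\<close> congruent to 1. The
  \<open>\<sigma> j\<close>-th power of \<open>W i\<close> sends \<open>y\<close> to vectors tending
  to \<open>W i y\<close>, as the exponent tends adically to 1; the \<open>\<sigma> i\<close>-th
  power of \<open>W j\<close> sends \<open>y\<close> to vectors tending to \<open>y\<close>. For
  each \<open>j\<close> both vectors are multiples of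
  \<open>(U ^^ (\<sigma> i * \<sigma> j)) y\<close>, so their limits are proportional.\<close>

theorem line_recurrence:
  fixes U :: "'a :: prime_card padic ^ 'N \<Rightarrow> 'a padic ^ 'N" and y :: "'a padic ^ 'N"
  assumes U: "Vector_Spaces.linear (*s) (*s) U" and y: "y \<in> ivec" "y $ a0 = 1"
    and s: "\<And>j. s j \<noteq> 0" and lim: "(\<lambda>j. s j *s (U ^^ \<sigma> j) y) \<longlonglongrightarrow> y"
    and \<sigma>: "\<And>j. \<sigma> j \<ge> 1" "\<And>l. \<forall>\<^sub>F j in sequentially. CARD('a) ^ l dvd \<sigma> j - 1"
  shows "\<exists>i \<kappa>. (U ^^ \<sigma> i) y = \<kappa> *s y"
proof -
  have lin: "Vector_Spaces.linear (*s) (*s) (U ^^ n)" for n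
  proof (induction n)
    case 0
    show ?case using vec.linear_ident by (simp add: id_def)
  next
    case (Suc n)
    show ?case using Vector_Spaces.linear_compose[OF Suc U] by (simp only: funpow.simps(2))
  qed
  have Ucomm: "(U ^^ m) ((U ^^ n) v) = (U ^^ n) ((U ^^ m) v)" for m n v
    using fun_cong[OF funpow_add[of m n U], of v] fun_cong[OF funpow_add[of n m U], of v] by (simp add: add.commute)
  define E where "E = vec.span (range (\<lambda>n. (U ^^ n) y))"
  have yE: "y \<in> E" unfolding E_def by (rule vec.span_base) (rule image_eqI[of _ _ 0], simp_all)
  have UE: "(U ^^ n) v \<in> E" if "v \<in> E" for n v
    using that unfolding E_def
  proof (induction rule: vec.span_induct_alt)
    case base
    show ?case using vec.linear_0[OF lin] vec.span_zero by simp
  next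
    case (step c x z)
    then obtain m where "x = (U ^^ m) y" by auto
    then have "(U ^^ n) x \<in> range (\<lambda>n. (U ^^ n) y)"
      using fun_cong[OF funpow_add[of n m U], of y] by (intro image_eqI[of _ _ "n + m"]) simp_all
    then show ?case using step
      by (simp add: vec.linear_add[OF lin] vec.linear_scale[OF lin] vec.span_add vec.span_scale vec.span_base)
  qed
  define T where "T j v = s j *s (U ^^ \<sigma> j) v" for j v
  have Tlin: "Vector_Spaces.linear (*s) (*s) (T j)" for j
    unfolding T_def using vec.linear_compose_scale_right[OF lin] by simp
  have TE: "T j v \<in> E" if "v \<in> E" for j v
    unfolding T_def using UE[OF that] by (simp add: E_def vec.span_scale)
  have Tlim: "(\<lambda>j. T j v) \<longlonglongrightarrow> v" if "v \<in> E" for v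
    using that unfolding E_def
  proof (induction rule: vec.span_induct_alt)
    case base
    show ?case using vec.linear_0[OF Tlin] by simp
  next
    case (step c x z)
    then obtain m where m: "x = (U ^^ m) y" by auto
    have "T j x = (U ^^ m) (s j *s (U ^^ \<sigma> j) y)" for j
      by (simp only: T_def m Ucomm[of "\<sigma> j" m] vec.linear_scale[OF lin])
    then have x: "(\<lambda>j. T j x) \<longlonglongrightarrow> x" using tendsto_linear_padic[OF lin[of m] lim] by (simp add: m)
    have "(\<lambda>j. (c *s T j x) $ a) \<longlonglongrightarrow> (c *s x) $ a" for a
      unfolding vector_smult_component by (intro tendsto_mult tendsto_const tendsto_vec_nth x)
    then have "(\<lambda>j. c *s T j x) \<longlonglongrightarrow> c *s x" by (simp only: padic_vec_tendsto_iff) simp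
    then have "(\<lambda>j. c *s T j x + T j z) \<longlonglongrightarrow> c *s x + z"
      using step by (intro padic_vec_tendsto_add)
    then show ?case by (simp add: vec.linear_add[OF Tlin] vec.linear_scale[OF Tlin])
  qed
  \<comment> \<open>A projection onto the cyclic space. Nothing is known about \<open>T j\<close>
    off this space; taking the identity on the kernel of \<open>\<pi>\<close> instead yields maps of
    the whole space that tend to the identity.\<close>
  obtain \<pi> where \<pi>: "Vector_Spaces.linear (*s) (*s) \<pi>" "\<And>v. v \<in> E \<Longrightarrow> \<pi> v = v" "\<And>v. \<pi> v \<in> E"
  proof -
    obtain B where B: "B \<subseteq> E" "vec.independent B" "E \<subseteq> vec.span B" using vec.maximal_independent_subset by blast
    obtain g where g: "Vector_Spaces.linear (*s) (*s) g" "\<And>x. x \<in> B \<Longrightarrow> g x = x" "range g = vec.span ((\<lambda>x. x) ` B)"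
      using vec.linear_independent_extend_subspace[OF B(2), of "\<lambda>x. x"] by blast
    have "vec.span B \<subseteq> E" using vec.span_minimal[OF B(1)] by (simp add: E_def vec.subspace_span)
    then have 1: "g v \<in> E" for v using g(3) by auto
    have "g v = v" if "v \<in> E" for v
      using vec.linear_eq_on[OF g(1) vec.linear_ident, of v B] that B(3) g(2) by blast
    then show ?thesis using that g(1) 1 by blast
  qed
  define W where "W j v = T j (\<pi> v) + (v - \<pi> v)" for j v
  have Wlin: "Vector_Spaces.linear (*s) (*s) (W j)" for j
  proof -
    have "Vector_Spaces.linear (*s) (*s) (\<lambda>v. T j (\<pi> v))"
      using Vector_Spaces.linear_compose[OF \<pi>(1) Tlin] by (simp add: o_def)
    then show ?thesis unfolding W_def
      by (intro vec.linear_compose_add vec.linear_compose_sub vec.linear_ident \<pi>(1))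
  qed
  have Wlim: "(\<lambda>j. W j v) \<longlonglongrightarrow> v" for v
  proof -
    have "(\<lambda>j. T j (\<pi> v) + (v - \<pi> v)) \<longlonglongrightarrow> \<pi> v + (v - \<pi> v)"
      by (intro padic_vec_tendsto_add tendsto_const Tlim \<pi>(3))
    then show ?thesis by (simp add: W_def)
  qed
  have Wpow: "(W j ^^ n) y = s j ^ n *s (U ^^ (\<sigma> j * n)) y" for j n
  proof (induction n)
    case (Suc n)
    have "s j ^ n *s (U ^^ (\<sigma> j * n)) y \<in> E" using UE[OF yE] by (simp add: E_def vec.span_scale)
    then have "W j (s j ^ n *s (U ^^ (\<sigma> j * n)) y) = T j (s j ^ n *s (U ^^ (\<sigma> j * n)) y)"
      by (simp add: W_def \<pi>(2))
    also have "\<dots> = s j ^ Suc n *s (U ^^ (\<sigma> j * Suc n)) y"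
      by (simp add: T_def vec.linear_scale[OF lin] vector_smult_assoc funpow_add mult.commute)
    finally show ?case using Suc by simp
  qed simp
  have Wnear: "\<forall>\<^sub>F j in sequentially. near l (W j)" for l
  proof -
    have "\<forall>\<^sub>F j in sequentially. \<forall>b a. padic_norm ((W j (axis b 1) - axis b 1) $ a) \<le> inverse (real CARD('a)) ^ l"
    proof (intro eventually_all_finite)
      fix b a :: 'N
      have "(\<lambda>j. W j (axis b 1) $ a) \<longlonglongrightarrow> axis b 1 $ a" by (intro tendsto_vec_nth Wlim)
      then show "\<forall>\<^sub>F j in sequentially. padic_norm ((W j (axis b 1) - axis b 1) $ a) \<le> inverse (real CARD('a)) ^ l"
        unfolding padic_tendsto_norm_iff vector_minus_component by blast
    qed
    then show ?thesis
    proof (rule eventually_mono)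
      fix j assume j: "\<forall>b a. padic_norm ((W j (axis b 1) - axis b 1) $ a) \<le> inverse (real CARD('a)) ^ l"
      show "near l (W j)" unfolding near_def
      proof (intro conjI ballI allI Wlin)
        fix v :: "'a padic ^ 'N" and a assume v: "v \<in> ivec"
        have "v = (\<Sum>b\<in>UNIV. v $ b *s axis b 1)" by (simp add: basis_expansion)
        then have "W j v = W j (\<Sum>b\<in>UNIV. v $ b *s axis b 1)" by simp
        also have "\<dots> = (\<Sum>b\<in>UNIV. v $ b *s W j (axis b 1))"
          by (simp add: vec.linear_sum[OF Wlin] vec.linear_scale[OF Wlin])
        finally have "W j v - v = (\<Sum>b\<in>UNIV. v $ b *s W j (axis b 1)) - (\<Sum>b\<in>UNIV. v $ b *s axis b 1)"
          by (simp add: basis_expansion)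
        also have "\<dots> = (\<Sum>b\<in>UNIV. v $ b *s (W j (axis b 1) - axis b 1))"
          by (simp add: sum_subtractf vec.scale_right_diff_distrib)
        finally have "(W j v - v) $ a = (\<Sum>b\<in>UNIV. v $ b * (W j (axis b 1) - axis b 1) $ a)"
          by (simp only: sum_component vector_smult_component)
        also have "padic_norm \<dots> \<le> inverse (real CARD('a)) ^ l"
        proof (rule padic_norm_sum_le)
          fix b
          have "padic_norm (v $ b) * padic_norm ((W j (axis b 1) - axis b 1) $ a) \<le> 1 * inverse (real CARD('a)) ^ l"
            using v j by (intro mult_mono) (auto simp: ivec_def padic_norm_nonneg)
          then show "padic_norm (v $ b * (W j (axis b 1) - axis b 1) $ a) \<le> inverse (real CARD('a)) ^ l"
            by (simp only: padic_norm_mult mult_1)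
        qed simp
        finally show "padic_norm ((W j v - v) $ a) \<le> inverse (real CARD('a)) ^ l" .
      qed
    qed
  qed
  obtain i where i: "near 1 (W i)" using Wnear[of 1] by (auto simp: eventually_sequentially)
  define w where "w j = (W i ^^ \<sigma> j) y" for j
  define z where "z j = (W j ^^ \<sigma> i) y" for j
  have wi: "W i y \<in> ivec" by (rule near_ivec[OF i y(1)])
  have wlim: "(\<lambda>j. w j $ a) \<longlonglongrightarrow> W i y $ a" for a
    unfolding padic_tendsto_norm_iff
  proof
    fix l
    show "\<forall>\<^sub>F j in sequentially. padic_norm (w j $ a - W i y $ a) \<le> inverse (real CARD('a)) ^ l"
      using \<sigma>(2)[of l]
    proof (rule eventually_mono)
      fix j assume "CARD('a) ^ l dvd \<sigma> j - 1"
      then have "near l (W i ^^ (\<sigma> j - 1))" by (intro near_mono[OF _ near_power_dvd[OF i], of l l]) simp_all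
      \<comment> \<open>One application is split off because it is \<open>\<sigma> j - 1\<close>
        that becomes highly divisible.\<close>
      moreover have "w j = (W i ^^ (\<sigma> j - 1)) (W i y)"
        unfolding w_def using \<sigma>(1)[of j] funpow_Suc_right[of "\<sigma> j - 1" "W i"] by (simp del: funpow.simps)
      ultimately show "padic_norm (w j $ a - W i y $ a) \<le> inverse (real CARD('a)) ^ l"
        using wi unfolding near_def by (simp only: vector_minus_component[symmetric])
    qed
  qed
  have zlim: "(\<lambda>j. z j $ a) \<longlonglongrightarrow> y $ a" for a
    unfolding padic_tendsto_norm_iff
  proof
    fix l
    show "\<forall>\<^sub>F j in sequentially. padic_norm (z j $ a - y $ a) \<le> inverse (real CARD('a)) ^ l"
      using Wnear[of l]
    proof (rule eventually_mono)
      fix j assume "near l (W j)"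
      then have "near l (W j ^^ \<sigma> i)" by (rule near_funpow)
      then show "padic_norm (z j $ a - y $ a) \<le> inverse (real CARD('a)) ^ l"
        using y(1) unfolding near_def z_def by (simp only: vector_minus_component[symmetric])
    qed
  qed
  have cross: "w j $ a * z j $ b = w j $ b * z j $ a" for j a b
    unfolding w_def z_def Wpow by (simp add: mult_ac)
  have lims: "W i y $ a * y $ b = W i y $ b * y $ a" for a b
  proof (rule LIMSEQ_unique)
    show "(\<lambda>j. w j $ a * z j $ b) \<longlonglongrightarrow> W i y $ a * y $ b" by (intro tendsto_mult wlim zlim)
    show "(\<lambda>j. w j $ a * z j $ b) \<longlonglongrightarrow> W i y $ b * y $ a" unfolding cross[of _ a b] by (intro tendsto_mult wlim zlim)
  qed
  have Wi: "W i y = s i *s (U ^^ \<sigma> i) y" using Wpow[where j = i and n = 1] by simp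
  have "W i y $ a = W i y $ a0 * y $ a" for a using lims[of a a0] by (simp only: y(2) mult_1_right)
  then have "W i y = (W i y $ a0) *s y" unfolding vec_eq_iff vector_smult_component by (rule allI)
  then have "s i *s (U ^^ \<sigma> i) y = (W i y $ a0) *s y" unfolding Wi[symmetric] .
  then have "inverse (s i) *s (s i *s (U ^^ \<sigma> i) y) = inverse (s i) *s ((W i y $ a0) *s y)" by (rule arg_cong)
  then have "(U ^^ \<sigma> i) y = (inverse (s i) * (W i y $ a0)) *s y" using s[of i] by (simp add: vector_smult_assoc)
  then show ?thesis by blast
qed

section \<open>Pluecker coordinates\<close>

text \<open>Identifies the coordinate type with an initial segment of the numbers, so that the first
  \<open>k\<close> rows of a matrix make sense.\<close>

definition idx :: "'n :: finite \<Rightarrow> nat" where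
  "idx = (SOME h. bij_betw h (UNIV :: 'n set) {..<CARD('n)})"

lemma idx_bij: "bij_betw idx (UNIV :: 'n :: finite set) {..<CARD('n)}"
proof -
  have "\<exists>h. bij_betw h (UNIV :: 'n set) {0..<CARD('n)}" by (rule ex_bij_betw_finite_nat) simp
  then have "\<exists>h. bij_betw h (UNIV :: 'n set) {..<CARD('n)}" by (simp add: lessThan_atLeast0)
  then show ?thesis unfolding idx_def by (rule someI_ex)
qed

lemma inj_idx: "idx i = idx j \<longleftrightarrow> i = j"
  using idx_bij by (auto simp: bij_betw_def inj_on_def)

lemma idx_surj: "m < CARD('n :: finite) \<Longrightarrow> \<exists>i::'n. idx i = m"
  using idx_bij[where 'n = 'n] by (metis bij_betw_imp_surj_on imageE lessThan_iff)

text \<open>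
  Pluecker coordinates without exterior powers: the coordinate \<open>J\<close> of a \<open>k\<close>-frame is the determinant of the matrix whose
  first \<open>k\<close> rows (in the enumeration \<open>idx\<close>) are the frame and whose remaining rows are the unit vectors \<open>J i\<close>.
\<close>

definition frame_rows :: "nat \<Rightarrow> (nat \<Rightarrow> 'a :: field ^ 'n) \<Rightarrow> ('n \<Rightarrow> 'a ^ 'n) \<Rightarrow> 'a ^ 'n ^ 'n" where
  "frame_rows k v W = (\<chi> i. if idx i < k then v (idx i) else W i)"

definition plucker :: "nat \<Rightarrow> (nat \<Rightarrow> 'a :: field ^ 'n) \<Rightarrow> 'a ^ ('n \<Rightarrow> 'n)" where
  "plucker k v = (\<chi> J. det (frame_rows k v (\<lambda>i. axis (J i) 1)))"

text \<open>The coefficient of the coordinate \<open>J\<close> when only the rows of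
  \<open>W\<close> are expanded. On the first \<open>k\<close> rows \<open>J\<close> is pinned to
  the identity, so that each choice for the other rows occurs once among all functions.\<close>

definition minor_coeff :: "nat \<Rightarrow> ('n \<Rightarrow> 'a :: field ^ 'n) \<Rightarrow> ('n \<Rightarrow> 'n) \<Rightarrow> 'a" where
  "minor_coeff k W J = (if \<forall>i. idx i < k \<longrightarrow> J i = i then \<Prod>i\<in>UNIV. (if idx i < k then 1 else W i $ J i) else 0)"

lemma det_frame_rows_expand:
  fixes v :: "nat \<Rightarrow> 'a :: field ^ 'n"
  shows "det (frame_rows k v W) = (\<Sum>J\<in>UNIV. minor_coeff k W J * plucker k v $ J)"
proof -
  \<comment> \<open>A frame row is written as a sum with a single nonzero term, at
    \<open>j = i\<close>, so that the expansion can treat all rows alike.\<close>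
  define a where "a i j = (if idx i < k then (if j = i then v (idx i) else 0) else W i $ j *s axis j 1)" for i j :: 'n
  have "frame_rows k v W = (\<chi> i. sum (a i) UNIV)"
    unfolding frame_rows_def by (rule arg_cong[of _ _ vec_lambda]) (auto simp: a_def fun_eq_iff basis_expansion)
  then have "det (frame_rows k v W) = (\<Sum>J | \<forall>i. J i \<in> UNIV. det (\<chi> i. a i (J i)))"
    by (simp only: det_linear_rows_sum[OF finite])
  also have "\<dots> = (\<Sum>J\<in>UNIV. minor_coeff k W J * plucker k v $ J)"
  proof (intro sum.cong)
    fix J :: "'n \<Rightarrow> 'n"
    show "det (\<chi> i. a i (J i)) = minor_coeff k W J * plucker k v $ J"
    proof (cases "\<forall>i. idx i < k \<longrightarrow> J i = i")
      case True
      let ?c = "\<lambda>i. if idx i < k then 1 else W i $ J i"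
      let ?r = "\<lambda>i. if idx i < k then v (idx i) else axis (J i) 1"
      have "(\<chi> i. a i (J i)) = (\<chi> i. ?c i *s ?r i)"
        using True by (intro arg_cong[of _ _ vec_lambda]) (auto simp: a_def fun_eq_iff)
      then have "det (\<chi> i. a i (J i)) = det (\<chi> i. ?c i *s ?r i)" by simp
      also have "\<dots> = prod ?c UNIV * det (\<chi> i. ?r i)" by (rule det_rows_mul)
      finally show ?thesis using True by (simp add: minor_coeff_def plucker_def frame_rows_def)
    next
      case False
      then obtain i where i: "idx i < k" "J i \<noteq> i" by blast
      have "row i (\<chi> i. a i (J i)) = 0" using i by (simp add: row_def a_def vec_eq_iff)
      then have "det (\<chi> i. a i (J i)) = 0" by (rule det_zero_row(2))
      then show ?thesis using False by (auto simp: minor_coeff_def)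
    qed
  qed simp
  finally show ?thesis .
qed

lemma vec_dim_UNIV: "vec.dim (UNIV :: ('a :: field ^ 'n) set) = CARD('n)"
  by (simp add: vec.dim_UNIV card_cart_basis)

lemma matrix_inv_vec:
  fixes A :: "'a :: field ^ 'n ^ 'n"
  assumes "invertible A"
  shows "A *v (matrix_inv A *v x) = x" "matrix_inv A *v (A *v x) = x"
  using someI_ex[OF assms[unfolded invertible_def]] unfolding matrix_inv_def
  by (simp_all add: matrix_vector_mul_assoc)

lemma frame_extends:
  fixes v :: "nat \<Rightarrow> 'a :: field ^ 'n"
  assumes v: "inj_on v {..<k}" "vec.independent (v ` {..<k})"
  obtains W where "det (frame_rows k v W) \<noteq> 0" "vec.independent (range (\<lambda>i. frame_rows k v W $ i))" "inj (\<lambda>i. frame_rows k v W $ i)"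
    "vec.span (range (\<lambda>i. frame_rows k v W $ i)) = UNIV"
proof -
  let ?B = "v ` {..<k}"
  let ?B' = "vec.extend_basis ?B"
  have B': "?B \<subseteq> ?B'" "vec.independent ?B'" "vec.span ?B' = UNIV"
    using vec.extend_basis_superset[OF v(2)] vec.independent_extend_basis[OF v(2)] vec.span_extend_basis[OF v(2)] by auto
  have fin: "finite ?B'" using B'(2) by (rule vec.finiteI_independent)
  have cB': "card ?B' = CARD('n)"
    using vec.dim_eq_card_independent[OF B'(2)] vec.dim_span[of ?B'] vec_dim_UNIV[where 'a = 'a and 'n = 'n] B'(3)
    by metis
  have cB: "card ?B = k" using card_image[OF v(1)] by simp
  have kn: "k \<le> CARD('n)" using card_mono[OF fin B'(1)] cB cB' by simp
  have "card (?B' - ?B) = card {k..<CARD('n)}" using card_Diff_subset[OF finite_subset[OF B'(1) fin] B'(1)] cB cB' by simp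
  then obtain h where h: "bij_betw h {k..<CARD('n)} (?B' - ?B)"
    using finite_same_card_bij[of "{k..<CARD('n)}" "?B' - ?B"] fin by auto
  define F where "F m = (if m < k then v m else h m)" for m
  have "bij_betw F ({..<k} \<union> {k..<CARD('n)}) (?B \<union> (?B' - ?B))"
  proof (rule bij_betw_combine)
    show "bij_betw F {..<k} ?B" using v(1) by (auto simp: F_def bij_betw_def inj_on_def)
    show "bij_betw F {k..<CARD('n)} (?B' - ?B)"
      using h by (rule bij_betw_cong[THEN iffD1, rotated]) (auto simp: F_def)
  qed auto
  moreover have "{..<k} \<union> {k..<CARD('n)} = {..<CARD('n)}" using kn by auto
  moreover have "?B \<union> (?B' - ?B) = ?B'" using B'(1) by auto
  ultimately have F: "bij_betw F {..<CARD('n)} ?B'" by simp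
  then have Fi: "bij_betw (F \<circ> idx) (UNIV :: 'n set) ?B'" using bij_betw_trans[OF idx_bij] by blast
  define W where "W i = h (idx i)" for i :: 'n
  have row: "frame_rows k v W $ i = (F \<circ> idx) i" for i by (simp add: frame_rows_def F_def W_def)
  have rng: "range (\<lambda>i. frame_rows k v W $ i) = ?B'" using Fi unfolding row by (simp add: bij_betw_def)
  have inj: "inj (\<lambda>i. frame_rows k v W $ i)" using Fi unfolding row by (simp add: bij_betw_def o_def)
  have "\<exists>C. frame_rows k v W ** C = mat 1"
    unfolding matrix_right_invertible_independent_rows
  proof (intro allI impI)
    fix c :: "'n \<Rightarrow> 'a" and i :: 'n assume c: "(\<Sum>i\<in>UNIV. c i *s row i (frame_rows k v W)) = 0"
    let ?g = "inv_into (UNIV :: 'n set) (F \<circ> idx)"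
    have ro: "row i (frame_rows k v W) = (F \<circ> idx) i" for i :: 'n unfolding row_def using row[of i] by (simp add: vec_eq_iff)
    have gi: "?g ((F \<circ> idx) i) = i" for i :: 'n
      by (rule inv_into_f_f[OF bij_betw_imp_inj_on[OF Fi] UNIV_I])
    have "(\<Sum>b\<in>?B'. c (?g b) *s b) = (\<Sum>i\<in>(UNIV :: 'n set). c (?g ((F \<circ> idx) i)) *s (F \<circ> idx) i)"
      by (rule sum.reindex_bij_betw[OF Fi, symmetric])
    also have "\<dots> = 0" using c unfolding ro gi .
    finally have "(\<Sum>b\<in>?B'. c (?g b) *s b) = 0" .
    then have "c (?g ((F \<circ> idx) i)) = 0"
      using vec.independentD[OF B'(2) fin order_refl, of "\<lambda>b. c (?g b)"] bij_betwE[OF Fi] by blast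
    then show "c i = 0" by (simp only: gi)
  qed
  then have "det (frame_rows k v W) \<noteq> 0" using invertible_right_inverse invertible_det_nz by blast
  then show ?thesis using that inj rng B' by metis
qed

lemma plucker_nonzero:
  assumes "v \<in> frames k"
  shows "plucker k v \<noteq> 0"
proof
  assume 0: "plucker k v = 0"
  have "inj_on v {..<k}" "vec.independent (v ` {..<k})" using assms by (auto simp: frames_def)
  then obtain W where "det (frame_rows k v W) \<noteq> 0" by (rule frame_extends)
  then show False using 0 by (simp add: det_frame_rows_expand)
qed

lemma frame_rows_matrix_mult:
  fixes A :: "'a :: field ^ 'n ^ 'n"
  shows "frame_rows k (\<lambda>m. A *v v m) (\<lambda>i. A *v W i) = frame_rows k v W ** transpose A"
proof -
  have "(N ** transpose A) $ i = A *v (N $ i)" for N :: "'a ^ 'n ^ 'n" and i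
    by (simp add: vec_eq_iff matrix_matrix_mult_def matrix_vector_mult_def transpose_def mult.commute)
  then show ?thesis by (simp add: vec_eq_iff frame_rows_def)
qed

text \<open>The unit vectors among the rows do not move with the frame. Pulling \<open>A\<close> out
  of the whole matrix gives the factor \<open>det A\<close> and applies the inverse of
  \<open>A\<close> to them; expanding these rows again gives a linear map.\<close>

definition plucker_map :: "nat \<Rightarrow> 'a :: field ^ 'n ^ 'n \<Rightarrow> 'a ^ ('n \<Rightarrow> 'n) \<Rightarrow> 'a ^ ('n \<Rightarrow> 'n)" where
  "plucker_map k A = (*v) (\<chi> J J'. det A * minor_coeff k (\<lambda>i. matrix_inv A *v axis (J i) 1) J')"

lemma linear_plucker_map: "Vector_Spaces.linear (*s) (*s) (plucker_map k A)"
  unfolding plucker_map_def by (rule matrix_vector_mul_linear_gen)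

lemma frame_rows_cong: "(\<And>m. m < k \<Longrightarrow> v m = v' m) \<Longrightarrow> frame_rows k v W = frame_rows k v' W"
  by (simp add: frame_rows_def vec_eq_iff)

lemma plucker_image:
  fixes A :: "'a :: field ^ 'n ^ 'n"
  assumes A: "invertible A" and v': "\<And>m. m < k \<Longrightarrow> v' m = A *v v m"
  shows "plucker k v' = plucker_map k A (plucker k v)"
  unfolding vec_eq_iff
proof
  fix J
  note AA = matrix_inv_vec(1)[OF A]
  have "plucker k v' $ J = det (frame_rows k (\<lambda>m. A *v v m) (\<lambda>i. A *v (matrix_inv A *v axis (J i) 1)))"
    unfolding AA plucker_def vec_lambda_beta by (intro arg_cong[of _ _ det] frame_rows_cong v')
  also have "\<dots> = det (frame_rows k v (\<lambda>i. matrix_inv A *v axis (J i) 1)) * det A"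
    by (simp only: frame_rows_matrix_mult det_mul det_transpose)
  finally show "plucker k v' $ J = plucker_map k A (plucker k v) $ J" by (simp add: det_frame_rows_expand plucker_map_def matrix_vector_mult_def sum_distrib_left sum_distrib_right mult_ac)
qed

text \<open>Suppose \<open>v' j\<close> lies outside the span of \<open>v\<close>. Then some
  determinant with the rows \<open>v\<close>, the row \<open>v' j\<close> and further rows is
  nonzero, while replacing \<open>v\<close> by \<open>v'\<close> repeats the row
  \<open>v' j\<close>. Proportional coordinates exclude this.\<close>

lemma plucker_span_subset:
  fixes v :: "nat \<Rightarrow> 'a :: field ^ 'n"
  assumes v: "v \<in> frames k" and c: "plucker k v' = c *s plucker k v" "c \<noteq> 0"
  shows "v' ` {..<k} \<subseteq> vec.span (v ` {..<k})"
proof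
  fix x assume "x \<in> v' ` {..<k}"
  then obtain j where j: "j < k" "x = v' j" by auto
  show "x \<in> vec.span (v ` {..<k})"
  proof (rule ccontr)
    assume nx: "x \<notin> vec.span (v ` {..<k})"
    define w where "w = v(k := x)"
    have im: "w ` {..<Suc k} = insert x (v ` {..<k})" by (auto simp: w_def lessThan_Suc)
    have inj: "inj_on w {..<Suc k}"
    proof -
      have "v m \<noteq> x" if "m < k" for m using nx vec.span_base[of "v m" "v ` {..<k}"] that by auto
      then have "x \<notin> v ` {..<k}" by blast
      moreover have "inj_on w {..<k}" using v by (auto simp: w_def inj_on_def frames_def)
      moreover have "w k = x" "w ` {..<k} = v ` {..<k}" by (auto simp: w_def)
      ultimately show ?thesis by (simp add: lessThan_Suc)
    qed
    have "vec.independent (w ` {..<Suc k})"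
      unfolding im using v nx by (intro vec.independent_insertI) (auto simp: frames_def)
    then obtain W where W: "det (frame_rows (Suc k) w W) \<noteq> 0" using frame_extends[OF inj] by blast
    have "Suc k \<le> CARD('n)"
      using vec.independent_card_le_dim[OF subset_UNIV \<open>vec.independent (w ` {..<Suc k})\<close>] card_image[OF inj]
      by (simp add: card_cart_basis)
    then obtain i0 :: 'n where i0: "idx i0 = k" using idx_surj[where 'n = 'n, of k] by auto
    obtain j0 :: 'n where j0: "idx j0 = j" using idx_surj[where 'n = 'n, of j] j \<open>Suc k \<le> CARD('n)\<close> by auto
    define W' where "W' = W(i0 := x)"
    have "frame_rows (Suc k) w W = frame_rows k v W'"
      unfolding frame_rows_def
    proof (intro arg_cong[of _ _ vec_lambda] ext)
      fix i :: 'n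
      have "idx i = k \<longleftrightarrow> i = i0" using i0 inj_idx[of i i0] by simp
      then show "(if idx i < Suc k then w (idx i) else W i) = (if idx i < k then v (idx i) else W' i)"
        by (auto simp: w_def W'_def less_Suc_eq)
    qed
    then have nz: "det (frame_rows k v W') \<noteq> 0" using W by simp
    have "det (frame_rows k v' W') = c * det (frame_rows k v W')"
      unfolding det_frame_rows_expand c(1) by (simp add: sum_distrib_left mult_ac)
    moreover have "det (frame_rows k v' W') = 0"
    proof (rule det_identical_rows)
      show "i0 \<noteq> j0" using i0 j0 j by auto
      show "row i0 (frame_rows k v' W') = row j0 (frame_rows k v' W')"
        using i0 j0 j by (simp add: row_def frame_rows_def W'_def)
    qed
    ultimately show False using nz c(2) by simp
  qed
qed

lemma det_frame_rows_mod_span: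
  fixes v :: "nat \<Rightarrow> 'a :: field ^ 'n"
  assumes kn: "k \<le> CARD('n)" and W: "\<And>i. W i - W' i \<in> vec.span (v ` {..<k})"
  shows "det (frame_rows k v W) = det (frame_rows k v W')"
proof -
  have "det (frame_rows k v (\<lambda>i. if i \<in> S then W i else W' i)) = det (frame_rows k v W')" if "finite S" for S
    using that
  proof (induction S rule: finite_induct)
    case (insert i S)
    let ?N = "frame_rows k v (\<lambda>i. if i \<in> S then W i else W' i)"
    show ?case
    proof (cases "idx i < k")
      case True
      then have "frame_rows k v (\<lambda>j. if j \<in> insert i S then W j else W' j) = ?N" by (auto simp: frame_rows_def vec_eq_iff)
      then show ?thesis using insert by simp
    next
      case False
      have row: "row j ?N = (if idx j < k then v (idx j) else if j \<in> S then W j else W' j)" for j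
        by (simp add: row_def frame_rows_def vec_eq_iff)
      \<comment> \<open>Every frame vector occurs as a row, because \<open>k\<close> is at most the
        number of rows, and row \<open>i\<close> is not one of them.\<close>
      have "v ` {..<k} \<subseteq> {row j ?N |j. j \<noteq> i}"
      proof
        fix x assume "x \<in> v ` {..<k}"
        then obtain m where m: "m < k" "x = v m" by auto
        obtain j :: 'n where j: "idx j = m" using idx_surj[where 'n = 'n, of m] m kn by auto
        then show "x \<in> {row j ?N |j. j \<noteq> i}" using m False by (auto simp: row intro!: exI[of _ j])
      qed
      then have "W i - W' i \<in> vec.span {row j ?N |j. j \<noteq> i}" using W vec.span_mono by blast
      then have "det (\<chi> j. if j = i then row i ?N + (W i - W' i) else row j ?N) = det ?N" by (rule det_row_span)
      moreover have "(\<chi> j. if j = i then row i ?N + (W i - W' i) else row j ?N) = frame_rows k v (\<lambda>j. if j \<in> insert i S then W j else W' j)"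
        using insert False by (simp add: vec_eq_iff row) (simp add: frame_rows_def)
      ultimately show ?thesis using insert by simp
    qed
  qed simp
  from this[of UNIV] show ?thesis by simp
qed

text \<open>A linear map that carries one frame to the other and fixes a complement changes each
  vector by an element of the common span. In the remaining rows such changes do not affect
  determinants, so all coordinates scale by the determinant of the map.\<close>

lemma plucker_same_span:
  fixes v :: "nat \<Rightarrow> 'a :: field ^ 'n"
  assumes v: "v \<in> frames k" and v': "v' \<in> frames k" and sp: "vec.span (v' ` {..<k}) = vec.span (v ` {..<k})"
  shows "\<exists>c. c \<noteq> 0 \<and> plucker k v' = c *s plucker k v"
proof -
  have vi: "inj_on v {..<k}" "vec.independent (v ` {..<k})" using v by (auto simp: frames_def)
  have kn: "k \<le> CARD('n)"
    using vec.independent_card_le_dim[OF subset_UNIV vi(2)] card_image[OF vi(1)] by (simp add: card_cart_basis)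
  obtain W0 where W0: "vec.independent (range (\<lambda>i. frame_rows k v W0 $ i))" "inj (\<lambda>i. frame_rows k v W0 $ i)"
    "vec.span (range (\<lambda>i. frame_rows k v W0 $ i)) = UNIV"
    using frame_extends[OF vi] by blast
  let ?b = "\<lambda>i. frame_rows k v W0 $ i"
  obtain g where g: "Vector_Spaces.linear (*s) (*s) g" "\<And>x. x \<in> range ?b \<Longrightarrow> g x = frame_rows k v' W0 $ (inv_into UNIV ?b x)"
    using vec.linear_independent_extend[OF W0(1), of "\<lambda>x. frame_rows k v' W0 $ (inv_into UNIV ?b x)"] by blast
  have gb: "g (?b i) = frame_rows k v' W0 $ i" for i using g(2)[of "?b i"] inv_into_f_f[OF W0(2), of i] by simp
  have gv: "v' m = g (v m)" if m: "m < k" for m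
  proof -
    obtain i :: 'n where i: "idx i = m" using idx_surj[where 'n = 'n, of m] m kn by auto
    then show ?thesis using gb[of i] m by (simp add: frame_rows_def)
  qed
  have mod: "g x - x \<in> vec.span (v' ` {..<k})" for x
  proof -
    have "x \<in> vec.span (range ?b)" by (simp add: W0(3))
    then show ?thesis
    proof (induction rule: vec.span_induct_alt)
      case base
      show ?case using vec.linear_0[OF g(1)] vec.span_zero by simp
    next
      case (step c x z)
      then obtain i where x: "x = ?b i" by auto
      have "g x - x \<in> vec.span (v' ` {..<k})"
      proof (cases "idx i < k")
        case True
        have "v' (idx i) \<in> vec.span (v' ` {..<k})" "v (idx i) \<in> vec.span (v' ` {..<k})"
          using True sp by (auto intro: vec.span_base)
        then have "v' (idx i) - v (idx i) \<in> vec.span (v' ` {..<k})" by (rule vec.span_diff)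
        then show ?thesis using True unfolding x gb by (simp add: frame_rows_def)
      next
        case False
        then show ?thesis unfolding x gb by (simp add: frame_rows_def vec.span_zero)
      qed
      then have "c *s (g x - x) + (g z - z) \<in> vec.span (v' ` {..<k})" using step by (intro vec.span_add vec.span_scale)
      moreover have "g (c *s x + z) - (c *s x + z) = c *s (g x - x) + (g z - z)"
        by (simp add: vec.linear_add[OF g(1)] vec.linear_scale[OF g(1)] vec.scale_right_diff_distrib)
      ultimately show ?case by (simp only:)
    qed
  qed
  have gm: "g x = matrix g *v x" for x using matrix_works[OF g(1)] by simp
  have "plucker k v' = det (matrix g) *s plucker k v"
    unfolding vec_eq_iff
  proof
    fix J :: "'n \<Rightarrow> 'n"
    let ?W = "\<lambda>i. axis (J i) 1"
    have "plucker k v' $ J = det (frame_rows k v' (\<lambda>i. g (?W i)))"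
      unfolding plucker_def vec_lambda_beta
    proof (rule det_frame_rows_mod_span[OF kn])
      fix i show "?W i - g (?W i) \<in> vec.span (v' ` {..<k})" using vec.span_neg[OF mod[of "?W i"]] by simp
    qed
    also have "frame_rows k v' (\<lambda>i. g (?W i)) = frame_rows k (\<lambda>m. matrix g *v v m) (\<lambda>i. matrix g *v ?W i)"
      unfolding gm[symmetric] by (rule frame_rows_cong) (rule gv)
    also have "det \<dots> = det (matrix g) * plucker k v $ J" by (simp only: frame_rows_matrix_mult det_mul det_transpose) (simp add: plucker_def)
    finally show "plucker k v' $ J = (det (matrix g) *s plucker k v) $ J" by simp
  qed
  moreover have "det (matrix g) \<noteq> 0" using plucker_nonzero[OF v'] calculation by auto
  ultimately show ?thesis by blast
qed

section \<open>Normalised coordinates of a subspace\<close>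

definition max_index :: "'a :: prime_card padic ^ 'N \<Rightarrow> 'N" where
  "max_index D = (SOME J. J \<in> {J. \<forall>J'. padic_norm (D $ J') \<le> padic_norm (D $ J)})"

lemma max_index: "padic_norm (D $ J) \<le> padic_norm (D $ max_index D)"
proof -
  have "Max (range (\<lambda>J. padic_norm (D $ J))) \<in> range (\<lambda>J. padic_norm (D $ J))" by (rule Max_in) auto
  then obtain J where J: "Max (range (\<lambda>J. padic_norm (D $ J))) = padic_norm (D $ J)" by blast
  have "padic_norm (D $ J') \<le> padic_norm (D $ J)" for J' unfolding J[symmetric] by (rule Max_ge) auto
  then have "J \<in> {J. \<forall>J'. padic_norm (D $ J') \<le> padic_norm (D $ J)}" by simp
  then have "max_index D \<in> {J. \<forall>J'. padic_norm (D $ J') \<le> padic_norm (D $ J)}"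
    unfolding max_index_def by (rule someI)
  then show ?thesis by blast
qed

text \<open>The index is chosen from the set of maximising indices, and scaling does not change this
  set. The same form later makes the index measurable, as only finitely many sets occur.\<close>

lemma max_index_scale: "c \<noteq> 0 \<Longrightarrow> max_index (c *s D) = max_index D"
proof -
  assume "c \<noteq> 0"
  then have "padic_norm c > 0" using padic_norm_nonneg[of c] padic_norm_eq_0_iff[of c] by linarith
  then have "{J. \<forall>J'. padic_norm ((c *s D) $ J') \<le> padic_norm ((c *s D) $ J)} = {J. \<forall>J'. padic_norm (D $ J') \<le> padic_norm (D $ J)}"
    by (simp add: padic_norm_mult)
  then show ?thesis by (simp only: max_index_def)
qed

lemma max_index_nonzero: "D \<noteq> 0 \<Longrightarrow> D $ max_index D \<noteq> 0"
proof
  assume D: "D \<noteq> 0" and 0: "D $ max_index D = 0"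
  have "D $ J = 0" for J using max_index[of D J] 0 padic_norm_nonneg[of "D $ J"] by (simp add: padic_norm_eq_0_iff)
  then show False using D by (simp add: vec_eq_iff)
qed

text \<open>A representative of the projective point with integral coordinates, one of them equal to
  1, as \<open>line_recurrence\<close> demands.\<close>

definition normalise :: "'a :: prime_card padic ^ 'N \<Rightarrow> 'a padic ^ 'N" where
  "normalise D = inverse (D $ max_index D) *s D"

lemma normalise_scale: "c \<noteq> 0 \<Longrightarrow> normalise (c *s D) = normalise D"
  by (simp add: normalise_def max_index_scale vec_eq_iff)

lemma normalise_ivec:
  assumes D: "D \<noteq> 0"
  shows "normalise D \<in> ivec"
proof -
  have p: "padic_norm (D $ max_index D) > 0"
    using max_index_nonzero[OF D] padic_norm_eq_0_iff[of "D $ max_index D"] padic_norm_nonneg[of "D $ max_index D"] by linarith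
  have "padic_norm (normalise D $ J) \<le> 1" for J
  proof -
    have "padic_norm (normalise D $ J) = padic_norm (D $ J) / padic_norm (D $ max_index D)"
      by (simp add: normalise_def padic_norm_mult padic_norm_inverse divide_inverse mult.commute)
    then show ?thesis using max_index[of D J] p by simp
  qed
  then show ?thesis by (simp add: ivec_def)
qed

lemma normalise_one: "D \<noteq> 0 \<Longrightarrow> normalise D $ max_index D = 1"
  using max_index_nonzero[of D] by (simp add: normalise_def)

lemma normalise_eq_scale: "D \<noteq> 0 \<Longrightarrow> D = (D $ max_index D) *s normalise D"
  using max_index_nonzero[of D] by (simp add: normalise_def vec_eq_iff)

definition some_frame :: "nat \<Rightarrow> ('a :: prime_card padic ^ 'n) set \<Rightarrow> nat \<Rightarrow> 'a padic ^ 'n" where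
  "some_frame k V = (SOME v. v \<in> frames k \<and> vec.span (v ` {..<k}) = V)"

lemma some_frame:
  assumes "V \<in> grassmannian k"
  shows "some_frame k V \<in> frames k" "vec.span (some_frame k V ` {..<k}) = V"
  using someI_ex[of "\<lambda>v. v \<in> frames k \<and> vec.span (v ` {..<k}) = V"] grassmannian_frame[OF assms]
  unfolding some_frame_def by (metis (mono_tags, lifting))+

definition plucker_pt :: "nat \<Rightarrow> ('a :: prime_card padic ^ 'n) set \<Rightarrow> 'a padic ^ ('n \<Rightarrow> 'n)" where
  "plucker_pt k V = normalise (plucker k (some_frame k V))"

lemma plucker_some_frame:
  assumes "v \<in> frames k"
  shows "\<exists>c. c \<noteq> 0 \<and> plucker k (some_frame k (vec.span (v ` {..<k}))) = c *s plucker k v"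
  using some_frame[OF frame_span_grassmannian[OF assms]] by (intro plucker_same_span[OF assms]) auto

lemma plucker_pt_frame: "v \<in> frames k \<Longrightarrow> plucker_pt k (vec.span (v ` {..<k})) = normalise (plucker k v)"
  using plucker_some_frame[of v k] by (auto simp: plucker_pt_def normalise_scale)

lemma plucker_some_frame_nonzero: "V \<in> grassmannian k \<Longrightarrow> plucker k (some_frame k V) \<noteq> 0"
  by (rule plucker_nonzero[OF some_frame(1)])

lemma plucker_pt_inj_scale:
  assumes V: "V \<in> grassmannian k" and V': "V' \<in> grassmannian k" and c: "plucker_pt k V' = c *s plucker_pt k V" "c \<noteq> 0"
  shows "V' = V"
proof -
  let ?D = "plucker k (some_frame k V)" and ?D' = "plucker k (some_frame k V')"
  have D: "?D \<noteq> 0" "?D' \<noteq> 0" by (rule plucker_some_frame_nonzero[OF V], rule plucker_some_frame_nonzero[OF V'])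
  have "?D' = (?D' $ max_index ?D') *s (c *s normalise ?D)" using normalise_eq_scale[OF D(2)] c(1) by (simp add: plucker_pt_def)
  also have "\<dots> = (?D' $ max_index ?D' * c * inverse (?D $ max_index ?D)) *s ?D" by (simp add: normalise_def vector_smult_assoc mult.assoc)
  finally have eq: "?D' = (?D' $ max_index ?D' * c * inverse (?D $ max_index ?D)) *s ?D" .
  have "?D' $ max_index ?D' * c * inverse (?D $ max_index ?D) \<noteq> 0" using max_index_nonzero[OF D(1)] max_index_nonzero[OF D(2)] c(2) by simp
  from plucker_span_subset[OF some_frame(1)[OF V] eq this] have sub: "V' \<subseteq> V"
    using some_frame(2)[OF V] some_frame(2)[OF V'] vec.span_minimal[of "some_frame k V' ` {..<k}" "vec.span (some_frame k V ` {..<k})"]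
      vec.subspace_span[of "some_frame k V ` {..<k}"] by simp
  have "vec.subspace V" "vec.subspace V'" "vec.dim V = vec.dim V'" using V V' by (auto simp: grassmannian_def)
  then show ?thesis using sub vec.subspace_dim_equal[of V' V] by auto
qed

lemma plucker_pt_inj: "V \<in> grassmannian k \<Longrightarrow> V' \<in> grassmannian k \<Longrightarrow> plucker_pt k V' = plucker_pt k V \<Longrightarrow> V' = V"
  using plucker_pt_inj_scale[of V k V' 1] by simp

lemma matrix_image_grassmannian:
  fixes A :: "'a :: prime_card padic ^ 'n ^ 'n"
  assumes V: "V \<in> grassmannian k" and A: "invertible A"
  shows "matrix_image A V \<in> grassmannian k"
    "\<exists>s. s \<noteq> 0 \<and> plucker_pt k (matrix_image A V) = s *s plucker_map k A (plucker_pt k V)"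
proof -
  let ?v = "some_frame k V" and ?v' = "\<lambda>i\<in>{..<k}. A *v some_frame k V i"
  have v': "?v' \<in> frames k" by (rule matrix_image_frame[OF some_frame(1)[OF V] A])
  have sp: "matrix_image A V = vec.span (?v' ` {..<k})"
    using some_frame(2)[OF V] matrix_image_span[of A "?v ` {..<k}"] by (simp add: image_image)
  show "matrix_image A V \<in> grassmannian k" unfolding sp by (rule frame_span_grassmannian[OF v'])
  have "plucker k ?v' = plucker_map k A (plucker k ?v)" by (rule plucker_image[OF A]) simp
  also have "\<dots> = plucker_map k A ((plucker k ?v $ max_index (plucker k ?v)) *s plucker_pt k V)"
    using normalise_eq_scale[OF plucker_some_frame_nonzero[OF V]] by (simp add: plucker_pt_def)
  also have "\<dots> = (plucker k ?v $ max_index (plucker k ?v)) *s plucker_map k A (plucker_pt k V)" by (rule vec.linear_scale[OF linear_plucker_map])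
  finally have "plucker_pt k (matrix_image A V) = inverse (plucker k ?v' $ max_index (plucker k ?v')) *s ((plucker k ?v $ max_index (plucker k ?v)) *s plucker_map k A (plucker_pt k V))"
    unfolding sp plucker_pt_frame[OF v'] normalise_def by simp
  moreover have "inverse (plucker k ?v' $ max_index (plucker k ?v')) * (plucker k ?v $ max_index (plucker k ?v)) \<noteq> 0"
    using max_index_nonzero[OF plucker_nonzero[OF v']] max_index_nonzero[OF plucker_some_frame_nonzero[OF V]] by simp
  ultimately show "\<exists>s. s \<noteq> 0 \<and> plucker_pt k (matrix_image A V) = s *s plucker_map k A (plucker_pt k V)"
    by (intro exI[of _ "inverse (plucker k ?v' $ max_index (plucker k ?v')) * (plucker k ?v $ max_index (plucker k ?v))"] conjI)
      (simp_all only: vector_smult_assoc not_False_eq_True)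
qed

lemma plucker_pt_funpow:
  fixes A :: "'a :: prime_card padic ^ 'n ^ 'n"
  assumes V: "V \<in> grassmannian k" and A: "invertible A"
  shows "(matrix_image A ^^ n) V \<in> grassmannian k \<and>
    (\<exists>s. s \<noteq> 0 \<and> plucker_pt k ((matrix_image A ^^ n) V) = s *s (plucker_map k A ^^ n) (plucker_pt k V))"
proof (induction n)
  case 0
  show ?case using V by (auto intro: exI[of _ 1])
next
  case (Suc n)
  then obtain s where s: "s \<noteq> 0" "plucker_pt k ((matrix_image A ^^ n) V) = s *s (plucker_map k A ^^ n) (plucker_pt k V)" by blast
  obtain t where t: "t \<noteq> 0" "plucker_pt k (matrix_image A ((matrix_image A ^^ n) V)) = t *s plucker_map k A (plucker_pt k ((matrix_image A ^^ n) V))"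
    using matrix_image_grassmannian(2)[OF _ A] Suc by blast
  have "plucker_pt k ((matrix_image A ^^ Suc n) V) = (t * s) *s (plucker_map k A ^^ Suc n) (plucker_pt k V)"
    using t(2) unfolding s(2) vec.linear_scale[OF linear_plucker_map] by (simp add: vector_smult_assoc)
  then show ?case using s t matrix_image_grassmannian(1)[OF _ A, of "(matrix_image A ^^ n) V" k] Suc
    by (auto intro!: exI[of _ "t * s"])
qed

text \<open>Normalisation contributes the scalars \<open>s j\<close>. A fixed line of coordinates is
  a fixed subspace, because proportional coordinates determine the subspace.\<close>

lemma plucker_pt_recurrence:
  fixes A :: "'a :: prime_card padic ^ 'n ^ 'n"
  assumes V: "V \<in> grassmannian k" and A: "invertible A"
    and \<sigma>: "\<And>j. \<sigma> j \<ge> 1" "\<And>l. \<forall>\<^sub>F j in sequentially. CARD('a) ^ l dvd \<sigma> j - 1"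
    and lim: "(\<lambda>j. plucker_pt k ((matrix_image A ^^ \<sigma> j) V)) \<longlonglongrightarrow> plucker_pt k V"
  shows "\<exists>j. (matrix_image A ^^ \<sigma> j) V = V"
proof -
  have "\<forall>j. \<exists>s. s \<noteq> 0 \<and> plucker_pt k ((matrix_image A ^^ \<sigma> j) V) = s *s (plucker_map k A ^^ \<sigma> j) (plucker_pt k V)"
    using plucker_pt_funpow[OF V A] by blast
  then obtain s where s: "\<And>j. s j \<noteq> 0" "\<And>j. plucker_pt k ((matrix_image A ^^ \<sigma> j) V) = s j *s (plucker_map k A ^^ \<sigma> j) (plucker_pt k V)"
    by metis
  let ?D = "plucker k (some_frame k V)"
  have D: "?D \<noteq> 0" by (rule plucker_some_frame_nonzero[OF V])
  have y: "plucker_pt k V \<in> ivec" "plucker_pt k V $ max_index ?D = 1" using normalise_ivec[OF D] normalise_one[OF D] by (simp_all add: plucker_pt_def)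
  obtain i \<kappa> where i: "(plucker_map k A ^^ \<sigma> i) (plucker_pt k V) = \<kappa> *s plucker_pt k V"
    using line_recurrence[OF linear_plucker_map y s(1) lim[unfolded s(2)] \<sigma>] by blast
  have eq: "plucker_pt k ((matrix_image A ^^ \<sigma> i) V) = (s i * \<kappa>) *s plucker_pt k V" using s(2)[of i] by (simp add: i vector_smult_assoc)
  have W: "(matrix_image A ^^ \<sigma> i) V \<in> grassmannian k" using plucker_pt_funpow[OF V A] by blast
  have "plucker_pt k ((matrix_image A ^^ \<sigma> i) V) \<noteq> 0"
  proof
    let ?E = "plucker k (some_frame k ((matrix_image A ^^ \<sigma> i) V))"
    assume "plucker_pt k ((matrix_image A ^^ \<sigma> i) V) = 0"
    then have "normalise ?E $ max_index ?E = 0" by (simp add: plucker_pt_def)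
    then show False using normalise_one[OF plucker_some_frame_nonzero[OF W]] by simp
  qed
  then have "s i * \<kappa> \<noteq> 0" using eq by auto
  then show ?thesis using plucker_pt_inj_scale[OF V W eq] by blast
qed

section \<open>Continuity of the coordinates on frames\<close>

lemma tendsto_prod_padic:
  fixes g :: "'i \<Rightarrow> 'x \<Rightarrow> 'a :: prime_card padic"
  assumes "\<And>i. i \<in> S \<Longrightarrow> (g i \<longlongrightarrow> l i) F"
  shows "((\<lambda>x. \<Prod>i\<in>S. g i x) \<longlongrightarrow> (\<Prod>i\<in>S. l i)) F"
  using assms by (induction S rule: infinite_finite_induct) (auto intro!: tendsto_mult)

lemma continuous_map_padicI:
  "(\<And>x. x \<in> topspace X \<Longrightarrow> (g \<longlongrightarrow> g x) (atin X x)) \<Longrightarrow> continuous_map X euclidean g"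
  by (simp add: continuous_map_atin limitin_canonical_iff)

lemma continuous_map_padicD:
  "continuous_map X euclidean g \<Longrightarrow> x \<in> topspace X \<Longrightarrow> (g \<longlongrightarrow> g x) (atin X x)"
  by (simp add: continuous_map_atin limitin_canonical_iff)

lemma continuous_map_plucker:
  "continuous_map (frame_topology k) euclidean (\<lambda>v :: nat \<Rightarrow> 'a :: prime_card padic ^ 'n. plucker k v $ J)"
proof (rule continuous_map_padicI)
  fix v0 :: "nat \<Rightarrow> 'a padic ^ 'n" assume v0: "v0 \<in> topspace (frame_topology k)"
  let ?F = "atin (frame_topology k) v0"
  have pr: "((\<lambda>v. v m) \<longlongrightarrow> v0 m) ?F" if "m < k" for m
  proof (rule continuous_map_padicD[OF _ v0])
    show "continuous_map (frame_topology k) euclidean (\<lambda>v :: nat \<Rightarrow> 'a padic ^ 'n. v m)"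
      unfolding frame_topology_def using that
      by (intro continuous_map_from_subtopology continuous_map_product_projection) simp
  qed
  have ent: "((\<lambda>v. frame_rows k v W $ i $ j) \<longlongrightarrow> frame_rows k v0 W $ i $ j) ?F" for i j :: 'n and W
    using pr by (cases "idx i < k") (auto simp: frame_rows_def intro!: tendsto_vec_nth)
  show "((\<lambda>v. plucker k v $ J) \<longlongrightarrow> plucker k v0 $ J) ?F"
    unfolding plucker_def vec_lambda_beta det_def
    by (intro tendsto_sum tendsto_mult tendsto_const tendsto_prod_padic ent)
qed

section \<open>The Borel structure of Grassmannians\<close>

text \<open>A condition on the coordinates that ignores scaling does not depend on the frame, so it
  descends to the quotient topology and the arbitrary choice in \<open>some_frame\<close> does no
  harm.\<close>

lemma openin_grassmannianI:
  fixes Q :: "'a :: prime_card padic ^ ('n :: finite \<Rightarrow> 'n) \<Rightarrow> bool"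
  assumes sc: "\<And>c D. c \<noteq> 0 \<Longrightarrow> Q (c *s D) = Q D" and op: "openin (frame_topology k) {v \<in> frames k. Q (plucker k v)}"
  shows "openin (grassmannian_topology k) {V \<in> grassmannian k. Q (plucker k (some_frame k V))}"
proof -
  have "Q (plucker k (some_frame k (vec.span (v ` {..<k})))) = Q (plucker k v)" if "v \<in> frames k" for v :: "nat \<Rightarrow> 'a padic ^ 'n"
    using plucker_some_frame[OF that] sc by metis
  then have "{v \<in> frames k. vec.span (v ` {..<k}) \<in> {V \<in> grassmannian k. Q (plucker k (some_frame k V))}} = {v \<in> frames k. Q (plucker k v)}"
    using frame_span_grassmannian by auto
  then show ?thesis using op by (auto simp: openin_grassmannian_topology)
qed

lemma openin_less:
  fixes g h :: "'x \<Rightarrow> real"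
  assumes "continuous_map X euclidean g" "continuous_map X euclidean h"
  shows "openin X {x \<in> topspace X. g x < h x}"
proof -
  have c: "continuous_map X euclidean (\<lambda>x. h x - g x)" using assms by (intro continuous_map_diff) auto
  have "openin X {x \<in> topspace X. h x - g x \<in> {0<..}}"
    by (rule openin_continuous_map_preimage[OF c]) (simp add: open_greaterThan)
  then show ?thesis by (simp add: less_diff_eq)
qed

lemma continuous_map_norm:
  assumes "continuous_map X euclidean (g :: 'x \<Rightarrow> 'a :: prime_card padic)"
  shows "continuous_map X euclidean (\<lambda>x. padic_norm (g x))"
  using continuous_map_compose[OF assms, of euclidean padic_norm] isCont_padic_norm[of UNIV]
  by (simp add: o_def continuous_map_iff_continuous2)

lemma borel_of_open: "openin T U \<Longrightarrow> U \<in> sets (borel_of T)"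
proof -
  assume U: "openin T U"
  have "{U. openin T U} \<subseteq> Pow (topspace T)" by (auto dest: openin_subset)
  then show ?thesis unfolding borel_of_def using U by (simp add: sets_measure_of sigma_sets.Basic)
qed

lemma space_borel_of: "space (borel_of T) = topspace T"
proof -
  have "{U. openin T U} \<subseteq> Pow (topspace T)" by (auto dest: openin_subset)
  then show ?thesis unfolding borel_of_def by (rule space_measure_of)
qed

lemma measurable_borel_of:
  assumes "continuous_map S T g"
  shows "g \<in> measurable (borel_of S) (borel_of T)"
  unfolding borel_of_def[of T]
proof (rule measurable_measure_of)
  show "{U. openin T U} \<subseteq> Pow (topspace T)" by (auto dest: openin_subset)
  show "g \<in> space (borel_of S) \<rightarrow> topspace T" using continuous_map_funspace[OF assms] by (simp add: space_borel_of)
  fix U assume "U \<in> {U. openin T U}"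
  then have "openin S {x \<in> topspace S. g x \<in> U}" using openin_continuous_map_preimage[OF assms] by simp
  moreover have "g -` U \<inter> space (borel_of S) = {x \<in> topspace S. g x \<in> U}" by (auto simp: space_borel_of)
  ultimately show "g -` U \<inter> space (borel_of S) \<in> sets (borel_of S)" using borel_of_open by metis
qed

abbreviation (input) grass_borel :: "nat \<Rightarrow> ('a :: prime_card padic ^ 'n) set measure" where
  "grass_borel k \<equiv> borel_of (grassmannian_topology k)"

lemma space_grass_borel: "space (grass_borel k) = grassmannian k"
  by (simp add: space_borel_of)

lemma grass_borel_less:
  "{V \<in> grassmannian k. padic_norm (plucker k (some_frame k V) $ J) < padic_norm (plucker k (some_frame k V) $ J')} \<in> sets (grass_borel k :: ('a :: prime_card padic ^ 'n) set measure)"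
proof (rule borel_of_open, rule openin_grassmannianI)
  fix c :: "'a padic" and D :: "'a padic ^ ('n \<Rightarrow> 'n)" assume "c \<noteq> 0"
  then have "padic_norm c > 0" using padic_norm_nonneg[of c] padic_norm_eq_0_iff[of c] by linarith
  then show "(padic_norm ((c *s D) $ J) < padic_norm ((c *s D) $ J')) = (padic_norm (D $ J) < padic_norm (D $ J'))"
    by (simp add: padic_norm_mult)
next
  show "openin (frame_topology k) {v \<in> frames k. padic_norm (plucker k v $ J) < padic_norm (plucker k v $ J')}"
    using openin_less[OF continuous_map_norm[OF continuous_map_plucker[of k J]] continuous_map_norm[OF continuous_map_plucker[of k J']]] by simp
qed

text \<open>The condition is cleared of denominators: both sides scale alike, and it is open even
  where the coordinate \<open>J'\<close> vanishes.\<close>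

lemma grass_borel_near:
  "{V \<in> grassmannian k. padic_norm (plucker k (some_frame k V) $ J - r * plucker k (some_frame k V) $ J') < e * padic_norm (plucker k (some_frame k V) $ J')} \<in> sets (grass_borel k :: ('a :: prime_card padic ^ 'n) set measure)"
proof (rule borel_of_open, rule openin_grassmannianI)
  fix c :: "'a padic" and D :: "'a padic ^ ('n \<Rightarrow> 'n)" assume "c \<noteq> 0"
  then have c: "padic_norm c > 0" using padic_norm_nonneg[of c] padic_norm_eq_0_iff[of c] by linarith
  have "(c *s D) $ J - r * (c *s D) $ J' = c * (D $ J - r * D $ J')" by (simp add: algebra_simps)
  then have "padic_norm ((c *s D) $ J - r * (c *s D) $ J') = padic_norm c * padic_norm (D $ J - r * D $ J')"
    by (simp add: padic_norm_mult)
  moreover have "e * padic_norm ((c *s D) $ J') = padic_norm c * (e * padic_norm (D $ J'))" by (simp add: padic_norm_mult)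
  ultimately show "(padic_norm ((c *s D) $ J - r * (c *s D) $ J') < e * padic_norm ((c *s D) $ J')) =
     (padic_norm (D $ J - r * D $ J') < e * padic_norm (D $ J'))"
    using c by (simp only: mult_less_cancel_left_pos)
next
  have "continuous_map (frame_topology k) euclidean (\<lambda>v :: nat \<Rightarrow> 'a padic ^ 'n. plucker k v $ J + (- r) * plucker k v $ J')"
  proof (rule continuous_map_padicI)
    fix v0 :: "nat \<Rightarrow> 'a padic ^ 'n" assume v0: "v0 \<in> topspace (frame_topology k)"
    show "((\<lambda>v. plucker k v $ J + (- r) * plucker k v $ J') \<longlongrightarrow> plucker k v0 $ J + (- r) * plucker k v0 $ J') (atin (frame_topology k) v0)"
      by (intro tendsto_add tendsto_mult tendsto_const continuous_map_padicD[OF continuous_map_plucker v0])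
  qed
  then have 1: "continuous_map (frame_topology k) euclidean (\<lambda>v :: nat \<Rightarrow> 'a padic ^ 'n. plucker k v $ J - r * plucker k v $ J')" by simp
  have 2: "continuous_map (frame_topology k) euclidean (\<lambda>v :: nat \<Rightarrow> 'a padic ^ 'n. e * padic_norm (plucker k v $ J'))"
    using continuous_map_real_mult[OF continuous_map_const[THEN iffD2] continuous_map_norm[OF continuous_map_plucker[of k J']], of e] by simp
  show "openin (frame_topology k) {v \<in> frames k. padic_norm (plucker k v $ J - r * plucker k v $ J') < e * padic_norm (plucker k v $ J')}"
    using openin_less[OF continuous_map_norm[OF 1] 2] by simp
qed

lemma grass_borel_max_index: "{V \<in> grassmannian k. max_index (plucker k (some_frame k V)) = J0} \<in> sets (grass_borel k :: ('a :: prime_card padic ^ 'n) set measure)"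
proof -
  let ?D = "\<lambda>V :: ('a padic ^ 'n) set. plucker k (some_frame k V)"
  have le: "{V \<in> grassmannian k. padic_norm (?D V $ J) \<le> padic_norm (?D V $ J')} \<in> sets (grass_borel k)" for J J'
  proof -
    have "{V \<in> grassmannian k. padic_norm (?D V $ J) \<le> padic_norm (?D V $ J')} = space (grass_borel k) - {V \<in> grassmannian k. padic_norm (?D V $ J') < padic_norm (?D V $ J)}"
      by (auto simp: space_grass_borel)
    then show ?thesis using sets.compl_sets[OF grass_borel_less[of k J' J]] by simp
  qed
  have S: "{V \<in> grassmannian k. {J. \<forall>J'. padic_norm (?D V $ J') \<le> padic_norm (?D V $ J)} = S} \<in> sets (grass_borel k)" for S
  proof -
    have "{V \<in> space (grass_borel k). \<forall>J\<in>UNIV. (\<forall>J'\<in>UNIV. padic_norm (?D V $ J') \<le> padic_norm (?D V $ J)) = (J \<in> S)} \<in> sets (grass_borel k)"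
    proof (intro sets.sets_Collect_finite_All)
      fix J
      have a: "{V \<in> space (grass_borel k). \<forall>J'\<in>UNIV. padic_norm (?D V $ J') \<le> padic_norm (?D V $ J)} \<in> sets (grass_borel k)"
        by (intro sets.sets_Collect_finite_All) (use le in \<open>auto simp: space_grass_borel\<close>)
      show "{V \<in> space (grass_borel k). (\<forall>J'\<in>UNIV. padic_norm (?D V $ J') \<le> padic_norm (?D V $ J)) = (J \<in> S)} \<in> sets (grass_borel k)"
        using a sets.sets_Collect_neg[OF a] by (cases "J \<in> S") auto
    qed simp
    moreover have "{V \<in> space (grass_borel k). \<forall>J\<in>UNIV. (\<forall>J'\<in>UNIV. padic_norm (?D V $ J') \<le> padic_norm (?D V $ J)) = (J \<in> S)} =
      {V \<in> grassmannian k. {J. \<forall>J'. padic_norm (?D V $ J') \<le> padic_norm (?D V $ J)} = S}"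
      by (auto simp: space_grass_borel)
    ultimately show ?thesis by simp
  qed
  \<comment> \<open>The index is a function of the maximising set, of which there are finitely many,
    each described by finitely many inequalities.\<close>
  have "{V \<in> grassmannian k. max_index (?D V) = J0} = (\<Union>S\<in>{S. (SOME J. J \<in> S) = J0}. {V \<in> grassmannian k. {J. \<forall>J'. padic_norm (?D V $ J') \<le> padic_norm (?D V $ J)} = S})"
    unfolding max_index_def by auto
  also have "\<dots> \<in> sets (grass_borel k)" by (intro sets.finite_UN S) simp
  finally show ?thesis .
qed

lemma plucker_pt_sets: "{V \<in> grassmannian k. padic_norm (plucker_pt k V $ J - r) < e} \<in> sets (grass_borel k :: ('a :: prime_card padic ^ 'n) set measure)"
proof -
  let ?D = "\<lambda>V :: ('a padic ^ 'n) set. plucker k (some_frame k V)"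
  have eq: "padic_norm (plucker_pt k V $ J - r) < e \<longleftrightarrow> padic_norm (?D V $ J - r * ?D V $ max_index (?D V)) < e * padic_norm (?D V $ max_index (?D V))"
    if V: "V \<in> grassmannian k" for V :: "('a padic ^ 'n) set"
  proof -
    let ?d = "?D V $ max_index (?D V)"
    have d: "?d \<noteq> 0" by (rule max_index_nonzero[OF plucker_some_frame_nonzero[OF V]])
    then have n: "padic_norm ?d > 0" using padic_norm_nonneg[of ?d] padic_norm_eq_0_iff[of ?d] by linarith
    have "plucker_pt k V $ J - r = (?D V $ J - r * ?d) / ?d" using d by (simp add: plucker_pt_def normalise_def field_simps)
    then show ?thesis using n by (simp add: padic_norm_divide pos_divide_less_eq)
  qed
  have "{V \<in> grassmannian k. padic_norm (plucker_pt k V $ J - r) < e} = (\<Union>J0\<in>UNIV. {V \<in> grassmannian k. max_index (?D V) = J0} \<inter>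
     {V \<in> grassmannian k. padic_norm (?D V $ J - r * ?D V $ J0) < e * padic_norm (?D V $ J0)})"
    using eq by auto
  also have "\<dots> \<in> sets (grass_borel k)" by (intro sets.finite_UN sets.Int grass_borel_max_index grass_borel_near) simp
  finally show ?thesis .
qed

text \<open>Separating sets are required as a sequence, so the coordinate, the rational centre and
  the radius are packed into one number.\<close>

definition plucker_nbhd :: "nat \<Rightarrow> nat \<Rightarrow> ('a :: prime_card padic ^ 'n) set set" where
  "plucker_nbhd k m = (case from_nat m :: ('n \<Rightarrow> 'n) \<times> rat \<times> nat of (J, r, n) \<Rightarrow> {V \<in> grassmannian k. padic_norm (plucker_pt k V $ J - of_rat r) < 1 / real (Suc n)})"

lemma plucker_nbhd_sets: "plucker_nbhd k m \<in> sets (grass_borel k)"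
  unfolding plucker_nbhd_def by (auto split: prod.split intro: plucker_pt_sets)

lemma plucker_nbhd_separates:
  fixes V V' :: "('a :: prime_card padic ^ 'n) set"
  assumes V: "V \<in> grassmannian k" and V': "V' \<in> grassmannian k" and ne: "V \<noteq> V'"
  shows "\<exists>m. (V \<in> plucker_nbhd k m) \<noteq> (V' \<in> plucker_nbhd k m)"
proof -
  have "plucker_pt k V \<noteq> plucker_pt k V'" using plucker_pt_inj[OF V' V] ne by blast
  then obtain J where J: "plucker_pt k V $ J \<noteq> plucker_pt k V' $ J" by (auto simp: vec_eq_iff)
  define d where "d = padic_norm (plucker_pt k V $ J - plucker_pt k V' $ J)"
  have d: "d > 0" using J padic_norm_nonneg[of "plucker_pt k V $ J - plucker_pt k V' $ J"] padic_norm_eq_0_iff[of "plucker_pt k V $ J - plucker_pt k V' $ J"]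
    unfolding d_def by auto
  then obtain n where n: "1 / real (Suc n) < d" using nat_approx_posE by blast
  obtain r where r: "dist (of_rat r) (plucker_pt k V $ J) < 1 / real (Suc n)" using padic_rat_dense[of "1 / real (Suc n)" "plucker_pt k V $ J"] by auto
  define m where "m = to_nat (J, r, n)"
  have m: "X \<in> plucker_nbhd k m \<longleftrightarrow> X \<in> grassmannian k \<and> padic_norm (plucker_pt k X $ J - of_rat r) < 1 / real (Suc n)" for X :: "('a padic ^ 'n) set"
    by (simp add: plucker_nbhd_def m_def)
  have 1: "padic_norm (plucker_pt k V $ J - of_rat r) < 1 / real (Suc n)" using r by (simp add: dist_padic padic_norm_diff_commute)
  have "\<not> padic_norm (plucker_pt k V' $ J - of_rat r) < 1 / real (Suc n)"
  proof
    assume "padic_norm (plucker_pt k V' $ J - of_rat r) < 1 / real (Suc n)"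
    then have "padic_norm ((plucker_pt k V $ J - of_rat r) - (plucker_pt k V' $ J - of_rat r)) < 1 / real (Suc n)"
      using 1 padic_norm_diff_le[of "plucker_pt k V $ J - of_rat r" "plucker_pt k V' $ J - of_rat r"] by linarith
    then show False using n by (simp add: d_def)
  qed
  then show ?thesis using 1 V V' m by blast
qed

text \<open>Equality can be tested on countably many separating Borel sets.\<close>

lemma grass_borel_eq_sets:
  fixes g h :: "'x \<Rightarrow> ('a :: prime_card padic ^ 'n) set"
  assumes g: "g \<in> measurable M (grass_borel k)" and h: "h \<in> measurable M (grass_borel k)"
  shows "{x \<in> space M. g x = h x} \<in> sets M"
proof -
  have gs: "g x \<in> grassmannian k" "h x \<in> grassmannian k" if "x \<in> space M" for x
    using measurable_space[OF g that] measurable_space[OF h that] by (auto simp: space_grass_borel)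
  have "{x \<in> space M. g x = h x} = {x \<in> space M. \<forall>m. (g x \<in> plucker_nbhd k m) = (h x \<in> plucker_nbhd k m)}"
  proof (intro equalityI subsetI)
    fix x assume x: "x \<in> {x \<in> space M. \<forall>m. (g x \<in> plucker_nbhd k m) = (h x \<in> plucker_nbhd k m)}"
    then have "g x = h x" using plucker_nbhd_separates[OF gs(1) gs(2), of x x] by auto
    then show "x \<in> {x \<in> space M. g x = h x}" using x by simp
  qed simp
  also have "\<dots> \<in> sets M"
  proof (rule sets.sets_Collect_countable_All)
    fix m
    have a: "{x \<in> space M. g x \<in> plucker_nbhd k m} \<in> sets M" using measurable_sets[OF g plucker_nbhd_sets, of m] by (simp add: vimage_def Int_def conj_commute)
    have b: "{x \<in> space M. h x \<in> plucker_nbhd k m} \<in> sets M" using measurable_sets[OF h plucker_nbhd_sets, of m] by (simp add: vimage_def Int_def conj_commute)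
    have "{x \<in> space M. (g x \<in> plucker_nbhd k m) = (h x \<in> plucker_nbhd k m)} =
      ({x \<in> space M. g x \<in> plucker_nbhd k m} \<inter> {x \<in> space M. h x \<in> plucker_nbhd k m}) \<union> ((space M - {x \<in> space M. g x \<in> plucker_nbhd k m}) \<inter> (space M - {x \<in> space M. h x \<in> plucker_nbhd k m}))"
      by auto
    then show "{x \<in> space M. (g x \<in> plucker_nbhd k m) = (h x \<in> plucker_nbhd k m)} \<in> sets M" using a b by auto
  qed
  finally show ?thesis .
qed

lemma plucker_pt_cover:
  fixes g :: "'x \<Rightarrow> ('a :: prime_card padic ^ 'n) set"
  assumes g: "g \<in> measurable M (grass_borel k)" and e: "e > 0"
  shows "\<exists>B::nat \<Rightarrow> 'x set. (\<forall>n. B n \<in> sets M) \<and> space M \<subseteq> (\<Union>n. B n) \<and>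
      (\<forall>n x x'. x \<in> B n \<longrightarrow> x' \<in> B n \<longrightarrow> dist (plucker_pt k (g x)) (plucker_pt k (g x')) < e)"
proof -
  define N where "N = real CARD('n \<Rightarrow> 'n)"
  have N: "N > 0" by (simp add: N_def)
  \<comment> \<open>Two points of one box differ by at most \<open>e'\<close> in each coordinate, by
    the ultrametric inequality; summing over the coordinates leaves \<open>e / 2\<close>.\<close>
  define e' where "e' = e / (2 * N)"
  have e': "e' > 0" using e N by (simp add: e'_def)
  define B where "B m = {x \<in> space M. \<forall>J\<in>UNIV. padic_norm (plucker_pt k (g x) $ J - of_rat ((from_nat m :: rat ^ ('n \<Rightarrow> 'n)) $ J)) < e'}" for m
  show ?thesis
  proof (intro exI[of _ B] conjI allI impI)
    show "B m \<in> sets M" for m unfolding B_def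
    proof (rule sets.sets_Collect_finite_All)
      fix J
      let ?r = "of_rat ((from_nat m :: rat ^ ('n \<Rightarrow> 'n)) $ J) :: 'a padic"
      have "{x \<in> space M. padic_norm (plucker_pt k (g x) $ J - ?r) < e'} = g -` {V \<in> grassmannian k. padic_norm (plucker_pt k V $ J - ?r) < e'} \<inter> space M"
        using measurable_space[OF g] by (auto simp: space_grass_borel)
      then show "{x \<in> space M. padic_norm (plucker_pt k (g x) $ J - ?r) < e'} \<in> sets M" using measurable_sets[OF g plucker_pt_sets] by simp
    qed simp
    show "space M \<subseteq> (\<Union>m. B m)"
    proof
      fix x assume x: "x \<in> space M"
      have "\<forall>J. \<exists>r. dist (of_rat r) (plucker_pt k (g x) $ J) < e'" using padic_rat_dense[OF e'] by blast
      then obtain r where r: "\<And>J. dist (of_rat (r J)) (plucker_pt k (g x) $ J) < e'" by metis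
      have "x \<in> B (to_nat (\<chi> J. r J))" using x r by (simp add: B_def dist_padic padic_norm_diff_commute)
      then show "x \<in> (\<Union>m. B m)" by blast
    qed
    fix m x x' assume x: "x \<in> B m" "x' \<in> B m"
    have "dist (plucker_pt k (g x) $ J) (plucker_pt k (g x') $ J) \<le> e'" for J
    proof -
      let ?r = "of_rat ((from_nat m :: rat ^ ('n \<Rightarrow> 'n)) $ J) :: 'a padic"
      have "padic_norm (plucker_pt k (g x) $ J - ?r) < e'" "padic_norm (plucker_pt k (g x') $ J - ?r) < e'" using x by (auto simp: B_def)
      then show ?thesis using padic_norm_diff_le[of "plucker_pt k (g x) $ J - ?r" "plucker_pt k (g x') $ J - ?r"] by (simp add: dist_padic)
    qed
    then have "(\<Sum>J\<in>UNIV. dist (plucker_pt k (g x) $ J) (plucker_pt k (g x') $ J)) \<le> (\<Sum>J\<in>(UNIV :: ('n \<Rightarrow> 'n) set). e')" by (intro sum_mono)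
    also have "\<dots> = e / 2" using N by (simp add: e'_def N_def)
    finally have "(\<Sum>J\<in>UNIV. dist (plucker_pt k (g x) $ J) (plucker_pt k (g x') $ J)) < e" using e by simp
    moreover have "dist (plucker_pt k (g x)) (plucker_pt k (g x')) \<le> (\<Sum>J\<in>UNIV. dist (plucker_pt k (g x) $ J) (plucker_pt k (g x') $ J))"
      unfolding dist_vec_def by (intro L2_set_le_sum) simp
    ultimately show "dist (plucker_pt k (g x)) (plucker_pt k (g x')) < e" by linarith
  qed
qed

lemma continuous_map_matrix_image:
  fixes A :: "'a :: prime_card padic ^ 'n ^ 'n"
  assumes A: "invertible A"
  shows "continuous_map (grassmannian_topology k) (grassmannian_topology k) (matrix_image A)"
proof -
  let ?f = "\<lambda>v. \<lambda>i\<in>{..<k}. A *v v i"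
  have c: "continuous_map (frame_topology k) (frame_topology k) ?f"
    unfolding frame_topology_def[of k] continuous_map_in_subtopology
  proof (intro conjI)
    show "?f \<in> topspace (subtopology (product_topology (\<lambda>_. euclidean) {..<k}) (frames k)) \<rightarrow> frames k"
      using matrix_image_frame[OF _ A] by auto
    show "continuous_map (subtopology (product_topology (\<lambda>_. euclidean) {..<k}) (frames k)) (product_topology (\<lambda>_. euclidean) {..<k}) ?f"
      unfolding continuous_map_componentwise
    proof (intro conjI ballI)
      fix m assume m: "m \<in> {..<k}"
      let ?X = "subtopology (product_topology (\<lambda>_. euclidean :: ('a padic ^ 'n) topology) {..<k}) (frames k)"
      have "continuous_map ?X euclidean (\<lambda>v. v m)" using m by (intro continuous_map_from_subtopology continuous_map_product_projection)
      moreover have "continuous_map euclidean euclidean ((*v) A)"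
        unfolding continuous_map_iff_continuous2 matrix_vector_mult_def
        by (intro continuous_on_vec_lambda continuous_intros)
      ultimately have "continuous_map ?X euclidean ((*v) A \<circ> (\<lambda>v. v m))" by (rule continuous_map_compose)
      then show "continuous_map ?X euclidean (\<lambda>v. ?f v m)" using m by (simp add: o_def)
    qed auto
  qed
  have eq: "matrix_image A (vec.span (v ` {..<k})) = vec.span (?f v ` {..<k})" for v
    by (simp add: matrix_image_span image_image)
  have "continuous_map (frame_topology k) (grassmannian_topology k) (\<lambda>v. vec.span (?f v ` {..<k}))"
    using continuous_map_compose[OF c quotient_imp_continuous_map[OF quotient_map_frame_span]] by (simp add: o_def)
  then have "continuous_map (frame_topology k) (grassmannian_topology k) (matrix_image A \<circ> (\<lambda>v. vec.span (v ` {..<k})))"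
    by (simp add: o_def eq)
  then show ?thesis by (rule continuous_compose_quotient_map[OF quotient_map_frame_span])
qed

section \<open>Rational matrices and stabilisers\<close>

lemma countable_rat_subspaces: "countable {S :: (rat ^ 'N) set. vec.subspace S}"
proof -
  have "{S :: (rat ^ 'N) set. vec.subspace S} \<subseteq> vec.span ` {B. finite B}"
  proof
    fix S :: "(rat ^ 'N) set" assume "S \<in> {S. vec.subspace S}"
    then have S: "vec.subspace S" by simp
    obtain B where B: "B \<subseteq> S" "vec.independent B" "S \<subseteq> vec.span B" using vec.maximal_independent_subset by blast
    have "S = vec.span B" using B S vec.span_minimal[of B S] by blast
    then show "S \<in> vec.span ` {B. finite B}" using vec.finiteI_independent[OF B(2)] by blast
  qed
  moreover have "countable (vec.span ` {B :: (rat ^ 'N) set. finite B})"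
    by (intro countable_image countable_Collect_finite)
  ultimately show ?thesis by (rule countable_subset)
qed

lemma matrix_image_comp: "matrix_image A (matrix_image B V) = matrix_image (A ** B) V"
  by (simp add: matrix_image_def image_image matrix_vector_mul_assoc)

lemma matrix_image_one: "matrix_image (mat 1) V = V"
  by (simp add: matrix_image_def)

lemma map_matrix_mult:
  "map_matrix (of_rat :: rat \<Rightarrow> 'a :: field_char_0) (A ** B) = map_matrix of_rat A ** map_matrix of_rat B"
  by (simp add: map_matrix_def matrix_matrix_mult_def vec_eq_iff of_rat_sum of_rat_mult)

lemma map_matrix_mat1: "map_matrix (of_rat :: rat \<Rightarrow> 'a :: field_char_0) (mat 1) = mat 1"
  by (simp add: map_matrix_def mat_def vec_eq_iff)

definition rat_maps :: "(('a :: prime_card padic ^ 'n) set \<Rightarrow> ('a padic ^ 'n) set) set" where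
  "rat_maps = (\<lambda>A. matrix_image (map_matrix of_rat A)) ` GL_rat"

lemma countable_rat_maps: "countable rat_maps"
  unfolding rat_maps_def by (intro countable_image) simp

lemma GL_rat_inv:
  assumes "A \<in> GL_rat"
  obtains B where "B \<in> GL_rat" "A ** B = mat 1" "B ** A = mat 1"
  using assms unfolding GL_rat_def invertible_def by blast

lemma map_matrix_invertible: "A \<in> GL_rat \<Longrightarrow> invertible (map_matrix (of_rat :: rat \<Rightarrow> 'a :: field_char_0) A)"
  by (metis GL_rat_inv invertible_def map_matrix_mat1 map_matrix_mult)

lemma rat_maps_id: "id \<in> rat_maps"
proof -
  have "mat 1 \<in> GL_rat" by (auto simp: GL_rat_def invertible_def intro: exI[of _ "mat 1"])
  moreover have "(id :: ('a :: prime_card padic ^ 'n) set \<Rightarrow> _) = matrix_image (map_matrix of_rat (mat 1))"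
    by (simp add: map_matrix_mat1 matrix_image_one fun_eq_iff)
  ultimately show ?thesis unfolding rat_maps_def by blast
qed

lemma rat_maps_comp:
  assumes "l \<in> rat_maps" "m \<in> rat_maps"
  shows "l \<circ> m \<in> rat_maps"
proof -
  obtain A B where AB: "A \<in> GL_rat" "B \<in> GL_rat" "l = matrix_image (map_matrix of_rat A)" "m = matrix_image (map_matrix of_rat B)"
    using assms by (auto simp: rat_maps_def)
  have "A ** B \<in> GL_rat" using AB by (simp add: GL_rat_def invertible_mult)
  moreover have "l \<circ> m = matrix_image (map_matrix of_rat (A ** B))"
    by (simp add: AB fun_eq_iff matrix_image_comp map_matrix_mult)
  ultimately show ?thesis unfolding rat_maps_def by blast
qed

lemma rat_maps_inv_ex:
  assumes "l \<in> rat_maps"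
  obtains m where "m \<in> rat_maps" "m \<circ> l = id" "l \<circ> m = id"
proof -
  obtain A where A: "A \<in> GL_rat" "l = matrix_image (map_matrix of_rat A)" using assms by (auto simp: rat_maps_def)
  obtain B where B: "B \<in> GL_rat" "A ** B = mat 1" "B ** A = mat 1" using A(1) by (rule GL_rat_inv)
  show ?thesis
  proof (rule that)
    show "matrix_image (map_matrix of_rat B) \<in> rat_maps" using B by (auto simp: rat_maps_def)
    show "matrix_image (map_matrix of_rat B) \<circ> l = id" "l \<circ> matrix_image (map_matrix of_rat B) = id"
      by (simp_all add: A fun_eq_iff matrix_image_comp B map_matrix_mat1 matrix_image_one flip: map_matrix_mult)
  qed
qed

lemma rat_maps_bij: "l \<in> rat_maps \<Longrightarrow> bij l"
  by (metis rat_maps_inv_ex o_bij)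

lemma rat_maps_inv: "l \<in> rat_maps \<Longrightarrow> inv_into UNIV l \<in> rat_maps"
  by (metis rat_maps_inv_ex inv_unique_comp)

text \<open>The rational matrices mapping \<open>V\<close> into itself form a rational vector space,
  and the stabiliser is recovered from it by taking the invertible elements.\<close>

lemma countable_stabilisers:
  "countable ((\<lambda>V. {l \<in> rat_maps. l V = V}) ` (grassmannian k :: ('a :: prime_card padic ^ 'n) set set))"
proof -
  \<comment> \<open>Matrices are flattened to vectors indexed by pairs, so that rational subspaces
    of them are covered by \<open>countable_rat_subspaces\<close>.\<close>
  define un :: "rat ^ ('n \<times> 'n) \<Rightarrow> rat ^ 'n ^ 'n" where "un a = (\<chi> i j. a $ (i, j))" for a
  define RR where "RR V = {a. \<forall>v\<in>V. map_matrix of_rat (un a) *v v \<in> V}" for V :: "('a padic ^ 'n) set"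
  define St where "St S = {matrix_image (map_matrix of_rat (un a) :: 'a padic ^ 'n ^ 'n) |a. un a \<in> GL_rat \<and> a \<in> S}" for S :: "(rat ^ ('n \<times> 'n)) set"
  have sub: "vec.subspace (RR V)" if V: "V \<in> grassmannian k" for V
  proof -
    have Vs: "vec.subspace V" using V by (simp add: grassmannian_def)
    have add: "map_matrix of_rat (un (a + b)) *v v = map_matrix of_rat (un a) *v v + map_matrix of_rat (un b) *v (v :: 'a padic ^ 'n)" for a b v
      by (simp add: vec_eq_iff map_matrix_def un_def matrix_vector_mult_def of_rat_add algebra_simps sum.distrib)
    have sc: "map_matrix of_rat (un (c *s a)) *v v = of_rat c *s (map_matrix of_rat (un a) *v (v :: 'a padic ^ 'n))" for a c v
      by (simp add: vec_eq_iff map_matrix_def un_def matrix_vector_mult_def of_rat_mult sum_distrib_left mult_ac)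
    have z: "map_matrix of_rat (un 0) *v v = (0 :: 'a padic ^ 'n)" for v
      by (simp add: vec_eq_iff map_matrix_def un_def matrix_vector_mult_def)
    show ?thesis unfolding vec.subspace_def RR_def
      using vec.subspace_0[OF Vs] vec.subspace_add[OF Vs] vec.subspace_scale[OF Vs] by (simp add: add sc z)
  qed
  have stab: "{l \<in> rat_maps. l V = V} = St (RR V)" if V: "V \<in> grassmannian k" for V :: "('a padic ^ 'n) set"
  proof (intro equalityI subsetI)
    fix l assume "l \<in> {l \<in> rat_maps. l V = V}"
    then obtain A where A: "A \<in> GL_rat" "l = matrix_image (map_matrix of_rat A)" "l V = V" by (auto simp: rat_maps_def)
    define a where "a = (\<chi> z. A $ fst z $ snd z)"
    have ua: "un a = A" by (simp add: un_def a_def vec_eq_iff)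
    have "map_matrix of_rat A *v v \<in> V" if "v \<in> V" for v
      using A(3) that unfolding A(2) matrix_image_def by blast
    then have "a \<in> RR V" by (simp add: RR_def ua)
    then show "l \<in> St (RR V)" unfolding St_def using A ua by blast
  next
    fix l assume "l \<in> St (RR V)"
    then obtain a where a: "un a \<in> GL_rat" "a \<in> RR V" "l = matrix_image (map_matrix of_rat (un a))" by (auto simp: St_def)
    \<comment> \<open>Inclusion is enough, since the image has the same dimension as
      \<open>V\<close>.\<close>
    have sub: "l V \<subseteq> V" using a(2) unfolding a(3) RR_def matrix_image_def by auto
    have "l V \<in> grassmannian k" unfolding a(3) by (rule matrix_image_grassmannian(1)[OF V map_matrix_invertible[OF a(1)]])
    then have "l V = V" using sub V vec.subspace_dim_equal[of "l V" V] by (simp add: grassmannian_def)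
    then show "l \<in> {l \<in> rat_maps. l V = V}" using a by (auto simp: rat_maps_def)
  qed
  have "(\<lambda>V. {l \<in> rat_maps. l V = V}) ` (grassmannian k :: ('a padic ^ 'n) set set) \<subseteq> St ` {S. vec.subspace S}"
  proof
    fix z assume "z \<in> (\<lambda>V. {l \<in> rat_maps. l V = V}) ` (grassmannian k :: ('a padic ^ 'n) set set)"
    then obtain V where V: "V \<in> grassmannian k" "z = {l \<in> rat_maps. l V = V}" by (rule imageE)
    have "z = St (RR V)" using stab[OF V(1)] V(2) by simp
    then show "z \<in> St ` {S. vec.subspace S}" using sub[OF V(1)] by simp
  qed
  then show ?thesis by (rule countable_subset) (intro countable_image countable_rat_subspaces)
qed

section \<open>Charts of projective space\<close>

lemma map_matrix_of_int_mult:
  "map_matrix (of_int :: int \<Rightarrow> 'a :: comm_ring_1) (A ** B) = map_matrix of_int A ** map_matrix of_int B"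
  by (simp add: map_matrix_def matrix_matrix_mult_def vec_eq_iff)

lemma map_matrix_of_int_mat1: "map_matrix (of_int :: int \<Rightarrow> 'a :: comm_ring_1) (mat 1) = mat 1"
  by (simp add: map_matrix_def mat_def vec_eq_iff)

lemma det_map_matrix_of_int: "det (map_matrix of_int A :: 'a :: comm_ring_1 ^ 'm ^ 'm) = of_int (det A)"
  by (simp add: det_def map_matrix_def of_int_sum of_int_prod)

lemma SL_int_padic: "h \<in> SL_int \<Longrightarrow> (map_matrix of_int h :: 'a :: prime_card padic ^ 'm ^ 'm) \<in> SL_padic_integers"
  using det_map_matrix_of_int[of h, where 'a = "'a :: prime_card padic"]
  by (simp add: SL_int_def SL_padic_integers_def padic_integers_def padic_norm_of_int_le_1)

text \<open>Records an integral inverse with each element. Elementary matrices and their products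
  come with one, so no adjugate has to be formed.\<close>

definition SL_int_units :: "(int ^ 'm ^ 'm) set" where
  "SL_int_units = {h \<in> SL_int. \<exists>h'\<in>SL_int. h ** h' = mat 1 \<and> h' ** h = mat 1}"

lemma SL_int_units_SL_int: "h \<in> SL_int_units \<Longrightarrow> h \<in> SL_int"
  by (simp add: SL_int_units_def)

lemma SL_int_units_inverse:
  assumes "h \<in> SL_int_units"
  obtains h' where "h' \<in> SL_int_units" "h ** h' = mat 1" "h' ** h = mat 1"
  using assms unfolding SL_int_units_def by blast

lemma SL_int_units_mult:
  assumes g: "g \<in> SL_int_units" and h: "h \<in> SL_int_units"
  shows "g ** h \<in> SL_int_units"
proof -
  obtain g' where g': "g' \<in> SL_int_units" "g ** g' = mat 1" "g' ** g = mat 1" using g by (rule SL_int_units_inverse)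
  obtain h' where h': "h' \<in> SL_int_units" "h ** h' = mat 1" "h' ** h = mat 1" using h by (rule SL_int_units_inverse)
  have "(g ** h) ** (h' ** g') = g ** (h ** h') ** g'" "(h' ** g') ** (g ** h) = h' ** (g' ** g) ** h"
    by (simp_all only: matrix_mul_assoc)
  then have "(g ** h) ** (h' ** g') = mat 1" "(h' ** g') ** (g ** h) = mat 1" using g' h' by simp_all
  moreover have "g ** h \<in> SL_int" "h' ** g' \<in> SL_int" using g h g' h' by (auto simp: SL_int_units_def SL_int_def det_mul)
  ultimately show ?thesis unfolding SL_int_units_def by blast
qed

lemma SL_int_units_one: "mat 1 \<in> SL_int_units"
  by (auto simp: SL_int_units_def SL_int_def intro!: bexI[of _ "mat 1"])

definition elem_matrix :: "'m \<Rightarrow> 'm \<Rightarrow> int \<Rightarrow> int ^ 'm ^ 'm" where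
  "elem_matrix i j c = (\<chi> k. if k = i then row i (mat 1) + c *s row j (mat 1) else row k (mat 1))"

lemma elem_matrix_nth: "elem_matrix i j c $ k $ l = (if k = l then 1 else 0) + (if k = i \<and> l = j then c else 0)"
  by (auto simp: elem_matrix_def row_def mat_def)

lemma elem_matrix_mult_vec:
  fixes a :: "'a :: comm_ring_1 ^ 'm"
  shows "(map_matrix of_int (elem_matrix i j c) *v a) $ k = (if k = i then a $ i + of_int c * a $ j else a $ k)"
proof -
  have "(map_matrix of_int (elem_matrix i j c) *v a) $ k =
      (\<Sum>l\<in>UNIV. (if k = l then a $ l else 0) + (if l = j then (if k = i then of_int c * a $ l else 0) else 0))"
    unfolding matrix_vector_mult_def vec_lambda_beta by (rule sum.cong) (auto simp: map_matrix_def elem_matrix_nth algebra_simps)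
  also have "\<dots> = a $ k + (if k = i then of_int c * a $ j else 0)"
    by (simp add: sum.distrib sum.delta sum.delta' del: if_split)
  finally show ?thesis by auto
qed

lemma elem_matrix_SL_int: "i \<noteq> j \<Longrightarrow> elem_matrix i j c \<in> SL_int"
  unfolding SL_int_def elem_matrix_def by (simp add: det_row_operation)

lemma elem_matrix_elem_matrix:
  fixes i j :: "'m :: finite"
  assumes ij: "i \<noteq> j"
  shows "elem_matrix i j c ** elem_matrix i j (- c) = mat 1"
proof -
  have "(elem_matrix i j c ** elem_matrix i j (- c)) *v a = a" for a :: "int ^ 'm"
  proof -
    have m: "elem_matrix i j d = map_matrix of_int (elem_matrix i j d)" for d :: int by (simp add: map_matrix_def vec_eq_iff)
    have "(elem_matrix i j c ** elem_matrix i j (- c)) *v a = map_matrix of_int (elem_matrix i j c) *v (map_matrix of_int (elem_matrix i j (- c)) *v a)"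
      by (subst (1 2) m) (simp add: matrix_vector_mul_assoc)
    also have "\<dots> = a" using ij by (simp add: vec_eq_iff elem_matrix_mult_vec del: of_int_eq_id)
    finally show ?thesis .
  qed
  then show ?thesis by (simp add: matrix_eq)
qed

lemma elem_matrix_SL_int_units: "i \<noteq> j \<Longrightarrow> elem_matrix i j c \<in> SL_int_units"
  using elem_matrix_elem_matrix[of i j c] elem_matrix_elem_matrix[of i j "- c"] elem_matrix_SL_int[of i j c] elem_matrix_SL_int[of i j "- c"]
  unfolding SL_int_units_def by auto

lemma swap_SL_int_units:
  fixes i j :: "'m :: finite"
  shows "\<exists>h\<in>SL_int_units. \<forall>a :: 'a :: comm_ring_1 ^ 'm. (map_matrix of_int h *v a) $ i = a $ j \<or> (map_matrix of_int h *v a) $ i = - a $ j"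
proof (cases "i = j")
  case True
  show ?thesis by (rule bexI[OF _ SL_int_units_one]) (simp add: map_matrix_of_int_mat1 True)
next
  case False
  \<comment> \<open>A quarter turn in the plane of \<open>i\<close> and \<open>j\<close>, as a
    product of three elementary matrices.\<close>
  let ?h = "elem_matrix i j 1 ** (elem_matrix j i (- 1) ** elem_matrix i j 1)"
  have "?h \<in> SL_int_units" using False by (intro SL_int_units_mult elem_matrix_SL_int_units) auto
  moreover have "(map_matrix of_int ?h *v a) $ i = a $ j" for a :: "'a ^ 'm"
    using False by (simp add: map_matrix_of_int_mult matrix_vector_mul_assoc[symmetric] elem_matrix_mult_vec)
  ultimately show ?thesis by blast
qed

section \<open>Integral matrices and the maximum norm\<close>

lemma padic_norm_prod: "padic_norm (\<Prod>i\<in>S. h i) = (\<Prod>i\<in>S. padic_norm (h i))" for h :: "'i \<Rightarrow> 'a :: prime_card padic"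
  by (induction S rule: infinite_finite_induct) (auto simp: padic_norm_mult)

lemma padic_norm_mult_vec_le:
  fixes A :: "'a :: prime_card padic ^ 'm ^ 'n"
  assumes A: "\<And>i j. padic_norm (A $ i $ j) \<le> 1" and x: "\<And>j. padic_norm (x $ j) \<le> C"
  shows "padic_norm ((A *v x) $ i) \<le> C"
proof -
  have C: "0 \<le> C" using x[of undefined] padic_norm_nonneg[of "x $ undefined"] by linarith
  show ?thesis unfolding matrix_vector_mult_def vec_lambda_beta
  proof (rule padic_norm_sum_le[OF C])
    fix j
    have "padic_norm (A $ i $ j) * padic_norm (x $ j) \<le> 1 * C" using A x padic_norm_nonneg by (intro mult_mono) auto
    then show "padic_norm (A $ i $ j * x $ j) \<le> C" by (simp add: padic_norm_mult)
  qed
qed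

text \<open>As the determinant is 1, Cramer's rule writes \<open>x $ k\<close> as a determinant
  whose column \<open>k\<close> is \<open>A *v x\<close> and whose other entries are integral; each
  of its terms has norm at most \<open>C\<close>. Together with the direct estimate, these matrices
  preserve the maximum norm.\<close>

lemma SL_padic_norm_le:
  fixes A :: "'a :: prime_card padic ^ 'm ^ 'm"
  assumes A: "A \<in> SL_padic_integers" and x: "\<And>i. padic_norm ((A *v x) $ i) \<le> C"
  shows "padic_norm (x $ k) \<le> C"
proof -
  have C: "0 \<le> C" using x[of undefined] padic_norm_nonneg[of "(A *v x) $ undefined"] by linarith
  let ?B = "(\<chi> i j. if j = k then (A *v x) $ i else A $ i $ j) :: 'a padic ^ 'm ^ 'm"
  have "x $ k = det ?B" using cramer_lemma[of k A x] A by (simp add: SL_padic_integers_def)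
  moreover have "padic_norm (det ?B) \<le> C" unfolding det_def
  proof (rule padic_norm_sum_le[OF C])
    fix \<pi> assume "\<pi> \<in> {\<pi>. \<pi> permutes (UNIV :: 'm set)}"
    then have \<pi>: "bij \<pi>" by (simp add: permutes_bij)
    obtain i0 where i0: "\<pi> i0 = k" using \<pi> by (metis bij_pointE)
    have "padic_norm (\<Prod>i\<in>UNIV. ?B $ i $ \<pi> i) = padic_norm (?B $ i0 $ \<pi> i0) * (\<Prod>i\<in>UNIV - {i0}. padic_norm (?B $ i $ \<pi> i))"
      unfolding padic_norm_prod by (rule prod.remove) auto
    also have "\<dots> \<le> C * 1"
    proof (rule mult_mono)
      show "padic_norm (?B $ i0 $ \<pi> i0) \<le> C" using x i0 by simp
      show "(\<Prod>i\<in>UNIV - {i0}. padic_norm (?B $ i $ \<pi> i)) \<le> 1"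
      proof (rule prod_le_1)
        fix i assume "i \<in> UNIV - {i0}"
        then have "\<pi> i \<noteq> k" using i0 \<pi> by (metis DiffD2 bij_pointE singletonI)
        then show "0 \<le> padic_norm (?B $ i $ \<pi> i) \<and> padic_norm (?B $ i $ \<pi> i) \<le> 1"
          using A by (simp add: SL_padic_integers_def padic_integers_def padic_norm_nonneg)
      qed
    qed (use C in \<open>auto intro!: prod_nonneg padic_norm_nonneg\<close>)
    finally have "padic_norm (\<Prod>i\<in>UNIV. ?B $ i $ \<pi> i) \<le> C" by simp
    moreover have "padic_norm (of_int (sign \<pi>) :: 'a padic) = 1" by (simp add: sign_def padic_norm_minus)
    ultimately show "padic_norm (of_int (sign \<pi>) * (\<Prod>i\<in>UNIV. ?B $ i $ \<pi> i)) \<le> C" by (simp add: padic_norm_mult)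
  qed
  ultimately show ?thesis by simp
qed

lemma SL_padic_mult:
  fixes A B :: "'a :: prime_card padic ^ 'm ^ 'm"
  assumes A: "A \<in> SL_padic_integers" and B: "B \<in> SL_padic_integers"
  shows "A ** B \<in> SL_padic_integers"
proof -
  have "padic_norm ((A ** B) $ i $ j) \<le> 1" for i j
  proof -
    have "(A ** B) $ i $ j = (A *v (\<chi> l. B $ l $ j)) $ i" by (simp add: matrix_matrix_mult_def matrix_vector_mult_def)
    then show ?thesis using padic_norm_mult_vec_le[of A "\<chi> l. B $ l $ j" 1 i] A B
      by (simp add: SL_padic_integers_def padic_integers_def)
  qed
  then show ?thesis using A B by (simp add: SL_padic_integers_def padic_integers_def det_mul)
qed

section \<open>Charts and their balls\<close>

definition chart :: "'m \<Rightarrow> ('a :: prime_card padic ^ 'm) set" where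
  "chart c = {a. a $ c = 1 \<and> (\<forall>i. padic_norm (a $ i) \<le> 1)}"

definition padic_cell :: "nat \<Rightarrow> 'a :: prime_card padic ^ 'm \<Rightarrow> ('a padic ^ 'm) set" where
  "padic_cell k a = {b. \<forall>i. padic_norm (a $ i - b $ i) \<le> inverse (real CARD('a)) ^ k}"

lemma padic_cell_eq_iff:
  fixes a b :: "'a :: prime_card padic ^ 'm"
  shows "padic_cell k a = padic_cell k b \<longleftrightarrow> (\<forall>i. padic_norm (a $ i - b $ i) \<le> inverse (real CARD('a)) ^ k)"
proof
  assume "padic_cell k a = padic_cell k b"
  moreover have "b \<in> padic_cell k b" by (simp add: padic_cell_def)
  ultimately have "b \<in> padic_cell k a" by simp
  then show "\<forall>i. padic_norm (a $ i - b $ i) \<le> inverse (real CARD('a)) ^ k" by (simp add: padic_cell_def)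
next
  assume *: "\<forall>i. padic_norm (a $ i - b $ i) \<le> inverse (real CARD('a)) ^ k"
  have "padic_norm (a $ i - x $ i) \<le> inverse (real CARD('a)) ^ k \<longleftrightarrow> padic_norm (b $ i - x $ i) \<le> inverse (real CARD('a)) ^ k" for x i
    using *[rule_format, of i] padic_norm_add_le[of "a $ i - b $ i" "inverse (real CARD('a)) ^ k" "b $ i - x $ i"]
      padic_norm_diff_commute[of "a $ i" "b $ i"] padic_norm_add_le[of "b $ i - a $ i" "inverse (real CARD('a)) ^ k" "a $ i - x $ i"] by auto
  then show "padic_cell k a = padic_cell k b" by (simp add: padic_cell_def)
qed

definition chart_cells :: "'m \<Rightarrow> ('a :: prime_card padic ^ 'm) set set" where
  "chart_cells c = {{x \<in> chart c. padic_cell k x = b} |k b. True}"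

definition chart_space :: "'m \<Rightarrow> ('a :: prime_card padic ^ 'm) measure" where
  "chart_space c = sigma (chart c) (chart_cells c)"

lemma chart_cells_Pow: "chart_cells c \<subseteq> Pow (chart c)"
  by (auto simp: chart_cells_def)

lemma space_chart_space [simp]: "space (chart_space c) = chart c"
  unfolding chart_space_def by (rule space_measure_of[OF chart_cells_Pow])

lemma sets_chart_space: "sets (chart_space c) = sigma_sets (chart c) (chart_cells c)"
  unfolding chart_space_def by (rule sets_measure_of[OF chart_cells_Pow])

text \<open>Natural numbers below the \<open>k\<close>-th power represent all residues, so the balls
  are counted by the residues of the coordinates other than \<open>c\<close>.\<close>

lemma padic_cell_image_chart:
  fixes c :: "'m :: finite"
  shows "padic_cell k ` (chart c :: ('a :: prime_card padic ^ 'm) set) \<subseteq>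
    (\<lambda>t. padic_cell k (\<chi> i. if i = c then 1 else of_nat (t i))) ` ((UNIV - {c}) \<rightarrow>\<^sub>E {..<CARD('a) ^ k})"
proof
  fix s assume "s \<in> padic_cell k ` (chart c :: ('a padic ^ 'm) set)"
  then obtain x :: "'a padic ^ 'm" where x: "x \<in> chart c" "s = padic_cell k x" by blast
  have "\<exists>n. n < CARD('a) ^ k \<and> padic_norm (x $ i - of_nat n) \<le> inverse (real CARD('a)) ^ k" for i
    using padic_int_dense[of "x $ i" k] x(1) by (auto simp: chart_def)
  then obtain t where t: "\<And>i. t i < CARD('a) ^ k" "\<And>i. padic_norm (x $ i - of_nat (t i)) \<le> inverse (real CARD('a)) ^ k" by metis
  let ?t = "restrict t (UNIV - {c})"
  have "s = padic_cell k (\<chi> i. if i = c then 1 else of_nat (?t i))"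
    unfolding x(2) padic_cell_eq_iff using t(2) x(1) by (auto simp: chart_def)
  moreover have "?t \<in> (UNIV - {c}) \<rightarrow>\<^sub>E {..<CARD('a) ^ k}" using t(1) by auto
  ultimately show "s \<in> (\<lambda>t. padic_cell k (\<chi> i. if i = c then 1 else of_nat (t i))) ` ((UNIV - {c}) \<rightarrow>\<^sub>E {..<CARD('a) ^ k})" by blast
qed

lemma finite_padic_cell_chart: "finite (padic_cell k ` (chart c :: ('a :: prime_card padic ^ 'm) set))"
  by (rule finite_subset[OF padic_cell_image_chart]) (auto intro!: finite_PiE)

lemma card_padic_cell_chart:
  "card (padic_cell k ` (chart c :: ('a :: prime_card padic ^ 'm) set)) \<le> CARD('a) ^ (k * card (UNIV - {c}))"
proof -
  have fin: "finite ((UNIV - {c}) \<rightarrow>\<^sub>E {..<CARD('a) ^ k})" by (auto intro!: finite_PiE)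
  have "card (padic_cell k ` (chart c :: ('a padic ^ 'm) set)) \<le> card ((UNIV - {c}) \<rightarrow>\<^sub>E {..<CARD('a) ^ k})"
    using card_mono[OF finite_imageI[OF fin] padic_cell_image_chart] card_image_le[OF fin] by (rule order_trans)
  also have "\<dots> = CARD('a) ^ (k * card (UNIV - {c}))" by (simp add: card_PiE power_mult)
  finally show ?thesis .
qed

lemma cell_sets_chart: "{x \<in> chart c. padic_cell k x = b} \<in> sets (chart_space c)"
  unfolding sets_chart_space by (rule sigma_sets.Basic) (auto simp: chart_cells_def)

text \<open>An open set is the union of the balls inside it, and each level has only finitely many
  balls.\<close>

lemma open_chart_sets:
  fixes U :: "('a :: prime_card padic ^ 'm) set"
  assumes U: "open U"
  shows "U \<inter> chart c \<in> sets (chart_space c)"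
proof -
  define K where "K = {(k, b). b \<in> padic_cell k ` (chart c :: ('a padic ^ 'm) set) \<and> {x \<in> chart c. padic_cell k x = b} \<subseteq> U}"
  have "K \<subseteq> Sigma UNIV (\<lambda>k. padic_cell k ` (chart c :: ('a padic ^ 'm) set))" by (auto simp: K_def)
  moreover have "countable (Sigma (UNIV :: nat set) (\<lambda>k. padic_cell k ` (chart c :: ('a padic ^ 'm) set)))"
    by (rule countable_SIGMA) (simp_all add: countable_finite finite_padic_cell_chart)
  ultimately have K: "countable K" by (rule countable_subset)
  have "U \<inter> chart c = (\<Union>(k, b)\<in>K. {x \<in> chart c. padic_cell k x = b})"
  proof (intro equalityI subsetI)
    fix x assume x: "x \<in> U \<inter> chart c"
    then obtain e where e: "e > 0" "\<And>y. dist y x < e \<Longrightarrow> y \<in> U" using U by (auto simp: open_dist)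
    have m: "real CARD('m) > 0" by simp
    obtain k where k: "inverse (real CARD('a)) ^ k < e / real CARD('m)"
      using real_arch_pow_inv[of "e / real CARD('m)" "inverse (real CARD('a))"] e(1) card_gt_1[where 'a = 'a] by (auto simp: inverse_less_1_iff)
    have "y \<in> U" if "y \<in> chart c" "padic_cell k y = padic_cell k x" for y
    proof -
      have "dist y x \<le> (\<Sum>i\<in>UNIV. dist (y $ i) (x $ i))" unfolding dist_vec_def by (intro L2_set_le_sum) simp
      also have "\<dots> \<le> (\<Sum>i\<in>(UNIV :: 'm set). inverse (real CARD('a)) ^ k)"
        using that(2) unfolding padic_cell_eq_iff by (intro sum_mono) (simp add: dist_padic)
      also have "\<dots> < e" using k m by (simp add: field_simps)
      finally show ?thesis by (rule e(2))
    qed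
    then have "(k, padic_cell k x) \<in> K" using x by (auto simp: K_def)
    then show "x \<in> (\<Union>(k, b)\<in>K. {x \<in> chart c. padic_cell k x = b})" using x by blast
  qed (auto simp: K_def)
  also have "\<dots> \<in> sets (chart_space c)" using K by (intro sets.countable_UN') (auto intro: cell_sets_chart)
  finally show ?thesis .
qed

lemma span_singleton_grassmannian: "a \<noteq> 0 \<Longrightarrow> vec.span {a} \<in> grassmannian 1"
  for a :: "'a :: prime_card padic ^ 'm"
  by (simp add: grassmannian_def vec.dim_span vec.dim_eq_card_independent)

lemma chart_nonzero: "a \<in> chart c \<Longrightarrow> a \<noteq> 0"
  by (auto simp: chart_def)

lemma continuous_map_span:
  "continuous_map (top_of_set (- {0})) (grassmannian_topology 1) (\<lambda>a :: 'a :: prime_card padic ^ 'm. vec.span {a})"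
proof -
  let ?f = "\<lambda>a :: 'a padic ^ 'm. \<lambda>i\<in>{..<1::nat}. a"
  have "continuous_map (top_of_set (- {0})) (product_topology (\<lambda>_. euclidean) {..<1}) ?f"
    by (auto simp: continuous_map_componentwise)
  moreover have "?f ` topspace (top_of_set (- {0})) \<subseteq> frames 1"
    by (auto simp: frames_def inj_on_def PiE_def extensional_def lessThan_Suc)
  ultimately have "continuous_map (top_of_set (- {0})) (frame_topology 1) ?f"
    unfolding frame_topology_def by (auto simp: continuous_map_in_subtopology)
  from continuous_map_compose[OF this quotient_imp_continuous_map[OF quotient_map_frame_span]]
  show ?thesis by (simp add: o_def lessThan_Suc)
qed

lemma measurable_span_chart:
  "(\<lambda>a :: 'a :: prime_card padic ^ 'm. vec.span {a}) \<in> measurable (chart_space c) (borel_of (grassmannian_topology 1))"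
  unfolding borel_of_def
proof (rule measurable_measure_of)
  let ?T = "grassmannian_topology 1 :: ('a padic ^ 'm) set topology"
  show "{U. openin ?T U} \<subseteq> Pow (topspace ?T)" using openin_subset by blast
  show "(\<lambda>a. vec.span {a}) \<in> space (chart_space c) \<rightarrow> topspace ?T"
  proof
    fix a :: "'a padic ^ 'm" assume "a \<in> space (chart_space c)"
    then have "a \<noteq> 0" using chart_nonzero[of a c] by simp
    then show "vec.span {a} \<in> topspace ?T" using span_singleton_grassmannian[of a] by simp
  qed
  fix U assume "U \<in> {U. openin ?T U}"
  then have "openin (top_of_set (- {0})) {a \<in> topspace (top_of_set (- {0 :: 'a padic ^ 'm})). vec.span {a} \<in> U}"
    using openin_continuous_map_preimage[OF continuous_map_span] by blast
  then obtain W where W: "open W" "{a. a \<noteq> 0 \<and> vec.span {a} \<in> U} = - {0} \<inter> W" by (auto simp: openin_open)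
  have "(\<lambda>a. vec.span {a}) -` U \<inter> space (chart_space c) = W \<inter> chart c"
  proof (intro equalityI subsetI)
    fix a assume a: "a \<in> (\<lambda>a. vec.span {a}) -` U \<inter> space (chart_space c)"
    then have "a \<in> {a. a \<noteq> 0 \<and> vec.span {a} \<in> U}" using chart_nonzero[of a c] by simp
    then show "a \<in> W \<inter> chart c" using a unfolding W(2) by simp
  next
    fix a assume a: "a \<in> W \<inter> chart c"
    then have "a \<in> - {0} \<inter> W" using chart_nonzero[of a c] by simp
    then show "a \<in> (\<lambda>a. vec.span {a}) -` U \<inter> space (chart_space c)" using a unfolding W(2)[symmetric] by simp
  qed
  then show "(\<lambda>a. vec.span {a}) -` U \<inter> space (chart_space c) \<in> sets (chart_space c)"
    using open_chart_sets[OF W(1)] by simp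
qed

section \<open>Haar measure seen in a chart\<close>

locale haar_line =
  fixes \<nu> :: "('p :: prime_card padic ^ 'm ^ 'm) measure" and w :: "'p padic ^ 'm"
  assumes haar: "is_haar_prob SL_padic_integers \<nu>" and w_le: "\<And>i. padic_norm (w $ i) \<le> 1"
    and w_unit: "\<exists>i. padic_norm (w $ i) = 1"
begin

lemma prob_nu: "prob_space \<nu>"
  using haar by (simp add: is_haar_prob_def)

lemma sets_nu: "sets \<nu> = sets (restrict_space borel SL_padic_integers)"
  using haar by (simp add: is_haar_prob_def)

lemma space_nu: "space \<nu> = SL_padic_integers"
  using sets_eq_imp_space_eq[OF sets_nu] by (simp add: space_restrict_space)

lemma borel_nu: "B \<in> sets borel \<Longrightarrow> {g \<in> SL_padic_integers. g \<in> B} \<in> sets \<nu>"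
  unfolding sets_nu sets_restrict_space by (auto simp: image_iff Int_def)

lemma continuous_mult_vec: "continuous_on UNIV (\<lambda>g :: 'p padic ^ 'm ^ 'm. (g *v w) $ i)"
  unfolding matrix_vector_mult_def vec_lambda_beta
  by (intro continuous_intros)

lemma mult_vec_sets:
  "{g \<in> SL_padic_integers. padic_norm ((g *v w) $ i - b * (g *v w) $ j) \<le> r} \<in> sets \<nu>"
proof -
  have "continuous_on UNIV (\<lambda>g. (g *v w) $ i + (- b) * (g *v w) $ j)"
    by (intro continuous_intros continuous_mult_vec)
  then have "continuous_on UNIV (\<lambda>g. padic_norm ((g *v w) $ i - b * (g *v w) $ j))"
    using continuous_on_compose2[OF isCont_padic_norm[of UNIV]] by simp
  then have "closed {g. padic_norm ((g *v w) $ i - b * (g *v w) $ j) \<le> r}"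
    by (intro closed_Collect_le) simp_all
  from borel_nu[OF borel_closed[OF this]] show ?thesis by simp
qed

text \<open>Invariance is given for images; it passes to preimages because \<open>h\<close> is
  invertible over the integers.\<close>

lemma haar_vimage:
  fixes h :: "int ^ 'm ^ 'm"
  assumes h: "h \<in> SL_int_units" and B: "B \<in> sets \<nu>"
  shows "{g \<in> SL_padic_integers. map_matrix of_int h ** g \<in> B} \<in> sets \<nu>"
    "emeasure \<nu> {g \<in> SL_padic_integers. map_matrix of_int h ** g \<in> B} = emeasure \<nu> B"
proof -
  let ?H = "map_matrix of_int h :: 'p padic ^ 'm ^ 'm"
  let ?A = "{g \<in> SL_padic_integers. ?H ** g \<in> B}"
  obtain h' where h': "h' \<in> SL_int_units" "h ** h' = mat 1" "h' ** h = mat 1" using h by (rule SL_int_units_inverse)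
  let ?H' = "map_matrix of_int h' :: 'p padic ^ 'm ^ 'm"
  have H: "?H \<in> SL_padic_integers" "?H' \<in> SL_padic_integers" using h h' by (auto intro: SL_int_padic SL_int_units_SL_int)
  have HH: "?H ** ?H' = mat 1" "?H' ** ?H = mat 1"
    using h'(2,3) by (simp_all add: map_matrix_of_int_mat1 flip: map_matrix_of_int_mult)
  obtain C where C: "C \<in> sets borel" "B = SL_padic_integers \<inter> C" using B unfolding sets_nu sets_restrict_space by auto
  have c: "continuous_on UNIV (\<lambda>g :: 'p padic ^ 'm ^ 'm. ?H ** g)"
    unfolding matrix_matrix_mult_def
    by (intro continuous_on_vec_lambda continuous_intros)
  have "(\<lambda>g. ?H ** g) -` C \<inter> space borel \<in> sets borel" by (rule measurable_sets[OF borel_measurable_continuous_onI[OF c] C(1)])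
  then have "{g \<in> SL_padic_integers. g \<in> (\<lambda>g. ?H ** g) -` C} \<in> sets \<nu>" by (intro borel_nu) simp
  moreover have "{g \<in> SL_padic_integers. g \<in> (\<lambda>g. ?H ** g) -` C} = ?A"
    using C(2) SL_padic_mult[OF H(1)] by auto
  ultimately show A: "?A \<in> sets \<nu>" by simp
  have BS: "B \<subseteq> SL_padic_integers" using sets.sets_into_space[OF B] by (simp add: space_nu)
  have "(\<lambda>g. ?H ** g) ` ?A = B"
  proof (intro equalityI subsetI)
    fix b assume b: "b \<in> B"
    then have "?H' ** b \<in> SL_padic_integers" using BS SL_padic_mult[OF H(2)] by blast
    moreover have e: "?H ** (?H' ** b) = b" by (simp add: matrix_mul_assoc HH)
    ultimately have "?H' ** b \<in> ?A" using b by simp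
    from imageI[OF this, of "\<lambda>g. ?H ** g"] show "b \<in> (\<lambda>g. ?H ** g) ` ?A" by (simp only: e)
  qed auto
  moreover have "emeasure \<nu> ((\<lambda>g. ?H ** g) ` ?A) = emeasure \<nu> ?A"
    using haar A H(1) by (simp add: is_haar_prob_def)
  ultimately show "emeasure \<nu> ?A = emeasure \<nu> B" by simp
qed

text \<open>The part of the group that moves the line of \<open>w\<close> into the chart of
  coordinate \<open>c\<close>: dividing by a unit coordinate keeps the others integral.\<close>

definition unit_coord :: "'m \<Rightarrow> ('p padic ^ 'm ^ 'm) set" where
  "unit_coord i = {g \<in> SL_padic_integers. padic_norm ((g *v w) $ i) = 1}"

lemma SL_w_le: "g \<in> SL_padic_integers \<Longrightarrow> padic_norm ((g *v w) $ i) \<le> 1"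
  by (rule padic_norm_mult_vec_le) (auto simp: SL_padic_integers_def padic_integers_def w_le)

lemma unit_coord_cover: "(\<Union>i. unit_coord i) = SL_padic_integers"
proof (intro equalityI subsetI)
  fix g :: "'p padic ^ 'm ^ 'm" assume g: "g \<in> SL_padic_integers"
  obtain k where k: "padic_norm (w $ k) = 1" using w_unit by blast
  have "1 \<le> padic_norm ((g *v w) $ max_index (g *v w))" using SL_padic_norm_le[OF g max_index, of w k] k by simp
  then have "padic_norm ((g *v w) $ max_index (g *v w)) = 1" using SL_w_le[OF g] by (intro antisym)
  then show "g \<in> (\<Union>i. unit_coord i)" using g by (auto simp: unit_coord_def)
qed (auto simp: unit_coord_def)

lemma unit_coord_sets: "unit_coord i \<in> sets \<nu>"
proof -
  have "closed {g :: 'p padic ^ 'm ^ 'm. padic_norm ((g *v w) $ i) = 1}"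
    using continuous_on_compose2[OF isCont_padic_norm[of UNIV] continuous_mult_vec[of i]] by (intro closed_Collect_eq) simp_all
  from borel_nu[OF borel_closed[OF this]] show ?thesis by (simp add: unit_coord_def)
qed

lemma unit_coord_swap:
  obtains h where "h \<in> SL_int_units" "{g \<in> SL_padic_integers. map_matrix of_int h ** g \<in> unit_coord c} = unit_coord i"
proof -
  obtain h :: "int ^ 'm ^ 'm" where h: "h \<in> SL_int_units"
    "\<And>a :: 'p padic ^ 'm. (map_matrix of_int h *v a) $ c = a $ i \<or> (map_matrix of_int h *v a) $ c = - a $ i"
    using swap_SL_int_units[of c i, where 'a = "'p padic"] by auto
  have n: "padic_norm ((map_matrix of_int h *v a) $ c) = padic_norm (a $ i)" for a :: "'p padic ^ 'm"
    using h(2)[of a] by (auto simp: padic_norm_minus)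
  have "{g \<in> SL_padic_integers. map_matrix of_int h ** g \<in> unit_coord c} = unit_coord i"
    using SL_padic_mult[OF SL_int_padic[OF SL_int_units_SL_int[OF h(1)]]]
    by (auto simp: unit_coord_def n simp flip: matrix_vector_mul_assoc)
  then show ?thesis by (rule that[OF h(1)])
qed

text \<open>Signed exchanges of coordinates carry these sets to one another, and they cover the
  group, so none of them is null.\<close>

lemma unit_coord_pos: "emeasure \<nu> (unit_coord c) \<noteq> 0"
proof
  assume 0: "emeasure \<nu> (unit_coord c) = 0"
  have "unit_coord i \<in> null_sets \<nu>" for i
  proof -
    obtain h where h: "h \<in> SL_int_units" "{g \<in> SL_padic_integers. map_matrix of_int h ** g \<in> unit_coord c} = unit_coord i" by (rule unit_coord_swap)
    show ?thesis using haar_vimage(2)[OF h(1) unit_coord_sets[of c]] 0 unit_coord_sets[of i] by (auto simp: h(2))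
  qed
  then have "(\<Union>i. unit_coord i) \<in> null_sets \<nu>" by (intro null_sets_UN') auto
  then show False using prob_space.emeasure_space_1[OF prob_nu] by (auto simp: unit_coord_cover space_nu)
qed

text \<open>The value \<open>axis c 1\<close> is a dummy that keeps the map inside the chart.\<close>

definition chart_pt :: "'m \<Rightarrow> 'p padic ^ 'm ^ 'm \<Rightarrow> 'p padic ^ 'm" where
  "chart_pt c g = (if g \<in> unit_coord c then inverse ((g *v w) $ c) *s (g *v w) else axis c 1)"

lemma chart_pt_chart: "chart_pt c g \<in> chart c"
proof (cases "g \<in> unit_coord c")
  case True
  then have g: "g \<in> SL_padic_integers" "padic_norm ((g *v w) $ c) = 1" by (auto simp: unit_coord_def)
  then have "(g *v w) $ c \<noteq> 0" by auto
  then show ?thesis using g True SL_w_le[OF g(1)] by (simp add: chart_pt_def chart_def padic_norm_mult padic_norm_inverse)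
qed (auto simp: chart_pt_def chart_def axis_def)

lemma chart_pt_near:
  assumes g: "g \<in> unit_coord c"
  shows "padic_norm (chart_pt c g $ i - b) = padic_norm ((g *v w) $ i - b * (g *v w) $ c)"
proof -
  have n: "padic_norm ((g *v w) $ c) = 1" using g by (simp add: unit_coord_def)
  then have "(g *v w) $ c \<noteq> 0" by auto
  then have "chart_pt c g $ i - b = ((g *v w) $ i - b * (g *v w) $ c) / (g *v w) $ c"
    using g by (simp add: chart_pt_def field_simps)
  then show ?thesis by (simp add: padic_norm_divide n)
qed

lemma measurable_chart_pt: "chart_pt c \<in> measurable \<nu> (chart_space c)"
  unfolding chart_space_def
proof (rule measurable_measure_of[OF chart_cells_Pow])
  show "chart_pt c \<in> space \<nu> \<rightarrow> chart c" by (simp add: chart_pt_chart)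
  fix D assume "D \<in> (chart_cells c :: ('p padic ^ 'm) set set)"
  then obtain k b where D: "D = {x \<in> chart c. padic_cell k x = b}" by (auto simp: chart_cells_def)
  show "chart_pt c -` D \<inter> space \<nu> \<in> sets \<nu>"
  proof (cases "D = {}")
    case False
    then obtain x0 where x0: "x0 \<in> chart c" "padic_cell k x0 = b" using D by blast
    \<comment> \<open>Since coordinate \<open>c\<close> is a unit here, membership in a ball is
      tested after multiplying by it; this leaves closed conditions on the entries of
      \<open>g\<close>.\<close>
    let ?V = "unit_coord c \<inter> {g \<in> space \<nu>. \<forall>i\<in>UNIV. padic_norm ((g *v w) $ i - x0 $ i * (g *v w) $ c) \<le> inverse (real CARD('p)) ^ k}"
    have V: "?V \<in> sets \<nu>"
      by (intro sets.Int unit_coord_sets sets.sets_Collect_finite_All) (use mult_vec_sets in \<open>auto simp: space_nu\<close>)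
    have m: "chart_pt c g \<in> D \<longleftrightarrow> (\<forall>i. padic_norm (chart_pt c g $ i - x0 $ i) \<le> inverse (real CARD('p)) ^ k)" for g
      unfolding D x0(2)[symmetric] by (simp add: chart_pt_chart padic_cell_eq_iff)
    have W: "{g \<in> space \<nu>. g \<notin> unit_coord c \<and> axis c 1 \<in> D} \<in> sets \<nu>"
      by (cases "axis c 1 \<in> D") (use sets.compl_sets[OF unit_coord_sets[of c]] in \<open>auto simp: set_diff_eq\<close>)
    have "chart_pt c -` D \<inter> space \<nu> = ?V \<union> {g \<in> space \<nu>. g \<notin> unit_coord c \<and> axis c 1 \<in> D}"
    proof (intro equalityI subsetI)
      fix g assume g: "g \<in> chart_pt c -` D \<inter> space \<nu>"
      show "g \<in> ?V \<union> {g \<in> space \<nu>. g \<notin> unit_coord c \<and> axis c 1 \<in> D}"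
      proof (cases "g \<in> unit_coord c")
        case True
        then show ?thesis using g m[of g] by (simp add: chart_pt_near[OF True])
      next
        case False
        then show ?thesis using g by (simp add: chart_pt_def)
      qed
    next
      fix g assume g: "g \<in> ?V \<union> {g \<in> space \<nu>. g \<notin> unit_coord c \<and> axis c 1 \<in> D}"
      show "g \<in> chart_pt c -` D \<inter> space \<nu>"
      proof (cases "g \<in> unit_coord c")
        case True
        then show ?thesis using g m[of g] by (simp add: chart_pt_near[OF True])
      next
        case False
        then show ?thesis using g by (simp add: chart_pt_def)
      qed
    qed
    then show ?thesis using V W by simp
  qed simp
qed

definition chart_measure :: "'m \<Rightarrow> ('p padic ^ 'm) measure" where
  "chart_measure c = distr (uniform_measure \<nu> (unit_coord c)) (chart_space c) (chart_pt c)"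

lemma sets_chart_measure: "sets (chart_measure c) = sets (chart_space c)" and space_chart_measure [simp]: "space (chart_measure c) = chart c"
  by (simp_all add: chart_measure_def)

lemma prob_chart_measure: "prob_space (chart_measure c)"
proof -
  interpret prob_space \<nu> by (rule prob_nu)
  have "prob_space (uniform_measure \<nu> (unit_coord c))" by (rule prob_space_uniform_measure[OF unit_coord_pos]) simp
  then show ?thesis unfolding chart_measure_def
    by (rule prob_space.prob_space_distr) (simp add: measurable_cong_sets[OF sets_uniform_measure refl] measurable_chart_pt)
qed

lemma emeasure_chart_measure:
  assumes D: "D \<in> sets (chart_space c)"
  shows "emeasure (chart_measure c) D = emeasure \<nu> {g \<in> unit_coord c. chart_pt c g \<in> D} / emeasure \<nu> (unit_coord c)"
proof -
  have V: "chart_pt c -` D \<inter> space \<nu> \<in> sets \<nu>" by (rule measurable_sets[OF measurable_chart_pt D])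
  have "emeasure (chart_measure c) D = emeasure (uniform_measure \<nu> (unit_coord c)) (chart_pt c -` D \<inter> space \<nu>)"
    unfolding chart_measure_def by (subst emeasure_distr) (simp_all add: D measurable_cong_sets[OF sets_uniform_measure refl] measurable_chart_pt)
  also have "\<dots> = emeasure \<nu> (unit_coord c \<inter> (chart_pt c -` D \<inter> space \<nu>)) / emeasure \<nu> (unit_coord c)"
    by (rule emeasure_uniform_measure[OF unit_coord_sets V])
  also have "unit_coord c \<inter> (chart_pt c -` D \<inter> space \<nu>) = {g \<in> unit_coord c. chart_pt c g \<in> D}"
    by (auto simp: space_nu unit_coord_def)
  finally show ?thesis .
qed

text \<open>Keeping coordinate \<open>c\<close> preserves the chart, and an integral matrix with
  integral inverse permutes the balls of each level.\<close>

definition chart_group :: "'m \<Rightarrow> ('p padic ^ 'm \<Rightarrow> 'p padic ^ 'm) set" where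
  "chart_group c = {g. \<exists>h\<in>SL_int_units. g = (\<lambda>a. map_matrix of_int h *v a) \<and> (\<forall>a. g a $ c = a $ c)}"

lemma chart_group_chart: "g \<in> chart_group c \<Longrightarrow> x \<in> chart c \<Longrightarrow> g x \<in> chart c"
  unfolding chart_group_def chart_def
  by (auto intro!: padic_norm_mult_vec_le simp: map_matrix_def padic_norm_of_int_le_1)

lemma chart_group_comp: "g \<in> chart_group c \<Longrightarrow> h \<in> chart_group c \<Longrightarrow> (\<lambda>x. g (h x)) \<in> chart_group c"
  unfolding chart_group_def by (auto intro!: bexI[OF _ SL_int_units_mult] simp: map_matrix_of_int_mult matrix_vector_mul_assoc)

lemma chart_group_inverse:
  assumes "g \<in> chart_group c"
  obtains g' where "g' \<in> chart_group c" "\<And>x. g' (g x) = x" "\<And>x. g (g' x) = x"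
proof -
  obtain h where h: "h \<in> SL_int_units" "g = (\<lambda>a. map_matrix of_int h *v a)" "\<And>a. g a $ c = a $ c" using assms by (auto simp: chart_group_def)
  obtain h' where h': "h' \<in> SL_int_units" "h ** h' = mat 1" "h' ** h = mat 1" using h(1) by (rule SL_int_units_inverse)
  define g' where "g' = (\<lambda>a :: 'p padic ^ 'm. map_matrix of_int h' *v a)"
  have e: "g' (g x) = x" "g (g' x) = x" for x
    using h'(2,3) by (simp_all add: g'_def h(2) matrix_vector_mul_assoc map_matrix_of_int_mat1 flip: map_matrix_of_int_mult)
  have "g' a $ c = a $ c" for a using h(3)[of "g' a"] by (simp add: e)
  then have "g' \<in> chart_group c" using h'(1) g'_def by (auto simp: chart_group_def)
  then show ?thesis using e by (rule that)
qed

lemma chart_group_level_imp: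
  assumes g: "g \<in> chart_group c" and e: "padic_cell k x = padic_cell k y"
  shows "padic_cell k (g x) = padic_cell k (g y)"
proof -
  obtain h where h: "g = (\<lambda>a. map_matrix of_int h *v a)" using g by (auto simp: chart_group_def)
  have "g x $ i - g y $ i = (map_matrix of_int h *v (x - y)) $ i" for i by (simp add: h matrix_vector_mult_diff_distrib)
  moreover have "padic_norm ((map_matrix of_int h *v (x - y)) $ i) \<le> inverse (real CARD('p)) ^ k" for i
    using e unfolding padic_cell_eq_iff by (intro padic_norm_mult_vec_le) (simp_all add: map_matrix_def padic_norm_of_int_le_1)
  ultimately show ?thesis by (simp add: padic_cell_eq_iff)
qed

lemma chart_group_level: "g \<in> chart_group c \<Longrightarrow> padic_cell k (g x) = padic_cell k (g y) \<longleftrightarrow> padic_cell k x = padic_cell k y"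
  by (metis chart_group_inverse chart_group_level_imp)

lemma chart_group_meas: "g \<in> chart_group c \<Longrightarrow> g \<in> measurable (chart_space c) (chart_space c)"
  unfolding chart_space_def[of c]
proof (rule measurable_measure_of[OF chart_cells_Pow])
  assume g: "g \<in> chart_group c"
  show "g \<in> space (sigma (chart c) (chart_cells c)) \<rightarrow> chart c" using chart_group_chart[OF g] by (simp flip: chart_space_def)
  fix D assume "D \<in> (chart_cells c :: ('p padic ^ 'm) set set)"
  then obtain k b where D: "D = {x \<in> chart c. padic_cell k x = b}" by (auto simp: chart_cells_def)
  have "g -` D \<inter> chart c \<in> sets (chart_space c)"
  proof (cases "g -` D \<inter> chart c = {}")
    case False
    then obtain x0 where x0: "x0 \<in> chart c" "padic_cell k (g x0) = b" using D by blast
    have "g -` D \<inter> chart c = {x \<in> chart c. padic_cell k x = padic_cell k x0}"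
      using chart_group_chart[OF g] chart_group_level[OF g, of k] x0 by (auto simp: D)
    then show ?thesis by (simp only: cell_sets_chart)
  next
    case True
    show ?thesis unfolding True by simp
  qed
  then show "g -` D \<inter> space (sigma (chart c) (chart_cells c)) \<in> sets (sigma (chart c) (chart_cells c))"
    by (simp flip: chart_space_def)
qed

text \<open>\<open>chart_pt\<close> divides by coordinate \<open>c\<close>, which the matrix leaves
  alone, so it intertwines left multiplication in the group with the action on the chart.\<close>

lemma chart_group_distr:
  assumes g: "g \<in> chart_group c"
  shows "distr (chart_measure c) (chart_measure c) g = chart_measure c"
proof (rule measure_eqI)
  fix D assume "D \<in> sets (distr (chart_measure c) (chart_measure c) g)"
  then have D: "D \<in> sets (chart_space c)" by (simp add: sets_chart_measure)
  have gm: "g \<in> measurable (chart_measure c) (chart_measure c)" using chart_group_meas[OF g] by (simp add: measurable_cong_sets[OF sets_chart_measure sets_chart_measure])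
  obtain h where h: "h \<in> SL_int_units" "g = (\<lambda>a. map_matrix of_int h *v a)" "\<And>a. g a $ c = a $ c" using g by (auto simp: chart_group_def)
  let ?H = "map_matrix of_int h :: 'p padic ^ 'm ^ 'm"
  have HS: "?H ** x \<in> SL_padic_integers" if "x \<in> SL_padic_integers" for x
    using SL_padic_mult[OF SL_int_padic[OF SL_int_units_SL_int[OF h(1)]] that] .
  have Hc: "((?H ** x) *v w) $ c = (x *v w) $ c" for x using h(3)[of "x *v w"] by (simp add: h(2) matrix_vector_mul_assoc)
  have HSg: "?H ** x \<in> unit_coord c \<longleftrightarrow> x \<in> unit_coord c" if "x \<in> SL_padic_integers" for x
    using HS[OF that] that by (simp add: unit_coord_def Hc)
  have Hchart_pt: "chart_pt c (?H ** x) = g (chart_pt c x)" if "x \<in> unit_coord c" for x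
  proof -
    have x: "x \<in> SL_padic_integers" using that by (simp add: unit_coord_def)
    show ?thesis using that HSg[OF x] unfolding h(2)
      by (simp add: chart_pt_def Hc vec.linear_scale[OF matrix_vector_mul_linear_gen] matrix_vector_mul_assoc)
  qed
  have V: "g -` D \<inter> space (chart_measure c) \<in> sets (chart_space c)" using measurable_sets[OF gm, of D] D by (simp add: sets_chart_measure)
  have B: "{x \<in> unit_coord c. chart_pt c x \<in> D} \<in> sets \<nu>"
  proof -
    have "{x \<in> unit_coord c. chart_pt c x \<in> D} = unit_coord c \<inter> (chart_pt c -` D \<inter> space \<nu>)" by (auto simp: space_nu unit_coord_def)
    then show ?thesis using unit_coord_sets measurable_sets[OF measurable_chart_pt D] by auto
  qed
  have "emeasure (distr (chart_measure c) (chart_measure c) g) D = emeasure (chart_measure c) (g -` D \<inter> space (chart_measure c))"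
    by (rule emeasure_distr[OF gm]) (simp add: D sets_chart_measure)
  also have "\<dots> = emeasure \<nu> {x \<in> unit_coord c. chart_pt c x \<in> g -` D \<inter> space (chart_measure c)} / emeasure \<nu> (unit_coord c)" by (rule emeasure_chart_measure[OF V])
  also have "{x \<in> unit_coord c. chart_pt c x \<in> g -` D \<inter> space (chart_measure c)} = {x \<in> SL_padic_integers. ?H ** x \<in> {x \<in> unit_coord c. chart_pt c x \<in> D}}"
  proof (intro equalityI subsetI)
    fix x assume x: "x \<in> {x \<in> unit_coord c. chart_pt c x \<in> g -` D \<inter> space (chart_measure c)}"
    then have "x \<in> SL_padic_integers" by (simp add: unit_coord_def)
    then show "x \<in> {x \<in> SL_padic_integers. ?H ** x \<in> {x \<in> unit_coord c. chart_pt c x \<in> D}}" using x HSg Hchart_pt by simp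
  next
    fix x assume x: "x \<in> {x \<in> SL_padic_integers. ?H ** x \<in> {x \<in> unit_coord c. chart_pt c x \<in> D}}"
    then have s: "x \<in> unit_coord c" using HSg[of x] by simp
    then show "x \<in> {x \<in> unit_coord c. chart_pt c x \<in> g -` D \<inter> space (chart_measure c)}" using x Hchart_pt[OF s] by (simp add: chart_pt_chart)
  qed
  also have "emeasure \<nu> \<dots> = emeasure \<nu> {x \<in> unit_coord c. chart_pt c x \<in> D}" by (rule haar_vimage(2)[OF h(1) B])
  also have "\<dots> / emeasure \<nu> (unit_coord c) = emeasure (chart_measure c) D" by (rule emeasure_chart_measure[OF D, symmetric])
  finally show "emeasure (distr (chart_measure c) (chart_measure c) g) D = emeasure (chart_measure c) D" .
qed simp

text \<open>The factor \<open>a $ c\<close> makes the map linear. On the chart it equals 1, and the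
  map is the translation by \<open>t\<close> in the other coordinates.\<close>

definition translate :: "'m \<Rightarrow> ('m \<Rightarrow> int) \<Rightarrow> 'p padic ^ 'm \<Rightarrow> 'p padic ^ 'm" where
  "translate c t a = (\<chi> k. if k = c then a $ k else a $ k + of_int (t k) * a $ c)"

lemma elem_matrix_chart_group: "i \<noteq> j \<Longrightarrow> i \<noteq> c \<Longrightarrow> (\<lambda>a. map_matrix of_int (elem_matrix i j d) *v a) \<in> chart_group c"
  unfolding chart_group_def using elem_matrix_SL_int_units[of i j d] by (auto simp: elem_matrix_mult_vec)

lemma translate_chart_group: "translate c t \<in> chart_group c"
proof -
  have "(\<lambda>a :: 'p padic ^ 'm. \<chi> k. if k \<in> K then a $ k + of_int (t k) * a $ c else a $ k) \<in> chart_group c" if "c \<notin> K" for K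
    using finite[of K] that
  proof (induction K rule: finite_induct)
    case empty
    show ?case unfolding chart_group_def using SL_int_units_one by (auto intro!: bexI[of _ "mat 1"] simp: map_matrix_of_int_mat1)
  next
    case (insert i K)
    let ?p = "\<lambda>a :: 'p padic ^ 'm. \<chi> k. if k \<in> K then a $ k + of_int (t k) * a $ c else a $ k"
    have "(\<lambda>a. map_matrix of_int (elem_matrix i c (t i)) *v ?p a) \<in> chart_group c"
      using insert by (intro chart_group_comp[OF elem_matrix_chart_group]) auto
    moreover have "map_matrix of_int (elem_matrix i c (t i)) *v ?p a = (\<chi> k. if k \<in> insert i K then a $ k + of_int (t k) * a $ c else a $ k)" for a
      using insert by (auto simp: vec_eq_iff elem_matrix_mult_vec)
    ultimately show ?case by simp
  qed
  from this[of "UNIV - {c}"] have "(\<lambda>a :: 'p padic ^ 'm. \<chi> k. if k \<in> UNIV - {c} then a $ k + of_int (t k) * a $ c else a $ k) \<in> chart_group c" by simp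
  moreover have "translate c t = (\<lambda>a. \<chi> k. if k \<in> UNIV - {c} then a $ k + of_int (t k) * a $ c else a $ k)"
    by (auto simp: translate_def fun_eq_iff vec_eq_iff)
  ultimately show ?thesis by simp
qed

lemma elem_matrix_translate:
  assumes "i \<noteq> c" "j \<noteq> c" "i \<noteq> j"
  shows "map_matrix of_int (elem_matrix i j d) *v translate c t x = translate c (t(i := t i + d * t j)) (map_matrix of_int (elem_matrix i j d) *v x)"
  using assms by (simp add: vec_eq_iff elem_matrix_mult_vec translate_def algebra_simps)

lemma odometer_chart_measure: "odometer (chart_measure c) padic_cell CARD('p) (UNIV - {c}) (translate c)"
proof -
  interpret prob_space "chart_measure c" by (rule prob_chart_measure)
  show ?thesis
  proof
    show "1 < CARD('p)" by (rule card_gt_1)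
    show "finite (UNIV - {c})" by simp
    show "finite (padic_cell k ` space (chart_measure c))" for k by (simp add: finite_padic_cell_chart)
    show "card (padic_cell k ` space (chart_measure c)) \<le> CARD('p) ^ (k * card (UNIV - {c}))" for k using card_padic_cell_chart[of k c] by simp
    show "{x \<in> space (chart_measure c). padic_cell k x = b} \<in> sets (chart_measure c)" for k b using cell_sets_chart by (simp add: sets_chart_measure)
    show "padic_cell k x = padic_cell k y" if "padic_cell (Suc k) x = padic_cell (Suc k) y" for k and x y :: "'p padic ^ 'm"
    proof -
      have "inverse (real CARD('p)) ^ Suc k \<le> inverse (real CARD('p)) ^ k"
        using card_gt_1[where 'a = 'p] by (intro power_decreasing) (auto simp: inverse_le_1_iff)
      then show ?thesis using that unfolding padic_cell_eq_iff by (meson order_trans)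
    qed
    show "sets (chart_measure c) = sigma_sets (space (chart_measure c)) {{x \<in> space (chart_measure c). padic_cell k x = b} |k b. True}"
      by (simp add: sets_chart_measure sets_chart_space chart_cells_def)
    show "translate c t \<in> measurable (chart_measure c) (chart_measure c)" for t
      using chart_group_meas[OF translate_chart_group] by (simp add: measurable_cong_sets[OF sets_chart_measure sets_chart_measure])
    show "distr (chart_measure c) (chart_measure c) (translate c t) = chart_measure c" for t by (rule chart_group_distr[OF translate_chart_group])
    show "translate c s (translate c t x) = translate c (\<lambda>i. s i + t i) x" for s t x
      by (simp add: translate_def vec_eq_iff algebra_simps)
    show "translate c (\<lambda>i. 0) x = x" for x by (simp add: translate_def vec_eq_iff)
    show "padic_cell k (translate c t x) = padic_cell k (translate c t y) \<longleftrightarrow> padic_cell k x = padic_cell k y" for k t x y by (rule chart_group_level[OF translate_chart_group])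
    show "padic_cell k (translate c t x) = padic_cell k x \<longleftrightarrow> (\<forall>i\<in>UNIV - {c}. int CARD('p) ^ k dvd t i)" if "x \<in> space (chart_measure c)" for k t x
    proof -
      have "translate c t x $ i - x $ i = (if i = c then 0 else of_int (t i))" for i using that by (simp add: translate_def chart_def)
      then show ?thesis unfolding padic_cell_eq_iff using padic_norm_of_int_le_iff[where 'a = 'p and k = k] by auto
    qed
    show "\<exists>t. padic_cell k (translate c t x) = padic_cell k y" if x: "x \<in> space (chart_measure c)" and y: "y \<in> space (chart_measure c)" for k x y
    proof -
      have "\<exists>n. padic_norm ((y $ i - x $ i) - of_nat n) \<le> inverse (real CARD('p)) ^ k" for i
      proof -
        have "padic_norm (y $ i - x $ i) \<le> 1" using x y padic_norm_diff_le[of "y $ i" "x $ i"] unfolding space_chart_measure chart_def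
          by (metis (no_types, lifting) max.bounded_iff mem_Collect_eq order_trans max_def)
        then show ?thesis using padic_int_dense[of "y $ i - x $ i" k] by metis
      qed
      then obtain t where t: "\<And>i. padic_norm ((y $ i - x $ i) - of_nat (t i)) \<le> inverse (real CARD('p)) ^ k" by metis
      have "padic_norm (translate c (\<lambda>i. int (t i)) x $ i - y $ i) \<le> inverse (real CARD('p)) ^ k" for i
      proof (cases "i = c")
        case True
        then show ?thesis using x y by (simp add: translate_def chart_def)
      next
        case False
        then have "translate c (\<lambda>i. int (t i)) x $ i - y $ i = - ((y $ i - x $ i) - of_nat (t i))" using x by (simp add: translate_def chart_def)
        then show ?thesis using t[of i] by (simp only: padic_norm_minus)
      qed
      then show ?thesis unfolding padic_cell_eq_iff by blast
    qed
  qed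
qed

lemma span_chart_pt:
  assumes g: "g \<in> unit_coord c"
  shows "vec.span {chart_pt c g} = matrix_image g (vec.span {w})"
proof -
  have "(g *v w) $ c \<noteq> 0" using g by (auto simp: unit_coord_def)
  then have "vec.span {inverse ((g *v w) $ c) *s (g *v w)} = vec.span {g *v w}"
    using vec.span_image_scale[of "{g *v w}" "\<lambda>_. inverse ((g *v w) $ c)"] by simp
  then show ?thesis using g by (simp add: chart_pt_def matrix_image_span)
qed

end

section \<open>Ergodicity\<close>

lemma crt_exponents:
  fixes p q :: nat
  assumes p: "prime p" and q: "prime q" and ne: "p \<noteq> q"
  obtains \<sigma> :: "nat \<Rightarrow> nat" where "\<And>l. p ^ l dvd \<sigma> l" "\<And>l. \<sigma> l > 0" "\<And>l. q ^ l dvd \<sigma> l - 1"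
proof -
  have "\<exists>s. p ^ l dvd s \<and> s > 0 \<and> q ^ l dvd s - 1" for l
  proof -
    have "coprime (p ^ l) (q ^ l)" using primes_coprime[OF p q ne] by simp
    then obtain x where x: "[x = 0] (mod p ^ l)" "[x = 1] (mod q ^ l)" using binary_chinese_remainder_nat by blast
    \<comment> \<open>The added product changes neither residue and makes the number
      positive.\<close>
    let ?s = "x + p ^ l * q ^ l"
    have pos: "?s > 0" using p q by (simp add: prime_gt_0_nat)
    have "[?s = 0] (mod p ^ l)" using x(1) by (simp add: cong_def)
    then have 1: "p ^ l dvd ?s" by (simp add: cong_0_iff)
    have "[?s = 1] (mod q ^ l)" using x(2) by (simp add: cong_def)
    then have "q ^ l dvd ?s - 1" using pos cong_to_1_nat by blast
    then show ?thesis using 1 pos by blast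
  qed
  then obtain \<sigma> where "\<And>l. p ^ l dvd \<sigma> l \<and> \<sigma> l > 0 \<and> q ^ l dvd \<sigma> l - 1" by metis
  then show ?thesis using that by blast
qed

lemma primitive_generator:
  assumes "L \<in> (grassmannian 1 :: ('a :: prime_card padic ^ 'm) set set)"
  obtains w where "L = vec.span {w}" "\<And>i. padic_norm (w $ i) \<le> 1" "\<exists>i. padic_norm (w $ i) = 1"
proof -
  obtain v where v: "v \<in> frames 1" "L = vec.span (v ` {..<1})" using grassmannian_frame[OF assms] by blast
  let ?a = "v 0"
  have L: "L = vec.span {?a}" using v(2) by (simp add: lessThan_Suc)
  have a: "?a \<noteq> 0" using v(1) by (simp add: frames_def lessThan_Suc)
  have "vec.span {normalise ?a} = vec.span {?a}"
    using vec.span_image_scale[of "{?a}" "\<lambda>_. inverse (?a $ max_index ?a)"] max_index_nonzero[OF a] by (simp add: normalise_def)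
  moreover have "padic_norm (normalise ?a $ max_index ?a) = 1" by (simp add: normalise_one[OF a])
  ultimately show ?thesis using L normalise_ivec[OF a] by (intro that[of "normalise ?a"]) (auto simp: ivec_def)
qed

theorem theorem3p6:
  fixes k :: nat
    and \<mu> :: "('p :: prime_card padic ^ 'm) set measure"
    and F :: "(('q :: prime_card padic ^ 'n) set \<times> ('q padic ^ 'n) set) set"
  assumes "3 \<le> CARD('m)" and "3 \<le> CARD('n)" and "k \<le> CARD('n)"
    and "CARD('p) \<noteq> CARD('q)"
    and "is_haar_projective \<mu>"
    and "F = orbit_rel GL_rat (\<lambda>A. matrix_image (map_matrix of_rat A)) (grassmannian k)"
  shows "F_ergodic SL_int (\<lambda>A. matrix_image (map_matrix of_int A)) \<mu>
           (borel_of (grassmannian_topology k)) F"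
  unfolding F_ergodic_def
proof (intro allI impI)
  let ?act = "\<lambda>A :: int ^ 'm ^ 'm. matrix_image (map_matrix of_int A) :: ('p padic ^ 'm) set \<Rightarrow> ('p padic ^ 'm) set"
  fix f assume "borel_homomorphism \<mu> (orbit_rel SL_int ?act (space \<mu>)) (grass_borel k) F f"
  then have fm: "f \<in> measurable \<mu> (grass_borel k)" and fh: "\<And>x x'. (x, x') \<in> orbit_rel SL_int ?act (space \<mu>) \<Longrightarrow> (f x, f x') \<in> F"
    by (auto simp: borel_homomorphism_def)
  obtain \<nu> L where \<nu>: "is_haar_prob SL_padic_integers \<nu>" and L: "L \<in> grassmannian 1"
    and \<mu>: "\<mu> = distr \<nu> (grass_borel 1) (\<lambda>g. matrix_image g L)"
    using assms(5) by (auto simp: is_haar_projective_def)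
  obtain w where w: "L = vec.span {w}" "\<And>i. padic_norm (w $ i) \<le> 1" "\<exists>i. padic_norm (w $ i) = 1"
    using primitive_generator[OF L] by blast
  interpret hl: haar_line \<nu> w by unfold_locales (use \<nu> w in auto)
  have space_\<mu>: "space \<mu> = grassmannian 1" and sets_\<mu>: "sets \<mu> = sets (grass_borel 1)" by (simp_all add: \<mu> space_grass_borel)
  have fm1: "f \<in> measurable (grass_borel 1) (grass_borel k)" using fm by (simp add: measurable_cong_sets[OF sets_\<mu> refl])
  \<comment> \<open>Any coordinate can be the one that is normalised; the trivial equation merely
    names it.\<close>
  obtain c :: 'm where "c = c" by blast
  let ?f = "\<lambda>a. f (vec.span {a})"
  have f'm: "?f \<in> measurable (hl.chart_measure c) (grass_borel k)"
    using measurable_compose[OF measurable_span_chart fm1] by (simp add: measurable_cong_sets[OF hl.sets_chart_measure refl])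
  have equiv: "\<exists>l\<in>rat_maps. l (f x) = f (?act h x)" if "h \<in> SL_int" "x \<in> grassmannian 1" for h x
  proof -
    have "?act h x \<in> grassmannian 1" by (rule matrix_image_grassmannian(1)[OF that(2) SL_padic_integers_invertible[OF SL_int_padic[OF that(1)]]])
    then have "(x, ?act h x) \<in> orbit_rel SL_int ?act (space \<mu>)" using that by (auto simp: orbit_rel_def space_\<mu>)
    then have "(f x, f (?act h x)) \<in> F" by (rule fh)
    then show ?thesis unfolding assms(6) orbit_rel_def rat_maps_def by auto
  qed
  have sp_act: "vec.span {map_matrix of_int h *v a} = ?act h (vec.span {a})" for h a
    by (simp add: matrix_image_span)
  interpret odometer "hl.chart_measure c" padic_cell "CARD('p)" "UNIV - {c}" "hl.translate c" by (rule hl.odometer_chart_measure)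
  interpret odometer_hom "hl.chart_measure c" padic_cell "CARD('p)" "UNIV - {c}" "hl.translate c" "hl.chart_group c" rat_maps ?f
  proof unfold_locales
    fix g assume g: "g \<in> hl.chart_group c"
    show gm: "g \<in> measurable (hl.chart_measure c) (hl.chart_measure c)"
      using hl.chart_group_meas[OF g] by (simp add: measurable_cong_sets[OF hl.sets_chart_measure hl.sets_chart_measure])
    show "distr (hl.chart_measure c) (hl.chart_measure c) g = hl.chart_measure c" by (rule hl.chart_group_distr[OF g])
    show "padic_cell k (g x) = padic_cell k (g y) \<longleftrightarrow> padic_cell k x = padic_cell k y" for k x y by (rule hl.chart_group_level[OF g])
    show "(\<lambda>x. g (h x)) \<in> hl.chart_group c" if "h \<in> hl.chart_group c" for h by (rule hl.chart_group_comp[OF g that])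
    show "\<exists>l\<in>rat_maps. l (?f x) = ?f (g x)" if x: "x \<in> space (hl.chart_measure c)" for x
    proof -
      obtain h where h: "h \<in> SL_int_units" "g = (\<lambda>a. map_matrix of_int h *v a)" using g by (auto simp: hl.chart_group_def)
      have "vec.span {x} \<in> grassmannian 1" using x by (intro span_singleton_grassmannian chart_nonzero[of x c]) simp
      from equiv[OF SL_int_units_SL_int[OF h(1)] this] show ?thesis by (simp add: h(2) sp_act)
    qed
    show "{x \<in> space (hl.chart_measure c). l (?f x) = ?f (g x)} \<in> sets (hl.chart_measure c)" if l: "l \<in> rat_maps" for l
    proof (rule grass_borel_eq_sets)
      obtain A where A: "A \<in> GL_rat" "l = matrix_image (map_matrix of_rat A)" using l by (auto simp: rat_maps_def)
      have "l \<in> measurable (grass_borel k) (grass_borel k)" unfolding A(2)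
        by (rule measurable_borel_of[OF continuous_map_matrix_image[OF map_matrix_invertible[OF A(1)]]])
      from measurable_compose[OF f'm this] show "(\<lambda>x. l (?f x)) \<in> measurable (hl.chart_measure c) (grass_borel k)" .
      from measurable_compose[OF gm f'm] show "(\<lambda>x. ?f (g x)) \<in> measurable (hl.chart_measure c) (grass_borel k)" .
    qed
  qed (auto intro: hl.translate_chart_group countable_rat_maps rat_maps_bij rat_maps_comp rat_maps_inv rat_maps_id)
  have f'k: "?f x \<in> grassmannian k" if "x \<in> space (hl.chart_measure c)" for x
    using measurable_space[OF f'm that] by (simp add: space_grass_borel)
  obtain \<sigma> :: "nat \<Rightarrow> nat" where \<sigma>: "\<And>l. CARD('p) ^ l dvd \<sigma> l" "\<And>l. \<sigma> l > 0" "\<And>l. CARD('q) ^ l dvd \<sigma> l - 1"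
    using crt_exponents[OF prime_card[where 'a = 'p] prime_card[where 'a = 'q] assms(4)] by blast
  have "\<exists>x0\<in>space (hl.chart_measure c). measure (hl.chart_measure c) {x \<in> space (hl.chart_measure c). ?f x = ?f x0} > 0"
  proof (rule constant_on_positive_set[where y = "plucker_pt k" and Os = "plucker_nbhd k" and \<sigma> = \<sigma>
        and Sh = "\<lambda>i j d a. map_matrix of_int (elem_matrix i j d) *v a"])
    show "\<exists>j\<in>UNIV - {c}. j \<noteq> i" if "i \<in> UNIV - {c}" for i
    proof (rule ccontr)
      assume "\<not> ?thesis"
      then have "(UNIV :: 'm set) \<subseteq> {c, i}" by auto
      then have "CARD('m) \<le> card {c, i}" by (intro card_mono) auto
      also have "\<dots> \<le> 2" by (simp add: card_insert_if)
      finally show False using assms(1) by simp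
    qed
    show "UNIV - {c} \<noteq> {}"
    proof
      assume "UNIV - {c} = {}"
      then have "(UNIV :: 'm set) \<subseteq> {c}" by auto
      then have "CARD('m) \<le> card {c}" by (intro card_mono) auto
      then show False using assms(1) by simp
    qed
    show "(\<lambda>a. map_matrix of_int (elem_matrix i j d) *v a) \<in> hl.chart_group c" if "i \<in> UNIV - {c}" "j \<in> UNIV - {c}" "i \<noteq> j" for i j d
      using that by (intro hl.elem_matrix_chart_group) auto
    show "map_matrix of_int (elem_matrix i j d) *v hl.translate c t x = hl.translate c (t(i := t i + d * t j)) (map_matrix of_int (elem_matrix i j d) *v x)"
      if "i \<in> UNIV - {c}" "j \<in> UNIV - {c}" "i \<noteq> j" for i j d t x
      using that by (intro hl.elem_matrix_translate) auto
    have "(\<lambda>x. {l \<in> rat_maps. l (?f x) = ?f x}) ` space (hl.chart_measure c) \<subseteq> (\<lambda>V. {l \<in> rat_maps. l V = V}) ` grassmannian k"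
      using f'k by blast
    then show "countable ((\<lambda>x. {l \<in> rat_maps. l (?f x) = ?f x}) ` space (hl.chart_measure c))"
      by (rule countable_subset[OF _ countable_stabilisers])
    show "\<exists>B::nat \<Rightarrow> ('p padic ^ 'm) set. (\<forall>n. B n \<in> sets (hl.chart_measure c)) \<and> space (hl.chart_measure c) \<subseteq> (\<Union>n. B n) \<and>
      (\<forall>n x x'. x \<in> B n \<longrightarrow> x' \<in> B n \<longrightarrow> dist (plucker_pt k (?f x)) (plucker_pt k (?f x')) < e)" if "e > 0" for e
      by (rule plucker_pt_cover[OF f'm that])
    show "CARD('p) ^ l dvd \<sigma> l" "\<sigma> l > 0" for l by (rule \<sigma>)+
    show "{x \<in> space (hl.chart_measure c). ?f x \<in> plucker_nbhd k n} \<in> sets (hl.chart_measure c)" for n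
      using measurable_sets[OF f'm plucker_nbhd_sets, of n] by (simp add: vimage_def Int_def conj_commute)
    show "\<exists>n. (?f x \<in> plucker_nbhd k n) \<noteq> (?f x' \<in> plucker_nbhd k n)" if "x \<in> space (hl.chart_measure c)" "x' \<in> space (hl.chart_measure c)" "?f x \<noteq> ?f x'" for x x'
      by (rule plucker_nbhd_separates[OF f'k[OF that(1)] f'k[OF that(2)] that(3)])
    show "\<exists>j. (u ^^ \<sigma> (r j)) (?f x) = ?f x"
      if u: "u \<in> rat_maps" and x: "x \<in> space (hl.chart_measure c)" and r: "strict_mono r"
        and lim: "(\<lambda>j. plucker_pt k ((u ^^ \<sigma> (r j)) (?f x))) \<longlonglongrightarrow> plucker_pt k (?f x)" for u x r
    proof -
      obtain A where A: "A \<in> GL_rat" "u = matrix_image (map_matrix of_rat A)" using u by (auto simp: rat_maps_def)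
      show ?thesis unfolding A(2)
      proof (rule plucker_pt_recurrence[OF f'k[OF x] map_matrix_invertible[OF A(1)] _ _ lim[unfolded A(2)]])
        show "1 \<le> \<sigma> (r j)" for j using \<sigma>(2)[of "r j"] by simp
        show "\<forall>\<^sub>F j in sequentially. CARD('q) ^ l dvd \<sigma> (r j) - 1" for l
          unfolding eventually_sequentially
        proof (intro exI[of _ l] allI impI)
          fix j assume "l \<le> j"
          \<comment> \<open>A strictly increasing \<open>r\<close> satisfies
            \<open>r j \<ge> j\<close>, so the divisibility passes to the subsequence.\<close>
          then have "l \<le> r j" using seq_suble[OF r, of j] by simp
          then show "CARD('q) ^ l dvd \<sigma> (r j) - 1" by (rule dvd_trans[OF le_imp_power_dvd \<sigma>(3)])
        qed
      qed
    qed
  qed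
  then obtain x0 where x0: "x0 \<in> space (hl.chart_measure c)" "measure (hl.chart_measure c) {x \<in> space (hl.chart_measure c). ?f x = ?f x0} > 0" by blast
  define y0 where "y0 = ?f x0"
  have y0: "y0 \<in> grassmannian k" using f'k[OF x0(1)] by (simp add: y0_def)
  \<comment> \<open>The lines whose value lies in the class of \<open>y0\<close>. Unlike the fibre
    of \<open>y0\<close>, this set is invariant under integer matrices.\<close>
  define D where "D = {x \<in> grassmannian 1. \<exists>l\<in>rat_maps. f x = l y0}"
  have Lamk: "l V \<in> grassmannian k" if "l \<in> rat_maps" "V \<in> grassmannian k" for l and V :: "('q padic ^ 'n) set"
    using that matrix_image_grassmannian(1)[OF _ map_matrix_invertible] by (auto simp: rat_maps_def)
  have D: "D \<in> sets (grass_borel 1)"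
  proof -
    have "D = (\<Union>l\<in>rat_maps. {x \<in> space (grass_borel 1). f x = l y0})" by (auto simp: D_def space_grass_borel)
    also have "\<dots> \<in> sets (grass_borel 1)"
    proof (rule sets.countable_UN'[OF countable_rat_maps], rule image_subsetI)
      fix l :: "('q padic ^ 'n) set \<Rightarrow> ('q padic ^ 'n) set" assume "l \<in> rat_maps"
      then show "{x \<in> space (grass_borel 1). f x = l y0} \<in> sets (grass_borel 1)"
        by (intro grass_borel_eq_sets[OF fm1] measurable_const) (simp add: space_grass_borel Lamk y0)
    qed
    finally show ?thesis .
  qed
  have D_act1: "?act h x \<in> D" if h: "h \<in> SL_int" and x: "x \<in> D" for h x
  proof -
    have xg: "x \<in> grassmannian 1" using x by (simp add: D_def)
    obtain l where l: "l \<in> rat_maps" "f x = l y0" using x by (auto simp: D_def)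
    obtain m where m: "m \<in> rat_maps" "m (f x) = f (?act h x)" using equiv[OF h xg] by blast
    have "f (?act h x) = (m \<circ> l) y0" using l m by simp
    moreover have "?act h x \<in> grassmannian 1" by (rule matrix_image_grassmannian(1)[OF xg SL_padic_integers_invertible[OF SL_int_padic[OF h]]])
    ultimately show ?thesis using rat_maps_comp[OF m(1) l(1)] unfolding D_def by blast
  qed
  have D_act: "?act h x \<in> D \<longleftrightarrow> x \<in> D" if h: "h \<in> SL_int_units" for h x
  proof -
    obtain h' where h': "h' \<in> SL_int_units" "h ** h' = mat 1" "h' ** h = mat 1" using h by (rule SL_int_units_inverse)
    have "?act h' (?act h x) = x"
      using h'(3) by (simp add: matrix_image_comp map_matrix_of_int_mat1 matrix_image_one flip: map_matrix_of_int_mult)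
    then show ?thesis using D_act1[OF SL_int_units_SL_int[OF h], of x] D_act1[OF SL_int_units_SL_int[OF h'(1)], of "?act h x"] by auto
  qed
  let ?D = "{a \<in> chart c. vec.span {a} \<in> D}"
  have D's: "?D \<in> sets (chart_space c)"
    using measurable_sets[OF measurable_span_chart D, of c] by (simp add: vimage_def Int_def conj_commute)
  have pos: "measure (hl.chart_measure c) ?D > 0"
  proof -
    have "{x \<in> space (hl.chart_measure c). ?f x = ?f x0} \<subseteq> ?D"
    proof
      fix x assume x: "x \<in> {x \<in> space (hl.chart_measure c). ?f x = ?f x0}"
      then have "f (vec.span {x}) = id y0" by (simp add: y0_def)
      moreover have "vec.span {x} \<in> grassmannian 1" using x by (intro span_singleton_grassmannian chart_nonzero[of x c]) simp
      ultimately have "vec.span {x} \<in> D" using rat_maps_id unfolding D_def by blast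
      then show "x \<in> ?D" using x by simp
    qed
    then have "measure (hl.chart_measure c) {x \<in> space (hl.chart_measure c). ?f x = ?f x0} \<le> measure (hl.chart_measure c) ?D"
      by (rule finite_measure_mono) (simp add: hl.sets_chart_measure D's)
    then show ?thesis using x0(2) by linarith
  qed
  \<comment> \<open>The fibre found above makes the chart part of \<open>D\<close> positive, and the
    translations alone are ergodic on the chart.\<close>
  have "measure (hl.chart_measure c) ?D = 1"
  proof (rule ergodic[OF _ _ pos])
    show "?D \<in> sets (hl.chart_measure c)" by (simp add: hl.sets_chart_measure D's)
    fix t x assume x: "x \<in> space (hl.chart_measure c)"
    obtain h where h: "h \<in> SL_int_units" "hl.translate c t = (\<lambda>a. map_matrix of_int h *v a)" using hl.translate_chart_group[of c t] by (auto simp: hl.chart_group_def)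
    have "hl.translate c t x \<in> chart c" using x hl.chart_group_chart[OF hl.translate_chart_group] by simp
    then show "hl.translate c t x \<in> ?D \<longleftrightarrow> x \<in> ?D" using x D_act[OF h(1)] by (simp add: h(2) sp_act)
  qed
  then have "measure (hl.chart_measure c) (chart c - ?D) = 0" using prob_compl[of ?D] by (simp add: hl.sets_chart_measure D's)
  then have e0: "emeasure (hl.chart_measure c) (chart c - ?D) = 0" by (simp add: emeasure_eq_measure)
  have cD: "chart c - ?D \<in> sets (chart_space c)" using sets.compl_sets[OF D's] by simp
  let ?N = "\<lambda>i. {g \<in> hl.unit_coord i. matrix_image g L \<notin> D}"
  interpret P: prob_space \<nu> by (rule hl.prob_nu)
  have Lm: "(\<lambda>g. matrix_image g L) \<in> measurable \<nu> (grass_borel 1)"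
    unfolding borel_of_def
  proof (rule measurable_measure_of)
    let ?T = "grassmannian_topology 1 :: ('p padic ^ 'm) set topology"
    have cont: "continuous_map (top_of_set SL_padic_integers) ?T (\<lambda>g. matrix_image g L)"
      using L SL_padic_integers_invertible by (rule continuous_map_orbit)
    show "{U. openin ?T U} \<subseteq> Pow (topspace ?T)" using openin_subset by blast
    show "(\<lambda>g. matrix_image g L) \<in> space \<nu> \<rightarrow> topspace ?T"
      using continuous_map_funspace[OF cont] by (simp add: hl.space_nu)
    fix U assume "U \<in> {U. openin ?T U}"
    then have "openin (top_of_set SL_padic_integers) {g \<in> SL_padic_integers. matrix_image g L \<in> U}"
      using openin_continuous_map_preimage[OF cont] by simp
    moreover have "(\<lambda>g. matrix_image g L) -` U \<inter> space \<nu> = {g \<in> SL_padic_integers. matrix_image g L \<in> U}"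
      by (auto simp: hl.space_nu)
    ultimately show "(\<lambda>g. matrix_image g L) -` U \<inter> space \<nu> \<in> sets \<nu>"
      by (auto simp: hl.sets_nu sets_restrict_space openin_open)
  qed
  \<comment> \<open>The chart measure is Haar measure conditioned on \<open>unit_coord c\<close>, a
    set of finite measure, so a null set of the chart comes from a null set of the group.\<close>
  have Nc: "?N c \<in> null_sets \<nu>"
  proof
    have eq: "?N c = {g \<in> hl.unit_coord c. hl.chart_pt c g \<in> chart c - ?D}"
      using hl.span_chart_pt[of _ c] hl.chart_pt_chart[of c] by (auto simp: w(1))
    have "emeasure \<nu> (?N c) / emeasure \<nu> (hl.unit_coord c) = 0" using hl.emeasure_chart_measure[OF cD] e0 by (simp only: eq)
    moreover have "emeasure \<nu> (hl.unit_coord c) \<noteq> \<infinity>" by simp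
    ultimately show "emeasure \<nu> (?N c) = 0" by (auto simp: ennreal_divide_eq_0_iff)
    have "?N c = hl.unit_coord c \<inter> ((\<lambda>g. matrix_image g L) -` (space (grass_borel 1) - D) \<inter> space \<nu>)"
      using measurable_space[OF Lm] by (auto simp: hl.unit_coord_def hl.space_nu)
    then show "?N c \<in> sets \<nu>" using hl.unit_coord_sets[of c] measurable_sets[OF Lm sets.compl_sets[OF D]] by auto
  qed
  \<comment> \<open>Invariance of \<open>D\<close> under a signed exchange of coordinates transfers
    the null set to every other chart, and the charts cover the projective space.\<close>
  have Ni: "?N i \<in> null_sets \<nu>" for i
  proof -
    obtain h where h: "h \<in> SL_int_units" "{g \<in> SL_padic_integers. map_matrix of_int h ** g \<in> hl.unit_coord c} = hl.unit_coord i" by (rule hl.unit_coord_swap)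
    have "{g \<in> SL_padic_integers. map_matrix of_int h ** g \<in> ?N c} = ?N i"
      unfolding h(2)[symmetric] using D_act[OF h(1)] by (auto simp flip: matrix_image_comp)
    then show ?thesis using hl.haar_vimage[OF h(1), of "?N c"] Nc by (metis (no_types, lifting) null_setsD1 null_setsD2 null_setsI)
  qed
  have "(\<Union>i. ?N i) \<in> null_sets \<nu>" using Ni by (intro null_sets_UN') auto
  also have "(\<Union>i. ?N i) = (\<lambda>g. matrix_image g L) -` (space \<mu> - D) \<inter> space \<nu>"
  proof (intro equalityI subsetI)
    fix g assume "g \<in> (\<lambda>g. matrix_image g L) -` (space \<mu> - D) \<inter> space \<nu>"
    then have "matrix_image g L \<notin> D" "g \<in> (\<Union>i. hl.unit_coord i)" unfolding hl.unit_coord_cover by (auto simp: hl.space_nu)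
    then show "g \<in> (\<Union>i. ?N i)" by auto
  next
    fix g assume g: "g \<in> (\<Union>i. ?N i)"
    then have "g \<in> space \<nu>" by (auto simp: hl.unit_coord_def hl.space_nu)
    then show "g \<in> (\<lambda>g. matrix_image g L) -` (space \<mu> - D) \<inter> space \<nu>"
      using g measurable_space[OF Lm, of g] by (auto simp: \<mu>)
  qed
  finally have "emeasure \<mu> (space \<mu> - D) = 0"
    unfolding \<mu> using sets.compl_sets[OF D] by (subst emeasure_distr[OF Lm]) auto
  then have null: "space \<mu> - D \<in> null_sets \<mu>" using D sets_\<mu> by (intro null_setsI) auto
  have "f ` D \<subseteq> F `` {y0}"
  proof
    fix y assume "y \<in> f ` D"
    then obtain l where l: "l \<in> rat_maps" "y = l y0" by (auto simp: D_def)
    then show "y \<in> F `` {y0}" using Lamk[OF l(1) y0] y0 unfolding assms(6) orbit_rel_def by (auto simp: rat_maps_def)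
  qed
  then show "\<exists>A\<in>sets \<mu>. space \<mu> - A \<in> null_sets \<mu> \<and> (\<exists>y\<in>space (grass_borel k). f ` A \<subseteq> F `` {y})"
    using null D y0 by (intro bexI[of _ D] conjI bexI[of _ y0]) (simp_all add: sets_\<mu> space_grass_borel)
qed

end
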